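(* Let $K\ge1$, and let $f:\mathbb{B}^2\to\mathbb{B}^2$ be a $K$-quasiconformal mapping with $f\mathbb{B}^2=\mathbb{B}^2$. Let $Q(a,b,c,d)$ be an ideal hyperbolic quadrilateral in $\mathbb{B}^2$. Denote $D_1=d_\rho(f(J^*[a,d]),f(J^*[b,c]))$ and $D_2=d_\rho(f(J^*[a,b]),f(J^*[c,d]))$. Let $A(K)=2\operatorname{artanh}(\varphi_K(\tanh\frac12))$ and $f_1(r)=\frac{r}{\operatorname{artanh}r}$ for $0<r<1$. Further denote $r_1=\frac{2\sqrt e}{e+1}$ and $$M_1=\frac{(e-1)(\log(\sqrt e+1)-\log(\sqrt e-1))}{\sqrt e},$$ and, for $K>M_1$, define $r_1(K)$ to be the unique solution $r$ to the equation $Kf_1(r)=f_1(\sqrt{1-r^2})$ with $r_1<r<1$. With the notation $$T(x)=\operatorname{artanh}(x)\left(\operatorname{artanh}(\sqrt{1-x^2})\right)^{1/K},\quad 0<x<1,$$ we have $$D_1D_2\le A(K)^2\max\left\{2^{1+1/K}T(r_1(K)),\ \left(2\log(\sqrt2+1)\right)^2\right\}$$ if $K>M_1$, and $$D_1D_2\le A(K)^2\max\left\{2^{1+1/K}T(r_1),\ \left(2\log(\sqrt2+1)\right)^2\right\}$$ if $1\le K\le M_1$.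
   Context: $\mathbb{B}^2$ is the open unit disk in the plane with the hyperbolic metric $\rho$ of weight $2/(1-|x|^2)$, i.e. $\tanh\frac{\rho(x,y)}{2}=\frac{|x-y|}{\sqrt{|x-y|^2+(1-|x|^2)(1-|y|^2)}}$. Hyperbolic geodesic lines are the sets $C\cap\mathbb{B}^2$ where $C$ is a circle perpendicular to the unit circle or a Euclidean line through $0$. For distinct $a,b\in\partial\mathbb{B}^2$, $J^*[a,b]$ is the hyperbolic geodesic line with end points $a,b$. For nonempty $A,B\subset\mathbb{B}^2$, $d_\rho(A,B)=\inf_{x\in A,\,y\in B}\rho(x,y)$. An ideal hyperbolic quadrilateral $Q(a,b,c,d)$ is the domain in $\mathbb{B}^2$ bounded by the geodesic lines $J^*[a,b],J^*[b,c],J^*[c,d],J^*[d,a]$, where $a,b,c,d$ are four distinct points of the unit circle in positive order (all angles are zero). A homeomorphism $f:G\to G'$ between domains is $K$-quasiconformal if $M(\Gamma)/K\le M(f\Gamma)\le KM(\Gamma)$ for every curve family $\Gamma$ in $G$, where $M(\Gamma)$ is the (conformal) modulus of $\Gamma$. For $r\in(0,1)$ and $K\ge1$, $\varphi_K(r)=\mu^{-1}(\mu(r)/K)$, where $\mu(r)$ is the modulus of the planar Grötzsch ring $\mathbb{B}^2\setminus[0,r]$, that is, $\mu(r)=\frac{\pi}{2}\frac{\mathcal{K}(\sqrt{1-r^2})}{\mathcal{K}(r)}$ with $\mathcal{K}(r)=\int_0^1\frac{dx}{\sqrt{(1-x^2)(1-r^2x^2)}}$; $\mu$ is a decreasing homeomorphism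 of $(0,1)$ onto $(0,\infty)$. *)

theory Defs
  imports "HOL-Analysis.Analysis"
begin

section \<open>The hyperbolic plane\<close>

text \<open>The plane is \<^typ>\<open>complex\<close> and the unit disk is \<open>ball 0 1\<close>.\<close>

definition hyp_dist :: "complex \<Rightarrow> complex \<Rightarrow> real" where
  "hyp_dist x y =
     2 * artanh (dist x y / sqrt ((dist x y)\<^sup>2 + (1 - (norm x)\<^sup>2) * (1 - (norm y)\<^sup>2)))"

definition hyp_setdist :: "complex set \<Rightarrow> complex set \<Rightarrow> real" where
  "hyp_setdist A B = (INF (x, y) \<in> A \<times> B. hyp_dist x y)"

definition perpendicular_circles :: "complex \<Rightarrow> real \<Rightarrow> complex \<Rightarrow> real \<Rightarrow> bool" where
  "perpendicular_circles c r c' r' \<longleftrightarrow>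
     sphere c r \<inter> sphere c' r' \<noteq> {} \<and>
     (\<forall>p \<in> sphere c r \<inter> sphere c' r'. (p - c) \<bullet> (p - c') = 0)"

definition hyp_line :: "complex set \<Rightarrow> bool" where
  "hyp_line L \<longleftrightarrow>
     (\<exists>c r. r > 0 \<and> perpendicular_circles c r 0 1 \<and> L = sphere c r \<inter> ball 0 1) \<or>
     (\<exists>u. u \<noteq> 0 \<and> L = span {u} \<inter> ball 0 1)"

text \<open>The end points of a line are the points where its closure meets the unit circle.
  They determine the line, so the description below is proper whenever \<open>a\<close> and \<open>b\<close>
  are distinct points of the unit circle.\<close>

definition geodesic :: "complex \<Rightarrow> complex \<Rightarrow> complex set" where
  "geodesic a b = (THE L. hyp_line L \<and> closure L \<inter> sphere 0 1 = {a, b})"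

text \<open>An ideal quadrilateral is given by its vertices, which are distinct points of the unit
  circle in positive (counterclockwise) order.  Its sides lie on the lines
  \<open>geodesic a b\<close>, \<open>geodesic b c\<close>, \<open>geodesic c d\<close> and \<open>geodesic d a\<close>.\<close>

definition ideal_quadrilateral :: "complex \<Rightarrow> complex \<Rightarrow> complex \<Rightarrow> complex \<Rightarrow> bool" where
  "ideal_quadrilateral a b c d \<longleftrightarrow>
     (\<exists>s t u v. s < t \<and> t < u \<and> u < v \<and> v < s + 2 * pi \<and>
        a = cis s \<and> b = cis t \<and> c = cis u \<and> d = cis v)"


section \<open>Curve families and quasiconformal mappings\<close>

text \<open>A curve is a continuous map on an arbitrary (open, closed or half-open) real interval;
  it is represented by the interval together with the map.\<close>

type_synonym curve = "real set \<times> (real \<Rightarrow> complex)"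

definition curve_in :: "complex set \<Rightarrow> curve \<Rightarrow> bool" where
  "curve_in G = (\<lambda>(I, \<gamma>).
     is_interval I \<and> I \<noteq> {} \<and> continuous_on I \<gamma> \<and> \<gamma> ` I \<subseteq> G)"

definition curve_length :: "real set \<Rightarrow> (real \<Rightarrow> complex) \<Rightarrow> ennreal" where
  "curve_length I \<gamma> =
     (SUP ts \<in> {ts. sorted ts \<and> set ts \<subseteq> I}.
        \<Sum>i < length ts - 1. ennreal (dist (\<gamma> (ts ! i)) (\<gamma> (ts ! Suc i))))"

definition locally_rectifiable :: "curve \<Rightarrow> bool" where
  "locally_rectifiable = (\<lambda>(I, \<gamma>).
     \<forall>a b. a \<le> b \<and> {a..b} \<subseteq> I \<longrightarrow> curve_length {a..b} \<gamma> < \<infinity>)"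

text \<open>Arc length parametrization of the curve \<open>\<gamma>\<close> on \<open>{a..b}\<close>: its value at \<open>s\<close> is \<open>\<gamma> t\<close>
  for any \<open>t\<close> such that the restriction to \<open>{a..t}\<close> has length \<open>s\<close>.  Two such \<open>t\<close> give
  the same value, since \<open>\<gamma>\<close> is constant between them.\<close>

definition arc_param :: "real \<Rightarrow> real \<Rightarrow> (real \<Rightarrow> complex) \<Rightarrow> real \<Rightarrow> complex" where
  "arc_param a b \<gamma> s = \<gamma> (SOME t. t \<in> {a..b} \<and> curve_length {a..t} \<gamma> = ennreal s)"

definition closed_line_integral ::
    "(complex \<Rightarrow> ennreal) \<Rightarrow> real \<Rightarrow> real \<Rightarrow> (real \<Rightarrow> complex) \<Rightarrow> ennreal" where
  "closed_line_integral \<rho> a b \<gamma> =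
     (\<integral>\<^sup>+ s \<in> {0..enn2real (curve_length {a..b} \<gamma>)}. \<rho> (arc_param a b \<gamma> s) \<partial>lborel)"

text \<open>For a locally rectifiable curve the line integral is the supremum over the closed
  subcurves.\<close>

definition line_integral :: "(complex \<Rightarrow> ennreal) \<Rightarrow> curve \<Rightarrow> ennreal" where
  "line_integral \<rho> = (\<lambda>(I, \<gamma>).
     SUP (a, b) \<in> {(a, b). a \<le> b \<and> {a..b} \<subseteq> I}. closed_line_integral \<rho> a b \<gamma>)"

definition admissible :: "curve set \<Rightarrow> (complex \<Rightarrow> ennreal) \<Rightarrow> bool" where
  "admissible \<Gamma> \<rho> \<longleftrightarrow>
     \<rho> \<in> borel_measurable borel \<and>
     (\<forall>C \<in> \<Gamma>. locally_rectifiable C \<longrightarrow> 1 \<le> line_integral \<rho> C)"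

definition curve_modulus :: "curve set \<Rightarrow> ennreal" where
  "curve_modulus \<Gamma> = (INF \<rho> \<in> {\<rho>. admissible \<Gamma> \<rho>}. \<integral>\<^sup>+ z. (\<rho> z)\<^sup>2 \<partial>lborel)"

definition curve_image :: "(complex \<Rightarrow> complex) \<Rightarrow> curve \<Rightarrow> curve" where
  "curve_image f = (\<lambda>(I, \<gamma>). (I, f \<circ> \<gamma>))"

definition quasiconformal ::
    "real \<Rightarrow> complex set \<Rightarrow> complex set \<Rightarrow> (complex \<Rightarrow> complex) \<Rightarrow> bool" where
  "quasiconformal K G G' f \<longleftrightarrow>
     open G \<and> connected G \<and> open G' \<and> connected G' \<and>
     (\<exists>g. homeomorphism G G' f g) \<and>
     (\<forall>\<Gamma>. (\<forall>C \<in> \<Gamma>. curve_in G C) \<longrightarrow>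
        curve_modulus \<Gamma> / ennreal K \<le> curve_modulus (curve_image f ` \<Gamma>) \<and>
        curve_modulus (curve_image f ` \<Gamma>) \<le> ennreal K * curve_modulus \<Gamma>)"


section \<open>Special functions and constants\<close>

definition ellK :: "real \<Rightarrow> real" where
  "ellK r = integral {0..1} (\<lambda>x. 1 / sqrt ((1 - x\<^sup>2) * (1 - r\<^sup>2 * x\<^sup>2)))"

definition mu :: "real \<Rightarrow> real" where
  "mu r = pi / 2 * (ellK (sqrt (1 - r\<^sup>2)) / ellK r)"

text \<open>\<open>mu\<close> maps \<open>(0, 1)\<close> bijectively onto \<open>(0, \<infinity>)\<close>; the inverse is taken on that interval.\<close>

definition phi :: "real \<Rightarrow> real \<Rightarrow> real" where
  "phi K r = inv_into {0<..<1} mu (mu r / K)"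

definition A_const :: "real \<Rightarrow> real" where
  "A_const K = 2 * artanh (phi K (tanh (1 / 2)))"

definition f1 :: "real \<Rightarrow> real" where
  "f1 r = r / artanh r"

definition r1 :: real where
  "r1 = 2 * sqrt (exp 1) / (exp 1 + 1)"

definition M1 :: real where
  "M1 = (exp 1 - 1) * (ln (sqrt (exp 1) + 1) - ln (sqrt (exp 1) - 1)) / sqrt (exp 1)"

text \<open>For \<open>K > M1\<close> there is exactly one such \<open>r\<close>: \<open>f1\<close> decreases from \<open>1\<close> to \<open>0\<close> on \<open>(0, 1)\<close>, so
  \<open>K * f1 r - f1 (sqrt (1 - r\<^sup>2))\<close> is strictly decreasing; its sign at \<open>r1\<close> is that of \<open>K - M1\<close>
  because \<open>f1 (sqrt (1 - r1\<^sup>2)) = M1 * f1 r1\<close>.\<close>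

definition r1K :: "real \<Rightarrow> real" where
  "r1K K = (THE r. r1 < r \<and> r < 1 \<and> K * f1 r = f1 (sqrt (1 - r\<^sup>2)))"

definition T :: "real \<Rightarrow> real \<Rightarrow> real" where
  "T K x = artanh x * artanh (sqrt (1 - x\<^sup>2)) powr (1 / K)"

end

theory Submission
  imports Defs "HOL-Complex_Analysis.Complex_Analysis"
begin

text \<open>An elliptic integral of the first kind maps the disk, slit along the two geodesic rays that prolong the
  hyperbolic segment from \<open>x\<close> to \<open>y\<close>, to a rectangle, and the segment to its midline.  The pulled back
  Euclidean metric bounds the modulus of the curves joining the segment to the unit circle from above; the length-area method along the vertical lines
  of the rectangle shows that no continuum through \<open>x\<close> and \<open>y\<close> has a smaller modulus.  Hence a
  \<open>K\<close>-quasiconformal self-map of the disk increases \<open>tanh (\<rho> / 2)\<close> at most to \<open>\<phi>\<^sub>K (tanh (\<rho> / 2))\<close>.  A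
  monotonicity property of \<open>\<mu>\<close> that rests on Legendre's relation turns this into
  \<open>\<rho> (f x) (f y) \<le> A(K) * max d (d powr (1 / K))\<close> with \<open>d = \<rho> x y\<close>.

  The distances \<open>d\<^sub>1\<close>, \<open>d\<^sub>2\<close> between opposite sides of an ideal quadrilateral satisfy
  \<open>sinh (d\<^sub>1 / 2) * sinh (d\<^sub>2 / 2) = 1\<close>, so \<open>tanh (d\<^sub>1 / 2)\<close> and \<open>tanh (d\<^sub>2 / 2)\<close> are \<open>x\<close> and
  \<open>sqrt (1 - x\<^sup>2)\<close> for some \<open>x\<close>.  It remains to maximize the product of the two bounds over \<open>x\<close>; the
  logarithmic derivative of \<open>T\<close> has the sign of the strictly decreasing function
  \<open>K * f1 x - f1 (sqrt (1 - x\<^sup>2))\<close>.\<close>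

section \<open>Curve length and line integrals\<close>

text \<open>Quasiconformality is defined by moduli alone, so no boundary values of \<open>f\<close>
  are at hand and the image of the segment is known only to be a continuum. Hence a curve running to
  the unit circle is one that leaves every compact subset of the disk, a condition that a
  homeomorphism preserves, and the lower estimate has to hold for all continua through the two image
  points. Vertical lines serve for it because the horizontal coordinate of the rectangle extends
  continuously to the whole disk: by connectedness every vertical meets the continuum, and both its
  ends run to the unit circle. The rectangle has sides 2 K(r) and 2 K'(r), so the extremal modulus
  is 4 K(r) / K'(r) = 2 pi / \<mu>(r) and the comparison reads \<mu>(s) \<ge> \<mu>(r) / K. The
  constants: A(K) bounds the distance of the images of points at distance 1, where d and
  \<open>d powr (1 / K)\<close> change order. \<open>r1 = 1 / cosh (1/2)\<close> is the x for which
  the other distance is 1, \<open>M1\<close> is the quotient of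
  \<open>f1 (sqrt (1 - r1\<^sup>2))\<close> by \<open>f1 r1\<close>, and 2 log (sqrt 2 + 1) is the
  value of d1 and d2 when they are equal.\<close>

fun polygon_length :: "(real \<Rightarrow> complex) \<Rightarrow> real list \<Rightarrow> ennreal" where
  "polygon_length \<gamma> (x # y # ts) = ennreal (dist (\<gamma> x) (\<gamma> y)) + polygon_length \<gamma> (y # ts)"
| "polygon_length \<gamma> ts = 0"

lemma polygon_length_eq_sum:
  "(\<Sum>i < length ts - 1. ennreal (dist (\<gamma> (ts ! i)) (\<gamma> (ts ! Suc i)))) = polygon_length \<gamma> ts"
proof (induction \<gamma> ts rule: polygon_length.induct)
  case (1 \<gamma> x y ts)
  then show ?case
    by (simp add: sum.lessThan_Suc_shift del: sum.lessThan_Suc sum_ennreal)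
qed auto

lemma curve_length_eq_SUP:
  "curve_length I \<gamma> = (SUP ts \<in> {ts. sorted ts \<and> set ts \<subseteq> I}. polygon_length \<gamma> ts)"
  unfolding curve_length_def polygon_length_eq_sum ..

lemma polygon_length_le_curve_length:
  "sorted ts \<Longrightarrow> set ts \<subseteq> I \<Longrightarrow> polygon_length \<gamma> ts \<le> curve_length I \<gamma>"
  unfolding curve_length_eq_SUP by (rule SUP_upper) auto

lemma polygon_length_append_ge:
  "polygon_length \<gamma> xs + polygon_length \<gamma> ys \<le> polygon_length \<gamma> (xs @ ys)"
proof (induction \<gamma> xs rule: polygon_length.induct)
  case (1 \<gamma> x y ts)
  then show ?case
    by (simp add: add.assoc)
next
  case ("2_2" \<gamma> v)
  then show ?case by (cases ys) auto
qed auto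

text \<open>Triangle inequality at an inserted vertex \<open>c\<close>. It cuts a partition at a
  point that need not belong to it, which gives both the additivity of length and the localization
  of nearly optimal partitions.\<close>

lemma polygon_length_append_le:
  "polygon_length \<gamma> (xs @ ys) \<le> polygon_length \<gamma> (xs @ [c]) + polygon_length \<gamma> (c # ys)"
proof (induction \<gamma> xs rule: polygon_length.induct)
  case (1 \<gamma> x y ts)
  then show ?case
    by (simp add: add.assoc)
next
  case ("2_1" \<gamma>)
  then show ?case by (cases ys) auto
next
  case ("2_2" \<gamma> v)
  then show ?case
    by (cases ys) (auto simp flip: ennreal_plus add.assoc intro!: add_right_mono ennreal_leI dist_triangle)
qed

lemma dist_le_curve_length:
  assumes "a \<le> b"
  shows "ennreal (dist (\<gamma> a) (\<gamma> b)) \<le> curve_length {a..b} \<gamma>"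
  using polygon_length_le_curve_length[of "[a, b]" "{a..b}" \<gamma>] assms by simp

lemma curve_length_mono: "I \<subseteq> J \<Longrightarrow> curve_length I \<gamma> \<le> curve_length J \<gamma>"
  unfolding curve_length_eq_SUP by (rule SUP_subset_mono) auto

lemma curve_length_add:
  assumes "a \<le> c" "c \<le> b"
  shows "curve_length {a..b} \<gamma> = curve_length {a..c} \<gamma> + curve_length {c..b} \<gamma>"
proof (rule antisym)
  show "curve_length {a..b} \<gamma> \<le> curve_length {a..c} \<gamma> + curve_length {c..b} \<gamma>"
    unfolding curve_length_eq_SUP[of "{a..b}"]
  proof (rule SUP_least, clarify)
    fix ts assume ts: "sorted ts" "set ts \<subseteq> {a..b}"
    define xs where "xs = takeWhile (\<lambda>t. t \<le> c) ts"
    define ys where "ys = dropWhile (\<lambda>t. t \<le> c) ts"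
    have eq: "ts = xs @ ys" by (simp add: xs_def ys_def)
    have xs: "t \<le> c" if "t \<in> set xs" for t
      using that unfolding xs_def by (meson set_takeWhileD)
    have ys: "c \<le> t" if "t \<in> set ys" for t
    proof (cases ys)
      case (Cons y zs)
      have "\<not> y \<le> c" by (metis Cons hd_dropWhile list.distinct(1) list.sel(1) ys_def)
      moreover have "y \<le> t" using ts(1) that unfolding eq sorted_append by (auto simp: Cons)
      ultimately show ?thesis by simp
    qed (use that in auto)
    have "polygon_length \<gamma> ts \<le> polygon_length \<gamma> (xs @ [c]) + polygon_length \<gamma> (c # ys)"
      unfolding eq by (rule polygon_length_append_le)
    also have "\<dots> \<le> curve_length {a..c} \<gamma> + curve_length {c..b} \<gamma>"
      using ts xs ys assms unfolding eq sorted_append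
      by (intro add_mono polygon_length_le_curve_length) (auto simp: sorted_append)
    finally show "polygon_length \<gamma> ts \<le> curve_length {a..c} \<gamma> + curve_length {c..b} \<gamma>" .
  qed
next
  let ?P = "\<lambda>a b. {ts. sorted ts \<and> set ts \<subseteq> {a..b::real}}"
  have ne: "?P a b \<noteq> {}" for a b :: real
    by (auto intro: exI[of _ "[]"])
  have le: "polygon_length \<gamma> xs + polygon_length \<gamma> ys \<le> curve_length {a..b} \<gamma>"
    if "xs \<in> ?P a c" "ys \<in> ?P c b" for xs ys
  proof -
    have "sorted (xs @ ys)" "set (xs @ ys) \<subseteq> {a..b}"
      using that assms by (fastforce simp: sorted_append)+
    then show ?thesis
      using polygon_length_append_ge polygon_length_le_curve_length order_trans by blast
  qed
  have "curve_length {a..c} \<gamma> + polygon_length \<gamma> ys \<le> curve_length {a..b} \<gamma>" if "ys \<in> ?P c b" for ys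
    unfolding curve_length_eq_SUP[of "{a..c}"] ennreal_SUP_add_left[OF ne, symmetric]
    by (rule SUP_least) (use le that in auto)
  then show "curve_length {a..c} \<gamma> + curve_length {c..b} \<gamma> \<le> curve_length {a..b} \<gamma>"
    unfolding curve_length_eq_SUP[of "{c..b}"]
    by (subst ennreal_SUP_add_right[OF ne]) (intro SUP_least, auto)
qed

lemma curve_length_le_Lipschitz:
  assumes "0 \<le> M" "a \<le> b"
    and lip: "\<And>s t. a \<le> s \<Longrightarrow> s \<le> t \<Longrightarrow> t \<le> b \<Longrightarrow> dist (\<gamma> s) (\<gamma> t) \<le> M * (t - s)"
  shows "curve_length {a..b} \<gamma> \<le> ennreal (M * (b - a))"
proof -
  have *: "polygon_length \<gamma> ts \<le> ennreal (M * (b - hd ts))"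
    if "sorted ts" "set ts \<subseteq> {a..b}" "ts \<noteq> []" for ts
    using that
  proof (induction ts rule: induct_list012)
    case (3 x y ts)
    have "polygon_length \<gamma> (x # y # ts) \<le> ennreal (M * (y - x)) + ennreal (M * (b - y))"
      using 3 lip[of x y] by (auto intro!: add_mono ennreal_leI)
    also have "\<dots> = ennreal (M * (b - x))"
      using 3 assms by (subst ennreal_plus[symmetric]) (auto simp: algebra_simps intro!: mult_left_mono)
    finally show ?case by simp
  qed auto
  show ?thesis
    unfolding curve_length_eq_SUP
  proof (rule SUP_least, clarify)
    fix ts assume ts: "sorted ts" "set ts \<subseteq> {a..b}"
    show "polygon_length \<gamma> ts \<le> ennreal (M * (b - a))"
    proof (cases "ts = []")
      case False
      then have "a \<le> hd ts" using ts hd_in_set by fastforce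
      then have "ennreal (M * (b - hd ts)) \<le> ennreal (M * (b - a))"
        using assms by (intro ennreal_leI mult_left_mono) auto
      then show ?thesis using *[OF ts False] by order
    qed auto
  qed
qed

lemma curve_length_singleton: "curve_length {a} \<gamma> = 0"
proof -
  have "curve_length {a..a} \<gamma> \<le> ennreal (0 * (a - a))"
  proof (rule curve_length_le_Lipschitz)
    fix s t assume "a \<le> s" "s \<le> t" "t \<le> a"
    then have "s = a" "t = a" by auto
    then show "dist (\<gamma> s) (\<gamma> t) \<le> 0 * (t - s)" by simp
  qed auto
  then show ?thesis by simp
qed

lemma curve_length_finite_subinterval:
  assumes "curve_length {a..b} \<gamma> < \<infinity>" "a \<le> s" "t \<le> b"
  shows "curve_length {s..t} \<gamma> < \<infinity>"
  using curve_length_mono[of "{s..t}" "{a..b}" \<gamma>] assms by (auto simp: order.strict_trans1)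

lemma curve_length_diff:
  assumes "curve_length {a..b} \<gamma> < \<infinity>" "a \<le> s" "s \<le> t" "t \<le> b"
  shows "enn2real (curve_length {a..t} \<gamma>) - enn2real (curve_length {a..s} \<gamma>)
    = enn2real (curve_length {s..t} \<gamma>)"
proof -
  have "curve_length {a..s} \<gamma> < \<infinity>" "curve_length {s..t} \<gamma> < \<infinity>"
    using assms curve_length_finite_subinterval[OF assms(1)] by auto
  then show ?thesis
    using curve_length_add[of a s t \<gamma>] assms by (simp add: enn2real_plus)
qed

lemma dist_le_enn2real_curve_length:
  assumes "curve_length {a..b} \<gamma> < \<infinity>" "a \<le> b"
  shows "dist (\<gamma> a) (\<gamma> b) \<le> enn2real (curve_length {a..b} \<gamma>)"
  using dist_le_curve_length[of a b \<gamma>] assms by (metis enn2real_ennreal enn2real_mono infinity_ennreal_def zero_le_dist)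

lemma arc_param_curve_length:
  assumes fin: "curve_length {a..b} \<gamma> < \<infinity>" and t: "a \<le> t" "t \<le> b"
  shows "arc_param a b \<gamma> (enn2real (curve_length {a..t} \<gamma>)) = \<gamma> t"
proof -
  let ?L = "\<lambda>t. curve_length {a..t} \<gamma>"
  define P where "P t' \<longleftrightarrow> t' \<in> {a..b} \<and> ?L t' = ennreal (enn2real (?L t))" for t'
  have Lt: "?L t < \<infinity>" using curve_length_finite_subinterval[OF fin] t by auto
  have "P t" using t Lt by (auto simp: P_def)
  then have "P (SOME t. P t)" by (rule someI)
  moreover have "\<gamma> t' = \<gamma> t" if "P t'" for t'
  proof -
    have eq: "?L t' = ?L t" and t': "t' \<in> {a..b}" using that Lt by (auto simp: P_def)
    have "\<gamma> x = \<gamma> y" if "?L x = ?L y" "a \<le> x" "x \<le> y" "y \<le> b" for x y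
      using curve_length_diff[OF fin, of x y] dist_le_enn2real_curve_length[of x y \<gamma>]
        curve_length_finite_subinterval[OF fin, of x y] that by auto
    then show ?thesis using eq t t' by (metis atLeastAtMost_iff linear)
  qed
  ultimately show ?thesis by (simp add: arc_param_def P_def)
qed

text \<open>Take \<open>T\<close> to be the vertices of a polygon whose length falls short by less
  than \<open>e\<close>. Inserting \<open>x\<close> and \<open>y\<close> distributes the shortfall
  over the pieces, and a piece without vertices inside contributes arc minus chord, so this
  difference is at most \<open>e\<close>.\<close>

lemma curve_length_nearly_polygonal:
  assumes fin: "curve_length {a..b} \<gamma> < \<infinity>" and "a \<le> b" "0 < e"
  obtains T where "finite T"
    "\<And>x y. a \<le> x \<Longrightarrow> x \<le> y \<Longrightarrow> y \<le> b \<Longrightarrow> T \<inter> {x<..<y} = {} \<Longrightarrow>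
      enn2real (curve_length {x..y} \<gamma>) \<le> dist (\<gamma> x) (\<gamma> y) + e"
proof -
  have "\<exists>ts\<in>{ts. sorted ts \<and> set ts \<subseteq> {a..b}}. curve_length {a..b} \<gamma> < polygon_length \<gamma> ts + ennreal e"
  proof (rule ccontr)
    let ?P = "{ts. sorted ts \<and> set ts \<subseteq> {a..b}}"
    assume "\<not> (\<exists>ts\<in>?P. curve_length {a..b} \<gamma> < polygon_length \<gamma> ts + ennreal e)"
    then have "(SUP ts\<in>?P. polygon_length \<gamma> ts + ennreal e) \<le> curve_length {a..b} \<gamma>"
      by (intro SUP_least) (auto simp: not_less)
    moreover have "?P \<noteq> {}" by (auto intro: exI[of _ "[]"])
    ultimately have "curve_length {a..b} \<gamma> + ennreal e \<le> curve_length {a..b} \<gamma>"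
      by (simp add: ennreal_SUP_add_left curve_length_eq_SUP[symmetric])
    then show False using fin \<open>0 < e\<close>
      by (cases "curve_length {a..b} \<gamma>") (auto simp flip: ennreal_plus)
  qed
  then obtain ts where ts: "sorted ts" "set ts \<subseteq> {a..b}"
    and le: "curve_length {a..b} \<gamma> < polygon_length \<gamma> ts + ennreal e" by auto
  show thesis
  proof (rule that[of "set ts"])
    fix x y assume xy: "a \<le> x" "x \<le> y" "y \<le> b" "set ts \<inter> {x<..<y} = {}"
    define xs where "xs = takeWhile (\<lambda>t. t \<le> x) ts"
    define ys where "ys = dropWhile (\<lambda>t. t \<le> x) ts"
    have eq: "ts = xs @ ys" by (simp add: xs_def ys_def)
    have xs: "t \<le> x" if "t \<in> set xs" for t
      using that unfolding xs_def by (meson set_takeWhileD)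
    have ys: "y \<le> t" if "t \<in> set ys" for t
    proof (cases ys)
      case (Cons z zs)
      have "\<not> z \<le> x" by (metis Cons hd_dropWhile list.distinct(1) list.sel(1) ys_def)
      moreover have "z \<le> t" using ts(1) that unfolding eq sorted_append by (auto simp: Cons)
      moreover have "t \<in> set ts" using that eq by auto
      ultimately show ?thesis using xy(4) by fastforce
    qed (use that in auto)
    have fins: "curve_length {a..x} \<gamma> < \<infinity>" "curve_length {x..y} \<gamma> < \<infinity>" "curve_length {y..b} \<gamma> < \<infinity>"
      using xy curve_length_finite_subinterval[OF fin] by auto
    have "polygon_length \<gamma> ts \<le> polygon_length \<gamma> (xs @ [x]) + polygon_length \<gamma> (x # ys)"
      unfolding eq by (rule polygon_length_append_le)
    also have "polygon_length \<gamma> (x # ys) \<le> polygon_length \<gamma> [x, y] + polygon_length \<gamma> (y # ys)"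
      using polygon_length_append_le[of \<gamma> "[x]" ys y] by simp
    also have "polygon_length \<gamma> (xs @ [x]) \<le> curve_length {a..x} \<gamma>"
      using ts xs xy unfolding eq sorted_append
      by (intro polygon_length_le_curve_length) (auto simp: sorted_append)
    also have "polygon_length \<gamma> (y # ys) \<le> curve_length {y..b} \<gamma>"
      using ts ys xy unfolding eq sorted_append
      by (intro polygon_length_le_curve_length) (auto simp: sorted_append)
    finally have "polygon_length \<gamma> ts \<le> curve_length {a..x} \<gamma> + (polygon_length \<gamma> [x, y] + curve_length {y..b} \<gamma>)"
      by (simp add: add_left_mono add_right_mono)
    then have "curve_length {a..b} \<gamma> \<le>
        curve_length {a..x} \<gamma> + (ennreal (dist (\<gamma> x) (\<gamma> y)) + curve_length {y..b} \<gamma>) + ennreal e"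
      by (intro order.trans[OF less_imp_le[OF le]] add_right_mono) simp
    moreover have "curve_length {a..b} \<gamma> = curve_length {a..x} \<gamma> + (curve_length {x..y} \<gamma> + curve_length {y..b} \<gamma>)"
      using xy by (simp add: curve_length_add[of a x b] curve_length_add[of x y b])
    moreover obtain p where p: "curve_length {a..x} \<gamma> = ennreal p" "p \<ge> 0"
      using fins by (cases "curve_length {a..x} \<gamma>") auto
    moreover obtain q where q: "curve_length {x..y} \<gamma> = ennreal q" "q \<ge> 0"
      using fins by (cases "curve_length {x..y} \<gamma>") auto
    moreover obtain s where s: "curve_length {y..b} \<gamma> = ennreal s" "s \<ge> 0"
      using fins by (cases "curve_length {y..b} \<gamma>") auto
    ultimately have "ennreal (p + (q + s)) \<le> ennreal (p + (dist (\<gamma> x) (\<gamma> y) + s) + e)"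
      using \<open>0 < e\<close> by (simp add: ennreal_plus)
    then have "q \<le> dist (\<gamma> x) (\<gamma> y) + e"
      using p s \<open>0 < e\<close> by (subst (asm) ennreal_le_iff) (auto simp: add_nonneg_nonneg)
    then show "enn2real (curve_length {x..y} \<gamma>) \<le> dist (\<gamma> x) (\<gamma> y) + e"
      using q by simp
  qed auto
qed

lemma continuous_on_curve_length:
  assumes cont: "continuous_on {a..b} \<gamma>" and fin: "curve_length {a..b} \<gamma> < \<infinity>" and "a \<le> b"
  shows "continuous_on {a..b} (\<lambda>t. enn2real (curve_length {a..t} \<gamma>))"
  unfolding continuous_on_iff
proof (intro ballI allI impI)
  fix t e assume t: "t \<in> {a..b}" and "0 < (e::real)"
  obtain T where T: "finite T" and le: "\<And>x y. a \<le> x \<Longrightarrow> x \<le> y \<Longrightarrow> y \<le> b \<Longrightarrow> T \<inter> {x<..<y} = {} \<Longrightarrow>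
      enn2real (curve_length {x..y} \<gamma>) \<le> dist (\<gamma> x) (\<gamma> y) + e / 2"
    using curve_length_nearly_polygonal[OF fin \<open>a \<le> b\<close>, of "e / 2"] \<open>0 < e\<close> by auto
  \<comment> \<open>Within distance \<open>d\<close> of \<open>t\<close> there is no vertex except
    possibly \<open>t\<close> itself. So a short interval with end point \<open>t\<close> has no
    vertex inside, and its arc exceeds its chord by at most \<open>e / 2\<close>.\<close>
  have "\<exists>d>0. \<forall>x\<in>T. x \<noteq> t \<longrightarrow> d \<le> dist t x"
    using finite_set_avoid[OF T] by blast
  then obtain d where d: "d > 0" "\<And>x. x \<in> T \<Longrightarrow> x \<noteq> t \<Longrightarrow> d \<le> dist t x"
    by blast
  obtain d' where d': "d' > 0" "\<And>s. s \<in> {a..b} \<Longrightarrow> dist s t < d' \<Longrightarrow> dist (\<gamma> s) (\<gamma> t) < e / 2"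
  proof -
    have "0 < e / 2" using \<open>0 < e\<close> by simp
    from cont[unfolded continuous_on_iff, rule_format, OF t this] show ?thesis using that by blast
  qed
  have near: "enn2real (curve_length {x..y} \<gamma>) < e"
    if "a \<le> x" "x \<le> y" "y \<le> b" "y - x < min d d'" "x = t \<or> y = t" for x y
  proof -
    have "T \<inter> {x<..<y} = {}" using d(2) that by (force simp: dist_real_def)
    moreover have "dist (\<gamma> x) (\<gamma> y) < e / 2"
      using d'(2)[of x] d'(2)[of y] that by (auto simp: dist_real_def dist_commute)
    ultimately show ?thesis using le[of x y] that by simp
  qed
  show "\<exists>d>0. \<forall>s\<in>{a..b}. dist s t < d \<longrightarrow>
      dist (enn2real (curve_length {a..s} \<gamma>)) (enn2real (curve_length {a..t} \<gamma>)) < e"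
  proof (intro exI conjI ballI impI)
    fix s assume s: "s \<in> {a..b}" "dist s t < min d d'"
    show "dist (enn2real (curve_length {a..s} \<gamma>)) (enn2real (curve_length {a..t} \<gamma>)) < e"
    proof (cases "s \<le> t")
      case True
      then have "enn2real (curve_length {a..t} \<gamma>) - enn2real (curve_length {a..s} \<gamma>) = enn2real (curve_length {s..t} \<gamma>)"
        "enn2real (curve_length {s..t} \<gamma>) < e"
        using curve_length_diff[OF fin, of s t] near[of s t] s t by (auto simp: dist_real_def)
      then show ?thesis
        using enn2real_nonneg[of "curve_length {s..t} \<gamma>"] unfolding dist_real_def by linarith
    next
      case False
      then have "enn2real (curve_length {a..s} \<gamma>) - enn2real (curve_length {a..t} \<gamma>) = enn2real (curve_length {t..s} \<gamma>)"
        "enn2real (curve_length {t..s} \<gamma>) < e"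
        using curve_length_diff[OF fin, of t s] near[of t s] s t by (auto simp: dist_real_def)
      then show ?thesis
        using enn2real_nonneg[of "curve_length {t..s} \<gamma>"] unfolding dist_real_def by linarith
    qed
  qed (use d d' in auto)
qed

lemma arc_length_attained:
  assumes cont: "continuous_on {a..b} \<gamma>" and fin: "curve_length {a..b} \<gamma> < \<infinity>" and "a \<le> b"
    and s: "0 \<le> s" "s \<le> enn2real (curve_length {a..b} \<gamma>)"
  obtains t where "a \<le> t" "t \<le> b" "enn2real (curve_length {a..t} \<gamma>) = s"
proof -
  show thesis
    using curve_length_singleton IVT'[of "\<lambda>t. enn2real (curve_length {a..t} \<gamma>)" a s b] that s \<open>a \<le> b\<close>
      continuous_on_curve_length[OF cont fin \<open>a \<le> b\<close>] by auto
qed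

lemma arc_param_1_Lipschitz:
  assumes cont: "continuous_on {a..b} \<gamma>" and fin: "curve_length {a..b} \<gamma> < \<infinity>" and "a \<le> b"
    and s: "0 \<le> s" "s \<le> s'" "s' \<le> enn2real (curve_length {a..b} \<gamma>)"
  shows "dist (arc_param a b \<gamma> s) (arc_param a b \<gamma> s') \<le> s' - s"
proof -
  let ?V = "\<lambda>t. enn2real (curve_length {a..t} \<gamma>)"
  obtain t where t: "a \<le> t" "t \<le> b" "?V t = s"
    using arc_length_attained[OF cont fin \<open>a \<le> b\<close>, of s] s by auto
  obtain t' where t': "a \<le> t'" "t' \<le> b" "?V t' = s'"
    using arc_length_attained[OF cont fin \<open>a \<le> b\<close>, of s'] s by auto
  have *: "dist (\<gamma> x) (\<gamma> y) \<le> ?V y - ?V x" if "a \<le> x" "x \<le> y" "y \<le> b" for x y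
    using curve_length_diff[OF fin, of x y] dist_le_enn2real_curve_length[of x y \<gamma>]
      curve_length_finite_subinterval[OF fin, of x y] that by auto
  have "dist (\<gamma> t) (\<gamma> t') \<le> s' - s"
  proof (cases "t \<le> t'")
    case True
    then show ?thesis using *[of t t'] t t' by simp
  next
    case False
    then show ?thesis using *[of t' t] t t' s zero_le_dist[of "\<gamma> t" "\<gamma> t'"]
      by (simp add: dist_commute)
  qed
  then show ?thesis
    using arc_param_curve_length[OF fin, of t] arc_param_curve_length[OF fin, of t'] t t' by simp
qed

lemma continuous_on_arc_param:
  assumes "continuous_on {a..b} \<gamma>" "curve_length {a..b} \<gamma> < \<infinity>" "a \<le> b"
  shows "continuous_on {0..enn2real (curve_length {a..b} \<gamma>)} (arc_param a b \<gamma>)"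
proof -
  have "1-lipschitz_on {0..enn2real (curve_length {a..b} \<gamma>)} (arc_param a b \<gamma>)"
    using arc_param_1_Lipschitz[OF assms]
    by (intro lipschitz_on_leI) (auto simp: dist_real_def)
  then show ?thesis by (rule lipschitz_on_continuous_on)
qed

text \<open>\<open>\<rho>\<close> acts as an upper gradient of \<open>u\<close>. The hypothesis is a
  local Lipschitz bound instead of differentiability because the function to which this is applied
  is an absolute value with a crease along the segment.\<close>

lemma closed_line_integral_ge_oscillation:
  fixes u \<rho> :: "complex \<Rightarrow> real"
  assumes cont: "continuous_on {a..b} \<gamma>" and fin: "curve_length {a..b} \<gamma> < \<infinity>" and "a \<le> b"
    and S: "\<gamma> ` {a..b} \<subseteq> S" and \<rho>: "continuous_on S \<rho>" "\<And>z. z \<in> S \<Longrightarrow> 0 \<le> \<rho> z"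
    and lip: "\<And>z e. z \<in> S \<Longrightarrow> 0 < e \<Longrightarrow> \<exists>d>0. \<forall>w\<in>S. \<forall>w'\<in>S.
        dist w z < d \<longrightarrow> dist w' z < d \<longrightarrow> \<bar>u w - u w'\<bar> \<le> (\<rho> z + e) * dist w w'"
    and \<rho>': "\<And>z. z \<in> S \<Longrightarrow> \<rho>' z = ennreal (\<rho> z)"
  shows "ennreal \<bar>u (\<gamma> b) - u (\<gamma> a)\<bar> \<le> closed_line_integral \<rho>' a b \<gamma>"
proof -
  define l where "l = enn2real (curve_length {a..b} \<gamma>)"
  define g where "g = arc_param a b \<gamma>"
  have l: "0 \<le> l" by (simp add: l_def)
  have gcont: "continuous_on {0..l} g"
    unfolding g_def l_def by (rule continuous_on_arc_param[OF cont fin \<open>a \<le> b\<close>])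
  have glip: "dist (g s) (g s') \<le> s' - s" if "0 \<le> s" "s \<le> s'" "s' \<le> l" for s s'
    using arc_param_1_Lipschitz[OF cont fin \<open>a \<le> b\<close>] that by (simp add: g_def l_def)
  have gS: "g s \<in> S" if "s \<in> {0..l}" for s
  proof -
    have "0 \<le> s" "s \<le> enn2real (curve_length {a..b} \<gamma>)" using that by (simp_all add: l_def)
    then obtain t where "a \<le> t" "t \<le> b" "enn2real (curve_length {a..t} \<gamma>) = s"
      by (rule arc_length_attained[OF cont fin \<open>a \<le> b\<close>])
    then show ?thesis
      using arc_param_curve_length[OF fin, of t] S by (auto simp: g_def)
  qed
  define h where "h = (\<lambda>s. \<rho> (g s))"
  have hcont: "continuous_on {0..l} h"
    unfolding h_def using gcont gS by (intro continuous_on_compose2[OF \<rho>(1)]) auto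
  have hint: "h integrable_on {x..y}" if "0 \<le> x" "y \<le> l" for x y
    using that by (intro integrable_continuous_real continuous_on_subset[OF hcont]) auto
  have bound: "\<bar>u (g l) - u (g 0)\<bar> \<le> integral {0..l} h + e * l" if "0 < e" for e
  proof -
    define P where "P x y \<longleftrightarrow> 0 \<le> x \<and> y \<le> l \<longrightarrow> \<bar>u (g y) - u (g x)\<bar> \<le> integral {x..y} h + e * (y - x)" for x y
    \<comment> \<open>Bisection: the inequality \<open>P\<close>, with its slack
      \<open>e * (y - x)\<close>, is additive over adjacent intervals and holds on all sufficiently
      short intervals around a given point.\<close>
    have "P 0 l" using l
    proof (induction rule: Bolzano)
      case (trans x y z)
      show ?case
        unfolding P_def
      proof
        assume "0 \<le> x \<and> z \<le> l"
        moreover have "integral {x..y} h + integral {y..z} h = integral {x..z} h"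
          using trans hint[of x z] calculation by (intro Henstock_Kurzweil_Integration.integral_combine) auto
        ultimately show "\<bar>u (g z) - u (g x)\<bar> \<le> integral {x..z} h + e * (z - x)"
          using trans unfolding P_def by (simp add: algebra_simps)
      qed
    next
      case (local x)
      obtain d1 where d1: "d1 > 0" "\<And>w w'. w \<in> S \<Longrightarrow> w' \<in> S \<Longrightarrow> dist w (g x) < d1 \<Longrightarrow> dist w' (g x) < d1 \<Longrightarrow>
          \<bar>u w - u w'\<bar> \<le> (\<rho> (g x) + e / 2) * dist w w'"
        using lip[of "g x" "e / 2"] gS[of x] \<open>0 < e\<close> local by auto
      obtain d2 where d2: "d2 > 0" "\<And>s. s \<in> {0..l} \<Longrightarrow> dist s x < d2 \<Longrightarrow> dist (h s) (h x) < e / 2"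
      proof -
        have "x \<in> {0..l}" "0 < e / 2" using local \<open>0 < e\<close> by auto
        from hcont[unfolded continuous_on_iff, rule_format, OF this] show ?thesis using that by blast
      qed
      show ?case
      proof (intro exI conjI allI impI)
        fix s t assume st: "s \<le> x \<and> x \<le> t \<and> t - s < min d1 d2"
        show "P s t" unfolding P_def
        proof
          assume st': "0 \<le> s \<and> t \<le> l"
          have "dist (g s) (g x) < d1" "dist (g t) (g x) < d1"
            using glip[of s x] glip[of x t] st st' by (auto simp: dist_commute)
          then have "\<bar>u (g t) - u (g s)\<bar> \<le> (h x + e / 2) * dist (g t) (g s)"
            using d1(2)[of "g t" "g s"] gS[of t] gS[of s] st st' by (auto simp: h_def)
          also have "\<dots> \<le> (h x + e / 2) * (t - s)"
            using glip[of s t] st st' \<rho>(2)[OF gS[of x]] \<open>0 < e\<close>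
            by (intro mult_left_mono) (auto simp: dist_commute h_def)
          also have "(h x - e / 2) * (t - s) \<le> integral {s..t} h"
          proof -
            have "integral {s..t} (\<lambda>_. h x - e / 2) \<le> integral {s..t} h"
              using st st' hint[of s t]
            proof (intro integral_le)
              fix r assume "r \<in> {s..t}"
              then have "dist (h r) (h x) < e / 2" using st st' by (intro d2(2)) (auto simp: dist_real_def)
              then show "h x - e / 2 \<le> h r" unfolding dist_real_def by linarith
            qed auto
            then show ?thesis using st by (simp add: algebra_simps)
          qed
          then have "(h x + e / 2) * (t - s) \<le> integral {s..t} h + e * (t - s)"
            by (simp add: field_simps)
          finally show "\<bar>u (g t) - u (g s)\<bar> \<le> integral {s..t} h + e * (t - s)" .
        qed
      qed (use d1 d2 in auto)
    qed
    then show ?thesis using l by (simp add: P_def)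
  qed
  have "\<bar>u (g l) - u (g 0)\<bar> \<le> integral {0..l} h"
  proof (rule field_le_epsilon)
    fix e :: real assume "0 < e"
    then have "\<bar>u (g l) - u (g 0)\<bar> \<le> integral {0..l} h + e / (l + 1) * l"
      using l by (intro bound) auto
    also have "e / (l + 1) * l \<le> e" using l \<open>0 < e\<close> by (simp add: field_simps)
    finally show "\<bar>u (g l) - u (g 0)\<bar> \<le> integral {0..l} h + e" by simp
  qed
  moreover have "g l = \<gamma> b" "g 0 = \<gamma> a"
  proof -
    show "g l = \<gamma> b" "g 0 = \<gamma> a"
      using arc_param_curve_length[OF fin, of b] arc_param_curve_length[OF fin, of a] \<open>a \<le> b\<close>
      by (auto simp: g_def l_def curve_length_singleton)
  qed
  ultimately have "ennreal \<bar>u (\<gamma> b) - u (\<gamma> a)\<bar> \<le> ennreal (integral {0..l} h)"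
    by (intro ennreal_leI) simp
  also have "\<dots> = (\<integral>\<^sup>+ s. ennreal (h s) * indicator {0..l} s \<partial>lborel)"
  proof -
    have "set_integrable lborel {0..l} h"
      using borel_integrable_compact[OF _ hcont] by (simp add: set_integrable_def)
    then have "(LINT s:{0..l}|lborel. h s) = integral {0..l} h"
      by (rule set_borel_integral_eq_integral)
    moreover have "(\<integral>\<^sup>+ s. ennreal (indicator {0..l} s *\<^sub>R h s) \<partial>lborel) = ennreal (LINT s:{0..l}|lborel. h s)"
      using \<open>set_integrable lborel {0..l} h\<close> gS \<rho>(2)
      unfolding set_lebesgue_integral_def set_integrable_def
      by (intro nn_integral_eq_integral AE_I2) (auto simp: h_def indicator_def)
    moreover have "ennreal (indicator {0..l} s *\<^sub>R h s) = ennreal (h s) * indicator {0..l} s" for s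
      by (simp add: indicator_def)
    ultimately show ?thesis by simp
  qed
  also have "\<dots> = closed_line_integral \<rho>' a b \<gamma>"
    unfolding closed_line_integral_def l_def[symmetric] g_def[symmetric]
    using gS by (intro nn_integral_cong) (auto simp: h_def \<rho>' split: split_indicator)
  finally show ?thesis .
qed

text \<open>Mean value inequality for \<gamma> minus the uniform motion with velocity
  \<open>v\<close>, whose derivative is bounded by \<open>B\<close>.\<close>

lemma vector_derivative_increment_bound:
  assumes der: "\<And>t. t \<in> {x..y} \<Longrightarrow> (\<gamma> has_vector_derivative \<gamma>' t) (at t)"
    and B: "\<And>t. t \<in> {x..y} \<Longrightarrow> norm (\<gamma>' t - v) \<le> B"
    and st: "x \<le> s" "s \<le> t" "t \<le> y"
  shows "norm (\<gamma> t - \<gamma> s - (t - s) *\<^sub>R v) \<le> B * (t - s)"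
proof -
  have "norm ((\<gamma> t - t *\<^sub>R v) - (\<gamma> s - s *\<^sub>R v)) \<le> B * norm (t - s)"
  proof (rule differentiable_bound[where S = "{x..y}" and f' = "\<lambda>t h. h *\<^sub>R (\<gamma>' t - v)"])
    fix r assume r: "r \<in> {x..y}"
    have "((\<lambda>t. \<gamma> t - t *\<^sub>R v) has_vector_derivative \<gamma>' r - v) (at r within {x..y})"
      using has_vector_derivative_diff[OF has_vector_derivative_at_within[OF der[OF r]]
        has_vector_derivative_scaleR[OF DERIV_ident has_vector_derivative_const]]
      by simp
    then show "((\<lambda>t. \<gamma> t - t *\<^sub>R v) has_derivative (\<lambda>h. h *\<^sub>R (\<gamma>' r - v))) (at r within {x..y})"
      by (simp add: has_vector_derivative_def)
    show "onorm (\<lambda>h. h *\<^sub>R (\<gamma>' r - v)) \<le> B"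
      using mult_left_mono[OF B[OF r] abs_ge_zero] by (intro onorm_le) (simp add: mult.commute)
  qed (use st in auto)
  then show ?thesis using st by (simp add: algebra_simps)
qed

section \<open>Regular curves: arc length and line integrals in the given parameter\<close>

context
  fixes \<gamma> \<gamma>' :: "real \<Rightarrow> complex" and I :: "real set"
  assumes I: "open I" "is_interval I"
    and der: "\<And>t. t \<in> I \<Longrightarrow> (\<gamma> has_vector_derivative \<gamma>' t) (at t)"
    and cont: "continuous_on I \<gamma>'"
begin

text \<open>While the velocity stays close to \<open>v\<close>, arc and chord are both close to
  \<open>norm v * (y - x)\<close>: a Lipschitz bound controls the arc from above, and the chord
  controls it from below.\<close>

lemma curve_length_regular_close:
  assumes xy: "{x..y} \<subseteq> I" "x \<le> y" and B: "\<And>t. t \<in> {x..y} \<Longrightarrow> norm (\<gamma>' t - v) \<le> B"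
  shows "curve_length {x..y} \<gamma> < \<infinity>"
    and "\<bar>enn2real (curve_length {x..y} \<gamma>) - norm v * (y - x)\<bar> \<le> B * (y - x)"
proof -
  have "x \<in> {x..y}" using xy by simp
  then have "0 \<le> B" by (rule order.trans[OF norm_ge_zero B])
  have le: "curve_length {x..y} \<gamma> \<le> ennreal ((norm v + B) * (y - x))"
  proof (rule curve_length_le_Lipschitz)
    fix s t assume st: "x \<le> s" "s \<le> t" "t \<le> y"
    have "norm (\<gamma> t - \<gamma> s - (t - s) *\<^sub>R v) \<le> B * (t - s)"
      by (rule vector_derivative_increment_bound[where x = x and y = y and \<gamma>' = \<gamma>'])
        (use st xy der B in auto)
    moreover have "norm (\<gamma> t - \<gamma> s) \<le> norm (\<gamma> t - \<gamma> s - (t - s) *\<^sub>R v) + norm ((t - s) *\<^sub>R v)"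
      using norm_triangle_ineq[of "\<gamma> t - \<gamma> s - (t - s) *\<^sub>R v" "(t - s) *\<^sub>R v"] by simp
    moreover have "norm ((t - s) *\<^sub>R v) = norm v * (t - s)" using st by simp
    moreover have "dist (\<gamma> s) (\<gamma> t) = norm (\<gamma> t - \<gamma> s)" by (simp add: dist_norm norm_minus_commute)
    ultimately show "dist (\<gamma> s) (\<gamma> t) \<le> (norm v + B) * (t - s)"
      unfolding distrib_right by linarith
  qed (use xy \<open>0 \<le> B\<close> in auto)
  then show fin: "curve_length {x..y} \<gamma> < \<infinity>" by (simp add: order.strict_trans1)
  have "enn2real (curve_length {x..y} \<gamma>) \<le> (norm v + B) * (y - x)"
    using enn2real_mono[OF le] xy \<open>0 \<le> B\<close> by simp
  moreover have "norm v * (y - x) - B * (y - x) \<le> norm (\<gamma> y - \<gamma> x)"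
  proof -
    have "norm (\<gamma> y - \<gamma> x - (y - x) *\<^sub>R v) \<le> B * (y - x)"
      by (rule vector_derivative_increment_bound[where x = x and y = y and \<gamma>' = \<gamma>'])
        (use xy der B in auto)
    moreover have "norm ((y - x) *\<^sub>R v) \<le> norm (\<gamma> y - \<gamma> x) + norm (\<gamma> y - \<gamma> x - (y - x) *\<^sub>R v)"
      using norm_triangle_ineq4[of "\<gamma> y - \<gamma> x" "\<gamma> y - \<gamma> x - (y - x) *\<^sub>R v"] by simp
    ultimately show ?thesis using xy by (simp add: mult.commute)
  qed
  moreover have "norm (\<gamma> y - \<gamma> x) \<le> enn2real (curve_length {x..y} \<gamma>)"
    using dist_le_enn2real_curve_length[OF fin] xy by (simp add: dist_norm norm_minus_commute)
  ultimately show "\<bar>enn2real (curve_length {x..y} \<gamma>) - norm v * (y - x)\<bar> \<le> B * (y - x)"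
    by (simp add: algebra_simps abs_le_iff)
qed

lemma curve_length_regular_finite:
  assumes ab: "{a..b} \<subseteq> I"
  shows "curve_length {a..b} \<gamma> < \<infinity>"
proof (cases "a \<le> b")
  case True
  have "bounded (\<gamma>' ` {a..b})"
    by (intro compact_imp_bounded compact_continuous_image continuous_on_subset[OF cont ab] compact_Icc)
  then obtain M where "\<forall>x \<in> \<gamma>' ` {a..b}. norm x \<le> M"
    unfolding bounded_iff by (rule exE)
  then have M: "norm (\<gamma>' t) \<le> M" if "t \<in> {a..b}" for t
    using that by blast
  show ?thesis
    using curve_length_regular_close(1)[OF ab True, of 0 M] M by simp
next
  case False
  then have "curve_length {a..b} \<gamma> \<le> 0"
    unfolding curve_length_eq_SUP by (intro SUP_least) auto
  then show ?thesis by simp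
qed

lemma curve_length_has_real_derivative:
  assumes a: "a \<in> I" and t: "t \<in> I" "a < t"
  shows "((\<lambda>t. enn2real (curve_length {a..t} \<gamma>)) has_real_derivative norm (\<gamma>' t)) (at t)"
  unfolding has_field_derivative_def has_derivative_at_alt
proof (intro conjI allI impI)
  show "bounded_linear ((*) (norm (\<gamma>' t)))" by (rule bounded_linear_mult_right)
  fix e :: real assume "0 < e"
  obtain d1 where d1: "d1 > 0" "ball t d1 \<subseteq> I"
    using openE[OF I(1) t(1)] by blast
  obtain d2 where d2: "d2 > 0" "\<And>s. s \<in> I \<Longrightarrow> dist s t < d2 \<Longrightarrow> dist (\<gamma>' s) (\<gamma>' t) < e"
    using cont[unfolded continuous_on_iff, rule_format, OF t(1) \<open>0 < e\<close>] by blast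
  define d where "d = min (min d1 d2) (t - a)"
  have close: "\<bar>enn2real (curve_length {a..y} \<gamma>) - enn2real (curve_length {a..x} \<gamma>) - norm (\<gamma>' t) * (y - x)\<bar>
      \<le> e * (y - x)" if "x \<le> y" "x = t \<or> y = t" "y - x < d" for x y
  proof -
    have sub: "{x..y} \<subseteq> ball t d" using that by (auto simp: dist_real_def)
    then have I1: "{x..y} \<subseteq> I" using d1(2) by (force simp: d_def)
    have ax: "a \<le> x" using that by (auto simp: d_def)
    have "y \<in> I" using I1 that by auto
    then have I2: "{a..y} \<subseteq> I"
      using mem_is_interval_1_I[OF I(2) a \<open>y \<in> I\<close>] by auto
    have "norm (\<gamma>' s - \<gamma>' t) \<le> e" if "s \<in> {x..y}" for s
    proof -
      have "s \<in> I" "dist s t < d2" using that sub I1 by (auto simp: d_def dist_commute)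
      then show ?thesis using d2(2)[of s] by (simp add: dist_norm)
    qed
    from curve_length_regular_close(2)[OF I1 that(1) this] show ?thesis
      using curve_length_diff[OF curve_length_regular_finite[OF I2] ax that(1)] by simp
  qed
  show "\<exists>d>0. \<forall>y. norm (y - t) < d \<longrightarrow>
      norm (enn2real (curve_length {a..y} \<gamma>) - enn2real (curve_length {a..t} \<gamma>) - norm (\<gamma>' t) * (y - t)) \<le> e * norm (y - t)"
  proof (intro exI conjI allI impI)
    fix y assume "norm (y - t) < d"
    then show "norm (enn2real (curve_length {a..y} \<gamma>) - enn2real (curve_length {a..t} \<gamma>) - norm (\<gamma>' t) * (y - t)) \<le> e * norm (y - t)"
      using close[of t y] close[of y t]
      by (cases "t \<le> y") (auto simp: abs_le_iff algebra_simps)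
  qed (use d1 d2 t in \<open>auto simp: d_def\<close>)
qed

lemma closed_line_integral_regular:
  assumes ab: "{a..b} \<subseteq> I" "a \<le> b" and \<rho>: "\<rho> \<in> borel_measurable borel"
  shows "closed_line_integral \<rho> a b \<gamma> = (\<integral>\<^sup>+ t. \<rho> (\<gamma> t) * ennreal (norm (\<gamma>' t)) * indicator {a..b} t \<partial>lborel)"
proof (cases "a = b")
  case True
  have null: "(\<integral>\<^sup>+ s\<in>{x}. h s \<partial>lborel) = 0" for x :: real and h
    by (rule nn_integral_null_set) (simp add: finite_imp_null_set_lborel)
  show ?thesis
    by (simp add: True closed_line_integral_def curve_length_singleton null)
next
  case False
  then have "a < b" using ab by simp
  obtain d where d: "d > 0" "ball a d \<subseteq> I" 
  proof -
    have "a \<in> I" using ab by auto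
    then show ?thesis using that openE[OF I(1)] by blast
  qed
  \<comment> \<open>Arc length is counted from a point slightly to the left of \<open>a\<close>,
    which the open interval \<open>I\<close> allows, because the substitution rule wants a two-sided
    derivative at \<open>a\<close> as well.\<close>
  define a0 where "a0 = a - d / 2"
  have a0: "a0 \<in> I" "a0 < a" using d by (auto simp: a0_def dist_real_def intro!: subsetD[OF d(2)])
  have "b \<in> I" using ab by auto
  then have I0: "{a0..b} \<subseteq> I" using mem_is_interval_1_I[OF I(2) a0(1)] by auto
  note fin = curve_length_regular_finite[OF I0]
  note fin' = curve_length_regular_finite[OF ab(1)]
  define g where "g t = enn2real (curve_length {a0..t} \<gamma>) - enn2real (curve_length {a0..a} \<gamma>)" for t
  have g: "g t = enn2real (curve_length {a..t} \<gamma>)" if "t \<in> {a..b}" for t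
    using curve_length_diff[OF fin, of a t] a0 that by (simp add: g_def)
  have g0: "g a = 0" by (simp add: g_def)
  define l where "l = enn2real (curve_length {a..b} \<gamma>)"
  have gl: "g b = l" using g[of b] ab by (simp add: l_def)
  have \<gamma>cont: "continuous_on {a..b} \<gamma>"
    using ab by (intro continuous_at_imp_continuous_on ballI has_vector_derivative_continuous[OF der]) auto
  define F where "F s = \<rho> (arc_param a b \<gamma> s) * indicator {0..l} s" for s
  have F: "F \<in> borel_measurable borel"
  proof -
    have "(\<lambda>s. if s \<in> {0..l} then arc_param a b \<gamma> s else 0) \<in> borel_measurable borel"
      using continuous_on_arc_param[OF \<gamma>cont fin' ab(2)]
      by (intro borel_measurable_continuous_on_if) (auto simp: l_def)
    then have "(\<lambda>s. \<rho> (if s \<in> {0..l} then arc_param a b \<gamma> s else 0) * indicator {0..l} s) \<in> borel_measurable borel"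
      using \<rho> by measurable
    also have "(\<lambda>s. \<rho> (if s \<in> {0..l} then arc_param a b \<gamma> s else 0) * indicator {0..l} s) = F"
      by (auto simp: F_def fun_eq_iff)
    finally show ?thesis .
  qed
  have "closed_line_integral \<rho> a b \<gamma> = (\<integral>\<^sup>+ s. F s * indicator {g a..g b} s \<partial>lborel)"
    unfolding closed_line_integral_def F_def g0 gl
    by (intro nn_integral_cong) (auto simp: l_def indicator_def)
  also have "\<dots> = (\<integral>\<^sup>+ t. F (g t) * ennreal (norm (\<gamma>' t)) * indicator {a..b} t \<partial>lborel)"
  proof (rule nn_integral_substitution_aux[OF F])
    fix t assume "t \<in> {a..b}"
    then have "((\<lambda>t. enn2real (curve_length {a0..t} \<gamma>)) has_real_derivative norm (\<gamma>' t)) (at t)"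
      using a0 ab by (intro curve_length_has_real_derivative) auto
    then show "(g has_real_derivative norm (\<gamma>' t)) (at t)"
      unfolding g_def by (auto intro!: derivative_eq_intros)
  qed (use \<open>a < b\<close> in \<open>auto intro!: continuous_intros continuous_on_subset[OF cont ab(1)]\<close>)
  also have "\<dots> = (\<integral>\<^sup>+ t. \<rho> (\<gamma> t) * ennreal (norm (\<gamma>' t)) * indicator {a..b} t \<partial>lborel)"
  proof (rule nn_integral_cong)
    fix t
    show "F (g t) * ennreal (norm (\<gamma>' t)) * indicator {a..b} t = \<rho> (\<gamma> t) * ennreal (norm (\<gamma>' t)) * indicator {a..b} t"
    proof (cases "t \<in> {a..b}")
      case True
      have "curve_length {a..t} \<gamma> \<le> curve_length {a..b} \<gamma>" using True by (intro curve_length_mono) auto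
      then have "g t \<in> {0..l}" using True fin' by (auto simp: g l_def intro!: enn2real_mono)
      then have "F (g t) = \<rho> (arc_param a b \<gamma> (g t))" by (simp add: F_def)
      also have "arc_param a b \<gamma> (g t) = \<gamma> t"
        using arc_param_curve_length[OF fin', of t] True by (simp add: g)
      finally show ?thesis by simp
    qed simp
  qed
  finally show ?thesis .
qed

lemma locally_rectifiable_regular: "locally_rectifiable (I, \<gamma>)"
  using curve_length_regular_finite by (auto simp: locally_rectifiable_def)

lemma line_integral_regular_le:
  assumes \<rho>: "\<rho> \<in> borel_measurable borel"
  shows "line_integral \<rho> (I, \<gamma>) \<le> (\<integral>\<^sup>+ t. \<rho> (\<gamma> t) * ennreal (norm (\<gamma>' t)) * indicator I t \<partial>lborel)"
  unfolding line_integral_def prod.case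
proof (rule SUP_least, clarify)
  fix a b assume ab: "a \<le> b" "{a..b} \<subseteq> I"
  show "closed_line_integral \<rho> a b \<gamma> \<le> (\<integral>\<^sup>+ t. \<rho> (\<gamma> t) * ennreal (norm (\<gamma>' t)) * indicator I t \<partial>lborel)"
    unfolding closed_line_integral_regular[OF ab(2,1) \<rho>]
    by (intro nn_integral_mono mult_left_mono) (use ab in \<open>auto simp: indicator_def\<close>)
qed

end

section \<open>Change of variables in the plane\<close>

text \<open>Planar Lebesgue measure as a product, so that Fubini can integrate along the vertical
  lines of a rectangle.\<close>

lemma lborel_complex_eq_distr_prod:
  "lborel = distr (lborel \<Otimes>\<^sub>M lborel) borel (\<lambda>(x, y). Complex x y)" (is "_ = distr ?P _ ?c")
proof (rule lborel_eqI)
  have c: "?c \<in> borel_measurable (borel \<Otimes>\<^sub>M borel)"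
    unfolding borel_prod by (intro borel_measurable_continuous_onI) (auto simp: case_prod_beta complex_eq_iff intro!: continuous_intros)
  have [measurable]: "?c \<in> borel_measurable ?P"
    using c by (simp cong: measurable_cong_sets)
  fix l u :: complex assume le: "\<And>b. b \<in> Basis \<Longrightarrow> l \<bullet> b \<le> u \<bullet> b"
  have "?c -` box l u = {Re l<..<Re u} \<times> {Im l<..<Im u}"
    by (auto simp: box_def Basis_complex_def inner_complex_def)
  then have "emeasure (distr ?P borel ?c) (box l u) = emeasure ?P ({Re l<..<Re u} \<times> {Im l<..<Im u})"
    by (simp add: emeasure_distr space_pair_measure)
  also have "\<dots> = ennreal (Re u - Re l) * ennreal (Im u - Im l)"
    using le[of 1] le[of \<i>] by (subst lborel.emeasure_pair_measure_Times) auto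
  also have "\<dots> = (\<Prod>b\<in>Basis. (u - l) \<bullet> b)"
    using le[of 1] le[of \<i>] by (simp add: Basis_complex_def inner_complex_def ennreal_mult' complex_eq_iff)
  finally show "emeasure (distr ?P borel ?c) (box l u) = (\<Prod>b\<in>Basis. (u - l) \<bullet> b)" .
qed simp

lemma nn_integral_lborel_complex:
  assumes h: "h \<in> borel_measurable borel"
  shows "(\<integral>\<^sup>+ z. h z \<partial>lborel) = (\<integral>\<^sup>+ x. \<integral>\<^sup>+ y. h (Complex x y) \<partial>lborel \<partial>lborel)"
proof -
  have c: "(\<lambda>(x, y). Complex x y) \<in> borel_measurable (borel \<Otimes>\<^sub>M borel)"
    unfolding borel_prod by (intro borel_measurable_continuous_onI) (auto simp: case_prod_beta complex_eq_iff intro!: continuous_intros)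
  have c': "(\<lambda>(x, y). Complex x y) \<in> borel_measurable (lborel \<Otimes>\<^sub>M lborel)"
    using c by (simp cong: measurable_cong_sets)
  have "(\<integral>\<^sup>+ z. h z \<partial>lborel) = (\<integral>\<^sup>+ p. h (case p of (x, y) \<Rightarrow> Complex x y) \<partial>(lborel \<Otimes>\<^sub>M lborel))"
    by (subst lborel_complex_eq_distr_prod, subst nn_integral_distr[OF c']) (use h in auto)
  also have "\<dots> = (\<integral>\<^sup>+ x. \<integral>\<^sup>+ y. h (Complex x y) \<partial>lborel \<partial>lborel)"
    using measurable_compose[OF c' h] by (subst lborel.nn_integral_fst[symmetric]) auto
  finally show ?thesis .
qed

text \<open>The change of variables formula with a Jacobian determinant speaks of
  \<open>real ^ 2\<close>; this map and its inverse carry it over to \<open>complex\<close>.\<close>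

definition complex_of_vec :: "real ^ 2 \<Rightarrow> complex" where
  "complex_of_vec v = Complex (v $ 1) (v $ 2)"

definition vec_of_complex :: "complex \<Rightarrow> real ^ 2" where
  "vec_of_complex z = vector [Re z, Im z]"

lemma complex_of_vec_inverse [simp]: "complex_of_vec (vec_of_complex z) = z"
  by (simp add: complex_of_vec_def vec_of_complex_def)

lemma vec_of_complex_inverse [simp]: "vec_of_complex (complex_of_vec v) = v"
  by (simp add: complex_of_vec_def vec_of_complex_def vec_eq_iff forall_2)

lemma bounded_linear_complex_of_vec: "bounded_linear complex_of_vec"
  unfolding linear_conv_bounded_linear[symmetric]
  by (rule linearI) (simp_all add: complex_of_vec_def complex_eq_iff)

lemma bounded_linear_vec_of_complex: "bounded_linear vec_of_complex"
  unfolding linear_conv_bounded_linear[symmetric]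
  by (rule linearI) (simp_all add: vec_of_complex_def vec_eq_iff forall_2)

lemma complex_of_vec_measurable [measurable]: "complex_of_vec \<in> borel_measurable borel"
  using bounded_linear_complex_of_vec by (intro borel_measurable_continuous_onI linear_continuous_on)

lemma lborel_complex_eq_distr_vec: "lborel = distr lborel borel complex_of_vec"
proof (rule lborel_eqI)
  fix l u :: complex assume le: "\<And>b. b \<in> Basis \<Longrightarrow> l \<bullet> b \<le> u \<bullet> b"
  have "complex_of_vec -` box l u = box (vec_of_complex l) (vec_of_complex u)"
    by (auto simp: box_def Basis_complex_def inner_complex_def complex_of_vec_def vec_of_complex_def
        Basis_vec_def inner_axis forall_2)
  then have "emeasure (distr lborel borel complex_of_vec) (box l u)
      = emeasure lborel (box (vec_of_complex l) (vec_of_complex u))"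
    by (simp add: emeasure_distr)
  also have "\<dots> = emeasure lborel (cbox (vec_of_complex l) (vec_of_complex u))"
    by (simp add: emeasure_lborel_box_eq emeasure_lborel_cbox_eq)
  also have "\<dots> = ennreal (measure lborel (cbox (vec_of_complex l) (vec_of_complex u)))"
    using emeasure_lborel_cbox_finite[of "vec_of_complex l" "vec_of_complex u"]
    by (intro emeasure_eq_ennreal_measure) (simp add: less_top)
  also have "measure lborel (cbox (vec_of_complex l) (vec_of_complex u)) = (Re u - Re l) * (Im u - Im l)"
    using le[of 1] le[of \<i>] by (subst content_cbox_cart) (auto simp: interval_ne_empty_cart forall_2 vec_of_complex_def UNIV_2)
  also have "\<dots> = (\<Prod>b\<in>Basis. (u - l) \<bullet> b)"
    using le[of 1] le[of \<i>] by (simp add: Basis_complex_def inner_complex_def complex_eq_iff)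
  finally show "emeasure (distr lborel borel complex_of_vec) (box l u) = (\<Prod>b\<in>Basis. (u - l) \<bullet> b)" .
qed simp

lemma det_matrix_complex_mult:
  "det (matrix (\<lambda>v. vec_of_complex (w * complex_of_vec v))) = (norm w)\<^sup>2"
  unfolding cmod_power2
  by (simp add: det_2 matrix_def vec_of_complex_def complex_of_vec_def axis_def power2_eq_square)

text \<open>The real derivative of a holomorphic map is a similarity with determinant
  \<open>(norm (\<Phi>' z))\<^sup>2\<close>, so the Jacobian formula becomes the area formula for
  conformal images.\<close>

lemma emeasure_conformal_image:
  fixes \<Phi> \<Phi>' :: "complex \<Rightarrow> complex"
  assumes S: "S \<in> sets borel" and der: "\<And>z. z \<in> S \<Longrightarrow> (\<Phi> has_field_derivative \<Phi>' z) (at z)"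
    and inj: "inj_on \<Phi> S" and meas: "\<Phi>' \<in> borel_measurable borel"
    and im: "\<Phi> ` S \<in> sets borel" "bounded (\<Phi> ` S)"
  shows "emeasure lborel (\<Phi> ` S) = (\<integral>\<^sup>+ z\<in>S. ennreal ((norm (\<Phi>' z))\<^sup>2) \<partial>lborel)"
proof -
  define f where "f = (\<lambda>v. vec_of_complex (\<Phi> (complex_of_vec v)))"
  define f' where "f' = (\<lambda>v h. vec_of_complex (\<Phi>' (complex_of_vec v) * complex_of_vec h))"
  define S2 where "S2 = complex_of_vec -` S"
  have S2: "S2 \<in> sets borel"
    using measurable_sets[OF complex_of_vec_measurable S] by (simp add: S2_def)
  have fder: "(f has_derivative f' v) (at v within S2)" if "v \<in> S2" for v
  proof -
    have "(\<Phi> has_derivative (*) (\<Phi>' (complex_of_vec v))) (at (complex_of_vec v))"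
      using der[of "complex_of_vec v"] that by (simp add: S2_def has_field_derivative_def)
    from has_derivative_compose[OF bounded_linear_imp_has_derivative[OF bounded_linear_complex_of_vec] this]
    have "((\<lambda>v. \<Phi> (complex_of_vec v)) has_derivative (\<lambda>h. \<Phi>' (complex_of_vec v) * complex_of_vec h)) (at v)" .
    then show ?thesis
      unfolding f_def f'_def
      by (rule has_derivative_at_withinI[OF bounded_linear.has_derivative[OF bounded_linear_vec_of_complex]])
  qed
  have finj: "inj_on f S2"
  proof (rule inj_onI)
    fix v w assume vw: "v \<in> S2" "w \<in> S2" "f v = f w"
    then have "complex_of_vec (f v) = complex_of_vec (f w)" by simp
    then have "\<Phi> (complex_of_vec v) = \<Phi> (complex_of_vec w)" by (simp add: f_def)
    then have "complex_of_vec v = complex_of_vec w" using inj vw by (auto simp: S2_def inj_on_def)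
    then have "vec_of_complex (complex_of_vec v) = vec_of_complex (complex_of_vec w)" by simp
    then show "v = w" by simp
  qed
  have img: "f ` S2 = complex_of_vec -` (\<Phi> ` S)"
  proof (intro equalityI subsetI)
    fix v assume "v \<in> complex_of_vec -` (\<Phi> ` S)"
    then obtain z where z: "z \<in> S" "complex_of_vec v = \<Phi> z" by auto
    then have "f (vec_of_complex z) = vec_of_complex (complex_of_vec v)" by (simp add: f_def)
    then have "v = f (vec_of_complex z)" by simp
    then show "v \<in> f ` S2" using z by (auto simp: S2_def)
  qed (auto simp: f_def S2_def)
  have fS: "f ` S2 \<in> sets borel"
    using measurable_sets[OF complex_of_vec_measurable im(1)] by (simp add: img)
  have "f ` S2 \<subseteq> vec_of_complex ` (\<Phi> ` S)"
    by (auto simp: f_def S2_def)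
  then have "bounded (f ` S2)"
    using bounded_linear_image[OF im(2) bounded_linear_vec_of_complex] bounded_subset by blast
  then have lm: "f ` S2 \<in> lmeasurable"
    using fS by (intro bounded_set_imp_lmeasurable) auto
  have eq: "\<bar>det (matrix (f' v))\<bar> = (norm (\<Phi>' (complex_of_vec v)))\<^sup>2" for v
    by (simp add: f'_def det_matrix_complex_mult)
  have hi0: "((\<lambda>v. (norm (\<Phi>' (complex_of_vec v)))\<^sup>2) has_integral measure lebesgue (f ` S2)) S2"
    using has_measure_differentiable_image[OF _ fder finj, of "measure lebesgue (f ` S2)"] S2 lm
    by (simp add: eq)
  have hi: "((\<lambda>v. (norm (\<Phi>' (complex_of_vec v)))\<^sup>2 * indicator S2 v) has_integral measure lebesgue (f ` S2)) UNIV"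
  proof -
    have "(\<lambda>v. g v * indicator S2 v) = (\<lambda>v. if v \<in> S2 then g v else 0)" for g :: "real ^ 2 \<Rightarrow> real"
      by (simp add: fun_eq_iff)
    then show ?thesis using hi0 by (simp only: has_integral_restrict_UNIV)
  qed
  have [measurable]: "(\<lambda>v. \<Phi>' (complex_of_vec v)) \<in> borel_measurable borel"
    by (rule measurable_compose[OF complex_of_vec_measurable meas])
  have "(\<integral>\<^sup>+ v. ennreal ((norm (\<Phi>' (complex_of_vec v)))\<^sup>2 * indicator S2 v) \<partial>lborel) = ennreal (measure lebesgue (f ` S2))"
    using S2 by (intro nn_integral_has_integral_lborel[OF _ _ hi]) auto
  also have "\<dots> = emeasure lborel (f ` S2)"
    using lm fS by (subst emeasure_eq_measure2[OF lm, symmetric]) simp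
  also have "\<dots> = emeasure lborel (\<Phi> ` S)"
    using arg_cong[OF lborel_complex_eq_distr_vec, of "\<lambda>M. emeasure M (\<Phi> ` S)"] im(1)
    by (simp add: emeasure_distr img)
  finally have "emeasure lborel (\<Phi> ` S) = (\<integral>\<^sup>+ v. ennreal ((norm (\<Phi>' (complex_of_vec v)))\<^sup>2 * indicator S2 v) \<partial>lborel)"
    by simp
  also have "\<dots> = (\<integral>\<^sup>+ v. ennreal ((norm (\<Phi>' (complex_of_vec v)))\<^sup>2) * indicator S (complex_of_vec v) \<partial>lborel)"
    by (intro nn_integral_cong) (auto simp: S2_def indicator_def)
  also have "\<dots> = (\<integral>\<^sup>+ z. ennreal ((norm (\<Phi>' z))\<^sup>2) * indicator S z \<partial>distr lborel borel complex_of_vec)"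
    using meas S by (subst nn_integral_distr) auto
  finally show ?thesis by (simp add: lborel_complex_eq_distr_vec[symmetric])
qed

lemma nn_integral_conformal_image:
  fixes \<Phi> :: "complex \<Rightarrow> complex"
  assumes R: "open R" and hol: "\<Phi> holomorphic_on R" and inj: "inj_on \<Phi> R"
    and bdd: "bounded (\<Phi> ` R)" and h: "h \<in> borel_measurable borel"
  shows "(\<integral>\<^sup>+ z\<in>\<Phi> ` R. h z \<partial>lborel) = (\<integral>\<^sup>+ z\<in>R. h (\<Phi> z) * ennreal ((norm (deriv \<Phi> z))\<^sup>2) \<partial>lborel)"
proof -
  \<comment> \<open>Extension by 0 makes the derivative and the map Borel functions on the whole
    plane.\<close>
  define \<Phi>' where "\<Phi>' z = (if z \<in> R then deriv \<Phi> z else 0)" for z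
  define \<Psi> where "\<Psi> z = (if z \<in> R then \<Phi> z else 0)" for z
  have m1 [measurable]: "\<Phi>' \<in> borel_measurable borel" "\<Psi> \<in> borel_measurable borel"
    unfolding \<Phi>'_def \<Psi>_def using R
    by (auto intro!: borel_measurable_continuous_on_if holomorphic_on_imp_continuous_on hol holomorphic_deriv continuous_intros)
  have oimg: "open (\<Phi> ` R)" by (rule open_mapping_thm3[OF hol R inj])
  have [measurable]: "R \<in> sets borel" "\<Phi> ` R \<in> sets borel" using R oimg by auto
  let ?N = "density lborel (\<lambda>z. ennreal ((norm (\<Phi>' z))\<^sup>2) * indicator R z)"
  \<comment> \<open>By the area formula the two measures agree on all Borel sets; integrating
    \<open>h\<close> against both is the claim.\<close>
  have "density lborel (indicator (\<Phi> ` R)) = distr ?N borel \<Psi>"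
  proof (rule measure_eqI)
    fix A assume "A \<in> sets (density lborel (indicator (\<Phi> ` R)))"
    then have A [measurable]: "A \<in> sets borel" by simp
    define S where "S = R \<inter> \<Psi> -` A"
    have S: "S \<in> sets borel" unfolding S_def using measurable_sets[OF m1(2) A] by auto
    have img: "\<Phi> ` S = A \<inter> \<Phi> ` R" by (auto simp: S_def \<Psi>_def)
    have "emeasure (density lborel (indicator (\<Phi> ` R))) A = emeasure lborel (A \<inter> \<Phi> ` R)"
      by (simp add: emeasure_density indicator_inter_arith[symmetric] Int_commute)
    also have "\<dots> = emeasure lborel (\<Phi> ` S)" by (simp add: img)
    also have "\<dots> = (\<integral>\<^sup>+ z\<in>S. ennreal ((norm (\<Phi>' z))\<^sup>2) \<partial>lborel)"
    proof (rule emeasure_conformal_image[OF S])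
      fix z assume "z \<in> S"
      then show "(\<Phi> has_field_derivative \<Phi>' z) (at z)"
        using hol R by (auto simp: S_def \<Phi>'_def intro: holomorphic_derivI)
    next
      show "inj_on \<Phi> S" using inj by (rule inj_on_subset) (auto simp: S_def)
      show "bounded (\<Phi> ` S)" using bdd by (rule bounded_subset) (auto simp: S_def)
    qed (auto simp: img)
    also have "\<dots> = (\<integral>\<^sup>+ z. (ennreal ((norm (\<Phi>' z))\<^sup>2) * indicator R z) * indicator (\<Psi> -` A) z \<partial>lborel)"
      by (intro nn_integral_cong) (auto simp: S_def indicator_def)
    also have "\<dots> = emeasure (distr ?N borel \<Psi>) A"
      using measurable_sets[OF m1(2) A] by (simp add: emeasure_distr emeasure_density)
    finally show "emeasure (density lborel (indicator (\<Phi> ` R))) A = emeasure (distr ?N borel \<Psi>) A" .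
  qed simp
  then have "(\<integral>\<^sup>+ z. h z \<partial>density lborel (indicator (\<Phi> ` R))) = (\<integral>\<^sup>+ z. h z \<partial>distr ?N borel \<Psi>)" by simp
  then have "(\<integral>\<^sup>+ z. indicator (\<Phi> ` R) z * h z \<partial>lborel) = (\<integral>\<^sup>+ z. (ennreal ((norm (\<Phi>' z))\<^sup>2) * indicator R z) * h (\<Psi> z) \<partial>lborel)"
    using h by (simp add: nn_integral_density nn_integral_distr)
  also have "\<dots> = (\<integral>\<^sup>+ z\<in>R. h (\<Phi> z) * ennreal ((norm (deriv \<Phi> z))\<^sup>2) \<partial>lborel)"
    by (intro nn_integral_cong) (auto simp: \<Phi>'_def \<Psi>_def indicator_def mult.commute)
  finally show ?thesis by (simp add: mult.commute)
qed

section \<open>Complete elliptic integrals\<close>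

definition ell_Delta :: "real \<Rightarrow> real \<Rightarrow> real" where
  "ell_Delta r \<theta> = sqrt (1 - r\<^sup>2 * (sin \<theta>)\<^sup>2)"

definition compl_K :: "real \<Rightarrow> real" where
  "compl_K r = integral {0..pi/2} (\<lambda>\<theta>. 1 / ell_Delta r \<theta>)"

definition compl_E :: "real \<Rightarrow> real" where
  "compl_E r = integral {0..pi/2} (ell_Delta r)"

lemma ell_Delta_radicand_pos:
  fixes r \<theta> :: real
  assumes "\<bar>r\<bar> < 1"
  shows "0 < 1 - r\<^sup>2 * (sin \<theta>)\<^sup>2"
proof -
  have "r\<^sup>2 * (sin \<theta>)\<^sup>2 \<le> r\<^sup>2 * 1" by (intro mult_left_mono) (simp_all add: abs_square_le_1)
  also have "r\<^sup>2 < 1" using assms by (simp add: abs_square_less_1)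
  finally show ?thesis by simp
qed

lemma ell_Delta_pos: "\<bar>r\<bar> < 1 \<Longrightarrow> 0 < ell_Delta r \<theta>"
  using ell_Delta_radicand_pos by (simp add: ell_Delta_def)

lemma ell_Delta_power2: "\<bar>r\<bar> < 1 \<Longrightarrow> (ell_Delta r \<theta>)\<^sup>2 = 1 - r\<^sup>2 * (sin \<theta>)\<^sup>2"
  using ell_Delta_radicand_pos[of r \<theta>] by (simp add: ell_Delta_def)

lemma ell_Delta_le_1: "ell_Delta r \<theta> \<le> 1"
  by (simp add: ell_Delta_def)

lemma continuous_on_ell_Delta: "continuous_on S (ell_Delta r)"
  unfolding ell_Delta_def by (intro continuous_intros)

lemma ell_Delta_integrable:
  assumes "\<bar>r\<bar> < 1" "continuous_on {0..pi/2} f"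
  shows "(\<lambda>\<theta>. f \<theta> / ell_Delta r \<theta>) integrable_on {0..pi/2}"
proof -
  have "ell_Delta r \<theta> \<noteq> 0" for \<theta> using ell_Delta_pos[OF assms(1), of \<theta>] by simp
  then show ?thesis
    by (intro integrable_continuous_real continuous_on_divide continuous_on_ell_Delta assms(2)) auto
qed

text \<open>Substitution x = sin \<theta>. The integrand of \<open>ellK\<close> is singular at 1, so
  the fundamental theorem is used in the form with continuity on the closed and differentiability on
  the open interval.\<close>

lemma ellK_eq_compl_K:
  assumes "\<bar>r\<bar> < 1"
  shows "ellK r = compl_K r"
proof -
  define G where "G t = integral {0..t} (\<lambda>\<theta>. 1 / ell_Delta r \<theta>)" for t
  have cont: "continuous_on {0..pi/2} (\<lambda>\<theta>. 1 / ell_Delta r \<theta>)"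
  proof (intro continuous_on_divide continuous_on_ell_Delta continuous_on_const ballI)
    show "ell_Delta r \<theta> \<noteq> 0" for \<theta> using ell_Delta_pos[OF assms, of \<theta>] by simp
  qed
  have Gcont: "continuous_on {0..pi/2} G"
    unfolding G_def by (rule indefinite_integral_continuous_1[OF integrable_continuous_real[OF cont]])
  have "((\<lambda>x. 1 / sqrt ((1 - x\<^sup>2) * (1 - r\<^sup>2 * x\<^sup>2))) has_integral (G (arcsin 1) - G (arcsin 0))) {0..1}"
  proof (rule fundamental_theorem_of_calculus_interior)
    show "continuous_on {0..1} (\<lambda>x. G (arcsin x))"
    proof (rule continuous_on_compose2[OF Gcont continuous_on_subset[OF continuous_on_arcsin']])
      show "arcsin ` {0..1} \<subseteq> {0..pi / 2}"
      proof (clarify)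
        fix x :: real assume "x \<in> {0..1}"
        then show "arcsin x \<in> {0..pi / 2}"
          using arcsin_le_arcsin[of 0 x] arcsin_ubound[of x] by auto
      qed
    qed auto
    fix x :: real assume x: "x \<in> {0<..<1}"
    have asx: "arcsin x \<in> {0<..<pi/2}"
      using x arcsin_less_arcsin[of 0 x] arcsin_lt_bounded[of x] by auto
    have "(G has_real_derivative 1 / ell_Delta r (arcsin x)) (at (arcsin x) within {0..pi/2})"
      unfolding G_def using asx by (intro integral_has_real_derivative cont) auto
    then have G': "(G has_real_derivative 1 / ell_Delta r (arcsin x)) (at (arcsin x))"
      using asx by (subst (asm) at_within_interior) auto
    have "((\<lambda>x. G (arcsin x)) has_real_derivative 1 / ell_Delta r (arcsin x) * inverse (sqrt (1 - x\<^sup>2))) (at x)"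
      using x by (intro DERIV_chain2[where f = G and g = arcsin, OF G'] DERIV_arcsin) auto
    moreover have "1 / ell_Delta r (arcsin x) * inverse (sqrt (1 - x\<^sup>2)) = 1 / sqrt ((1 - x\<^sup>2) * (1 - r\<^sup>2 * x\<^sup>2))"
      using x unfolding real_sqrt_mult by (simp add: ell_Delta_def divide_inverse)
    ultimately show "((\<lambda>x. G (arcsin x)) has_vector_derivative 1 / sqrt ((1 - x\<^sup>2) * (1 - r\<^sup>2 * x\<^sup>2))) (at x)"
      by (simp add: has_real_derivative_iff_has_vector_derivative)
  qed simp
  then show ?thesis
    unfolding ellK_def compl_K_def by (simp add: integral_unique G_def)
qed

text \<open>Classically \<open>E - (1 - r\<^sup>2) * K\<close>. The derivatives of K, E and \<mu>
  and Legendre's relation become short in terms of it, and it is visibly nonnegative.\<close>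

definition compl_X :: "real \<Rightarrow> real" where
  "compl_X r = integral {0..pi/2} (\<lambda>\<theta>. r\<^sup>2 * (cos \<theta>)\<^sup>2 / ell_Delta r \<theta>)"

lemma compl_E_eq:
  assumes "\<bar>r\<bar> < 1"
  shows "compl_E r = compl_X r + (1 - r\<^sup>2) * compl_K r"
proof -
  have i1: "(\<lambda>\<theta>. r\<^sup>2 * (cos \<theta>)\<^sup>2 / ell_Delta r \<theta>) integrable_on {0..pi/2}"
    by (intro ell_Delta_integrable[OF assms] continuous_intros)
  have i2: "(\<lambda>\<theta>. 1 / ell_Delta r \<theta>) integrable_on {0..pi/2}"
    by (intro ell_Delta_integrable[OF assms] continuous_intros)
  have "compl_X r + (1 - r\<^sup>2) * compl_K r
      = integral {0..pi/2} (\<lambda>\<theta>. r\<^sup>2 * (cos \<theta>)\<^sup>2 / ell_Delta r \<theta> + (1 - r\<^sup>2) * (1 / ell_Delta r \<theta>))"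
    unfolding compl_X_def compl_K_def
    by (simp only: integral_add[OF i1 integrable_on_mult_right[OF i2]] integral_mult_right)
  also have "\<dots> = compl_E r"
    unfolding compl_E_def
  proof (rule integral_cong)
    fix \<theta> assume "\<theta> \<in> {0..pi/2}"
    have "r\<^sup>2 * (cos \<theta>)\<^sup>2 + (1 - r\<^sup>2) = (ell_Delta r \<theta>)\<^sup>2"
      unfolding ell_Delta_power2[OF assms] cos_squared_eq by (simp add: algebra_simps)
    then have "r\<^sup>2 * (cos \<theta>)\<^sup>2 / ell_Delta r \<theta> + (1 - r\<^sup>2) * (1 / ell_Delta r \<theta>) = (ell_Delta r \<theta>)\<^sup>2 / ell_Delta r \<theta>"
      by (simp add: add_divide_distrib[symmetric])
    then show "r\<^sup>2 * (cos \<theta>)\<^sup>2 / ell_Delta r \<theta> + (1 - r\<^sup>2) * (1 / ell_Delta r \<theta>) = ell_Delta r \<theta>"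
      by (simp add: power2_eq_square)
  qed
  finally show ?thesis by simp
qed

lemma ell_Delta_has_derivative_r:
  assumes "\<bar>r\<bar> < 1"
  shows "((\<lambda>r. ell_Delta r \<theta>) has_real_derivative (- r * (sin \<theta>)\<^sup>2 / ell_Delta r \<theta>)) (at r within U)"
  unfolding ell_Delta_def using ell_Delta_radicand_pos[OF assms, of \<theta>]
  by (auto intro!: derivative_eq_intros simp: field_simps)

lemma ell_Delta_has_derivative_theta:
  assumes "\<bar>r\<bar> < 1"
  shows "(ell_Delta r has_real_derivative (- r\<^sup>2 * sin \<theta> * cos \<theta> / ell_Delta r \<theta>)) (at \<theta> within U)"
  unfolding ell_Delta_def using ell_Delta_radicand_pos[OF assms, of \<theta>]
  by (auto intro!: derivative_eq_intros simp: field_simps)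

lemma compl_E_has_derivative:
  assumes r: "0 < r" "r < 1"
  shows "(compl_E has_real_derivative (compl_E r - compl_K r) / r) (at r)"
proof -
  let ?U = "{-1<..<1::real}"
  have "((\<lambda>r. integral (cbox 0 (pi/2)) (ell_Delta r)) has_field_derivative
      integral (cbox 0 (pi/2)) (\<lambda>\<theta>. - r * (sin \<theta>)\<^sup>2 / ell_Delta r \<theta>)) (at r within ?U)"
  proof (rule leibniz_rule_field_derivative)
    fix x t assume "x \<in> ?U"
    then show "((\<lambda>r. ell_Delta r t) has_real_derivative (- x * (sin t)\<^sup>2 / ell_Delta x t)) (at x within ?U)"
      by (intro ell_Delta_has_derivative_r) auto
  next
    fix x show "ell_Delta x integrable_on cbox 0 (pi/2)"
      by (intro integrable_continuous continuous_on_ell_Delta)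
  next
    have "ell_Delta x t \<noteq> 0" if "x \<in> ?U" for x t
      using ell_Delta_pos[of x t] that by (auto simp: abs_less_iff)
    then show "continuous_on (?U \<times> cbox 0 (pi/2)) (\<lambda>(x, t). - x * (sin t)\<^sup>2 / ell_Delta x t)"
      unfolding case_prod_beta
      by (intro continuous_on_divide) (auto simp: ell_Delta_def intro!: continuous_intros)
  qed (use r in auto)
  moreover have "at r within ?U = at r" using r by (intro at_within_open) auto
  moreover have "integral (cbox 0 (pi/2)) (\<lambda>\<theta>. - r * (sin \<theta>)\<^sup>2 / ell_Delta r \<theta>) = (compl_E r - compl_K r) / r"
  proof -
    have i2: "(\<lambda>\<theta>. 1 / ell_Delta r \<theta>) integrable_on {0..pi/2}"
      using r by (intro ell_Delta_integrable continuous_intros) auto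
    have i1: "ell_Delta r integrable_on {0..pi/2}"
      by (intro integrable_continuous_real continuous_on_ell_Delta)
    have "(compl_E r - compl_K r) / r = integral {0..pi/2} (\<lambda>\<theta>. (ell_Delta r \<theta> - 1 / ell_Delta r \<theta>) / r)"
      unfolding compl_E_def compl_K_def integral_diff[OF i1 i2, symmetric] by simp
    also have "\<dots> = integral {0..pi/2} (\<lambda>\<theta>. - r * (sin \<theta>)\<^sup>2 / ell_Delta r \<theta>)"
    proof (rule integral_cong)
      fix \<theta>
      have "ell_Delta r \<theta> > 0" using r by (intro ell_Delta_pos) auto
      then have "(ell_Delta r \<theta> - 1 / ell_Delta r \<theta>) / r = ((ell_Delta r \<theta>)\<^sup>2 - 1) / (r * ell_Delta r \<theta>)"
        using r by (simp add: field_simps power2_eq_square)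
      also have "(ell_Delta r \<theta>)\<^sup>2 = 1 - r\<^sup>2 * (sin \<theta>)\<^sup>2" using r by (intro ell_Delta_power2) auto
      finally show "(ell_Delta r \<theta> - 1 / ell_Delta r \<theta>) / r = - r * (sin \<theta>)\<^sup>2 / ell_Delta r \<theta>"
        using r by (simp add: power2_eq_square)
    qed
    finally show ?thesis by simp
  qed
  ultimately show ?thesis
    by (simp add: compl_E_def[abs_def])
qed

lemma compl_K_has_derivative:
  assumes r: "0 < r" "r < 1"
  shows "(compl_K has_real_derivative compl_X r / (r * (1 - r\<^sup>2))) (at r)"
proof -
  let ?U = "{-1<..<1::real}"
  have r': "\<bar>r\<bar> < 1" using r by simp
  have r2: "r\<^sup>2 < 1" using r' by (simp add: abs_square_less_1)
  have pos: "ell_Delta r \<theta> > 0" for \<theta> using r' by (rule ell_Delta_pos)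
  have D2: "(ell_Delta r \<theta>)\<^sup>2 = 1 - r\<^sup>2 * (sin \<theta>)\<^sup>2" for \<theta> using r' by (rule ell_Delta_power2)
  let ?f = "\<lambda>x \<theta>. x * (sin \<theta>)\<^sup>2 / (ell_Delta x \<theta>) ^ 3"
  have nz: "ell_Delta x t \<noteq> 0" if "x \<in> ?U" for x t
    using ell_Delta_pos[of x t] that by (auto simp: abs_less_iff)
  have "((\<lambda>r. integral (cbox 0 (pi/2)) (\<lambda>\<theta>. 1 / ell_Delta r \<theta>)) has_field_derivative
      integral (cbox 0 (pi/2)) (?f r)) (at r within ?U)"
  proof (rule leibniz_rule_field_derivative)
    fix x t assume x: "x \<in> ?U"
    then have "((\<lambda>r. ell_Delta r t) has_real_derivative (- x * (sin t)\<^sup>2 / ell_Delta x t)) (at x within ?U)"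
      by (intro ell_Delta_has_derivative_r) auto
    from DERIV_inverse'[OF this nz[OF x]]
    show "((\<lambda>r. 1 / ell_Delta r t) has_real_derivative (?f x t)) (at x within ?U)"
      by (simp add: field_simps power3_eq_cube)
  next
    fix x assume "x \<in> ?U"
    then show "(\<lambda>\<theta>. 1 / ell_Delta x \<theta>) integrable_on cbox 0 (pi/2)"
      using ell_Delta_integrable[of x "\<lambda>_. 1"] by (simp add: abs_less_iff)
  next
    show "continuous_on (?U \<times> cbox 0 (pi/2)) (\<lambda>(x, t). ?f x t)"
      unfolding case_prod_beta
    proof (intro continuous_on_divide ballI)
      show "continuous_on (?U \<times> cbox 0 (pi/2)) (\<lambda>z. fst z * (sin (snd z))\<^sup>2)"
        by (intro continuous_intros)
      show "continuous_on (?U \<times> cbox 0 (pi/2)) (\<lambda>z. ell_Delta (fst z) (snd z) ^ 3)"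
        unfolding ell_Delta_def by (intro continuous_intros)
      fix z assume "z \<in> ?U \<times> cbox 0 (pi/2)"
      then show "ell_Delta (fst z) (snd z) ^ 3 \<noteq> 0" using nz[of "fst z" "snd z"] by auto
    qed
  qed (use r in auto)
  moreover have "at r within ?U = at r" using r by (intro at_within_open) auto
  moreover have "integral (cbox 0 (pi/2)) (?f r) = compl_X r / (r * (1 - r\<^sup>2))"
  proof -
    \<comment> \<open>integration by parts: the derivative of \<open>sin \<theta> * cos \<theta> / \<Delta>\<close> integrates to 0\<close>
    let ?h = "\<lambda>\<theta>. (r\<^sup>2 * (cos \<theta>)\<^sup>2 / ell_Delta r \<theta>) / (r * (1 - r\<^sup>2)) - ?f r \<theta>"
    have "(?h has_integral (r / (1 - r\<^sup>2) * (sin (pi/2) * cos (pi/2) / ell_Delta r (pi/2)) -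
        r / (1 - r\<^sup>2) * (sin 0 * cos 0 / ell_Delta r 0))) {0..pi/2}"
    proof (rule fundamental_theorem_of_calculus)
      fix x
      have "((\<lambda>\<theta>. r / (1 - r\<^sup>2) * (sin \<theta> * cos \<theta> / ell_Delta r \<theta>)) has_real_derivative
          r / (1 - r\<^sup>2) * (((cos x * cos x - sin x * sin x) * ell_Delta r x -
            sin x * cos x * (- r\<^sup>2 * sin x * cos x / ell_Delta r x)) / (ell_Delta r x * ell_Delta r x))) (at x within {0..pi/2})"
      proof (intro DERIV_cmult DERIV_divide ell_Delta_has_derivative_theta[OF r'])
        show "((\<lambda>\<theta>. sin \<theta> * cos \<theta>) has_real_derivative cos x * cos x - sin x * sin x) (at x within {0..pi/2})"
          by (auto intro!: derivative_eq_intros)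
        show "ell_Delta r x \<noteq> 0" using pos[of x] by simp
      qed
      moreover have "r / (1 - r\<^sup>2) * (((cos x * cos x - sin x * sin x) * ell_Delta r x -
            sin x * cos x * (- r\<^sup>2 * sin x * cos x / ell_Delta r x)) / (ell_Delta r x * ell_Delta r x)) = ?h x"
      proof -
        define D s c where "D = ell_Delta r x" and "s = sin x" and "c = cos x"
        have D: "D > 0" "D\<^sup>2 = 1 - r\<^sup>2 * s\<^sup>2" using pos[of x] D2[of x] by (auto simp: D_def s_def)
        have sc: "c\<^sup>2 = 1 - s\<^sup>2" by (simp add: c_def s_def cos_squared_eq)
        have "r / (1 - r\<^sup>2) * (((c * c - s * s) * D - s * c * (- r\<^sup>2 * s * c / D)) / (D * D))
            = r / (1 - r\<^sup>2) * (((c\<^sup>2 - s\<^sup>2) * D\<^sup>2 + r\<^sup>2 * s\<^sup>2 * c\<^sup>2) / D ^ 3)"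
          using D(1) by (simp add: field_simps power2_eq_square power3_eq_cube)
        also have "(c\<^sup>2 - s\<^sup>2) * D\<^sup>2 + r\<^sup>2 * s\<^sup>2 * c\<^sup>2 = c\<^sup>2 * D\<^sup>2 - (1 - r\<^sup>2) * s\<^sup>2"
          unfolding D(2) sc by (simp add: algebra_simps power2_eq_square)
        also have "r / (1 - r\<^sup>2) * ((c\<^sup>2 * D\<^sup>2 - (1 - r\<^sup>2) * s\<^sup>2) / D ^ 3)
            = (r\<^sup>2 * c\<^sup>2 / D) / (r * (1 - r\<^sup>2)) - r * s\<^sup>2 / D ^ 3"
        proof -
          define q where "q = 1 - r\<^sup>2"
          have q: "q \<noteq> 0" using r2 by (simp add: q_def)
          have e1: "c\<^sup>2 * D\<^sup>2 / D ^ 3 = c\<^sup>2 / D"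
            using D(1) by (simp add: power2_eq_square power3_eq_cube)
          have e2: "(r\<^sup>2 * c\<^sup>2 / D) / (r * q) = r / q * (c\<^sup>2 / D)"
            using r by (simp add: power2_eq_square)
          have e3: "r / q * (q * s\<^sup>2 / D ^ 3) = r * s\<^sup>2 / D ^ 3"
            using q by simp
          show ?thesis
            unfolding q_def[symmetric] e2 diff_divide_distrib right_diff_distrib e1 e3 ..
        qed
        finally show ?thesis by (simp add: D_def s_def c_def)
      qed
      ultimately show "((\<lambda>\<theta>. r / (1 - r\<^sup>2) * (sin \<theta> * cos \<theta> / ell_Delta r \<theta>)) has_vector_derivative ?h x) (at x within {0..pi/2})"
        by (simp add: has_real_derivative_iff_has_vector_derivative)
    qed simp
    then have h0: "(?h has_integral 0) {0..pi/2}" by simp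
    have "((\<lambda>\<theta>. (r\<^sup>2 * (cos \<theta>)\<^sup>2 / ell_Delta r \<theta>) / (r * (1 - r\<^sup>2))) has_integral compl_X r / (r * (1 - r\<^sup>2))) {0..pi/2}"
      unfolding compl_X_def
      by (intro has_integral_divide integrable_integral ell_Delta_integrable[OF r'] continuous_intros)
    from has_integral_diff[OF this h0]
    show ?thesis by (simp add: integral_unique)
  qed
  ultimately show ?thesis
    by (simp add: compl_K_def[abs_def])
qed

lemma compl_X_has_derivative:
  assumes r: "0 < r" "r < 1"
  shows "(compl_X has_real_derivative r * compl_K r) (at r)"
proof -
  have r2: "r\<^sup>2 < 1" using r by (simp add: abs_square_less_1)
  have "((\<lambda>r. compl_E r - (1 - r\<^sup>2) * compl_K r) has_real_derivative r * compl_K r) (at r)"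
    using r r2 compl_E_eq[of r]
    by (auto intro!: derivative_eq_intros compl_E_has_derivative compl_K_has_derivative simp: divide_simps)
       (simp add: algebra_simps power2_eq_square)
  then show ?thesis
  proof (rule has_field_derivative_transform_within_open[where S = "{0<..<1}"])
    fix x :: real assume "x \<in> {0<..<1}"
    then show "compl_E x - (1 - x\<^sup>2) * compl_K x = compl_X x" using compl_E_eq[of x] by simp
  qed (use r in auto)
qed

lemma compl_K_ge: "\<bar>r\<bar> < 1 \<Longrightarrow> pi / 2 \<le> compl_K r"
proof -
  assume r: "\<bar>r\<bar> < 1"
  have "integral {0..pi/2} (\<lambda>_. 1 :: real) \<le> compl_K r"
    unfolding compl_K_def
    using ell_Delta_integrable[OF r, of "\<lambda>_. 1"]
    by (intro integral_le) (use ell_Delta_pos[OF r] ell_Delta_le_1 in auto)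
  then show ?thesis by simp
qed

lemma compl_K_pos: "\<bar>r\<bar> < 1 \<Longrightarrow> 0 < compl_K r"
  using compl_K_ge[of r] pi_gt_zero by linarith

lemma integral_cos_squared: "integral {0..pi/2} (\<lambda>\<theta>. (cos \<theta>)\<^sup>2) = (pi / 4 :: real)"
proof -
  have "((\<lambda>\<theta>. (cos \<theta>)\<^sup>2) has_integral ((pi/2) / 2 + sin (pi/2) * cos (pi/2) / 2 - (0 / 2 + sin 0 * cos 0 / 2))) {0..pi/2}"
  proof (rule fundamental_theorem_of_calculus)
    fix x :: real
    have "((\<lambda>x. x / 2 + sin x * cos x / 2) has_real_derivative 1 / 2 + (cos x * cos x - sin x * sin x) / 2) (at x within {0..pi/2})"
      by (auto intro!: derivative_eq_intros)
    moreover have "1 / 2 + (cos x * cos x - sin x * sin x) / 2 = (cos x)\<^sup>2"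
    proof -
      have "sin x * sin x = 1 - cos x * cos x"
        using sin_cos_squared_add[of x] unfolding power2_eq_square by (rule eq_diff_eq[THEN iffD2])
      then show ?thesis by (simp add: power2_eq_square field_simps)
    qed
    ultimately have "((\<lambda>x. x / 2 + sin x * cos x / 2) has_real_derivative (cos x)\<^sup>2) (at x within {0..pi/2})"
      by simp
    then show "((\<lambda>x. x / 2 + sin x * cos x / 2) has_vector_derivative (cos x)\<^sup>2) (at x within {0..pi/2})"
      by (simp add: has_real_derivative_iff_has_vector_derivative)
  qed simp
  then show ?thesis by (simp add: integral_unique)
qed

lemma integral_sin_squared: "integral {0..pi/2} (\<lambda>\<theta>. (sin \<theta>)\<^sup>2) = (pi / 4 :: real)"
proof -
  have "integral {0..pi/2} (\<lambda>\<theta>. (sin \<theta>)\<^sup>2) = integral {0..pi/2} (\<lambda>\<theta>. 1 - (cos \<theta>)\<^sup>2)"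
    by (simp add: sin_squared_eq)
  also have "\<dots> = pi / 2 - pi / 4"
  proof (subst integral_diff)
    show "(\<lambda>\<theta>. (cos \<theta>)\<^sup>2 :: real) integrable_on {0..pi/2}"
      by (intro integrable_continuous_real continuous_intros)
    show "(\<lambda>\<theta>. 1 :: real) integrable_on {0..pi/2}" by (rule integrable_const_ivl)
  qed (simp add: integral_cos_squared)
  finally show ?thesis by simp
qed

text \<open>Here Delta is bounded by 1. Together with \<open>compl_X_le\<close> this confines
  \<open>compl_X r / r\<^sup>2\<close> between pi / 4 and 1, and at the complementary modulus this
  means logarithmic growth of K' at 0.\<close>

lemma compl_X_ge:
  assumes "\<bar>r\<bar> < 1"
  shows "r\<^sup>2 * pi / 4 \<le> compl_X r"
proof -
  have "integral {0..pi/2} (\<lambda>\<theta>. r\<^sup>2 * (cos \<theta>)\<^sup>2) \<le> compl_X r"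
    unfolding compl_X_def
  proof (rule integral_le)
    show "(\<lambda>\<theta>. r\<^sup>2 * (cos \<theta>)\<^sup>2) integrable_on {0..pi/2}"
      by (intro integrable_continuous_real continuous_intros)
    show "(\<lambda>\<theta>. r\<^sup>2 * (cos \<theta>)\<^sup>2 / ell_Delta r \<theta>) integrable_on {0..pi/2}"
      by (intro ell_Delta_integrable[OF assms] continuous_intros)
    fix \<theta>
    have "r\<^sup>2 * (cos \<theta>)\<^sup>2 * ell_Delta r \<theta> \<le> r\<^sup>2 * (cos \<theta>)\<^sup>2 * 1"
      by (intro mult_left_mono ell_Delta_le_1) simp
    then show "r\<^sup>2 * (cos \<theta>)\<^sup>2 \<le> r\<^sup>2 * (cos \<theta>)\<^sup>2 / ell_Delta r \<theta>"
      using ell_Delta_pos[OF assms, of \<theta>] by (simp add: le_divide_eq)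
  qed
  then show ?thesis by (simp add: integral_cos_squared)
qed

lemma cos_le_ell_Delta: "\<bar>r\<bar> < 1 \<Longrightarrow> \<bar>cos \<theta>\<bar> \<le> ell_Delta r \<theta>"
proof -
  assume r: "\<bar>r\<bar> < 1"
  have "r\<^sup>2 * (sin \<theta>)\<^sup>2 \<le> 1 * (sin \<theta>)\<^sup>2"
    using r by (intro mult_right_mono) (simp_all add: abs_square_le_1)
  then have "\<bar>cos \<theta>\<bar>\<^sup>2 \<le> (ell_Delta r \<theta>)\<^sup>2"
    unfolding ell_Delta_power2[OF r] power2_abs cos_squared_eq by linarith
  then show ?thesis
    by (rule power2_le_imp_le) (rule less_imp_le[OF ell_Delta_pos[OF r]])
qed

lemma integral_cos: "integral {0..pi/2} cos = (1 :: real)"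
proof -
  have "((cos :: real \<Rightarrow> real) has_integral (sin (pi/2) - sin 0)) {0..pi/2}"
  proof (rule fundamental_theorem_of_calculus)
    fix x :: real
    show "(sin has_vector_derivative cos x) (at x within {0..pi/2})"
      unfolding has_real_derivative_iff_has_vector_derivative[symmetric]
      by (rule has_field_derivative_at_within[OF DERIV_sin])
  qed simp
  then show ?thesis by (simp add: integral_unique)
qed

lemma compl_X_le:
  assumes "\<bar>r\<bar> < 1"
  shows "compl_X r \<le> r\<^sup>2"
proof -
  have "compl_X r \<le> integral {0..pi/2} (\<lambda>\<theta>. r\<^sup>2 * cos \<theta>)"
    unfolding compl_X_def
  proof (rule integral_le)
    show "(\<lambda>\<theta>. r\<^sup>2 * cos \<theta>) integrable_on {0..pi/2}"
      by (intro integrable_continuous_real continuous_intros)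
    show "(\<lambda>\<theta>. r\<^sup>2 * (cos \<theta>)\<^sup>2 / ell_Delta r \<theta>) integrable_on {0..pi/2}"
      by (intro ell_Delta_integrable[OF assms] continuous_intros)
    fix \<theta> assume "\<theta> \<in> {0..pi/2}"
    then have c: "0 \<le> cos \<theta>" by (intro cos_ge_zero) auto
    have "r\<^sup>2 * cos \<theta> * cos \<theta> \<le> r\<^sup>2 * cos \<theta> * ell_Delta r \<theta>"
      using c cos_le_ell_Delta[OF assms, of \<theta>] by (intro mult_left_mono) auto
    then show "r\<^sup>2 * (cos \<theta>)\<^sup>2 / ell_Delta r \<theta> \<le> r\<^sup>2 * cos \<theta>"
      using ell_Delta_pos[OF assms, of \<theta>] by (simp add: divide_le_eq power2_eq_square)
  qed
  then show ?thesis by (simp add: integral_cos)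
qed

text \<open>With the complementary modulus \<open>q\<close> one has
  \<open>ell_Delta r \<theta> \<le> cos \<theta> + q\<close>, so the integrand is at least
  \<open>r\<^sup>2 * (cos \<theta> - q)\<close>. This bound tends to 1 as \<open>r\<close> tends to
  1, and it is what bounds Legendre's constant from below.\<close>

lemma compl_X_ge_near_1:
  assumes "0 \<le> r" "r < 1"
  shows "r\<^sup>2 * (1 - sqrt (1 - r\<^sup>2) * pi / 2) \<le> compl_X r"
proof -
  have r: "\<bar>r\<bar> < 1" and r2: "r\<^sup>2 < 1" using assms by (auto simp: abs_square_less_1)
  define q where "q = sqrt (1 - r\<^sup>2)"
  have q: "q > 0" "q\<^sup>2 = 1 - r\<^sup>2" using r2 by (auto simp: q_def)
  have "integral {0..pi/2} (\<lambda>\<theta>. r\<^sup>2 * (cos \<theta> - q)) \<le> compl_X r"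
    unfolding compl_X_def
  proof (rule integral_le)
    show "(\<lambda>\<theta>. r\<^sup>2 * (cos \<theta> - q)) integrable_on {0..pi/2}"
      by (intro integrable_continuous_real continuous_intros)
    show "(\<lambda>\<theta>. r\<^sup>2 * (cos \<theta>)\<^sup>2 / ell_Delta r \<theta>) integrable_on {0..pi/2}"
      by (intro ell_Delta_integrable[OF r] continuous_intros)
    fix \<theta> assume "\<theta> \<in> {0..pi/2}"
    then have c: "0 \<le> cos \<theta>" by (intro cos_ge_zero) auto
    have "q\<^sup>2 * (sin \<theta>)\<^sup>2 \<le> q\<^sup>2 * 1" by (intro mult_left_mono) (simp_all add: abs_square_le_1)
    moreover have "(ell_Delta r \<theta>)\<^sup>2 = (cos \<theta>)\<^sup>2 + q\<^sup>2 * (sin \<theta>)\<^sup>2"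
      unfolding ell_Delta_power2[OF r] q(2) cos_squared_eq by (simp add: algebra_simps)
    moreover have "0 \<le> cos \<theta> * q" using c q by simp
    ultimately have "(ell_Delta r \<theta>)\<^sup>2 \<le> (cos \<theta> + q)\<^sup>2"
      by (simp add: power2_sum)
    then have D: "ell_Delta r \<theta> \<le> cos \<theta> + q" by (rule power2_le_imp_le) (use c q in auto)
    have "(cos \<theta> - q) * ell_Delta r \<theta> \<le> (cos \<theta>)\<^sup>2"
    proof (cases "cos \<theta> \<le> q")
      case True
      then have "(cos \<theta> - q) * ell_Delta r \<theta> \<le> 0"
        using ell_Delta_pos[OF r, of \<theta>] by (intro mult_nonpos_nonneg) auto
      also have "0 \<le> (cos \<theta>)\<^sup>2" by simp
      finally show ?thesis .
    next
      case False
      then have "(cos \<theta> - q) * ell_Delta r \<theta> \<le> (cos \<theta> - q) * (cos \<theta> + q)"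
        using D by (intro mult_left_mono) auto
      also have "\<dots> = (cos \<theta>)\<^sup>2 - q\<^sup>2" by (simp add: algebra_simps power2_eq_square)
      finally show ?thesis using zero_le_power2[of q] by linarith
    qed
    then have "r\<^sup>2 * ((cos \<theta> - q) * ell_Delta r \<theta>) \<le> r\<^sup>2 * (cos \<theta>)\<^sup>2" by (rule mult_left_mono) simp
    then show "r\<^sup>2 * (cos \<theta> - q) \<le> r\<^sup>2 * (cos \<theta>)\<^sup>2 / ell_Delta r \<theta>"
      using ell_Delta_pos[OF r, of \<theta>] by (simp add: le_divide_eq mult.assoc)
  qed
  also have "integral {0..pi/2} (\<lambda>\<theta>. r\<^sup>2 * (cos \<theta> - q)) = r\<^sup>2 * (integral {0..pi/2} cos - q * pi / 2)"
  proof -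
    have "integral {0..pi/2} (\<lambda>\<theta>. cos \<theta> - q) = integral {0..pi/2} cos - integral {0..pi/2} (\<lambda>_. q)"
      by (intro integral_diff integrable_continuous_real continuous_intros)
    then show ?thesis by simp
  qed
  finally show ?thesis by (simp add: integral_cos q_def)
qed

text \<open>The left side is the integral of
  \<open>(sin \<theta>)\<^sup>2 / ell_Delta r \<theta>\<close>, and Delta is at least the
  complementary modulus.\<close>

lemma compl_K_X_bound:
  assumes r: "0 < r" "r < 1"
  shows "compl_K r - compl_X r / r\<^sup>2 \<le> pi / (4 * sqrt (1 - r\<^sup>2))"
proof -
  have r': "\<bar>r\<bar> < 1" and r2: "r\<^sup>2 < 1" using r by (auto simp: abs_square_less_1)
  define q where "q = sqrt (1 - r\<^sup>2)"
  have q: "q > 0" "q\<^sup>2 = 1 - r\<^sup>2" using r2 by (auto simp: q_def)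
  have i1: "(\<lambda>\<theta>. r\<^sup>2 * (cos \<theta>)\<^sup>2 / ell_Delta r \<theta>) integrable_on {0..pi/2}"
    by (intro ell_Delta_integrable[OF r'] continuous_intros)
  have i2: "(\<lambda>\<theta>. 1 / ell_Delta r \<theta>) integrable_on {0..pi/2}"
    by (intro ell_Delta_integrable[OF r'] continuous_intros)
  have "compl_K r - compl_X r / r\<^sup>2 = integral {0..pi/2} (\<lambda>\<theta>. 1 / ell_Delta r \<theta> - (r\<^sup>2 * (cos \<theta>)\<^sup>2 / ell_Delta r \<theta>) / r\<^sup>2)"
    unfolding compl_K_def compl_X_def
    by (simp only: integral_diff[OF i2 integrable_on_divide[OF i1]] integral_divide)
  also have "\<dots> = integral {0..pi/2} (\<lambda>\<theta>. (sin \<theta>)\<^sup>2 / ell_Delta r \<theta>)"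
    using r by (intro integral_cong) (simp add: sin_squared_eq diff_divide_distrib)
  also have "\<dots> \<le> integral {0..pi/2} (\<lambda>\<theta>. (sin \<theta>)\<^sup>2 / q)"
  proof (rule integral_le)
    show "(\<lambda>\<theta>. (sin \<theta>)\<^sup>2 / ell_Delta r \<theta>) integrable_on {0..pi/2}"
      by (intro ell_Delta_integrable[OF r'] continuous_intros)
    show "(\<lambda>\<theta>. (sin \<theta>)\<^sup>2 / q) integrable_on {0..pi/2}"
      using q by (intro integrable_continuous_real continuous_intros) auto
    fix \<theta>
    have "r\<^sup>2 * (sin \<theta>)\<^sup>2 \<le> r\<^sup>2 * 1" by (intro mult_left_mono) (simp_all add: abs_square_le_1)
    then have "q \<le> ell_Delta r \<theta>" by (simp add: q_def ell_Delta_def)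
    then show "(sin \<theta>)\<^sup>2 / ell_Delta r \<theta> \<le> (sin \<theta>)\<^sup>2 / q" using q by (intro divide_left_mono) auto
  qed
  also have "\<dots> = pi / (4 * q)" by (simp add: integral_sin_squared)
  finally show ?thesis by (simp add: q_def)
qed

section \<open>The distortion function\<close>

lemma compl_modulus:
  assumes "0 < r" "r < (1 :: real)"
  shows "0 < sqrt (1 - r\<^sup>2)" "sqrt (1 - r\<^sup>2) < 1" "(sqrt (1 - r\<^sup>2))\<^sup>2 = 1 - r\<^sup>2" "r\<^sup>2 < 1" "\<bar>r\<bar> < 1" "\<bar>sqrt (1 - r\<^sup>2)\<bar> < 1"
    "sqrt (1 - (sqrt (1 - r\<^sup>2))\<^sup>2) = r"
proof -
  show r2: "r\<^sup>2 < 1" "\<bar>r\<bar> < 1" using assms by (auto simp: abs_square_less_1)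
  show "0 < sqrt (1 - r\<^sup>2)" "sqrt (1 - r\<^sup>2) < 1" using r2 assms by auto
  then show "\<bar>sqrt (1 - r\<^sup>2)\<bar> < 1" by simp
  show "(sqrt (1 - r\<^sup>2))\<^sup>2 = 1 - r\<^sup>2" using r2 by simp
  then show "sqrt (1 - (sqrt (1 - r\<^sup>2))\<^sup>2) = r" using assms by simp
qed

abbreviation compl_K' :: "real \<Rightarrow> real" where "compl_K' r \<equiv> compl_K (sqrt (1 - r\<^sup>2))"
abbreviation compl_X' :: "real \<Rightarrow> real" where "compl_X' r \<equiv> compl_X (sqrt (1 - r\<^sup>2))"

lemma compl_modulus_has_derivative:
  assumes "0 < r" "r < (1 :: real)"
  shows "((\<lambda>r. sqrt (1 - r\<^sup>2)) has_real_derivative - r / sqrt (1 - r\<^sup>2)) (at r)"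
  using compl_modulus[OF assms] by (auto intro!: derivative_eq_intros simp: field_simps)

lemma compl_K'_has_derivative:
  assumes r: "0 < r" "r < 1"
  shows "(compl_K' has_real_derivative - (compl_X' r / (r * (1 - r\<^sup>2)))) (at r)"
proof -
  note q = compl_modulus[OF r]
  have "(compl_K' has_real_derivative
      compl_X' r / (sqrt (1 - r\<^sup>2) * (1 - (sqrt (1 - r\<^sup>2))\<^sup>2)) * (- r / sqrt (1 - r\<^sup>2))) (at r)"
    by (rule DERIV_chain2[where f = compl_K, OF compl_K_has_derivative[OF q(1,2)] compl_modulus_has_derivative[OF r]])
  also have "compl_X' r / (sqrt (1 - r\<^sup>2) * (1 - (sqrt (1 - r\<^sup>2))\<^sup>2)) * (- r / sqrt (1 - r\<^sup>2))
      = - (compl_X' r * r / ((sqrt (1 - r\<^sup>2))\<^sup>2 * r\<^sup>2))"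
    unfolding q(3) using r q(4) by (simp add: power2_eq_square[of "sqrt (1 - r\<^sup>2)"])
  also have "\<dots> = - (compl_X' r / (r * (1 - r\<^sup>2)))"
    unfolding q(3) using r by (simp add: power2_eq_square)
  finally show ?thesis .
qed

lemma compl_X'_has_derivative:
  assumes r: "0 < r" "r < 1"
  shows "(compl_X' has_real_derivative - (r * compl_K' r)) (at r)"
proof -
  note q = compl_modulus[OF r]
  have "(compl_X' has_real_derivative sqrt (1 - r\<^sup>2) * compl_K' r * (- r / sqrt (1 - r\<^sup>2))) (at r)"
    by (rule DERIV_chain2[where f = compl_X, OF compl_X_has_derivative[OF q(1,2)] compl_modulus_has_derivative[OF r]])
  then show ?thesis using q(1) by (simp add: mult.commute)
qed

section \<open>Legendre's relation and the derivative of \<mu>\<close>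

definition legendre_sum :: "real \<Rightarrow> real" where
  "legendre_sum r = compl_K' r * compl_X r + compl_K r * compl_X' r"

text \<open>Classically this is pi / 2; it enters as the value at one point of a function that turns
  out to be constant.\<close>

definition legendre_const :: real where "legendre_const = legendre_sum (1/2)"

text \<open>The derivatives of K and X are X / (r (1 - r^2)) and r K; those of the complementary
  functions have the same form with the opposite sign. So the four terms of the derivative cancel in
  pairs.\<close>

lemma legendre_relation:
  assumes r: "0 < r" "r < 1"
  shows "compl_K' r * compl_X r + compl_K r * compl_X' r = legendre_const"
proof -
  have "legendre_sum r = legendre_sum (1/2)"
  proof (rule DERIV_isconst3[of 0 1 r "1/2" legendre_sum])
    fix x :: real assume "x \<in> {0<..<1}"
    then have x: "0 < x" "x < 1" by auto
    have "(legendre_sum has_real_derivative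
        (- (compl_X' x / (x * (1 - x\<^sup>2))) * compl_X x + x * compl_K x * compl_K' x) +
        (compl_X x / (x * (1 - x\<^sup>2)) * compl_X' x + - (x * compl_K' x) * compl_K x)) (at x)"
      unfolding legendre_sum_def[abs_def]
      by (intro DERIV_add DERIV_mult compl_K_has_derivative[OF x] compl_X_has_derivative[OF x]
          compl_K'_has_derivative[OF x] compl_X'_has_derivative[OF x])
    then show "(legendre_sum has_real_derivative 0) (at x)" by (simp add: mult.commute)
  qed (use r in auto)
  then show ?thesis by (simp add: legendre_sum_def legendre_const_def)
qed

lemma compl_X_nonneg: "\<bar>r\<bar> < 1 \<Longrightarrow> 0 \<le> compl_X r"
  using compl_X_ge[of r] zero_le_power2[of r] pi_gt_zero
  by (meson divide_nonneg_nonneg mult_nonneg_nonneg order_trans less_imp_le zero_le_numeral)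

text \<open>Let \<open>r\<close> tend to 1: K' is at least pi / 2, the lower bound for X tends to 1,
  and the other product is nonnegative.\<close>

lemma legendre_const_ge: "pi / 2 \<le> legendre_const"
proof -
  have "((\<lambda>r. pi / 2 * (r\<^sup>2 * (1 - sqrt (1 - r\<^sup>2) * pi / 2))) \<longlongrightarrow> pi / 2 * (1\<^sup>2 * (1 - sqrt (1 - 1\<^sup>2) * pi / 2))) (at_left 1)"
    by (intro tendsto_intros) auto
  then have lim: "((\<lambda>r. pi / 2 * (r\<^sup>2 * (1 - sqrt (1 - r\<^sup>2) * pi / 2))) \<longlongrightarrow> pi / 2) (at_left 1)" by simp
  show ?thesis
  proof (rule tendsto_upperbound[OF lim])
    show "\<forall>\<^sub>F r in at_left 1. pi / 2 * (r\<^sup>2 * (1 - sqrt (1 - r\<^sup>2) * pi / 2)) \<le> legendre_const"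
      unfolding eventually_at_left_field
    proof (intro exI[of _ 0] conjI allI impI)
      fix r :: real assume r: "0 < r" "r < 1"
      note q = compl_modulus[OF r]
      have "pi / 2 * (r\<^sup>2 * (1 - sqrt (1 - r\<^sup>2) * pi / 2)) \<le> pi / 2 * compl_X r"
        using compl_X_ge_near_1[of r] r by (intro mult_left_mono) auto
      also have "\<dots> \<le> compl_K' r * compl_X r"
        using compl_K_ge[OF q(6)] compl_X_nonneg[OF q(5)] by (intro mult_right_mono) auto
      also have "\<dots> \<le> legendre_const"
        using legendre_relation[OF r] mult_nonneg_nonneg[OF less_imp_le[OF compl_K_pos[OF q(5)]] compl_X_nonneg[OF q(6)]]
        by linarith
      finally show "pi / 2 * (r\<^sup>2 * (1 - sqrt (1 - r\<^sup>2) * pi / 2)) \<le> legendre_const" .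
    qed simp
  qed simp
qed

lemma mu_eq:
  assumes "0 < r" "r < 1"
  shows "mu r = pi / 2 * (compl_K' r / compl_K r)"
  using compl_modulus[OF assms] by (simp add: mu_def ellK_eq_compl_K)

lemma mu_pos: "0 < r \<Longrightarrow> r < 1 \<Longrightarrow> 0 < mu r"
  by (simp add: mu_eq compl_K_pos compl_modulus)

text \<open>Up to the factor - 1 / (r (1 - r^2)) the numerator in the quotient rule is Legendre's
  sum, so that only K remains in the derivative.\<close>

lemma mu_has_derivative:
  assumes r: "0 < r" "r < 1"
  shows "(mu has_real_derivative - (pi / 2 * legendre_const / (r * (1 - r\<^sup>2) * (compl_K r)\<^sup>2))) (at r)"
proof -
  note q = compl_modulus[OF r]
  have K: "compl_K r > 0" by (rule compl_K_pos[OF q(5)])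
  have "((\<lambda>r. pi / 2 * (compl_K' r / compl_K r)) has_real_derivative
      pi / 2 * ((- (compl_X' r / (r * (1 - r\<^sup>2))) * compl_K r - compl_K' r * (compl_X r / (r * (1 - r\<^sup>2)))) / (compl_K r * compl_K r))) (at r)"
    using K by (intro DERIV_cmult DERIV_divide compl_K_has_derivative[OF r] compl_K'_has_derivative[OF r]) auto
  moreover have "(- (compl_X' r / (r * (1 - r\<^sup>2))) * compl_K r - compl_K' r * (compl_X r / (r * (1 - r\<^sup>2)))) =
      - (legendre_const / (r * (1 - r\<^sup>2)))"
    unfolding legendre_relation[OF r, symmetric] by (simp add: add_divide_distrib mult.commute)
  ultimately have "((\<lambda>r. pi / 2 * (compl_K' r / compl_K r)) has_real_derivative
      - (pi / 2 * legendre_const / (r * (1 - r\<^sup>2) * (compl_K r)\<^sup>2))) (at r)"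
    by (simp add: power2_eq_square mult_ac)
  then show ?thesis
    by (rule has_field_derivative_transform_within_open[where S = "{0<..<1}"]) (use r mu_eq in auto)
qed

lemma mu_strict_antimono:
  assumes "0 < r" "r < s" "s < 1"
  shows "mu s < mu r"
proof (rule DERIV_neg_imp_decreasing[OF \<open>r < s\<close>])
  fix x assume "r \<le> x" "x \<le> s"
  then have x: "0 < x" "x < 1" using assms by auto
  have "0 < legendre_const" using legendre_const_ge pi_gt_zero by linarith
  then have "- (pi / 2 * legendre_const / (x * (1 - x\<^sup>2) * (compl_K x)\<^sup>2)) < 0"
    using x compl_modulus[OF x] compl_K_pos[of x] by simp
  then show "\<exists>y. (mu has_real_derivative y) (at x) \<and> y < 0"
    using mu_has_derivative[OF x] by blast
qed

lemma compl_K'_antimono: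
  assumes "0 < r" "r \<le> s" "s < 1"
  shows "compl_K' s \<le> compl_K' r"
proof (rule DERIV_nonpos_imp_nonincreasing[OF \<open>r \<le> s\<close>])
  fix x assume "r \<le> x" "x \<le> s"
  then have x: "0 < x" "x < 1" using assms by auto
  have "- (compl_X' x / (x * (1 - x\<^sup>2))) \<le> 0"
    using x compl_modulus[OF x] compl_X_nonneg[OF compl_modulus(6)[OF x]] by simp
  then show "\<exists>y. (compl_K' has_real_derivative y) (at x) \<and> y \<le> 0"
    using compl_K'_has_derivative[OF x] by blast
qed

lemma compl_K_mono:
  assumes "0 < r" "r \<le> s" "s < 1"
  shows "compl_K r \<le> compl_K s"
proof (rule DERIV_nonneg_imp_nondecreasing[OF \<open>r \<le> s\<close>])
  fix x assume "r \<le> x" "x \<le> s"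
  then have x: "0 < x" "x < 1" using assms by auto
  have "0 \<le> compl_X x / (x * (1 - x\<^sup>2))"
    using x compl_modulus[OF x] compl_X_nonneg[OF compl_modulus(5)[OF x]] by simp
  then show "\<exists>y. (compl_K has_real_derivative y) (at x) \<and> 0 \<le> y"
    using compl_K_has_derivative[OF x] by blast
qed

text \<open>The lower bound of X at the complementary modulus makes K' decrease at least at the rate
  (pi / 4) / x. So K' is unbounded near 0, which forces \<mu> to take arbitrarily small values near
  1.\<close>

lemma compl_K'_ge_log:
  assumes r: "0 < r" "r \<le> s" "s < 1"
  shows "compl_K' s + pi / 4 * (ln s - ln r) \<le> compl_K' r"
proof -
  have "compl_K' s + pi / 4 * ln s \<le> compl_K' r + pi / 4 * ln r"
  proof (rule DERIV_nonpos_imp_nonincreasing[OF \<open>r \<le> s\<close>])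
    fix x assume "r \<le> x" "x \<le> s"
    then have x: "0 < x" "x < 1" using assms by auto
    note q = compl_modulus[OF x]
    have "(1 - x\<^sup>2) * pi / 4 \<le> compl_X' x" using compl_X_ge[OF q(6)] by (simp only: q(3))
    then have "((1 - x\<^sup>2) * pi / 4) / (x * (1 - x\<^sup>2)) \<le> compl_X' x / (x * (1 - x\<^sup>2))"
      using x q(4) by (intro divide_right_mono) auto
    moreover have "((1 - x\<^sup>2) * pi / 4) / (x * (1 - x\<^sup>2)) = pi / 4 * (1 / x)"
      using x q(4) by simp
    ultimately have "pi / 4 * (1 / x) \<le> compl_X' x / (x * (1 - x\<^sup>2))" by simp
    moreover have "((\<lambda>x. compl_K' x + pi / 4 * ln x) has_real_derivative
        - (compl_X' x / (x * (1 - x\<^sup>2))) + pi / 4 * (1 / x)) (at x)"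
      using x by (intro DERIV_add DERIV_cmult compl_K'_has_derivative[OF x] DERIV_ln_divide)
    ultimately show "\<exists>y. ((\<lambda>x. compl_K' x + pi / 4 * ln x) has_real_derivative y) (at x) \<and> y \<le> 0"
      by (intro exI conjI) auto
  qed
  then show ?thesis by (simp add: right_diff_distrib)
qed

lemma compl_K'_le_log:
  assumes r: "0 < r" "r \<le> s" "s < 1"
  shows "compl_K' r \<le> compl_K' s + (ln s - ln r)"
proof -
  have "compl_K' r + ln r \<le> compl_K' s + ln s"
  proof (rule DERIV_nonneg_imp_nondecreasing[OF \<open>r \<le> s\<close>])
    fix x assume "r \<le> x" "x \<le> s"
    then have x: "0 < x" "x < 1" using assms by auto
    note q = compl_modulus[OF x]
    have "compl_X' x \<le> 1 - x\<^sup>2" using compl_X_le[OF q(6)] by (simp only: q(3))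
    then have "compl_X' x / (x * (1 - x\<^sup>2)) \<le> (1 - x\<^sup>2) / (x * (1 - x\<^sup>2))"
      using x q(4) by (intro divide_right_mono) auto
    moreover have "(1 - x\<^sup>2) / (x * (1 - x\<^sup>2)) = 1 / x"
      using x q(4) by simp
    ultimately have "compl_X' x / (x * (1 - x\<^sup>2)) \<le> 1 / x" by simp
    moreover have "((\<lambda>x. compl_K' x + ln x) has_real_derivative - (compl_X' x / (x * (1 - x\<^sup>2))) + 1 / x) (at x)"
      using x by (intro DERIV_add compl_K'_has_derivative[OF x] DERIV_ln_divide)
    ultimately show "\<exists>y. ((\<lambda>x. compl_K' x + ln x) has_real_derivative y) (at x) \<and> 0 \<le> y"
      by (intro exI conjI) auto
  qed
  then show ?thesis by simp
qed

text \<open>Intermediate value theorem between \<open>r\<close> and a point close to 1. Values up to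
  \<open>mu r\<close> suffice for \<phi>, since \<open>1 \<le> K\<close> makes
  \<open>mu r / K\<close> such a value.\<close>

lemma mu_attains:
  assumes r: "0 < r" "r < 1" and y: "0 < y" "y \<le> mu r"
  obtains s where "r \<le> s" "s < 1" "mu s = y"
proof -
  define C where "C = compl_K' r"
  note qr = compl_modulus[OF r]
  have C: "C > 0" unfolding C_def by (rule compl_K_pos[OF qr(6)])
  \<comment> \<open>a modulus \<open>q\<close> small enough that \<open>pi / 2 * C / compl_K' q \<le> y\<close>\<close>
  define b where "b = min (sqrt (1 - r\<^sup>2)) (1/2)"
  have b: "0 < b" "b < 1" "b \<le> sqrt (1 - r\<^sup>2)" using qr by (auto simp: b_def)
  define M where "M = max 0 ((pi / 2 * C / y) / (pi / 4))"
  define q where "q = b * exp (- M)"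
  have q: "0 < q" "q \<le> b" using b by (auto simp: q_def M_def)
  have "ln b - ln q = M" using b by (simp add: q_def ln_mult)
  then have M1: "pi / 4 * M \<le> compl_K' q"
    using compl_K'_ge_log[OF q b(2)] compl_K_pos[OF compl_modulus(6)[OF b(1,2)]] by simp
  have M2: "pi / 2 * C / y \<le> pi / 4 * M"
  proof -
    have "(pi / 2 * C / y) / (pi / 4) \<le> M" by (simp add: M_def)
    then have "(pi / 2 * C / y) \<le> M * (pi / 4)" by (subst (asm) pos_divide_le_eq) auto
    then show ?thesis by (simp only: mult.commute)
  qed
  have Kq: "pi / 2 * C / y \<le> compl_K' q" by (rule order.trans[OF M2 M1])
  define s where "s = sqrt (1 - q\<^sup>2)"
  have q1: "q < 1" using q b by simp
  note qq = compl_modulus[OF q(1) q1]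
  have rs: "r \<le> s"
  proof -
    have "q \<le> sqrt (1 - r\<^sup>2)" using q b by simp
    then have "q\<^sup>2 \<le> (sqrt (1 - r\<^sup>2))\<^sup>2" using q by (intro power_mono) auto
    then have "r\<^sup>2 \<le> 1 - q\<^sup>2" using qr(3) by simp
    then show ?thesis using r by (simp add: s_def real_le_rsqrt)
  qed
  have s: "0 < s" "s < 1" using qq by (auto simp: s_def)
  have Ks: "compl_K' q = compl_K s" by (simp add: s_def)
  have "mu s = pi / 2 * (compl_K' s / compl_K s)" by (rule mu_eq[OF s])
  also have "\<dots> \<le> pi / 2 * (C / compl_K s)"
    using compl_K'_antimono[OF r(1) rs s(2)] compl_K_pos[of s] s
    by (intro mult_left_mono divide_right_mono) (auto simp: C_def)
  also have "\<dots> \<le> y"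
    using Kq y compl_K_pos[of s] s unfolding Ks by (simp add: field_simps)
  finally have "mu s \<le> y" .
  moreover have "isCont mu x" if "r \<le> x" "x \<le> s" for x
    using mu_has_derivative[of x] that r s by (intro DERIV_isCont) auto
  ultimately obtain x where "r \<le> x" "x \<le> s" "mu x = y"
    using IVT2[of mu s y r] y rs by blast
  then show thesis using that s by force
qed

lemma phi_props:
  assumes "1 \<le> K" "0 < r" "r < 1"
  shows "0 < phi K r" "phi K r < 1" "mu (phi K r) = mu r / K"
proof -
  have "0 < mu r" by (rule mu_pos[OF assms(2,3)])
  then have "0 < mu r / K" "mu r / K \<le> mu r" using assms(1) by (auto simp: field_simps)
  then obtain s where "r \<le> s" "s < 1" "mu s = mu r / K" by (rule mu_attains[OF assms(2,3)])
  then have "s \<in> {0<..<1}" using assms by auto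
  from imageI[OF this, of mu] have "mu r / K \<in> mu ` {0<..<1}" by (simp only: \<open>mu s = mu r / K\<close>)
  from inv_into_into[OF this] f_inv_into_f[OF this]
  show "0 < phi K r" "phi K r < 1" "mu (phi K r) = mu r / K" by (auto simp: phi_def)
qed

lemma le_phi:
  assumes "1 \<le> K" "0 < r" "r < 1" "0 \<le> s" "s < 1" "0 < s \<Longrightarrow> mu r / K \<le> mu s"
  shows "s \<le> phi K r"
proof (rule ccontr)
  assume "\<not> s \<le> phi K r"
  then have "mu s < mu (phi K r)" "0 < s"
    using phi_props[OF assms(1-3)] mu_strict_antimono[of "phi K r" s] assms by auto
  then show False using assms(6) phi_props(3)[OF assms(1-3)] by simp
qed


section \<open>Monotone quotients with denominator artanh\<close>

lemma artanh_pos: "0 < r \<Longrightarrow> r < 1 \<Longrightarrow> 0 < artanh (r :: real)"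
  by (simp add: artanh_def)

lemma artanh_le_double:
  assumes "0 < r" "r \<le> (1/2 :: real)"
  shows "artanh r \<le> 2 * r"
proof -
  have "(1 + r) / (1 - r) = 1 + 2 * r / (1 - r)" using assms by (simp add: field_simps)
  then have "artanh r = ln (1 + 2 * r / (1 - r)) / 2" by (simp add: artanh_def)
  also have "\<dots> \<le> (2 * r / (1 - r)) / 2"
    using assms by (intro divide_right_mono ln_add_one_self_le_self) auto
  also have "\<dots> = r / (1 - r)" using assms by (simp add: field_simps)
  also have "\<dots> \<le> 2 * r"
  proof -
    have "r * 1 \<le> r * (2 * (1 - r))" using assms by (intro mult_left_mono) auto
    then show ?thesis using assms by (simp add: divide_le_eq algebra_simps)
  qed
  finally show ?thesis .
qed

text \<open>A monotone form of l'Hopital's rule. \<open>G\<close> is the quotient of the derivatives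
  of \<open>F\<close> and artanh. If it increases, then \<open>H = G * artanh - F\<close> has the
  derivative \<open>G' * artanh\<close>, which is nonnegative, and tends to 0 at 0; so
  \<open>H\<close> is nonnegative, and \<open>H\<close> is the numerator of the derivative of the
  quotient up to a positive factor. The majorant \<open>b\<close> supplies the limit at 0.\<close>

lemma artanh_quotient_mono:
  fixes F G :: "real \<Rightarrow> real"
  assumes F: "\<And>r. 0 < r \<Longrightarrow> r < 1 \<Longrightarrow> (F has_real_derivative G r / (1 - r\<^sup>2)) (at r)"
    and G: "\<And>r. 0 < r \<Longrightarrow> r < 1 \<Longrightarrow> (G has_real_derivative G' r) (at r)" "\<And>r. 0 < r \<Longrightarrow> r < 1 \<Longrightarrow> 0 \<le> G' r"
    and bound: "\<And>r. 0 < r \<Longrightarrow> r < 1/2 \<Longrightarrow> \<bar>G r * artanh r - F r\<bar> \<le> b r" and b: "(b \<longlongrightarrow> 0) (at_right 0)"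
    and rs: "0 < r" "r \<le> s" "s < 1"
  shows "F r / artanh r \<le> F s / artanh s"
proof -
  define H where "H r = G r * artanh r - F r" for r
  have dH: "(H has_real_derivative G' x * artanh x) (at x)" if x: "0 < x" "x < 1" for x
  proof -
    have "\<bar>x\<bar> < 1" using x by simp
    then have "(H has_real_derivative (G' x * artanh x + 1 / (1 - x\<^sup>2) * G x) - G x / (1 - x\<^sup>2)) (at x)"
      unfolding H_def[abs_def]
      by (intro DERIV_diff DERIV_mult F[OF x] G(1)[OF x] artanh_real_has_field_derivative)
    then show ?thesis by simp
  qed
  have Hmono: "H x \<le> H y" if "0 < x" "x \<le> y" "y < 1" for x y
  proof (rule DERIV_nonneg_imp_nondecreasing[OF \<open>x \<le> y\<close>])
    fix z assume "x \<le> z" "z \<le> y"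
    then have z: "0 < z" "z < 1" using that by auto
    then show "\<exists>d. (H has_real_derivative d) (at z) \<and> 0 \<le> d"
      using dH[OF z] mult_nonneg_nonneg[OF G(2)[OF z] less_imp_le[OF artanh_pos[OF z]]] by blast
  qed
  have H0: "0 \<le> H x" if x: "0 < x" "x < 1" for x
  proof -
    have "((\<lambda>y. - b y) \<longlongrightarrow> 0) (at_right 0)" using tendsto_minus[OF b] by simp
    then show ?thesis
    proof (rule tendsto_upperbound)
      show "\<forall>\<^sub>F y in at_right 0. - b y \<le> H x"
        unfolding eventually_at_right_field
      proof (intro exI[of _ "min x (1/2)"] conjI allI impI)
        fix y assume y: "0 < y" "y < min x (1/2)"
        then have "\<bar>H y\<bar> \<le> b y" unfolding H_def by (intro bound) auto
        moreover have "H y \<le> H x" using y x by (intro Hmono) auto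
        ultimately show "- b y \<le> H x" by linarith
      qed (use x in auto)
    qed simp
  qed
  show ?thesis
  proof (rule DERIV_nonneg_imp_nondecreasing[OF \<open>r \<le> s\<close>])
    fix x assume "r \<le> x" "x \<le> s"
    then have x: "0 < x" "x < 1" "\<bar>x\<bar> < 1" using rs by auto
    have t: "0 < artanh x" using artanh_pos x by simp
    have x2: "x\<^sup>2 < 1" using x by (simp add: abs_square_less_1)
    have "((\<lambda>r. F r / artanh r) has_real_derivative
        (G x / (1 - x\<^sup>2) * artanh x - F x * (1 / (1 - x\<^sup>2))) / (artanh x * artanh x)) (at x)"
      using t by (intro DERIV_divide F[OF x(1,2)] artanh_real_has_field_derivative[OF x(3)]) auto
    moreover have "G x / (1 - x\<^sup>2) * artanh x - F x * (1 / (1 - x\<^sup>2)) = H x / (1 - x\<^sup>2)"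
      by (simp add: H_def diff_divide_distrib)
    moreover have "0 \<le> H x / (1 - x\<^sup>2) / (artanh x * artanh x)"
      using H0[OF x(1,2)] x2 t by simp
    ultimately show "\<exists>y. ((\<lambda>r. F r / artanh r) has_real_derivative y) (at x) \<and> 0 \<le> y"
      by auto
  qed
qed

text \<open>Classically E + X. It is the factor that appears when r K^2 and r K K' are
  differentiated and multiplied by 1 - r^2.\<close>

definition compl_P :: "real \<Rightarrow> real" where
  "compl_P r = 2 * compl_X r + (1 - r\<^sup>2) * compl_K r"

lemma compl_P_has_derivative:
  assumes r: "0 < r" "r < 1"
  shows "(compl_P has_real_derivative compl_X r / r) (at r)"
proof -
  have r2: "1 - r\<^sup>2 \<noteq> 0" using compl_modulus(4)[OF r] by simp
  have "(compl_P has_real_derivative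
      2 * (r * compl_K r) + ((0 - 2 * r) * compl_K r + compl_X r / (r * (1 - r\<^sup>2)) * (1 - r\<^sup>2))) (at r)"
    unfolding compl_P_def[abs_def]
    by (intro DERIV_add DERIV_cmult DERIV_mult DERIV_diff DERIV_const compl_X_has_derivative[OF r] compl_K_has_derivative[OF r])
      (auto intro!: derivative_eq_intros)
  moreover have "2 * (r * compl_K r) + ((0 - 2 * r) * compl_K r + compl_X r / (r * (1 - r\<^sup>2)) * (1 - r\<^sup>2)) = compl_X r / r"
    using r2 by simp
  ultimately show ?thesis by simp
qed

lemma compl_bounds_near_0:
  assumes "0 < r" "r < 1/2"
  shows "0 \<le> compl_P r" "compl_P r \<le> 2 + compl_K (1/2)" "0 \<le> compl_K r" "compl_K r \<le> compl_K (1/2)"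
proof -
  have r: "0 < r" "r < 1" using assms by auto
  note q = compl_modulus[OF r]
  show K: "0 \<le> compl_K r" "compl_K r \<le> compl_K (1/2)"
    using compl_K_pos[OF q(5)] compl_K_mono[of r "1/2"] assms by auto
  show "0 \<le> compl_P r"
    using compl_X_nonneg[OF q(5)] K q(4) by (simp add: compl_P_def)
  have "(1 - r\<^sup>2) * compl_K r \<le> 1 * compl_K r" using K by (intro mult_right_mono) auto
  then show "compl_P r \<le> 2 + compl_K (1/2)"
    using compl_X_le[OF q(5)] K q(4) unfolding compl_P_def by linarith
qed

text \<open>Here \<open>G = K * P\<close> is a product of nonnegative increasing functions. In the
  variable t = artanh r the result says that t times the slope of \<mu>(tanh t) decreases in
  absolute value; this governs distances below 1.\<close>

lemma compl_K_squared_quotient_mono: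
  assumes "0 < r" "r \<le> s" "s < 1"
  shows "r * (compl_K r)\<^sup>2 / artanh r \<le> s * (compl_K s)\<^sup>2 / artanh s"
proof (rule artanh_quotient_mono[where G = "\<lambda>r. compl_K r * compl_P r"
      and b = "\<lambda>r. compl_K (1/2) * (2 + compl_K (1/2)) * (2 * r) + r * (compl_K (1/2))\<^sup>2"])
  fix r :: real assume r: "0 < r" "r < 1"
  note q = compl_modulus[OF r]
  have "((\<lambda>r. r * (compl_K r)\<^sup>2) has_real_derivative
      1 * (compl_K r)\<^sup>2 + (2 * (compl_X r / (r * (1 - r\<^sup>2)) * compl_K r)) * r) (at r)"
  proof (intro DERIV_mult DERIV_ident)
    show "((\<lambda>r. (compl_K r)\<^sup>2) has_real_derivative 2 * (compl_X r / (r * (1 - r\<^sup>2)) * compl_K r)) (at r)"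
      using DERIV_power[OF compl_K_has_derivative[OF r], of 2] by simp
  qed
  moreover have "1 * (compl_K r)\<^sup>2 + (2 * (compl_X r / (r * (1 - r\<^sup>2)) * compl_K r)) * r = compl_K r * compl_P r / (1 - r\<^sup>2)"
    using r q(4) by (simp add: compl_P_def divide_simps) (simp add: algebra_simps power2_eq_square)
  ultimately show "((\<lambda>r. r * (compl_K r)\<^sup>2) has_real_derivative compl_K r * compl_P r / (1 - r\<^sup>2)) (at r)"
    by simp
  show "((\<lambda>r. compl_K r * compl_P r) has_real_derivative
      compl_X r / (r * (1 - r\<^sup>2)) * compl_P r + compl_X r / r * compl_K r) (at r)"
    by (intro DERIV_mult compl_K_has_derivative[OF r] compl_P_has_derivative[OF r])
  have "0 \<le> compl_P r"
    using compl_X_nonneg[OF q(5)] compl_K_pos[OF q(5)] q(4) by (simp add: compl_P_def)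
  then show "0 \<le> compl_X r / (r * (1 - r\<^sup>2)) * compl_P r + compl_X r / r * compl_K r"
    using compl_X_nonneg[OF q(5)] compl_K_pos[OF q(5)] q(4) r by (intro add_nonneg_nonneg mult_nonneg_nonneg) auto
next
  fix r :: real assume r: "0 < r" "r < 1/2"
  note B = compl_bounds_near_0[OF r]
  have t: "0 \<le> artanh r" "artanh r \<le> 2 * r" using artanh_pos[of r] artanh_le_double[of r] r by auto
  have "compl_K r * compl_P r * artanh r \<le> compl_K (1/2) * (2 + compl_K (1/2)) * (2 * r)"
    using B t r by (intro mult_mono mult_nonneg_nonneg) auto
  moreover have "0 \<le> compl_K r * compl_P r * artanh r" using B t by (intro mult_nonneg_nonneg) auto
  moreover have "r * (compl_K r)\<^sup>2 \<le> r * (compl_K (1/2))\<^sup>2"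
    using B r by (intro mult_left_mono power_mono) auto
  moreover have "0 \<le> r * (compl_K r)\<^sup>2" using r by simp
  ultimately show "\<bar>compl_K r * compl_P r * artanh r - r * (compl_K r)\<^sup>2\<bar>
      \<le> compl_K (1/2) * (2 + compl_K (1/2)) * (2 * r) + r * (compl_K (1/2))\<^sup>2"
    by linarith
next
  have "((\<lambda>r. compl_K (1/2) * (2 + compl_K (1/2)) * (2 * r) + r * (compl_K (1/2))\<^sup>2) \<longlongrightarrow>
      compl_K (1/2) * (2 + compl_K (1/2)) * (2 * 0) + 0 * (compl_K (1/2))\<^sup>2) (at_right 0)"
    by (intro tendsto_intros)
  then show "((\<lambda>r. compl_K (1/2) * (2 + compl_K (1/2)) * (2 * r) + r * (compl_K (1/2))\<^sup>2) \<longlongrightarrow> 0) (at_right 0)"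
    by simp
qed (use assms in auto)

text \<open>Since K' grows logarithmically at 0, a majorant by a power of r with exponent above -1
  is enough to make r K' vanish there.\<close>

lemma neg_ln_le_sqrt:
  assumes "0 < (r :: real)" shows "- ln r \<le> 2 / sqrt r"
proof -
  have "ln (1 / sqrt r) \<le> 1 / sqrt r - 1" using assms by (intro ln_le_minus_one) auto
  moreover have "ln (1 / sqrt r) = - ln r / 2" using assms by (simp add: ln_div ln_sqrt)
  ultimately show ?thesis by simp
qed

text \<open>The negative of the function is treated, so that the criterion for increasing quotients
  applies with \<open>G = legendre_const - K' * P\<close>. In the variable t = artanh r the result
  concerns t times the logarithmic derivative of \<mu>(tanh t); this governs distances above
  1.\<close>

lemma compl_K_product_quotient_antimono:
  assumes "0 < r" "r \<le> s" "s < 1"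
  shows "s * (compl_K s * compl_K' s) / artanh s \<le> r * (compl_K r * compl_K' r) / artanh r"
proof -
  define C where "C = compl_K' (1/2) + 1"
  define k where "k = compl_K (1/2)"
  \<comment> \<open>Built from \<open>compl_K' r \<le> C + 2 / sqrt r\<close>,
    \<open>compl_P r \<le> 2 + k\<close> and \<open>artanh r \<le> 2 * r\<close>, plus a bound for
    the function itself; every term vanishes at least like sqrt r.\<close>
  define b where "b r = ((C + 2 / sqrt r) * (2 + k) + legendre_const) * (2 * r) + r * (k * (C + 2 / sqrt r))" for r
  have "- (r * (compl_K r * compl_K' r)) / artanh r \<le> - (s * (compl_K s * compl_K' s)) / artanh s"
  proof (rule artanh_quotient_mono[where G = "\<lambda>r. legendre_const - compl_K' r * compl_P r" and b = b])
    fix r :: real assume r: "0 < r" "r < 1"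
    note q = compl_modulus[OF r]
    have X0: "0 \<le> compl_X r" "0 \<le> compl_X' r" using compl_X_nonneg q by auto
    have K0: "0 < compl_K r" "0 < compl_K' r" using compl_K_pos q by auto
    have "((\<lambda>r. - (r * (compl_K r * compl_K' r))) has_real_derivative
        - (1 * (compl_K r * compl_K' r) + (compl_X r / (r * (1 - r\<^sup>2)) * compl_K' r + - (compl_X' r / (r * (1 - r\<^sup>2))) * compl_K r) * r)) (at r)"
      by (intro DERIV_minus DERIV_mult DERIV_ident compl_K_has_derivative[OF r] compl_K'_has_derivative[OF r])
    moreover have "- (1 * (compl_K r * compl_K' r) + (compl_X r / (r * (1 - r\<^sup>2)) * compl_K' r + - (compl_X' r / (r * (1 - r\<^sup>2))) * compl_K r) * r)
        = (legendre_const - compl_K' r * compl_P r) / (1 - r\<^sup>2)"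
      unfolding legendre_relation[OF r, symmetric] using r q(4)
      by (simp add: compl_P_def divide_simps) (simp add: algebra_simps power2_eq_square)
    ultimately show "((\<lambda>r. - (r * (compl_K r * compl_K' r))) has_real_derivative (legendre_const - compl_K' r * compl_P r) / (1 - r\<^sup>2)) (at r)"
      by simp
    show "((\<lambda>r. legendre_const - compl_K' r * compl_P r) has_real_derivative
        0 - (- (compl_X' r / (r * (1 - r\<^sup>2))) * compl_P r + compl_X r / r * compl_K' r)) (at r)"
      by (intro DERIV_diff DERIV_const DERIV_mult compl_K'_has_derivative[OF r] compl_P_has_derivative[OF r])
    \<comment> \<open>Legendre's relation reduces the sign to \<open>compl_X r * (compl_K' r - compl_X' r / (1 - r\<^sup>2)) \<le> pi / 4\<close>.\<close>
    define Y where "Y = compl_K' r - compl_X' r / (1 - r\<^sup>2)"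
    \<comment> \<open>The bound for K - X / r^2 read at the complementary modulus, whose own
      complementary modulus is \<open>r\<close>.\<close>
    have Y: "Y \<le> pi / (4 * r)"
      using compl_K_X_bound[OF q(1,2)] unfolding q(7) unfolding q(3) by (simp add: Y_def)
    have "compl_X r * Y \<le> compl_X r * (pi / (4 * r))" using X0 Y by (intro mult_left_mono) auto
    also have "\<dots> \<le> r\<^sup>2 * (pi / (4 * r))" using compl_X_le[OF q(5)] r by (intro mult_right_mono) auto
    also have "\<dots> = r * (pi / 4)" using r by (simp add: power2_eq_square)
    also have "\<dots> \<le> 1 * (pi / 4)" using r by (intro mult_right_mono) auto
    also have "\<dots> \<le> legendre_const / 2" using legendre_const_ge by simp
    finally have XY: "compl_X r * Y \<le> legendre_const / 2" .
    have "compl_X' r / (1 - r\<^sup>2) * compl_P r - compl_X r * compl_K' r = legendre_const - 2 * (compl_X r * Y)"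
      unfolding Y_def legendre_relation[OF r, symmetric] compl_P_def using q(4)
      by (simp add: divide_simps) (simp add: algebra_simps)
    then have "0 \<le> (compl_X' r / (1 - r\<^sup>2) * compl_P r - compl_X r * compl_K' r) / r"
      using XY r by simp
    also have "\<dots> = 0 - (- (compl_X' r / (r * (1 - r\<^sup>2))) * compl_P r + compl_X r / r * compl_K' r)"
      by (simp add: diff_divide_distrib mult.commute)
    finally show "0 \<le> 0 - (- (compl_X' r / (r * (1 - r\<^sup>2))) * compl_P r + compl_X r / r * compl_K' r)" .
  next
    fix r :: real assume r: "0 < r" "r < 1/2"
    note B = compl_bounds_near_0[OF r, folded k_def]
    have r1: "0 < r" "r < 1" using r by auto
    have t: "0 \<le> artanh r" "artanh r \<le> 2 * r" using artanh_pos[of r] artanh_le_double[of r] r by auto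
    have K': "0 \<le> compl_K' r" using compl_K_pos[OF compl_modulus(6)[OF r1]] by simp
    have "compl_K' r \<le> compl_K' (1/2) + (ln (1/2) - ln r)" using r by (intro compl_K'_le_log) auto
    moreover have "ln (1/2 :: real) \<le> 1" using ln_le_minus_one[of "1/2 :: real"] by simp
    ultimately have K'2: "compl_K' r \<le> C + 2 / sqrt r"
      using neg_ln_le_sqrt[OF r(1)] unfolding C_def by linarith
    have lc: "0 \<le> legendre_const" using legendre_const_ge pi_gt_zero by linarith
    have "\<bar>legendre_const - compl_K' r * compl_P r\<bar> \<le> (C + 2 / sqrt r) * (2 + k) + legendre_const"
    proof -
      have "compl_K' r * compl_P r \<le> (C + 2 / sqrt r) * (2 + k)"
        using B K' K'2 by (intro mult_mono) auto
      moreover have "0 \<le> compl_K' r * compl_P r" using K' B by (intro mult_nonneg_nonneg)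
      ultimately show ?thesis using lc by linarith
    qed
    then have "\<bar>legendre_const - compl_K' r * compl_P r\<bar> * artanh r \<le> ((C + 2 / sqrt r) * (2 + k) + legendre_const) * (2 * r)"
      using t by (intro mult_mono) auto
    moreover have "r * (compl_K r * compl_K' r) \<le> r * (k * (C + 2 / sqrt r))"
      using B K' K'2 r by (intro mult_left_mono mult_mono) auto
    moreover have "0 \<le> r * (compl_K r * compl_K' r)" using B K' r by (intro mult_nonneg_nonneg) auto
    moreover have "\<bar>(legendre_const - compl_K' r * compl_P r) * artanh r\<bar> = \<bar>legendre_const - compl_K' r * compl_P r\<bar> * artanh r"
      using t by (simp add: abs_mult)
    ultimately show "\<bar>(legendre_const - compl_K' r * compl_P r) * artanh r - - (r * (compl_K r * compl_K' r))\<bar> \<le> b r"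
      unfolding b_def by linarith
  next
    have "((\<lambda>r. (C * (2 + k) + legendre_const) * (2 * r) + 4 * (2 + k) * sqrt r + (k * C * r + 2 * k * sqrt r)) \<longlongrightarrow>
        (C * (2 + k) + legendre_const) * (2 * 0) + 4 * (2 + k) * sqrt 0 + (k * C * 0 + 2 * k * sqrt 0)) (at_right 0)"
      by (intro tendsto_intros)
    moreover have "\<forall>\<^sub>F r in at_right 0. (C * (2 + k) + legendre_const) * (2 * r) + 4 * (2 + k) * sqrt r + (k * C * r + 2 * k * sqrt r) = b r"
      unfolding eventually_at_right_field
    proof (intro exI[of _ 1] conjI allI impI)
      fix r :: real assume "0 < r" "r < 1"
      define Q where "Q = 2 / sqrt r"
      have "Q * r = 2 * (r / sqrt r)" by (simp add: Q_def)
      then have Q: "Q * r = 2 * sqrt r" using \<open>0 < r\<close> by (simp only: real_div_sqrt less_imp_le)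
      have "b r = (C * (2 + k) + legendre_const) * (2 * r) + 2 * (2 + k) * (Q * r) + (k * C * r + k * (Q * r))"
        unfolding b_def Q_def[symmetric] by (simp add: algebra_simps)
      then show "(C * (2 + k) + legendre_const) * (2 * r) + 4 * (2 + k) * sqrt r + (k * C * r + 2 * k * sqrt r) = b r"
        unfolding Q by simp
    qed simp
    ultimately show "(b \<longlongrightarrow> 0) (at_right 0)"
      using Lim_transform_eventually by fastforce
  qed (use assms in auto)
  then show ?thesis by simp
qed


section \<open>\<mu> as a function of hyperbolic distance\<close>

lemma tanh_artanh_real:
  assumes "\<bar>x\<bar> < (1 :: real)"
  shows "tanh (artanh x) = x"
proof -
  have x: "0 < 1 + x" "0 < 1 - x" using assms by auto
  have "exp (- 2 * artanh x) = inverse (exp (ln ((1 + x) / (1 - x))))"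
    by (simp add: artanh_def exp_minus)
  also have "\<dots> = (1 - x) / (1 + x)" using x by simp
  finally have e: "exp (- 2 * artanh x) = (1 - x) / (1 + x)" .
  have "(1 - (1 - x) / (1 + x)) / (1 + (1 - x) / (1 + x)) = x"
    using x by (simp add: divide_simps)
  then show ?thesis unfolding tanh_real_altdef e .
qed

lemma mu_tanh_has_derivative:
  assumes "0 < t"
  shows "((\<lambda>t. mu (tanh t)) has_real_derivative - (pi / 2 * legendre_const / (tanh t * (compl_K (tanh t))\<^sup>2))) (at t)"
proof -
  have r: "0 < tanh t" "tanh t < 1" using assms by (auto simp: tanh_real_lt_1)
  have r2: "1 - (tanh t)\<^sup>2 \<noteq> 0" using compl_modulus(4)[OF r] by simp
  have dt: "(tanh has_real_derivative 1 - (tanh t)\<^sup>2) (at t)"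
    by (auto intro!: derivative_eq_intros)
  have "((\<lambda>t. mu (tanh t)) has_real_derivative
      - (pi / 2 * legendre_const / (tanh t * (1 - (tanh t)\<^sup>2) * (compl_K (tanh t))\<^sup>2)) * (1 - (tanh t)\<^sup>2)) (at t)"
    by (rule DERIV_chain2[where f = mu, OF mu_has_derivative[OF r] dt])
  moreover have "- (pi / 2 * legendre_const / (tanh t * (1 - (tanh t)\<^sup>2) * (compl_K (tanh t))\<^sup>2)) * (1 - (tanh t)\<^sup>2)
      = - (pi / 2 * legendre_const / (tanh t * (compl_K (tanh t))\<^sup>2))"
    using r2 by simp
  ultimately show ?thesis by simp
qed

lemma mu_tanh_pos: "0 < t \<Longrightarrow> 0 < mu (tanh t)"
  by (intro mu_pos) (auto simp: tanh_real_lt_1)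

lemma mu_tanh_strict_antimono: "0 < s \<Longrightarrow> s < t \<Longrightarrow> mu (tanh t) < mu (tanh s)"
  by (intro mu_strict_antimono) (auto simp: tanh_real_lt_1)

text \<open>Concavity of log \<mu>(tanh t) as a function of log t: \<open>- g\<close> is the
  logarithmic derivative and \<open>s * g s\<close> increases, so
  \<open>ln (m (l * s)) - ln (m s)\<close> decreases in \<open>s\<close> when
  \<open>1 \<le> l\<close>.\<close>

lemma mu_tanh_ratio:
  assumes t: "0 < t" "t \<le> \<beta>" and l: "1 \<le> l"
  shows "mu (tanh (l * \<beta>)) * mu (tanh t) \<le> mu (tanh (l * t)) * mu (tanh \<beta>)"
proof -
  define m where "m t = mu (tanh t)" for t
  define g where "g t = legendre_const / (tanh t * (compl_K (tanh t) * compl_K' (tanh t)))" for t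
  have m0: "0 < m s" if "0 < s" for s using mu_tanh_pos[OF that] by (simp add: m_def)
  have lc: "0 < legendre_const" using legendre_const_ge pi_gt_zero by linarith
  have dm: "((\<lambda>s. ln (m s)) has_real_derivative - g s) (at s)" if s: "0 < s" for s
  proof -
    have r: "0 < tanh s" "tanh s < 1" using s by (auto simp: tanh_real_lt_1)
    have K: "0 < compl_K (tanh s)" "0 < compl_K' (tanh s)"
      using compl_K_pos compl_modulus[OF r] by auto
    have "((\<lambda>s. ln (m s)) has_real_derivative inverse (m s) * - (pi / 2 * legendre_const / (tanh s * (compl_K (tanh s))\<^sup>2))) (at s)"
      using mu_tanh_has_derivative[OF s] m0[OF s] unfolding m_def by (intro DERIV_chain2[where f = ln, OF DERIV_ln])
    moreover have "inverse (m s) * - (pi / 2 * legendre_const / (tanh s * (compl_K (tanh s))\<^sup>2)) = - g s"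
      unfolding m_def g_def mu_eq[OF r] using K r lc by (simp add: power2_eq_square divide_simps)
    ultimately show ?thesis by simp
  qed
  have gmono: "s * g s \<le> s' * g s'" if s: "0 < s" "s \<le> s'" for s s'
  proof -
    define N where "N r = r * (compl_K r * compl_K' r) / artanh r" for r
    have N: "0 < N (tanh s)" "s * g s = legendre_const / N (tanh s)" if s: "0 < s" for s
    proof -
      have r: "0 < tanh s" "tanh s < 1" using s by (auto simp: tanh_real_lt_1)
      have K: "0 < compl_K (tanh s)" "0 < compl_K' (tanh s)"
        using compl_K_pos compl_modulus[OF r] by auto
      show "0 < N (tanh s)" using r K s by (simp add: N_def artanh_tanh_real)
      show "s * g s = legendre_const / N (tanh s)" by (simp add: N_def g_def artanh_tanh_real)
    qed
    have "N (tanh s') \<le> N (tanh s)"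
      unfolding N_def using s by (intro compl_K_product_quotient_antimono) (auto simp: tanh_real_lt_1)
    then have "legendre_const / N (tanh s) \<le> legendre_const / N (tanh s')"
      using N(1)[of s'] s lc by (intro divide_left_mono) auto
    then show ?thesis using N(2)[of s] N(2)[of s'] s by simp
  qed
  have "ln (m (l * \<beta>)) - ln (m \<beta>) \<le> ln (m (l * t)) - ln (m t)"
  proof (rule DERIV_nonpos_imp_nonincreasing[OF \<open>t \<le> \<beta>\<close>])
    fix s assume "t \<le> s" "s \<le> \<beta>"
    then have s: "0 < s" "s \<le> l * s" "0 < l * s" using t l by auto
    have "((\<lambda>s. l * s) has_real_derivative l) (at s)" by (auto intro!: derivative_eq_intros)
    then have "((\<lambda>s. ln (m (l * s)) - ln (m s)) has_real_derivative - g (l * s) * l - - g s) (at s)"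
      by (intro DERIV_diff dm s DERIV_chain2[where f = "\<lambda>s. ln (m s)", OF dm])
    moreover have "- g (l * s) * l - - g s \<le> 0"
    proof -
      have "s * g s \<le> s * (l * g (l * s))" using gmono[OF s(1,2)] by (simp add: mult_ac)
      then show ?thesis using s by (simp add: mult.commute)
    qed
    ultimately show "\<exists>y. ((\<lambda>s. ln (m (l * s)) - ln (m s)) has_real_derivative y) (at s) \<and> y \<le> 0" by blast
  qed
  moreover have pos: "0 < m (l * \<beta>)" "0 < m \<beta>" "0 < m (l * t)" "0 < m t" using m0 t l by auto
  ultimately have "ln (m (l * \<beta>) * m t) \<le> ln (m (l * t) * m \<beta>)"
    by (simp add: ln_mult)
  then show ?thesis using pos by (simp add: m_def)
qed

text \<open>Both sides agree at \<open>l = 1\<close>. In the variable x = ln l, which is at most 0,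
  left side minus right side has the derivative \<open>s * m' s - b * m' b\<close> with
  \<open>s = exp x * t\<close> and \<open>b = exp (x / K) * \<beta>\<close>. This is nonnegative
  because \<open>s \<le> b\<close> and \<open>s * m' s\<close> decreases.\<close>

lemma mu_tanh_diff:
  assumes K: "1 \<le> K" and t: "0 < t" "t \<le> \<beta>" and l: "0 < l" "l \<le> 1" and eq: "K * mu (tanh \<beta>) = mu (tanh t)"
  shows "K * mu (tanh (l powr (1 / K) * \<beta>)) \<le> mu (tanh (l * t))"
proof -
  define m where "m t = mu (tanh t)" for t
  define m' where "m' t = pi / 2 * legendre_const / (tanh t * (compl_K (tanh t))\<^sup>2)" for t
  have lc: "0 < legendre_const" using legendre_const_ge pi_gt_zero by linarith
  have dm: "(m has_real_derivative - m' s) (at s)" if s: "0 < s" for s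
    using mu_tanh_has_derivative[OF s] by (simp add: m_def[abs_def] m'_def)
  have mono: "s' * m' s' \<le> s * m' s" if s: "0 < s" "s \<le> s'" for s s'
  proof -
    define N where "N r = r * (compl_K r)\<^sup>2 / artanh r" for r
    have N: "0 < N (tanh s)" "s * m' s = pi / 2 * legendre_const / N (tanh s)" if s: "0 < s" for s
    proof -
      have r: "0 < tanh s" "tanh s < 1" using s by (auto simp: tanh_real_lt_1)
      have K: "0 < compl_K (tanh s)"
        using compl_K_pos compl_modulus[OF r] by auto
      show "0 < N (tanh s)" using r K s by (simp add: N_def artanh_tanh_real)
      show "s * m' s = pi / 2 * legendre_const / N (tanh s)" by (simp add: N_def m'_def artanh_tanh_real)
    qed
    have "N (tanh s) \<le> N (tanh s')"
      unfolding N_def using s by (intro compl_K_squared_quotient_mono) (auto simp: tanh_real_lt_1)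
    then have "pi / 2 * legendre_const / N (tanh s') \<le> pi / 2 * legendre_const / N (tanh s)"
      using N(1)[of s] N(1)[of s'] s lc by (intro divide_left_mono mult_nonneg_nonneg mult_pos_pos) auto
    then show ?thesis using N(2)[of s] N(2)[of s'] s by simp
  qed
  have "K * m (exp (ln l / K) * \<beta>) - m (exp (ln l) * t) \<le> K * m (exp (0 / K) * \<beta>) - m (exp 0 * t)"
  proof (rule DERIV_nonneg_imp_nondecreasing[where f = "\<lambda>x. K * m (exp (x / K) * \<beta>) - m (exp x * t)"])
    show "ln l \<le> 0" using l by simp
    fix x assume x: "ln l \<le> x" "x \<le> 0"
    define b where "b = exp (x / K) * \<beta>"
    define s where "s = exp x * t"
    have s: "0 < s" using t by (simp add: s_def)
    have b: "0 < b" using t by (simp add: b_def)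
    have "x * K \<le> x * 1" using x K by (intro mult_left_mono_neg) auto
    then have "x \<le> x / K" using K by (simp add: field_simps)
    then have sb: "s \<le> b" unfolding s_def b_def using t by (intro mult_mono) auto
    have "((\<lambda>x. exp (x / K) * \<beta>) has_real_derivative b / K) (at x)"
      unfolding b_def using K by (auto intro!: derivative_eq_intros)
    moreover have "((\<lambda>x. exp x * t) has_real_derivative s) (at x)"
      unfolding s_def by (auto intro!: derivative_eq_intros)
    ultimately have "((\<lambda>x. K * m (exp (x / K) * \<beta>) - m (exp x * t)) has_real_derivative
        K * (- m' b * (b / K)) - - m' s * s) (at x)"
      using dm[OF b] dm[OF s] unfolding b_def s_def
      by (intro DERIV_diff DERIV_cmult DERIV_chain2[where f = m])
    moreover have "0 \<le> K * (- m' b * (b / K)) - - m' s * s"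
      using mono[OF s sb] K by (simp add: mult.commute)
    ultimately show "\<exists>y. ((\<lambda>x. K * m (exp (x / K) * \<beta>) - m (exp x * t)) has_real_derivative y) (at x) \<and> 0 \<le> y"
      by blast
  qed
  also have "\<dots> = 0" using eq by (simp add: m_def)
  finally show ?thesis using l by (simp add: m_def powr_def)
qed

text \<open>The distance \<open>d\<close> is compared with the distance 1, whose distorted value is
  \<open>A_const K = 2 * \<beta>\<close>. For \<open>1 \<le> d\<close> the logarithmic concavity
  gives at most linear growth; for \<open>d < 1\<close> the additive comparison gives the exponent 1
  / K.\<close>

lemma artanh_phi_le:
  assumes K: "1 \<le> K" and d: "0 < d"
  shows "2 * artanh (phi K (tanh (d / 2))) \<le> A_const K * max d (d powr (1 / K))"
proof -
  define b where "b t = artanh (phi K (tanh t))" for t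
  have b: "0 < b t" "mu (tanh (b t)) = mu (tanh t) / K" if "0 < t" for t
  proof -
    have r: "0 < tanh t" "tanh t < 1" using that by (auto simp: tanh_real_lt_1)
    note p = phi_props[OF K r]
    show "0 < b t" using artanh_pos p by (simp add: b_def)
    have "tanh (b t) = phi K (tanh t)" unfolding b_def using p by (intro tanh_artanh_real) auto
    then show "mu (tanh (b t)) = mu (tanh t) / K" using p by simp
  qed
  define \<beta> where "\<beta> = b (1/2)"
  have \<beta>: "0 < \<beta>" "mu (tanh \<beta>) = mu (tanh (1/2)) / K" unfolding \<beta>_def using b[of "1/2"] by auto
  have half: "1/2 \<le> \<beta>"
  proof (rule ccontr)
    assume "\<not> 1/2 \<le> \<beta>"
    then have "mu (tanh (1/2)) < mu (tanh \<beta>)" using \<beta>(1) by (intro mu_tanh_strict_antimono) auto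
    moreover have "mu (tanh (1/2)) / K \<le> mu (tanh (1/2))"
      using K mu_tanh_pos[of "1/2"] by (simp add: field_simps)
    ultimately show False using \<beta>(2) by linarith
  qed
  have le: "b t \<le> y" if "0 < t" "0 < y" "mu (tanh y) \<le> mu (tanh t) / K" for t y
  proof (rule ccontr)
    assume "\<not> b t \<le> y"
    then have "mu (tanh (b t)) < mu (tanh y)" using that by (intro mu_tanh_strict_antimono) auto
    then show False using that b(2)[of t] by simp
  qed
  have A: "A_const K = 2 * \<beta>" by (simp add: A_const_def \<beta>_def b_def)
  have "b (d / 2) \<le> \<beta> * max d (d powr (1 / K))"
  proof (cases "1 \<le> d")
    case True
    have "mu (tanh (d * \<beta>)) * mu (tanh (1/2)) \<le> mu (tanh (d * (1/2))) * mu (tanh \<beta>)"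
      using True half by (intro mu_tanh_ratio) auto
    also have "\<dots> = (mu (tanh (d / 2)) / K) * mu (tanh (1/2))" by (simp add: \<beta>(2))
    finally have "mu (tanh (d * \<beta>)) \<le> mu (tanh (d / 2)) / K"
      using mu_tanh_pos[of "1/2"] by (simp only: mult_le_cancel_right_pos)
    then have "b (d / 2) \<le> d * \<beta>" using d \<beta>(1) by (intro le) auto
    also have "\<dots> \<le> \<beta> * max d (d powr (1 / K))"
      using \<beta>(1) by (subst mult.commute) (intro mult_left_mono, auto)
    finally show ?thesis .
  next
    case False
    have "K * mu (tanh (d powr (1 / K) * \<beta>)) \<le> mu (tanh (d * (1/2)))"
      using False d half K \<beta>(2) by (intro mu_tanh_diff) auto
    then have "mu (tanh (d powr (1 / K) * \<beta>)) \<le> mu (tanh (d / 2)) / K"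
      using K by (simp add: field_simps)
    then have "b (d / 2) \<le> d powr (1 / K) * \<beta>" using d \<beta>(1) by (intro le) auto
    also have "\<dots> \<le> \<beta> * max d (d powr (1 / K))"
      using \<beta>(1) by (subst mult.commute) (intro mult_left_mono, auto)
    finally show ?thesis .
  qed
  then show ?thesis by (simp add: A b_def)
qed

section \<open>The elliptic integral in the complex plane\<close>

lemma sin_Complex: "sin (Complex x y) = Complex (sin x * cosh y) (cos x * sinh y)"
  by (simp add: complex_eq_iff Re_sin Im_sin cosh_field_def sinh_field_def)

lemma cos_Complex: "cos (Complex x y) = Complex (cos x * cosh y) (- (sin x * sinh y))"
  by (simp add: complex_eq_iff Re_cos Im_cos cosh_field_def sinh_field_def field_simps)

lemma norm_sin_Complex_squared: "norm ((sin (Complex x y))\<^sup>2) = (sin x)\<^sup>2 + (sinh y)\<^sup>2"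
proof -
  have "norm ((sin (Complex x y))\<^sup>2) = (sin x)\<^sup>2 * (cosh y)\<^sup>2 + (cos x)\<^sup>2 * (sinh y)\<^sup>2"
    by (simp add: norm_power cmod_power2 sin_Complex power_mult_distrib)
  also have "\<dots> = (sin x)\<^sup>2 + (sinh y)\<^sup>2"
    by (simp add: cosh_square_eq cos_squared_eq algebra_simps)
  finally show ?thesis .
qed

lemma norm_sin_squared_cart: "norm ((sin z)\<^sup>2) = (sin (Re z))\<^sup>2 + (sinh (Im z))\<^sup>2"
  using norm_sin_Complex_squared[of "Re z" "Im z"] by simp

lemma cosh_real_less_imp: "cosh x < cosh (y :: real) \<Longrightarrow> 0 \<le> y \<Longrightarrow> \<bar>x\<bar> < y"
proof -
  assume "cosh x < cosh y" "0 \<le> y"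
  moreover have "cosh \<bar>x\<bar> = cosh x" by (simp add: abs_if)
  ultimately show "\<bar>x\<bar> < y" using cosh_real_nonneg_less_iff[of "\<bar>x\<bar>" y] by simp
qed

lemma has_field_derivative_along_line:
  fixes E :: "complex \<Rightarrow> complex"
  assumes "(E has_field_derivative e) (at (p + of_real t * w))"
  shows "((\<lambda>t. E (p + of_real t * w)) has_vector_derivative e * w) (at t within S)"
proof -
  have "((\<lambda>t. p + of_real t * w) has_vector_derivative w) (at t within S)"
    unfolding has_vector_derivative_def by (auto intro!: derivative_eq_intros simp: scaleR_conv_of_real)
  from field_vector_diff_chain_within[OF this has_field_derivative_at_within[OF assms]]
  show ?thesis by (simp add: o_def mult.commute)
qed

text \<open>With the factor 2 the differential becomes dz / sqrt (z (r - z) (1 - r z)) for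
  \<open>z = r * (sin \<theta>)\<^sup>2\<close>. The principal root keeps the real part of the
  integrand positive.\<close>

definition ell_integrand :: "real \<Rightarrow> complex \<Rightarrow> complex" where
  "ell_integrand r \<theta> = 2 / csqrt (1 - of_real (r\<^sup>2) * (sin \<theta>)\<^sup>2)"

text \<open>A strip and a double sector that crosses the lines Re = pi / 2 and Re = - pi / 2 between
  the branch points at the heights \<open>arcosh (1 / r)\<close> and
  \<open>- arcosh (1 / r)\<close>. The sector is homogeneous, which keeps the domain starlike about
  0, and the edge Re = pi / 2 of the rectangle becomes interior.\<close>

definition ell_domain :: "real \<Rightarrow> complex set" where
  "ell_domain r = {\<theta>. \<bar>Re \<theta>\<bar> < pi / 2} \<union>
     {\<theta>. \<bar>Im \<theta>\<bar> * (pi / 2) < arcosh (1 / r) * \<bar>Re \<theta>\<bar> \<and> \<bar>Re \<theta>\<bar> < 3 * pi / 2}"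

lemma open_ell_domain: "open (ell_domain r)"
  unfolding ell_domain_def
  by (intro open_Un open_Collect_conj open_Collect_less continuous_intros)

lemma starlike_ell_domain: "starlike (ell_domain r)"
  unfolding starlike_def
proof (intro bexI[of _ 0] ballI subsetI)
  fix \<theta> z assume \<theta>: "\<theta> \<in> ell_domain r" and "z \<in> closed_segment 0 \<theta>"
  then obtain t where t: "0 \<le> t" "t \<le> 1" and z: "z = of_real t * \<theta>"
    by (auto simp: in_segment scaleR_conv_of_real)
  have Re: "\<bar>Re z\<bar> = t * \<bar>Re \<theta>\<bar>" and Im: "\<bar>Im z\<bar> = t * \<bar>Im \<theta>\<bar>" using t by (simp_all add: z abs_mult)
  have le: "t * \<bar>Re \<theta>\<bar> \<le> \<bar>Re \<theta>\<bar>" using t by (intro mult_left_le_one_le) auto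
  show "z \<in> ell_domain r"
  proof (cases "\<bar>Re z\<bar> < pi / 2")
    case False
    then have "\<not> \<bar>Re \<theta>\<bar> < pi / 2" using le by (simp add: Re)
    then have *: "\<bar>Im \<theta>\<bar> * (pi / 2) < arcosh (1 / r) * \<bar>Re \<theta>\<bar>" "\<bar>Re \<theta>\<bar> < 3 * pi / 2"
      using \<theta> by (auto simp: ell_domain_def)
    have "t \<noteq> 0" using False by (auto simp: Re)
    then have "t * (\<bar>Im \<theta>\<bar> * (pi / 2)) < t * (arcosh (1 / r) * \<bar>Re \<theta>\<bar>)"
      using * t by (intro mult_strict_left_mono) auto
    then have "\<bar>Im z\<bar> * (pi / 2) < arcosh (1 / r) * \<bar>Re z\<bar>"
      by (simp only: Re Im mult.assoc mult.left_commute)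
    moreover have "\<bar>Re z\<bar> < 3 * pi / 2" using le * by (simp only: Re)
    ultimately show ?thesis by (simp only: ell_domain_def Un_iff mem_Collect_eq simp_thms)
  qed (simp add: ell_domain_def)
qed (simp add: ell_domain_def)

text \<open>The part of the strip that \<open>r * (sin \<theta>)\<^sup>2\<close> maps into the
  closed unit disk: a rectangle with curved top and bottom.\<close>

definition ell_rect :: "real \<Rightarrow> complex set" where
  "ell_rect r = {\<theta>. 0 \<le> Re \<theta> \<and> Re \<theta> \<le> pi / 2 \<and> (sin (Re \<theta>))\<^sup>2 + (sinh (Im \<theta>))\<^sup>2 \<le> 1 / r}"

context
  fixes r :: real assumes r: "0 < r" "r < 1"
begin

text \<open>A nonpositive radicand makes \<open>(sin \<theta>)\<^sup>2\<close> real and larger than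
  1. Its imaginary part vanishes only for \<open>sin x = 0\<close>, \<open>y = 0\<close> or
  \<open>cos x = 0\<close>. The first two give values at most 1, and the last one puts \<theta> at
  or beyond a branch point, outside the sector.\<close>

lemma ell_radicand_not_nonpos:
  assumes \<theta>: "\<theta> \<in> ell_domain r"
  shows "1 - of_real (r\<^sup>2) * (sin \<theta>)\<^sup>2 \<notin> \<real>\<^sub>\<le>\<^sub>0"
proof
  assume neg: "1 - of_real (r\<^sup>2) * (sin \<theta>)\<^sup>2 \<in> \<real>\<^sub>\<le>\<^sub>0"
  define x y where "x = Re \<theta>" and "y = Im \<theta>"
  have \<theta>': "\<theta> = Complex x y" by (simp add: x_def y_def)
  have r2: "0 < r\<^sup>2" "r\<^sup>2 < 1" using r by (auto simp: power_less_one_iff)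
  have Re: "1 \<le> r\<^sup>2 * Re ((sin \<theta>)\<^sup>2)" and Im: "Im ((sin \<theta>)\<^sup>2) = 0"
    using neg r by (auto simp: complex_nonpos_Reals_iff)
  have Re': "Re ((sin \<theta>)\<^sup>2) = (sin x * cosh y)\<^sup>2 - (cos x * sinh y)\<^sup>2"
    by (simp add: \<theta>' sin_Complex power2_eq_square)
  have Im': "Im ((sin \<theta>)\<^sup>2) = 2 * (sin x * cosh y) * (cos x * sinh y)"
    by (simp add: \<theta>' sin_Complex power2_eq_square)
  have big: "1 < Re ((sin \<theta>)\<^sup>2)"
  proof (rule ccontr)
    assume "\<not> 1 < Re ((sin \<theta>)\<^sup>2)"
    then have "r\<^sup>2 * Re ((sin \<theta>)\<^sup>2) \<le> r\<^sup>2 * 1" using r2 by (intro mult_left_mono) auto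
    then show False using Re r2 by simp
  qed
  have "cosh y \<noteq> 0" by simp
  then consider "sin x = 0" | "sinh y = 0" | "cos x = 0" using Im Im' by auto
  then show False
  proof cases
    case 1 then show False using big Re' zero_le_power2[of "cos x * sinh y"] by simp
  next
    case 2
    then have "y = 0" by simp
    moreover have "(sin x)\<^sup>2 \<le> 1" by (simp add: abs_square_le_1)
    ultimately show False using big Re' by simp
  next
    case 3
    then have "(sin x)\<^sup>2 = 1" by (simp add: sin_squared_eq)
    then have "1 \<le> r\<^sup>2 * (cosh y)\<^sup>2" using Re Re' 3 by (simp add: power_mult_distrib)
    then have "1 \<le> (r * cosh y)\<^sup>2" by (simp add: power_mult_distrib)
    then have "1 \<le> r * cosh y"
      using power2_le_imp_le[of 1 "r * cosh y"] r by simp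
    then have "1 / r \<le> cosh y" using r by (simp add: field_simps)
    then have c: "cosh (arcosh (1 / r)) \<le> cosh \<bar>y\<bar>" using r by simp
    have y: "arcosh (1 / r) \<le> \<bar>y\<bar>"
      using c cosh_real_nonneg_le_iff[of "arcosh (1 / r)" "\<bar>y\<bar>"] r by simp
    have "\<not> \<bar>x\<bar> < pi / 2"
    proof
      assume "\<bar>x\<bar> < pi / 2"
      then have "- (pi / 2) < x" "x < pi / 2" by linarith+
      then show False using cos_gt_zero_pi[of x] 3 by simp
    qed
    then have x: "\<bar>x\<bar> \<ge> pi / 2" "\<bar>y\<bar> * (pi / 2) < arcosh (1 / r) * \<bar>x\<bar>" "\<bar>x\<bar> < 3 * pi / 2"
      using \<theta> by (auto simp: ell_domain_def x_def y_def)
    have "\<not> pi / 2 < \<bar>x\<bar>"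
    proof
      assume "pi / 2 < \<bar>x\<bar>"
      then have "0 < cos (\<bar>x\<bar> - pi)" using x by (intro cos_gt_zero_pi) auto
      also have "cos (\<bar>x\<bar> - pi) = - cos x" by (simp add: cos_diff)
      finally show False using 3 by simp
    qed
    then have ax: "\<bar>x\<bar> = pi / 2" using x by simp
    have "\<bar>y\<bar> * (pi / 2) < arcosh (1 / r) * (pi / 2)" using x(2) by (simp only: ax)
    then have "\<bar>y\<bar> < arcosh (1 / r)" by (simp only: mult_less_cancel_right_pos[OF pi_half_gt_zero])
    then show False using y by simp
  qed
qed

lemma ell_integrand_holomorphic: "ell_integrand r holomorphic_on ell_domain r"
  unfolding ell_integrand_def
proof (intro holomorphic_intros)
  show "csqrt (1 - of_real (r\<^sup>2) * (sin \<theta>)\<^sup>2) \<noteq> 0" if "\<theta> \<in> ell_domain r" for \<theta>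
    using ell_radicand_not_nonpos[OF that] by auto
qed (use ell_radicand_not_nonpos in auto)

text \<open>A principal root off the cut has positive real part, and so has its inverse. Hence the
  real part of the primitive increases along horizontals and its imaginary part along
  verticals.\<close>

lemma Re_ell_integrand_pos:
  assumes "\<theta> \<in> ell_domain r" shows "0 < Re (ell_integrand r \<theta>)"
proof -
  define w where "w = csqrt (1 - of_real (r\<^sup>2) * (sin \<theta>)\<^sup>2)"
  have w2: "w\<^sup>2 = 1 - of_real (r\<^sup>2) * (sin \<theta>)\<^sup>2" by (simp add: w_def)
  have "0 < Re w"
  proof (rule ccontr)
    assume "\<not> 0 < Re w"
    moreover have "0 < Re w \<or> Re w = 0 \<and> 0 \<le> Im w" unfolding w_def by (rule csqrt_principal)
    ultimately have "Re w = 0" by auto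
    then have "w\<^sup>2 \<in> \<real>\<^sub>\<le>\<^sub>0" by (simp add: complex_nonpos_Reals_iff power2_eq_square)
    then show False using ell_radicand_not_nonpos[OF assms] w2 by simp
  qed
  then show ?thesis
    by (simp add: ell_integrand_def Re_divide add_pos_nonneg w_def)
qed

lemma ell_integrand_squared:
  "(ell_integrand r \<theta>)\<^sup>2 = 4 / (1 - of_real (r\<^sup>2) * (sin \<theta>)\<^sup>2)"
  by (simp add: ell_integrand_def power_divide)

lemma ell_integrand_of_pos:
  assumes "1 - of_real (r\<^sup>2) * (sin \<theta>)\<^sup>2 = of_real d" "0 < d"
  shows "ell_integrand r \<theta> = of_real (2 / sqrt d)"
  unfolding ell_integrand_def assms(1) using assms(2) by simp

lemma ell_rect_subset: "ell_rect r \<subseteq> ell_domain r"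
proof
  fix \<theta> assume \<theta>: "\<theta> \<in> ell_rect r"
  show "\<theta> \<in> ell_domain r"
  proof (cases "Re \<theta> < pi / 2")
    case False
    then have R: "Re \<theta> = pi / 2" using \<theta> by (simp add: ell_rect_def)
    have "(sin (Re \<theta>))\<^sup>2 + (sinh (Im \<theta>))\<^sup>2 \<le> 1 / r" using \<theta> by (simp add: ell_rect_def)
    then have "(cosh (Im \<theta>))\<^sup>2 \<le> 1 / r" unfolding R by (simp add: cosh_square_eq)
    also have "\<dots> < (1 / r)\<^sup>2" using r by (simp add: power2_eq_square field_simps)
    finally have "cosh (Im \<theta>) < 1 / r" by (rule power2_less_imp_less) (use r in simp)
    then have "cosh (Im \<theta>) < cosh (arcosh (1 / r))" using r by simp
    then have "\<bar>Im \<theta>\<bar> < arcosh (1 / r)" by (rule cosh_real_less_imp) (use r in simp)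
    then show ?thesis unfolding ell_domain_def Un_iff mem_Collect_eq R by simp
  qed (use \<theta> in \<open>auto simp: ell_domain_def ell_rect_def\<close>)
qed

lemma ell_primitive_exists:
  "\<exists>E. E 0 = 0 \<and> (\<forall>\<theta> \<in> ell_domain r. (E has_field_derivative ell_integrand r \<theta>) (at \<theta>))"
proof -
  have "ell_integrand r field_differentiable at \<theta>" if "\<theta> \<in> ell_domain r" for \<theta>
    using ell_integrand_holomorphic open_ell_domain that holomorphic_on_imp_differentiable_at by blast
  then obtain g where g: "\<forall>\<theta>\<in>ell_domain r. (g has_field_derivative ell_integrand r \<theta>) (at \<theta>)"
    using holomorphic_starlike_primitive[OF holomorphic_on_imp_continuous_on[OF ell_integrand_holomorphic]
        starlike_ell_domain open_ell_domain finite.emptyI] by auto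
  show ?thesis
  proof (intro exI[of _ "\<lambda>\<theta>. g \<theta> - g 0"] conjI ballI)
    fix \<theta> assume "\<theta> \<in> ell_domain r"
    then have "((\<lambda>\<theta>. g \<theta> - g 0) has_field_derivative ell_integrand r \<theta> - 0) (at \<theta>)"
      using g by (intro DERIV_diff DERIV_const) auto
    then show "((\<lambda>\<theta>. g \<theta> - g 0) has_field_derivative ell_integrand r \<theta>) (at \<theta>)" by simp
  qed simp
qed

definition ell_F :: "complex \<Rightarrow> complex" where
  "ell_F = (SOME E. E 0 = 0 \<and> (\<forall>\<theta> \<in> ell_domain r. (E has_field_derivative ell_integrand r \<theta>) (at \<theta>)))"

lemma ell_F_0: "ell_F 0 = 0"
  and ell_F_deriv: "\<theta> \<in> ell_domain r \<Longrightarrow> (ell_F has_field_derivative ell_integrand r \<theta>) (at \<theta>)"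
  using someI_ex[OF ell_primitive_exists] unfolding ell_F_def by auto

lemma ell_F_continuous: "continuous_on (ell_rect r) ell_F"
  using ell_rect_subset ell_F_deriv
  by (intro continuous_at_imp_continuous_on ballI DERIV_isCont) auto

lemma ell_F_Re_along_Re:
  assumes "Complex x y \<in> ell_domain r"
  shows "((\<lambda>x. Re (ell_F (Complex x y))) has_real_derivative Re (ell_integrand r (Complex x y))) (at x)"
    and "((\<lambda>x. Im (ell_F (Complex x y))) has_real_derivative Im (ell_integrand r (Complex x y))) (at x)"
proof -
  have eq: "Complex t y = Complex 0 y + of_real t * 1" for t by (simp add: complex_eq_iff)
  have "((\<lambda>t. ell_F (Complex 0 y + of_real t * 1)) has_vector_derivative ell_integrand r (Complex x y) * 1) (at x)"
    by (rule has_field_derivative_along_line) (use ell_F_deriv[OF assms] in \<open>simp only: eq[symmetric]\<close>)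
  then have "((\<lambda>t. ell_F (Complex t y)) has_vector_derivative ell_integrand r (Complex x y) * 1) (at x)"
    by (simp only: eq[symmetric])
  then show "((\<lambda>x. Re (ell_F (Complex x y))) has_real_derivative Re (ell_integrand r (Complex x y))) (at x)"
    "((\<lambda>x. Im (ell_F (Complex x y))) has_real_derivative Im (ell_integrand r (Complex x y))) (at x)"
    unfolding has_real_derivative_iff_has_vector_derivative
    by (auto simp: has_vector_derivative_complex_iff has_real_derivative_iff_has_vector_derivative)
qed

lemma ell_F_along_Im:
  assumes "Complex x y \<in> ell_domain r"
  shows "((\<lambda>y. Im (ell_F (Complex x y))) has_real_derivative Re (ell_integrand r (Complex x y))) (at y)"
    and "((\<lambda>y. Re (ell_F (Complex x y))) has_real_derivative - Im (ell_integrand r (Complex x y))) (at y)"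
proof -
  have eq: "Complex x t = Complex x 0 + of_real t * \<i>" for t by (simp add: complex_eq_iff)
  have "((\<lambda>t. ell_F (Complex x 0 + of_real t * \<i>)) has_vector_derivative ell_integrand r (Complex x y) * \<i>) (at y)"
    by (rule has_field_derivative_along_line) (use ell_F_deriv[OF assms] in \<open>simp only: eq[symmetric]\<close>)
  then have "((\<lambda>t. ell_F (Complex x t)) has_vector_derivative ell_integrand r (Complex x y) * \<i>) (at y)"
    by (simp only: eq[symmetric])
  then show "((\<lambda>y. Im (ell_F (Complex x y))) has_real_derivative Re (ell_integrand r (Complex x y))) (at y)"
    "((\<lambda>y. Re (ell_F (Complex x y))) has_real_derivative - Im (ell_integrand r (Complex x y))) (at y)"
    by (auto simp: has_vector_derivative_complex_iff has_real_derivative_iff_has_vector_derivative)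
qed

lemma ell_F_Re_strict_mono:
  assumes "x < x'" "\<And>t. x \<le> t \<Longrightarrow> t \<le> x' \<Longrightarrow> Complex t y \<in> ell_domain r"
  shows "Re (ell_F (Complex x y)) < Re (ell_F (Complex x' y))"
proof (rule DERIV_pos_imp_increasing[OF assms(1)])
  fix t assume "x \<le> t" "t \<le> x'"
  from ell_F_Re_along_Re(1)[OF assms(2)[OF this]] Re_ell_integrand_pos[OF assms(2)[OF this]]
  show "\<exists>d. ((\<lambda>t. Re (ell_F (Complex t y))) has_real_derivative d) (at t) \<and> 0 < d" by blast
qed

lemma ell_F_Im_strict_mono:
  assumes "y < y'" "\<And>t. y \<le> t \<Longrightarrow> t \<le> y' \<Longrightarrow> Complex x t \<in> ell_domain r"
  shows "Im (ell_F (Complex x y)) < Im (ell_F (Complex x y'))"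
proof (rule DERIV_pos_imp_increasing[OF assms(1)])
  fix t assume "y \<le> t" "t \<le> y'"
  from ell_F_along_Im(1)[OF assms(2)[OF this]] Re_ell_integrand_pos[OF assms(2)[OF this]]
  show "\<exists>d. ((\<lambda>t. Im (ell_F (Complex x t))) has_real_derivative d) (at t) \<and> 0 < d" by blast
qed

end

lemma DERIV_zero_imp_eq:
  fixes f :: "real \<Rightarrow> real"
  assumes "a \<le> b" "\<And>t. a \<le> t \<Longrightarrow> t \<le> b \<Longrightarrow> (f has_real_derivative 0) (at t)"
  shows "f a = f b"
proof (rule antisym)
  show "f a \<le> f b"
    by (rule DERIV_nonneg_imp_nondecreasing[OF assms(1)]) (use assms(2) in auto)
  show "f b \<le> f a"
    by (rule DERIV_nonpos_imp_nonincreasing[OF assms(1)]) (use assms(2) in auto)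
qed

section \<open>Bijectivity of proper holomorphic maps\<close>

lemma holomorphic_locally_open:
  assumes hol: "F holomorphic_on Q" and Q: "open Q" "z \<in> Q" and nz: "deriv F z \<noteq> 0" and V: "open V" "z \<in> V"
  obtains U where "open U" "z \<in> U" "U \<subseteq> V \<inter> Q" "inj_on F U" "open (F ` U)"
proof -
  have hol': "F holomorphic_on (V \<inter> Q)" using hol by (rule holomorphic_on_subset) auto
  obtain e where e: "e > 0" "ball z e \<subseteq> V \<inter> Q" "inj_on F (ball z e)"
    by (rule has_complex_derivative_locally_injective[OF hol' _ _ nz]) (use Q V in auto)
  have "open (F ` ball z e)"
    by (rule open_mapping_thm3[OF holomorphic_on_subset[OF hol' e(2)] _ e(3)]) simp
  then show thesis using that[of "ball z e"] e by simp
qed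

text \<open>A proper local homeomorphism onto a connected set has a constant number of sheets. The
  image is open and closed in \<open>R\<close>, and so is the set \<open>D\<close> of values taken
  at least twice; the value at \<open>z0\<close>, taken once, makes \<open>D\<close> empty.
  Properness is expressed by the compact set \<open>C\<close>: the points of \<open>C - Q\<close>
  are sent outside \<open>R\<close>.\<close>

lemma holomorphic_bij_of_proper:
  fixes F :: "complex \<Rightarrow> complex"
  assumes Q: "open Q" "compact C" "Q \<subseteq> C" and cont: "continuous_on C F"
    and hol: "F holomorphic_on Q" and nz: "\<And>z. z \<in> Q \<Longrightarrow> deriv F z \<noteq> 0"
    and R: "connected R" and img: "F ` Q \<subseteq> R"
    and bd: "\<And>z. z \<in> C \<Longrightarrow> z \<notin> Q \<Longrightarrow> F z \<notin> R"
    and z0: "z0 \<in> Q" "\<And>z. z \<in> Q \<Longrightarrow> F z = F z0 \<Longrightarrow> z = z0"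
  shows "bij_betw F Q R"
proof -
  note loc = holomorphic_locally_open[OF hol Q(1) _ nz]
  have clopen: "T = {} \<or> T = R" if "open T" "closedin (top_of_set R) T" for T
    using R[unfolded connected_clopen, rule_format, of T] open_subset[OF closedin_imp_subset[OF that(2)] that(1)] that(2)
    by blast
  have "open (F ` Q)"
  proof (subst open_subopen, clarify)
    fix z assume z: "z \<in> Q"
    obtain U where U: "open U" "z \<in> U" "U \<subseteq> UNIV \<inter> Q" "open (F ` U)"
      by (rule loc[OF z z open_UNIV UNIV_I])
    then show "\<exists>T. open T \<and> F z \<in> T \<and> T \<subseteq> F ` Q" by (intro exI[of _ "F ` U"]) auto
  qed
  moreover have "F ` Q = R \<inter> F ` C" using img bd Q(3) by blast
  then have "closedin (top_of_set R) (F ` Q)"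
    using closedin_closed_Int[OF compact_imp_closed[OF compact_continuous_image[OF cont Q(2)]], of R] by simp
  ultimately have surj: "F ` Q = R" using clopen[of "F ` Q"] z0(1) by auto
  define D where "D = {w. \<exists>p\<in>Q. \<exists>q\<in>Q. p \<noteq> q \<and> F p = w \<and> F q = w}"
  have DR: "D \<subseteq> R" using img by (auto simp: D_def)
  have "open D"
  proof (subst open_subopen, clarify)
    fix w assume "w \<in> D"
    then obtain p q where pq: "p \<in> Q" "q \<in> Q" "p \<noteq> q" "F p = w" "F q = w" by (auto simp: D_def)
    obtain V V' where V: "open V" "open V'" "p \<in> V" "q \<in> V'" "V \<inter> V' = {}"
      using hausdorff[OF \<open>p \<noteq> q\<close>] by blast
    obtain U where U: "open U" "p \<in> U" "U \<subseteq> V \<inter> Q" "open (F ` U)"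
      by (rule loc[OF pq(1) pq(1) V(1,3)])
    obtain U' where U': "open U'" "q \<in> U'" "U' \<subseteq> V' \<inter> Q" "open (F ` U')"
      by (rule loc[OF pq(2) pq(2) V(2,4)])
    show "\<exists>T. open T \<and> w \<in> T \<and> T \<subseteq> D"
    proof (intro exI conjI)
      show "open (F ` U \<inter> F ` U')" using U U' by auto
      show "w \<in> F ` U \<inter> F ` U'" using imageI[OF U(2), of F] imageI[OF U'(2), of F] pq(4,5) by simp
      show "F ` U \<inter> F ` U' \<subseteq> D"
      proof
        fix w' assume "w' \<in> F ` U \<inter> F ` U'"
        then obtain a b where "a \<in> U" "b \<in> U'" "F a = w'" "F b = w'" by auto
        moreover have "a \<noteq> b" using calculation U(3) U'(3) V(5) by auto
        moreover have "a \<in> Q" "b \<in> Q" using calculation(1,2) U(3) U'(3) by auto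
        ultimately show "w' \<in> D" unfolding D_def by blast
      qed
    qed
  qed
  \<comment> \<open>Pairs of distinct preimages accumulate by compactness of
    \<open>C \<times> C\<close>. The members of a limit pair lie in \<open>Q\<close> because
    \<open>F\<close> sends \<open>C - Q\<close> outside \<open>R\<close>, and they differ because
    \<open>F\<close> is injective near each point of \<open>Q\<close>.\<close>
  moreover have "closedin (top_of_set R) D"
    unfolding closedin_limpt islimpt_sequential
  proof (intro conjI allI impI DR)
    fix l assume "(\<exists>f. (\<forall>n. f n \<in> D - {l}) \<and> f \<longlonglongrightarrow> l) \<and> l \<in> R"
    then obtain x where x: "\<And>n. x n \<in> D" "x \<longlonglongrightarrow> l" "l \<in> R" by auto
    define P where "P n pq \<longleftrightarrow> fst pq \<in> Q \<and> snd pq \<in> Q \<and> fst pq \<noteq> snd pq \<and> F (fst pq) = x n \<and> F (snd pq) = x n" for n pq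
    have "\<exists>pq. P n pq" for n using x(1)[of n] by (auto simp: D_def P_def)
    then have P: "P n (SOME pq. P n pq)" for n by (rule someI_ex)
    define pq where "pq n = (SOME pq. P n pq)" for n
    have pq: "fst (pq n) \<in> Q \<and> snd (pq n) \<in> Q \<and> fst (pq n) \<noteq> snd (pq n) \<and> F (fst (pq n)) = x n \<and> F (snd (pq n)) = x n" for n
      using P[of n] by (simp add: P_def pq_def)
    have "compact (C \<times> C)" using Q(2) by (simp add: compact_Times)
    moreover have "\<forall>n. pq n \<in> C \<times> C" using pq Q(3) by (auto simp: mem_Times_iff)
    ultimately obtain L \<phi> where L: "L \<in> C \<times> C" "strict_mono (\<phi> :: nat \<Rightarrow> nat)" "(pq \<circ> \<phi>) \<longlonglongrightarrow> L"
      unfolding compact_def by blast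
    define p q where "p = fst L" and "q = snd L"
    have lim: "(\<lambda>n. fst (pq (\<phi> n))) \<longlonglongrightarrow> p" "(\<lambda>n. snd (pq (\<phi> n))) \<longlonglongrightarrow> q"
      using tendsto_fst[OF L(3)] tendsto_snd[OF L(3)] by (auto simp: p_def q_def o_def)
    have xl: "(\<lambda>n. x (\<phi> n)) \<longlonglongrightarrow> l"
      using LIMSEQ_subseq_LIMSEQ[OF x(2) L(2)] by (simp add: o_def)
    have pC: "p \<in> C" "q \<in> C" using L(1) by (auto simp: p_def q_def mem_Times_iff)
    have inC: "fst (pq n) \<in> C" "snd (pq n) \<in> C" for n using pq[of n] Q(3) by blast+
    have "(\<lambda>n. F (fst (pq (\<phi> n)))) \<longlonglongrightarrow> F p"
      by (rule continuous_on_tendsto_compose[OF cont lim(1) pC(1) always_eventually]) (simp add: inC)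
    then have "(\<lambda>n. x (\<phi> n)) \<longlonglongrightarrow> F p" by (simp add: pq)
    then have Fp: "F p = l" by (rule LIMSEQ_unique[OF _ xl])
    have "(\<lambda>n. F (snd (pq (\<phi> n)))) \<longlonglongrightarrow> F q"
      by (rule continuous_on_tendsto_compose[OF cont lim(2) pC(2) always_eventually]) (simp add: inC)
    then have "(\<lambda>n. x (\<phi> n)) \<longlonglongrightarrow> F q" by (simp add: pq)
    then have Fq: "F q = l" by (rule LIMSEQ_unique[OF _ xl])
    have pQ: "p \<in> Q" using bd[OF pC(1)] x(3) Fp by auto
    have qQ: "q \<in> Q" using bd[OF pC(2)] x(3) Fq by auto
    have "p \<noteq> q"
    proof
      assume "p = q"
      obtain U where U: "open U" "p \<in> U" "U \<subseteq> UNIV \<inter> Q" "inj_on F U"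
        by (rule loc[OF pQ pQ open_UNIV UNIV_I])
      have "eventually (\<lambda>n. fst (pq (\<phi> n)) \<in> U) sequentially" "eventually (\<lambda>n. snd (pq (\<phi> n)) \<in> U) sequentially"
        using topological_tendstoD[OF lim(1) U(1,2)] topological_tendstoD[OF lim(2) U(1)] U(2) \<open>p = q\<close> by auto
      then have "eventually (\<lambda>n. fst (pq (\<phi> n)) \<in> U \<and> snd (pq (\<phi> n)) \<in> U) sequentially" by (rule eventually_conj)
      then obtain n where "fst (pq (\<phi> n)) \<in> U" "snd (pq (\<phi> n)) \<in> U"
        using eventually_happens'[OF sequentially_bot] by blast
      then show False using pq[of "\<phi> n"] U(4) by (auto simp: inj_on_def)
    qed
    then show "l \<in> D" using pQ qQ Fp Fq unfolding D_def by blast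
  qed
  ultimately have "D = {} \<or> D = R" by (rule clopen)
  moreover have "F z0 \<notin> D" using z0 by (auto simp: D_def)
  moreover have "F z0 \<in> R" using img z0 by auto
  ultimately have "D = {}" by auto
  then have "inj_on F Q" by (auto simp: D_def inj_on_def)
  then show ?thesis using surj by (simp add: bij_betw_def)
qed

lemma abs_sinh_real: "\<bar>sinh t\<bar> = sinh \<bar>t :: real\<bar>"
  by (simp add: abs_if)

lemma sinh_squared_le_iff: "(sinh x)\<^sup>2 \<le> (sinh y)\<^sup>2 \<longleftrightarrow> \<bar>x\<bar> \<le> \<bar>y :: real\<bar>"
  unfolding abs_le_square_iff[symmetric] abs_sinh_real sinh_real_le_iff ..

section \<open>Boundary values of the elliptic integral on the rectangle\<close>

context
  fixes r :: real assumes r: "0 < r" "r < 1"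
begin

lemma ell_rect_vertical:
  assumes "Complex x y \<in> ell_rect r" "\<bar>t\<bar> \<le> \<bar>y\<bar>"
  shows "Complex x t \<in> ell_rect r"
proof -
  have "\<bar>sinh t\<bar> \<le> \<bar>sinh y\<bar>"
    using assms(2) unfolding abs_sinh_real sinh_real_le_iff .
  then have "(sinh t)\<^sup>2 \<le> (sinh y)\<^sup>2" by (simp add: abs_le_square_iff)
  then show ?thesis using assms(1) by (simp add: ell_rect_def)
qed

lemma ell_rect_horizontal:
  assumes "Complex x y \<in> ell_rect r" "0 \<le> t" "t \<le> x"
  shows "Complex t y \<in> ell_rect r"
proof -
  have x: "x \<le> pi / 2" using assms(1) by (simp add: ell_rect_def)
  have "sin t \<le> sin x" using assms x by (intro sin_monotone_2pi_le) auto
  moreover have "0 \<le> sin t" using assms x by (intro sin_ge_zero) auto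
  ultimately have "(sin t)\<^sup>2 \<le> (sin x)\<^sup>2" by (intro power_mono)
  then show ?thesis using assms x by (simp add: ell_rect_def)
qed

lemma ell_integrand_real:
  assumes \<theta>: "\<theta> \<in> ell_domain r" and S: "(sin \<theta>)\<^sup>2 = of_real s"
  shows "ell_integrand r \<theta> = of_real (2 / sqrt (1 - r\<^sup>2 * s))"
proof -
  have eq: "1 - of_real (r\<^sup>2) * (sin \<theta>)\<^sup>2 = of_real (1 - r\<^sup>2 * s)" by (simp add: S)
  then have "0 < 1 - r\<^sup>2 * s"
    using ell_radicand_not_nonpos[OF r \<theta>] by (auto simp: complex_nonpos_Reals_iff)
  then show ?thesis by (rule ell_integrand_of_pos[OF r eq])
qed

lemma real_axis_in_rect: "0 \<le> x \<Longrightarrow> x \<le> pi / 2 \<Longrightarrow> Complex x 0 \<in> ell_rect r"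
proof -
  have "(sin x)\<^sup>2 \<le> 1" by (simp add: abs_square_le_1)
  also have "1 < 1 / r" using r by simp
  finally show "0 \<le> x \<Longrightarrow> x \<le> pi / 2 \<Longrightarrow> Complex x 0 \<in> ell_rect r" by (simp add: ell_rect_def)
qed

lemma ell_integrand_real_axis:
  assumes "0 \<le> x" "x \<le> pi / 2"
  shows "ell_integrand r (Complex x 0) = of_real (2 / ell_Delta r x)"
proof -
  have "Complex x 0 \<in> ell_domain r" using real_axis_in_rect[OF assms] ell_rect_subset[OF r] by auto
  moreover have "(sin (Complex x 0))\<^sup>2 = of_real ((sin x)\<^sup>2)"
    by (simp add: sin_Complex complex_eq_iff power2_eq_square)
  ultimately show ?thesis using ell_integrand_real by (simp add: ell_Delta_def)
qed

lemma ell_F_real_axis: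
  assumes "0 \<le> x" "x \<le> pi / 2"
  shows "Im (ell_F r (Complex x 0)) = 0"
proof -
  have "Im (ell_F r (Complex 0 0)) = Im (ell_F r (Complex x 0))"
  proof (rule DERIV_zero_imp_eq[OF assms(1)])
    fix t assume "0 \<le> t" "t \<le> x"
    then have t: "0 \<le> t" "t \<le> pi / 2" using assms by auto
    then have "Complex t 0 \<in> ell_domain r" using real_axis_in_rect ell_rect_subset[OF r] by auto
    from ell_F_Re_along_Re(2)[OF r this]
    show "((\<lambda>x. Im (ell_F r (Complex x 0))) has_real_derivative 0) (at t)"
      by (simp add: ell_integrand_real_axis[OF t])
  qed
  then show ?thesis by (simp add: ell_F_0[OF r] zero_complex.code[symmetric])
qed

lemma ell_F_half_period: "Re (ell_F r (Complex (pi / 2) 0)) = 2 * compl_K r"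
proof -
  have "((\<lambda>x. 2 * (1 / ell_Delta r x)) has_integral
      Re (ell_F r (Complex (pi / 2) 0)) - Re (ell_F r (Complex 0 0))) {0..pi/2}"
  proof (rule fundamental_theorem_of_calculus)
    fix x :: real assume "x \<in> {0..pi/2}"
    then have x: "0 \<le> x" "x \<le> pi / 2" by auto
    then have "Complex x 0 \<in> ell_domain r" using real_axis_in_rect ell_rect_subset[OF r] by auto
    from ell_F_Re_along_Re(1)[OF r this]
    have "((\<lambda>x. Re (ell_F r (Complex x 0))) has_real_derivative 2 * (1 / ell_Delta r x)) (at x)"
      unfolding ell_integrand_real_axis[OF x] by simp
    then have "((\<lambda>x. Re (ell_F r (Complex x 0))) has_real_derivative 2 * (1 / ell_Delta r x)) (at x within {0..pi/2})"
      by (rule has_field_derivative_at_within)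
    then show "((\<lambda>x. Re (ell_F r (Complex x 0))) has_vector_derivative 2 * (1 / ell_Delta r x)) (at x within {0..pi/2})"
      by (simp add: has_real_derivative_iff_has_vector_derivative)
  qed simp
  then have "integral {0..pi/2} (\<lambda>x. 2 * (1 / ell_Delta r x)) = Re (ell_F r (Complex (pi / 2) 0)) - Re (ell_F r (Complex 0 0))"
    by (rule integral_unique)
  then have "2 * compl_K r = Re (ell_F r (Complex (pi / 2) 0)) - Re (ell_F r (Complex 0 0))"
    unfolding compl_K_def by (simp only: integral_mult_right)
  then show ?thesis by (simp add: ell_F_0[OF r] zero_complex.code[symmetric])
qed

text \<open>On both vertical edges \<open>(sin \<theta>)\<^sup>2\<close> is real, hence so is the
  integrand, and the primitive moves vertically. The integrand is even in the height, so the
  imaginary part is odd.\<close>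

lemma ell_F_vertical_edge:
  assumes x: "x = 0 \<or> x = pi / 2" and rect: "Complex x y \<in> ell_rect r"
  shows "Re (ell_F r (Complex x y)) = Re (ell_F r (Complex x 0))"
    and "Im (ell_F r (Complex x (- y))) = - Im (ell_F r (Complex x y))"
proof -
  define s where "s t = (if x = 0 then - (sinh t)\<^sup>2 else (cosh t)\<^sup>2)" for t :: real
  have S: "(sin (Complex x t))\<^sup>2 = of_real (s t)" for t
  proof (cases "x = 0")
    case True
    then show ?thesis by (simp add: sin_Complex complex_eq_iff power2_eq_square s_def)
  next
    case False
    then have x2: "x = pi / 2" using x by blast
    show ?thesis unfolding s_def x2 by (simp add: sin_Complex complex_eq_iff power2_eq_square)
  qed
  have dom: "Complex x t \<in> ell_domain r" if "\<bar>t\<bar> \<le> \<bar>y\<bar>" for t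
    using ell_rect_vertical[OF rect that] ell_rect_subset[OF r] by auto
  have e: "ell_integrand r (Complex x t) = of_real (2 / sqrt (1 - r\<^sup>2 * s t))" if "\<bar>t\<bar> \<le> \<bar>y\<bar>" for t
    by (rule ell_integrand_real[OF dom[OF that] S])
  have Re: "((\<lambda>t. Re (ell_F r (Complex x t))) has_real_derivative 0) (at t)" if "\<bar>t\<bar> \<le> \<bar>y\<bar>" for t
    using ell_F_along_Im(2)[OF r dom[OF that]] by (simp add: e[OF that])
  show "Re (ell_F r (Complex x y)) = Re (ell_F r (Complex x 0))"
  proof (cases "0 \<le> y")
    case True
    show ?thesis by (rule DERIV_zero_imp_eq[OF True, symmetric]) (use Re in auto)
  next
    case False
    then have "y \<le> 0" by simp
    then show ?thesis by (rule DERIV_zero_imp_eq) (use Re False in auto)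
  qed
  have Im: "((\<lambda>t. Im (ell_F r (Complex x t))) has_real_derivative 2 / sqrt (1 - r\<^sup>2 * s t)) (at t)" if "\<bar>t\<bar> \<le> \<bar>y\<bar>" for t
    using ell_F_along_Im(1)[OF r dom[OF that]] by (simp add: e[OF that])
  define g where "g t = Im (ell_F r (Complex x t)) + Im (ell_F r (Complex x (- t)))" for t
  have g: "(g has_real_derivative 0) (at t)" if "\<bar>t\<bar> \<le> \<bar>y\<bar>" for t
  proof -
    have t: "\<bar>- t\<bar> \<le> \<bar>y\<bar>" using that by simp
    have "((\<lambda>t. - t) has_real_derivative - 1) (at t)" by (auto intro!: derivative_eq_intros)
    from DERIV_chain2[where f = "\<lambda>t. Im (ell_F r (Complex x t))", OF Im[OF t] this]
    have "(g has_real_derivative 2 / sqrt (1 - r\<^sup>2 * s t) + 2 / sqrt (1 - r\<^sup>2 * s (- t)) * - 1) (at t)"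
      unfolding g_def[abs_def] by (intro DERIV_add Im that)
    moreover have "s (- t) = s t" by (cases "x = 0") (simp_all add: s_def)
    ultimately show ?thesis by simp
  qed
  have "0 \<le> x" "x \<le> pi / 2" using x pi_gt_zero by linarith+
  then have "Im (ell_F r (Complex x 0)) = 0" by (rule ell_F_real_axis)
  then have "g 0 = 0" by (simp add: g_def)
  moreover have "g y = g 0"
  proof (cases "0 \<le> y")
    case True
    show ?thesis by (rule DERIV_zero_imp_eq[OF True, symmetric]) (use g in auto)
  next
    case False
    then have "y \<le> 0" by simp
    then show ?thesis by (rule DERIV_zero_imp_eq) (use g False in auto)
  qed
  ultimately show "Im (ell_F r (Complex x (- y))) = - Im (ell_F r (Complex x y))" by (simp add: g_def)
qed

text \<open>The positive solution \<open>y\<close> of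
  \<open>(sin x)\<^sup>2 + (sinh y)\<^sup>2 = 1 / r\<close>, that is, the curved top over
  \<open>x\<close>.\<close>

definition ell_height :: "real \<Rightarrow> real" where
  "ell_height x = arcosh (sqrt (1 + (1 / r - (sin x)\<^sup>2)))"

lemma ell_height_arg: "1 < sqrt (1 + (1 / r - (sin x)\<^sup>2))" "0 < 1 / r - (sin x)\<^sup>2"
proof -
  have "(sin x)\<^sup>2 \<le> 1" by (simp add: abs_square_le_1)
  also have "1 < 1 / r" using r by simp
  finally show "0 < 1 / r - (sin x)\<^sup>2" by simp
  then show "1 < sqrt (1 + (1 / r - (sin x)\<^sup>2))" by simp
qed

lemma ell_height_pos: "0 < ell_height x"
  using arcosh_real_strict_mono[of 1 "sqrt (1 + (1 / r - (sin x)\<^sup>2))"] ell_height_arg[of x]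
  by (simp add: ell_height_def)

lemma cosh_ell_height: "(cosh (ell_height x))\<^sup>2 = 1 + (1 / r - (sin x)\<^sup>2)"
  and sinh_ell_height: "(sinh (ell_height x))\<^sup>2 = 1 / r - (sin x)\<^sup>2"
proof -
  have "cosh (ell_height x) = sqrt (1 + (1 / r - (sin x)\<^sup>2))"
    unfolding ell_height_def using ell_height_arg[of x] by (intro cosh_arcosh_real) auto
  then show "(cosh (ell_height x))\<^sup>2 = 1 + (1 / r - (sin x)\<^sup>2)" using ell_height_arg(2)[of x] by simp
  then show "(sinh (ell_height x))\<^sup>2 = 1 / r - (sin x)\<^sup>2" by (simp add: cosh_square_eq)
qed

lemma ell_rect_height_iff:
  "Complex x y \<in> ell_rect r \<longleftrightarrow> 0 \<le> x \<and> x \<le> pi / 2 \<and> \<bar>y\<bar> \<le> ell_height x"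
  "(sin x)\<^sup>2 + (sinh y)\<^sup>2 < 1 / r \<longleftrightarrow> \<bar>y\<bar> < ell_height x"
proof -
  have "(sinh y)\<^sup>2 \<le> (sinh (ell_height x))\<^sup>2 \<longleftrightarrow> \<bar>y\<bar> \<le> ell_height x"
    using ell_height_pos[of x] by (simp add: sinh_squared_le_iff)
  then show "Complex x y \<in> ell_rect r \<longleftrightarrow> 0 \<le> x \<and> x \<le> pi / 2 \<and> \<bar>y\<bar> \<le> ell_height x"
    by (auto simp: ell_rect_def sinh_ell_height)
  have "(sinh (ell_height x))\<^sup>2 \<le> (sinh y)\<^sup>2 \<longleftrightarrow> ell_height x \<le> \<bar>y\<bar>"
    using ell_height_pos[of x] by (simp add: sinh_squared_le_iff)
  then show "(sin x)\<^sup>2 + (sinh y)\<^sup>2 < 1 / r \<longleftrightarrow> \<bar>y\<bar> < ell_height x"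
    by (auto simp: sinh_ell_height)
qed

lemma ell_height_has_derivative:
  "(ell_height has_real_derivative - (sin x * cos x) / (sinh (ell_height x) * cosh (ell_height x))) (at x)"
proof -
  define C where "C = sqrt (1 + (1 / r - (sin x)\<^sup>2))"
  have C: "1 < C" "C\<^sup>2 = 1 + (1 / r - (sin x)\<^sup>2)" using ell_height_arg[of x] by (auto simp: C_def)
  have ch: "cosh (ell_height x) = C"
    unfolding ell_height_def C_def using ell_height_arg[of x] by (intro cosh_arcosh_real) auto
  have sh: "sinh (ell_height x) = sqrt (C\<^sup>2 - 1)"
    using sinh_ell_height[of x] ell_height_pos[of x] C(2) by (intro real_sqrt_unique[symmetric]) auto
  have "((\<lambda>x. sqrt (1 + (1 / r - (sin x)\<^sup>2))) has_real_derivative - (sin x * cos x) / C) (at x)"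
    using ell_height_arg(2)[of x] unfolding C_def
    by (auto intro!: derivative_eq_intros simp: field_simps)
  from DERIV_chain2[where f = arcosh, OF arcosh_real_has_field_derivative this] C(1)
  have "(ell_height has_real_derivative 1 / sqrt (C\<^sup>2 - 1) * (- (sin x * cos x) / C)) (at x)"
    unfolding ell_height_def[abs_def] C_def by blast
  then show ?thesis by (simp add: sh ch)
qed

text \<open>On the curve \<open>norm ((sin \<theta>)\<^sup>2) = 1 / r\<close> the square of the differential of \<^term>\<open>ell_F r\<close> is positive.\<close>

lemma ell_F_along_arc:
  assumes s: "s = 1 \<or> s = -1" and x: "0 \<le> x" "x \<le> pi / 2"
  obtains d where "0 < d"
    "((\<lambda>x. Re (ell_F r (Complex x (s * ell_height x)))) has_real_derivative d) (at x)"
    "((\<lambda>x. Im (ell_F r (Complex x (s * ell_height x)))) has_real_derivative 0) (at x)"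
proof -
  define y where "y = s * ell_height x"
  define \<theta> where "\<theta> = Complex x y"
  define e where "e = ell_integrand r \<theta>"
  define S where "S = (sin \<theta>)\<^sup>2"
  have sy: "sinh y = s * sinh (ell_height x)" "cosh y = cosh (ell_height x)" using s by (auto simp: y_def)
  have sh: "(sinh y)\<^sup>2 = 1 / r - (sin x)\<^sup>2" "(cosh y)\<^sup>2 = 1 + (1 / r - (sin x)\<^sup>2)"
    using s by (auto simp: sy sinh_ell_height cosh_ell_height)
  have \<theta>: "\<theta> \<in> ell_domain r"
    using x sh(1) ell_rect_subset[OF r] by (auto simp: \<theta>_def ell_rect_def)
  have p: "sinh (ell_height x) * cosh (ell_height x) > 0" using ell_height_pos[of x] by simp
  have p0: "sinh y * cosh y \<noteq> 0" "sinh y * cosh y = s * (sinh (ell_height x) * cosh (ell_height x))"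
    using p s by (auto simp: sy)
  define y' where "y' = - (sin x * cos x) / (sinh y * cosh y)"
  have dy: "((\<lambda>x. s * ell_height x) has_real_derivative y') (at x)"
    using DERIV_cmult[OF ell_height_has_derivative, of s x] s by (auto simp: y'_def p0(2) divide_simps)
  have "((\<lambda>x. Complex x (s * ell_height x)) has_vector_derivative Complex 1 y') (at x)"
    using dy by (simp add: has_vector_derivative_complex_iff has_real_derivative_iff_has_vector_derivative[symmetric])
  from field_vector_diff_chain_at[OF this ell_F_deriv[OF r, folded \<theta>_def y_def]] \<theta>
  have "((\<lambda>x. ell_F r (Complex x (s * ell_height x))) has_vector_derivative Complex 1 y' * e) (at x)"
    by (simp add: o_def e_def \<theta>_def y_def)
  then have vd: "((\<lambda>x. Re (ell_F r (Complex x (s * ell_height x)))) has_real_derivative Re (Complex 1 y' * e)) (at x)"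
    "((\<lambda>x. Im (ell_F r (Complex x (s * ell_height x)))) has_real_derivative Im (Complex 1 y' * e)) (at x)"
    by (auto simp: has_vector_derivative_complex_iff has_real_derivative_iff_has_vector_derivative)
  \<comment> \<open>A real multiple of the tangent vector without denominators; by the addition
    formulas it equals \<open>- \<i> * (sin \<theta> * cnj (cos \<theta>))\<close>.\<close>
  define a where "a = Complex (sinh y * cosh y) (- (sin x * cos x))"
  have a: "Complex 1 y' = a / of_real (sinh y * cosh y)"
    using p0(1) by (simp add: a_def y'_def complex_eq_iff)
  have a': "a = - \<i> * (sin \<theta> * cnj (cos \<theta>))"
  proof -
    have "sin x * cosh y * (cos x * cosh y) - cos x * sinh y * (sin x * sinh y) = sin x * cos x * ((cosh y)\<^sup>2 - (sinh y)\<^sup>2)"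
      by (simp add: algebra_simps power2_eq_square)
    also have "\<dots> = sin x * cos x" by (simp add: cosh_square_eq)
    finally have 1: "sin x * cosh y * (cos x * cosh y) - cos x * sinh y * (sin x * sinh y) = sin x * cos x" .
    have "sin x * cosh y * (sin x * sinh y) + cos x * sinh y * (cos x * cosh y) = sinh y * cosh y * ((sin x)\<^sup>2 + (cos x)\<^sup>2)"
    proof -
      have "a * d * (a * c) + b * c * (b * d) = c * d * (a\<^sup>2 + b\<^sup>2)" for a b c d :: real
        by (simp add: algebra_simps power2_eq_square)
      then show ?thesis .
    qed
    then have 2: "sin x * cosh y * (sin x * sinh y) + cos x * sinh y * (cos x * cosh y) = sinh y * cosh y" by simp
    show ?thesis
      using 1 2 by (simp add: a_def \<theta>_def sin_Complex cos_Complex complex_eq_iff)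
  qed
  have C: "(cos \<theta>)\<^sup>2 = 1 - S" by (simp add: S_def cos_squared_eq)
  have nS: "norm S = 1 / r" using norm_sin_Complex_squared[of x y] sh(1) by (simp add: S_def \<theta>_def)
  \<comment> \<open>This relation, which holds on the arc, turns \<open>1 - r\<^sup>2 * S\<close>
    into \<open>- r\<^sup>2 * S * cnj (1 - S)\<close> and makes \<open>(e * a)\<^sup>2\<close> the
    constant \<open>(2 / r)\<^sup>2\<close>.\<close>
  have SS: "of_real (r\<^sup>2) * (S * cnj S) = 1"
    using r by (simp add: complex_mult_cnj cmod_power2[symmetric] nS power_divide flip: of_real_mult)
  have S1: "1 - S \<noteq> 0"
  proof
    assume "1 - S = 0"
    then have "norm S = 1" by simp
    then show False using nS r by simp
  qed
  have "a\<^sup>2 = - ((sin \<theta>)\<^sup>2 * (cnj (cos \<theta>))\<^sup>2)" by (simp add: a' power_mult_distrib)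
  also have "(cnj (cos \<theta>))\<^sup>2 = cnj ((cos \<theta>)\<^sup>2)" by simp
  also have "(cos \<theta>)\<^sup>2 = 1 - S" by (rule C)
  finally have a2: "a\<^sup>2 = - (S * cnj (1 - S))" by (simp only: S_def)
  have "(e * a)\<^sup>2 = 4 / (1 - of_real (r\<^sup>2) * S) * (- (S * cnj (1 - S)))"
    unfolding power_mult_distrib e_def ell_integrand_squared[OF r] a2 by (simp only: S_def)
  also have "1 - of_real (r\<^sup>2) * S = - (of_real (r\<^sup>2) * S * cnj (1 - S))"
    using SS by (simp add: algebra_simps)
  also have "4 / - (of_real (r\<^sup>2) * S * cnj (1 - S)) * (- (S * cnj (1 - S))) = of_real ((2 / r)\<^sup>2)"
  proof -
    have "S \<noteq> 0" using nS r by auto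
    moreover have "cnj (1 - S) \<noteq> 0" using S1 complex_cnj_zero_iff[of "1 - S"] by blast
    moreover have "4 / - (of_real (r\<^sup>2) * S * c) * (- (S * c)) = of_real ((2 / r)\<^sup>2)" if "S \<noteq> 0" "c \<noteq> 0" for c
      using r that by (simp add: power2_eq_square)
    ultimately show ?thesis by blast
  qed
  finally have "(e * a)\<^sup>2 = (of_real (2 / r))\<^sup>2" by simp
  then have "e * a = of_real (2 / r) \<or> e * a = - of_real (2 / r)" by (rule power2_eq_iff[THEN iffD1])
  then have "Im (e * a) = 0"
    by (elim disjE) (simp_all only: Im_complex_of_real uminus_complex.sel minus_zero)
  then have Im0: "Im (Complex 1 y' * e) = 0" unfolding a by (simp add: mult.commute Im_divide_of_real)
  define d where "d = Re (Complex 1 y' * e)"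
  have de: "Complex 1 y' * e = of_real d" using Im0 by (simp add: complex_eq_iff d_def)
  \<comment> \<open>Multiplying by the conjugate tangent transfers the positive real part of the
    integrand to \<open>d\<close>.\<close>
  have "e * (Complex 1 y' * cnj (Complex 1 y')) = of_real d * cnj (Complex 1 y')"
    unfolding de[symmetric] by (simp add: mult_ac)
  also have "Complex 1 y' * cnj (Complex 1 y') = of_real (1 + y'\<^sup>2)"
    by (simp add: complex_eq_iff power2_eq_square)
  finally have "Re (e * of_real (1 + y'\<^sup>2)) = Re (of_real d * cnj (Complex 1 y'))" by simp
  then have "Re e * (1 + y'\<^sup>2) = d" by simp
  moreover have "0 < Re e * (1 + y'\<^sup>2)"
    using Re_ell_integrand_pos[OF r \<theta>] by (intro mult_pos_pos) (auto simp: e_def add_pos_nonneg)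
  ultimately have "0 < d" by simp
  then show thesis using that[of d] vd Im0 d_def by simp
qed

definition ell_top :: real where "ell_top = Im (ell_F r (Complex 0 (ell_height 0)))"

lemma ell_F_arc_Im:
  assumes x: "0 \<le> x" "x \<le> pi / 2"
  shows "Im (ell_F r (Complex x (ell_height x))) = ell_top" "Im (ell_F r (Complex x (- ell_height x))) = - ell_top"
proof -
  have *: "Im (ell_F r (Complex 0 (s * ell_height 0))) = Im (ell_F r (Complex x (s * ell_height x)))"
    if s: "s = 1 \<or> s = -1" for s
  proof (rule DERIV_zero_imp_eq[OF x(1)])
    fix t assume "0 \<le> t" "t \<le> x"
    then have "0 \<le> t" "t \<le> pi / 2" using x by auto
    then show "((\<lambda>x. Im (ell_F r (Complex x (s * ell_height x)))) has_real_derivative 0) (at t)"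
      by (rule ell_F_along_arc[OF s])
  qed
  show "Im (ell_F r (Complex x (ell_height x))) = ell_top" using *[of 1] by (simp add: ell_top_def)
  have "Complex 0 (ell_height 0) \<in> ell_rect r" using ell_height_pos[of 0] by (simp add: ell_rect_height_iff)
  then have "Im (ell_F r (Complex 0 (- ell_height 0))) = - ell_top"
    unfolding ell_top_def by (intro ell_F_vertical_edge) auto
  then show "Im (ell_F r (Complex x (- ell_height x))) = - ell_top" using *[of "-1"] by simp
qed

text \<open>The real part increases along the arc up to the corner, and along the right edge it is
  constant.\<close>

lemma ell_F_arc_Re:
  assumes s: "s = 1 \<or> s = -1" and x: "0 \<le> x" "x \<le> pi / 2"
  shows "Re (ell_F r (Complex x (s * ell_height x))) \<le> 2 * compl_K r"
proof -
  have "Re (ell_F r (Complex x (s * ell_height x))) \<le> Re (ell_F r (Complex (pi / 2) (s * ell_height (pi / 2))))"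
  proof (rule DERIV_nonneg_imp_nondecreasing[OF x(2)])
    fix t assume "x \<le> t" "t \<le> pi / 2"
    then have t: "0 \<le> t" "t \<le> pi / 2" using x by auto
    obtain d where "0 < d" "((\<lambda>x. Re (ell_F r (Complex x (s * ell_height x)))) has_real_derivative d) (at t)"
      by (rule ell_F_along_arc[OF s t])
    then show "\<exists>d. ((\<lambda>x. Re (ell_F r (Complex x (s * ell_height x)))) has_real_derivative d) (at t) \<and> 0 \<le> d"
      by (intro exI[of _ d]) simp
  qed
  also have "\<dots> = Re (ell_F r (Complex (pi / 2) 0))"
    using s ell_height_pos[of "pi / 2"] by (intro ell_F_vertical_edge) (auto simp: ell_rect_height_iff)
  finally show ?thesis by (simp add: ell_F_half_period)
qed

end

context
  fixes r :: real assumes r: "0 < r" "r < 1"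
begin

text \<open>On the imaginary axis the integrand is \<open>2 / w y\<close>. With the incomplete
  integral \<open>G\<close> of modulus \<open>q\<close>, both \<open>G (arctan (sinh y))\<close>, by
  Jacobi's imaginary transformation, and \<open>- G (pi / 2 - arctan (r * sinh y))\<close> have the
  derivative \<open>1 / w y\<close>, so \<open>N\<close> is constant. At the top
  \<open>sinh y = 1 / sqrt r\<close>, the two arguments of \<open>G\<close> coincide and the terms
  cancel; at 0 only the complete integral \<open>G (pi / 2)\<close> remains.\<close>

lemma ell_top_eq: "ell_top r = compl_K (sqrt (1 - r\<^sup>2))"
proof -
  define q where "q = sqrt (1 - r\<^sup>2)"
  have q: "\<bar>q\<bar> < 1" "q\<^sup>2 = 1 - r\<^sup>2" using compl_modulus[OF r] by (simp_all add: q_def)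
  define f where "f \<theta> = 1 / ell_Delta q \<theta>" for \<theta>
  have nz: "ell_Delta q \<theta> \<noteq> 0" for \<theta> using ell_Delta_pos[OF q(1), of \<theta>] by simp
  have fc: "continuous_on S f" for S
    unfolding f_def by (intro continuous_on_divide continuous_on_const continuous_on_ell_Delta ballI nz)
  \<comment> \<open>The lower limit -1 places 0 and pi / 2 in the interior of
    \<open>{-1..2}\<close>, where the derivative is two-sided.\<close>
  define G where "G t = integral {-1..t} f - integral {-1..0} f" for t
  have G': "(G has_real_derivative f t) (at t)" if "-1 < t" "t < 2" for t
  proof -
    have "((\<lambda>t. integral {-1..t} f) has_real_derivative f t) (at t within {-1..2})"
      using that by (intro integral_has_real_derivative fc) auto
    moreover have "at t within {-1..2} = at t" using that by (intro at_within_interior) auto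
    ultimately have "((\<lambda>t. integral {-1..t} f) has_real_derivative f t) (at t)" by simp
    then have "(G has_real_derivative f t - 0) (at t)"
      unfolding G_def[abs_def] by (intro DERIV_diff DERIV_const)
    then show ?thesis by simp
  qed
  have G0: "G 0 = 0" by (simp add: G_def)
  have "integral {-1..0} f + integral {0..pi/2} f = integral {-1..pi/2} f"
    by (rule Henstock_Kurzweil_Integration.integral_combine) (auto intro!: integrable_continuous_real fc simp: order_trans[OF _ pi_ge_zero])
  then have Gpi: "G (pi / 2) = compl_K q" by (simp add: G_def compl_K_def f_def[abs_def])
  define w where "w y = sqrt (1 + r\<^sup>2 * (sinh y)\<^sup>2)" for y
  have w: "0 < w y" "(w y)\<^sup>2 = 1 + r\<^sup>2 * (sinh y)\<^sup>2" for y
    by (auto simp: w_def add_pos_nonneg)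
  define N where "N y = Im (ell_F r (Complex 0 y)) - G (arctan (sinh y)) + G (pi / 2 - arctan (r * sinh y))" for y
  have dN: "(N has_real_derivative 0) (at y)" if y: "0 \<le> y" "y \<le> ell_height r 0" for y
  proof -
    have dom: "Complex 0 y \<in> ell_domain r" using ell_rect_height_iff(1)[OF r, of 0 y] ell_rect_subset[OF r] y by auto
    have S: "(sin (Complex 0 y))\<^sup>2 = of_real (- (sinh y)\<^sup>2)"
      by (simp add: sin_Complex complex_eq_iff power2_eq_square)
    have d1: "((\<lambda>y. Im (ell_F r (Complex 0 y))) has_real_derivative 2 / w y) (at y)"
      using ell_F_along_Im(1)[OF r dom] unfolding ell_integrand_real[OF r dom S] by (simp add: w_def)
    have b: "0 \<le> arctan (sinh y)" "arctan (sinh y) < pi / 2" "0 \<le> arctan (r * sinh y)" "arctan (r * sinh y) < pi / 2"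
      using y r arctan_ubound[of "sinh y"] arctan_ubound[of "r * sinh y"] by auto
    have pi2: "pi / 2 < 2" using pi_less_4 by simp
    have D1: "ell_Delta q (arctan (sinh y)) = w y / cosh y"
    proof -
      have "(sin (arctan (sinh y)))\<^sup>2 = (sinh y)\<^sup>2 / (cosh y)\<^sup>2"
        by (simp add: sin_arctan power_divide cosh_square_eq add.commute)
      then have "1 - q\<^sup>2 * (sin (arctan (sinh y)))\<^sup>2 = ((cosh y)\<^sup>2 - (1 - r\<^sup>2) * (sinh y)\<^sup>2) / (cosh y)\<^sup>2"
        by (simp add: q(2) diff_divide_distrib)
      also have "(cosh y)\<^sup>2 - (1 - r\<^sup>2) * (sinh y)\<^sup>2 = (w y)\<^sup>2"
        unfolding w(2) cosh_square_eq by (simp add: algebra_simps)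
      finally show ?thesis using w(1)[of y] by (simp add: ell_Delta_def real_sqrt_divide)
    qed
    have D2: "ell_Delta q (pi / 2 - arctan (r * sinh y)) = r * cosh y / w y"
    proof -
      have "(sin (pi / 2 - arctan (r * sinh y)))\<^sup>2 = 1 / (w y)\<^sup>2"
        unfolding w(2) by (simp add: sin_diff cos_arctan power_divide power_mult_distrib)
      then have "1 - q\<^sup>2 * (sin (pi / 2 - arctan (r * sinh y)))\<^sup>2 = ((w y)\<^sup>2 - (1 - r\<^sup>2)) / (w y)\<^sup>2"
        using w(1)[of y] by (simp add: q(2) diff_divide_distrib)
      also have "(w y)\<^sup>2 - (1 - r\<^sup>2) = (r * cosh y)\<^sup>2"
        unfolding w(2) power_mult_distrib cosh_square_eq by (simp add: algebra_simps)
      finally show ?thesis using w(1)[of y] r by (simp add: ell_Delta_def real_sqrt_divide)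
    qed
    have "((\<lambda>y. arctan (sinh y)) has_real_derivative inverse (1 + (sinh y)\<^sup>2) * cosh y) (at y)"
      by (auto intro!: derivative_eq_intros)
    from DERIV_chain2[where f = G, OF G' this] b pi2
    have "((\<lambda>y. G (arctan (sinh y))) has_real_derivative f (arctan (sinh y)) * (inverse (1 + (sinh y)\<^sup>2) * cosh y)) (at y)"
      by simp
    moreover have "f (arctan (sinh y)) * (inverse (1 + (sinh y)\<^sup>2) * cosh y) = 1 / w y"
    proof -
      have "1 + (sinh y)\<^sup>2 = (cosh y)\<^sup>2" by (simp add: cosh_square_eq)
      then show ?thesis
        unfolding f_def D1 using w(1)[of y] cosh_real_pos[of y] by (simp add: power2_eq_square field_simps)
    qed
    ultimately have d2: "((\<lambda>y. G (arctan (sinh y))) has_real_derivative 1 / w y) (at y)" by simp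
    have "((\<lambda>y. pi / 2 - arctan (r * sinh y)) has_real_derivative - (inverse (1 + (r * sinh y)\<^sup>2) * (r * cosh y))) (at y)"
      by (auto intro!: derivative_eq_intros)
    from DERIV_chain2[where f = G, OF G' this] b pi2
    have "((\<lambda>y. G (pi / 2 - arctan (r * sinh y))) has_real_derivative
        f (pi / 2 - arctan (r * sinh y)) * - (inverse (1 + (r * sinh y)\<^sup>2) * (r * cosh y))) (at y)"
      by simp
    moreover have "f (pi / 2 - arctan (r * sinh y)) * - (inverse (1 + (r * sinh y)\<^sup>2) * (r * cosh y)) = - (1 / w y)"
    proof -
      have "1 + (r * sinh y)\<^sup>2 = (w y)\<^sup>2" unfolding w(2) by (simp add: power_mult_distrib)
      then show ?thesis unfolding f_def D2 using r w(1)[of y] cosh_real_pos[of y] by (simp add: power2_eq_square field_simps)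
    qed
    ultimately have d3: "((\<lambda>y. G (pi / 2 - arctan (r * sinh y))) has_real_derivative - (1 / w y)) (at y)" by simp
    have "(N has_real_derivative 2 / w y - 1 / w y + - (1 / w y)) (at y)"
      unfolding N_def[abs_def] by (intro DERIV_add DERIV_diff d1 d2 d3)
    then show ?thesis by simp
  qed
  have "N 0 = N (ell_height r 0)"
    using ell_height_pos[OF r, of 0] by (intro DERIV_zero_imp_eq dN) auto
  moreover have "N 0 = compl_K q"
    using ell_F_real_axis[OF r, of 0] by (simp add: N_def G0 Gpi)
  moreover have "N (ell_height r 0) = ell_top r"
  proof -
    have sh: "sinh (ell_height r 0) = 1 / sqrt r"
    proof (rule power2_eq_imp_eq)
      show "(sinh (ell_height r 0))\<^sup>2 = (1 / sqrt r)\<^sup>2" using r by (simp add: sinh_ell_height[OF r] power_divide)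
    qed (use ell_height_pos[OF r, of 0] r in auto)
    have "r * (1 / sqrt r) = sqrt r" using r by (simp add: real_div_sqrt)
    moreover have "arctan (1 / sqrt r) = pi / 2 - arctan (sqrt r)" using arctan_inverse[of "sqrt r"] r by (simp add: inverse_eq_divide)
    ultimately show ?thesis by (simp add: N_def sh ell_top_def[OF r])
  qed
  ultimately show ?thesis by (simp add: q_def)
qed

definition ell_open :: "complex set" where
  "ell_open = {\<theta>. 0 < Re \<theta> \<and> Re \<theta> < pi / 2 \<and> (sin (Re \<theta>))\<^sup>2 + (sinh (Im \<theta>))\<^sup>2 < 1 / r}"

definition ell_range :: "complex set" where
  "ell_range = {\<zeta>. 0 < Re \<zeta> \<and> Re \<zeta> < 2 * compl_K r \<and> \<bar>Im \<zeta>\<bar> < compl_K (sqrt (1 - r\<^sup>2))}"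

lemma ell_open_iff: "Complex x y \<in> ell_open \<longleftrightarrow> 0 < x \<and> x < pi / 2 \<and> \<bar>y\<bar> < ell_height r x"
  using ell_rect_height_iff(2)[OF r, of x y] by (auto simp: ell_open_def)

lemma open_ell_open: "open ell_open"
  unfolding ell_open_def by (intro open_Collect_conj open_Collect_less continuous_intros)

lemma ell_open_subset: "ell_open \<subseteq> ell_rect r"
  by (auto simp: ell_open_def ell_rect_def)

lemma compact_ell_rect: "compact (ell_rect r)"
proof -
  have cl: "closed (ell_rect r)"
    unfolding ell_rect_def by (intro closed_Collect_conj closed_Collect_le continuous_intros)
  have "ell_rect r \<subseteq> cbox (Complex 0 (- ell_height r 0)) (Complex (pi / 2) (ell_height r 0))"
  proof
    fix \<theta> assume \<theta>: "\<theta> \<in> ell_rect r"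
    then have "(sinh (Im \<theta>))\<^sup>2 \<le> 1 / r"
      using zero_le_power2[of "sin (Re \<theta>)"] unfolding ell_rect_def mem_Collect_eq by linarith
    then have "(sinh (Im \<theta>))\<^sup>2 \<le> (sinh (ell_height r 0))\<^sup>2" by (simp add: sinh_ell_height[OF r])
    then have "\<bar>Im \<theta>\<bar> \<le> ell_height r 0"
      using ell_height_pos[OF r, of 0] by (simp add: sinh_squared_le_iff)
    then show "\<theta> \<in> cbox (Complex 0 (- ell_height r 0)) (Complex (pi / 2) (ell_height r 0))"
      using \<theta> by (auto simp: in_cbox_complex_iff ell_rect_def)
  qed
  then have "cbox (Complex 0 (- ell_height r 0)) (Complex (pi / 2) (ell_height r 0)) \<inter> ell_rect r = ell_rect r" by blast
  then show ?thesis
    using cl compact_Int_closed[OF compact_cbox, of "ell_rect r" "Complex 0 (- ell_height r 0)" "Complex (pi / 2) (ell_height r 0)"]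
    by simp
qed

lemma ell_F_deriv_nz: "\<theta> \<in> ell_rect r \<Longrightarrow> deriv (ell_F r) \<theta> = ell_integrand r \<theta> \<and> deriv (ell_F r) \<theta> \<noteq> 0"
  using ell_F_deriv[OF r, of \<theta>] Re_ell_integrand_pos[OF r, of \<theta>] ell_rect_subset[OF r]
  by (auto simp: DERIV_imp_deriv subset_iff)

lemma ell_F_holomorphic: "ell_F r holomorphic_on ell_open"
  using ell_F_deriv[OF r] ell_rect_subset[OF r] ell_open_subset
  by (auto simp: holomorphic_on_open[OF open_ell_open] subset_iff)

lemma ell_F_Im_sign:
  assumes "Complex x y \<in> ell_rect r" "0 < y"
  shows "0 < Im (ell_F r (Complex x y))" "Im (ell_F r (Complex x (- y))) < 0"
proof -
  have x: "0 \<le> x" "x \<le> pi / 2" using assms by (auto simp: ell_rect_def)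
  have dom: "Complex x t \<in> ell_domain r" if "\<bar>t\<bar> \<le> \<bar>y\<bar>" for t
    using ell_rect_vertical[OF r assms(1) that] ell_rect_subset[OF r] by auto
  have "Im (ell_F r (Complex x 0)) < Im (ell_F r (Complex x y))"
    by (rule ell_F_Im_strict_mono[OF r assms(2)]) (rule dom, simp)
  then show "0 < Im (ell_F r (Complex x y))" by (simp add: ell_F_real_axis[OF r x])
  have "Im (ell_F r (Complex x (- y))) < Im (ell_F r (Complex x 0))"
    by (rule ell_F_Im_strict_mono[OF r]) (use assms in \<open>auto intro: dom\<close>)
  then show "Im (ell_F r (Complex x (- y))) < 0" by (simp add: ell_F_real_axis[OF r x])
qed

text \<open>The edges of the rectangle go into the lines that bound \<open>ell_range\<close>, which
  is the properness required. The point pi / 4 supplies a value taken once: the imaginary part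
  vanishes only on the real axis, and there the real part is strictly increasing.\<close>

lemma ell_F_bij: "bij_betw (ell_F r) ell_open ell_range"
proof (rule holomorphic_bij_of_proper[OF open_ell_open compact_ell_rect ell_open_subset ell_F_continuous[OF r] ell_F_holomorphic])
  let ?F = "ell_F r"
  have dom: "Complex x y \<in> ell_domain r" if "Complex x y \<in> ell_rect r" for x y
    using that ell_rect_subset[OF r] by auto
  show "deriv ?F z \<noteq> 0" if "z \<in> ell_open" for z
    using ell_F_deriv_nz that ell_open_subset by blast
  show "connected ell_range"
  proof -
    have "ell_range = box (Complex 0 (- compl_K (sqrt (1 - r\<^sup>2)))) (Complex (2 * compl_K r) (compl_K (sqrt (1 - r\<^sup>2))))"
      by (auto simp: ell_range_def in_box_complex_iff abs_less_iff)
    then show ?thesis using convex_connected[OF convex_box(2)] by simp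
  qed
  show "?F ` ell_open \<subseteq> ell_range"
  proof (clarify)
    fix \<theta> assume \<theta>: "\<theta> \<in> ell_open"
    obtain x y where xy: "\<theta> = Complex x y" by (cases \<theta>)
    have x: "0 < x" "x < pi / 2" and y: "\<bar>y\<bar> < ell_height r x" using \<theta> by (auto simp: xy ell_open_iff)
    have rect: "Complex x y \<in> ell_rect r" using \<theta> ell_open_subset by (auto simp: xy)
    have vert: "Complex x t \<in> ell_domain r" if "\<bar>t\<bar> \<le> ell_height r x" for t
      using that x by (intro dom) (simp add: ell_rect_height_iff(1)[OF r])
    have "Im (?F (Complex x y)) < Im (?F (Complex x (ell_height r x)))"
      by (rule ell_F_Im_strict_mono[OF r]) (use y in \<open>auto intro!: vert\<close>)
    moreover have "Im (?F (Complex x (- ell_height r x))) < Im (?F (Complex x y))"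
      by (rule ell_F_Im_strict_mono[OF r]) (use y in \<open>auto intro!: vert\<close>)
    ultimately have Im: "\<bar>Im (?F (Complex x y))\<bar> < compl_K (sqrt (1 - r\<^sup>2))"
      using ell_F_arc_Im[OF r, of x] x by (simp add: ell_top_eq abs_less_iff)
    have hor: "Complex t y \<in> ell_rect r" if "0 \<le> t" "t \<le> x" for t
      by (rule ell_rect_horizontal[OF r rect that])
    have "Re (?F (Complex 0 y)) = Re (?F (Complex 0 0))"
      by (rule ell_F_vertical_edge(1)[OF r]) (use hor[of 0] x in auto)
    then have "Re (?F (Complex 0 y)) = 0" by (simp add: ell_F_0[OF r] zero_complex.code[symmetric])
    moreover have "Re (?F (Complex 0 y)) < Re (?F (Complex x y))"
      by (rule ell_F_Re_strict_mono[OF r x(1)]) (intro dom hor)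
    ultimately have Re0: "0 < Re (?F (Complex x y))" by simp
    have Re1: "Re (?F (Complex x y)) < 2 * compl_K r"
    proof (cases "\<bar>y\<bar> \<le> ell_height r (pi / 2)")
      case True
      then have rect': "Complex (pi / 2) y \<in> ell_rect r" by (simp add: ell_rect_height_iff(1)[OF r])
      have "Re (?F (Complex x y)) < Re (?F (Complex (pi / 2) y))"
        by (rule ell_F_Re_strict_mono[OF r x(2)]) (rule dom, rule ell_rect_horizontal[OF r rect'], use x in auto)
      also have "\<dots> = Re (?F (Complex (pi / 2) 0))"
        by (rule ell_F_vertical_edge(1)[OF r _ rect']) simp
      finally show ?thesis by (simp add: ell_F_half_period[OF r])
    next
      case False
      \<comment> \<open>The horizontal line to the right leaves the rectangle through the curved arc
        before it reaches the right edge, at the abscissa \<open>x1\<close> where the height has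
        dropped to \<open>\<bar>y\<bar>\<close>.\<close>
      have "\<exists>x1. x \<le> x1 \<and> x1 \<le> pi / 2 \<and> ell_height r x1 = \<bar>y\<bar>"
      proof (rule IVT2)
        show "\<forall>t. x \<le> t \<and> t \<le> pi / 2 \<longrightarrow> isCont (ell_height r) t"
          using ell_height_has_derivative[OF r] DERIV_isCont by blast
      qed (use False y x in auto)
      then obtain x1 where x1: "x \<le> x1" "x1 \<le> pi / 2" "ell_height r x1 = \<bar>y\<bar>" by blast
      then have "x < x1" using y by (cases "x = x1") auto
      have rect': "Complex x1 y \<in> ell_rect r" using x1 x by (simp add: ell_rect_height_iff(1)[OF r])
      have "Re (?F (Complex x y)) < Re (?F (Complex x1 y))"
        by (rule ell_F_Re_strict_mono[OF r \<open>x < x1\<close>]) (rule dom, rule ell_rect_horizontal[OF r rect'], use x in auto)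
      also have "\<dots> \<le> 2 * compl_K r"
      proof -
        obtain s :: real where s: "s = 1 \<or> s = -1" "y = s * ell_height r x1"
          using x1(3) by (cases "0 \<le> y") force+
        show ?thesis unfolding s(2) by (rule ell_F_arc_Re[OF r s(1)]) (use x1 x in auto)
      qed
      finally show ?thesis .
    qed
    show "?F \<theta> \<in> ell_range" using Im Re0 Re1 by (simp add: ell_range_def xy)
  qed
  show "?F \<theta> \<notin> ell_range" if \<theta>: "\<theta> \<in> ell_rect r" "\<theta> \<notin> ell_open" for \<theta>
  proof -
    obtain x y where xy: "\<theta> = Complex x y" by (cases \<theta>)
    have x: "0 \<le> x" "x \<le> pi / 2" "\<bar>y\<bar> \<le> ell_height r x" using \<theta>(1) by (auto simp: xy ell_rect_height_iff(1)[OF r])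
    consider "x = 0" | "x = pi / 2" | "y = ell_height r x" | "y = - ell_height r x"
      using \<theta>(2) x unfolding xy ell_open_iff by linarith
    then show ?thesis
    proof cases
      case 1
      then have "Re (?F \<theta>) = Re (?F (Complex 0 0))"
        using ell_F_vertical_edge(1)[OF r, of 0 y] \<theta>(1) by (simp add: xy)
      then show ?thesis by (simp add: ell_range_def ell_F_0[OF r] zero_complex.code[symmetric])
    next
      case 2
      have "Complex (pi / 2) y \<in> ell_rect r" using \<theta>(1) unfolding xy 2 .
      then have "Re (?F \<theta>) = Re (?F (Complex (pi / 2) 0))"
        unfolding xy 2 by (rule ell_F_vertical_edge(1)[OF r, rotated]) simp
      then show ?thesis by (simp add: ell_range_def ell_F_half_period[OF r])
    next
      case 3
      have "Im (?F \<theta>) = ell_top r" unfolding xy 3 by (rule ell_F_arc_Im[OF r x(1,2)])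
      then show ?thesis by (auto simp: ell_range_def ell_top_eq)
    next
      case 4
      have "Im (?F \<theta>) = - ell_top r" unfolding xy 4 by (rule ell_F_arc_Im[OF r x(1,2)])
      then show ?thesis by (auto simp: ell_range_def ell_top_eq)
    qed
  qed
  show mem: "Complex (pi / 4) 0 \<in> ell_open" using ell_height_pos[OF r] by (simp add: ell_open_iff)
  show "\<theta> = Complex (pi / 4) 0" if \<theta>: "\<theta> \<in> ell_open" "?F \<theta> = ?F (Complex (pi / 4) 0)" for \<theta>
  proof -
    obtain x y where xy: "\<theta> = Complex x y" by (cases \<theta>)
    have rect: "Complex x y \<in> ell_rect r" using \<theta>(1) ell_open_subset by (auto simp: xy)
    have x: "0 < x" "x < pi / 2" using \<theta> by (auto simp: xy ell_open_iff)
    have "Im (?F (Complex x y)) = 0" using \<theta>(2) ell_F_real_axis[OF r, of "pi / 4"] by (simp add: xy)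
    moreover have "Complex x (- y) \<in> ell_rect r" by (rule ell_rect_vertical[OF r rect]) simp
    ultimately have "y = 0"
      using ell_F_Im_sign(1)[OF rect] ell_F_Im_sign(2)[of x "- y"] by (cases "y = 0") (auto simp: neq_iff)
    have hor: "Complex t 0 \<in> ell_domain r" if "0 \<le> t" "t \<le> pi / 2" for t
      by (intro dom real_axis_in_rect[OF r] that)
    have eq: "Re (?F (Complex x 0)) = Re (?F (Complex (pi / 4) 0))" using \<theta>(2) by (simp add: xy \<open>y = 0\<close>)
    have "x = pi / 4"
    proof (rule ccontr)
      assume "x \<noteq> pi / 4"
      then consider "x < pi / 4" | "pi / 4 < x" by linarith
      then show False
      proof cases
        case 1
        have "Re (?F (Complex x 0)) < Re (?F (Complex (pi / 4) 0))"
          by (rule ell_F_Re_strict_mono[OF r 1]) (use x in \<open>auto intro!: hor\<close>)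
        then show False using eq by simp
      next
        case 2
        have "Re (?F (Complex (pi / 4) 0)) < Re (?F (Complex x 0))"
          by (rule ell_F_Re_strict_mono[OF r 2]) (use x pi_gt_zero in \<open>auto intro!: hor\<close>)
        then show False using eq by simp
      qed
    qed
    then show ?thesis by (simp add: xy \<open>y = 0\<close>)
  qed
qed

end

section \<open>The Groetzsch ring\<close>

text \<open>A continuous map from a compact space onto a Hausdorff space is a quotient map: the
  preimage of a closed set under \<open>f\<close> is the image of a compact one.\<close>

lemma continuous_on_descend:
  fixes f :: "'b::t2_space \<Rightarrow> 'c::t2_space" and s :: "'a::t2_space \<Rightarrow> 'b"
  assumes S: "compact S" and s: "continuous_on S s" and g: "continuous_on S g"
    and f: "\<And>x. x \<in> S \<Longrightarrow> f (s x) = g x"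
  shows "continuous_on (s ` S) f"
proof -
  have cl: "closed (s ` S)" by (intro compact_imp_closed compact_continuous_image s S)
  have "closed (f -` B \<inter> s ` S)" if "closed B" for B
  proof -
    have "closed (g -` B \<inter> S)"
      using g \<open>closed B\<close> compact_imp_closed[OF S] by (simp add: continuous_on_closed_vimage)
    then have "compact ((g -` B \<inter> S) \<inter> S)" by (intro closed_Int_compact S)
    then have "compact (s ` (g -` B \<inter> S))"
      by (intro compact_continuous_image continuous_on_subset[OF s]) (auto simp: Int_assoc)
    moreover have "f -` B \<inter> s ` S = s ` (g -` B \<inter> S)" using f by (auto simp: image_iff)
    ultimately show ?thesis by (simp add: compact_imp_closed)
  qed
  then show ?thesis using cl by (simp add: continuous_on_closed_vimage)
qed

text \<open>Both points are pushed into the open half plane by \<open>t\<close>, and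
  \<open>t\<close> tends to 0.\<close>

lemma lipschitz_closed_half:
  fixes u :: "complex \<Rightarrow> real"
  assumes C: "open C" and u: "continuous_on C u"
    and lip: "\<And>z w. z \<in> C \<Longrightarrow> w \<in> C \<Longrightarrow> 0 < s * Im z \<Longrightarrow> 0 < s * Im w \<Longrightarrow> \<bar>u z - u w\<bar> \<le> M * dist z w"
    and s: "s = 1 \<or> s = -1"
    and zw: "z \<in> C" "w \<in> C" "0 \<le> s * Im z" "0 \<le> s * Im w"
  shows "\<bar>u z - u w\<bar> \<le> M * dist z w"
proof -
  define p where "p t z = z + of_real (s * t) * \<i>" for t z
  have lim: "((\<lambda>t. p t z) \<longlongrightarrow> z) (at_right 0)" for z
  proof -
    have "((\<lambda>t. p t z) \<longlongrightarrow> z + of_real (s * 0) * \<i>) (at_right 0)"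
      unfolding p_def by (intro tendsto_intros)
    then show ?thesis by simp
  qed
  have limu: "((\<lambda>t. u (p t z)) \<longlongrightarrow> u z) (at_right 0)" if "z \<in> C" for z
  proof -
    have "isCont u z" using u C that by (simp add: continuous_on_eq_continuous_at)
    then show ?thesis by (rule isCont_tendsto_compose[OF _ lim])
  qed
  have ev: "eventually (\<lambda>t. p t z \<in> C) (at_right 0)" if "z \<in> C" for z
    by (rule topological_tendstoD[OF lim C that])
  have "((\<lambda>t. \<bar>u (p t z) - u (p t w)\<bar>) \<longlongrightarrow> \<bar>u z - u w\<bar>) (at_right 0)"
    by (intro tendsto_intros limu zw)
  moreover have "((\<lambda>t. M * dist (p t z) (p t w)) \<longlongrightarrow> M * dist z w) (at_right 0)"
    by (intro tendsto_intros lim)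
  moreover have "eventually (\<lambda>t. \<bar>u (p t z) - u (p t w)\<bar> \<le> M * dist (p t z) (p t w)) (at_right 0)"
    using ev[OF zw(1)] ev[OF zw(2)] eventually_at_right_less[of "0 :: real"]
  proof eventually_elim
    case (elim t)
    have "s * s = 1" using s by auto
    then have st: "s * (s * t) = t" by (simp add: mult.assoc[symmetric])
    have Im: "s * Im (p t z) = s * Im z + t" for z by (simp add: p_def distrib_left st)
    show ?case
      by (rule lip) (use elim zw(3,4) in \<open>simp_all add: Im\<close>)
  qed
  ultimately show ?thesis
    by (intro tendsto_le[OF trivial_limit_at_right_real])
qed

text \<open>The segment between points on different sides is cut at the real axis, where both
  one-sided estimates hold, and the two distances add up. The chart of the disk is available only
  off the real axis, while the curves may cross it.\<close>

lemma lipschitz_across_real_axis: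
  fixes u :: "complex \<Rightarrow> real"
  assumes C: "open C" "convex C" and u: "continuous_on C u"
    and lip: "\<And>s z w. s = 1 \<or> s = -1 \<Longrightarrow> z \<in> C \<Longrightarrow> w \<in> C \<Longrightarrow> 0 < s * Im z \<Longrightarrow> 0 < s * Im w \<Longrightarrow> \<bar>u z - u w\<bar> \<le> M * dist z w"
    and zw: "z \<in> C" "w \<in> C"
  shows "\<bar>u z - u w\<bar> \<le> M * dist z w"
proof -
  have half: "\<bar>u z - u w\<bar> \<le> M * dist z w"
    if "s = 1 \<or> s = -1" "z \<in> C" "w \<in> C" "0 \<le> s * Im z" "0 \<le> s * Im w" for s :: real and z w
    by (rule lipschitz_closed_half[OF C(1) u lip]) (use that in auto)
  have cross: "\<bar>u z - u w\<bar> \<le> M * dist z w" if zw: "z \<in> C" "w \<in> C" "0 < Im z" "Im w < 0" for z w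
  proof -
    define t where "t = Im z / (Im z - Im w)"
    have t: "0 \<le> t" "t \<le> 1" using zw by (auto simp: t_def field_simps)
    define p where "p = (1 - t) *\<^sub>R z + t *\<^sub>R w"
    have p: "p \<in> C" unfolding p_def using convexD_alt[OF C(2) zw(1,2) t] .
    have "t * (Im z - Im w) = Im z" using zw by (simp add: t_def)
    then have Imp: "Im p = 0" by (simp add: p_def algebra_simps)
    have "z - p = t *\<^sub>R (z - w)" "p - w = (1 - t) *\<^sub>R (z - w)"
      by (simp_all add: p_def scaleR_conv_of_real algebra_simps)
    then have d: "dist z p + dist p w = dist z w"
      using t by (simp add: dist_norm left_diff_distrib)
    have "\<bar>u z - u p\<bar> \<le> M * dist z p" using half[of 1 z p] zw p Imp by simp
    moreover have "\<bar>u p - u w\<bar> \<le> M * dist p w" using half[of "-1" p w] zw p Imp by simp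
    ultimately have "\<bar>u z - u w\<bar> \<le> M * dist z p + M * dist p w" by linarith
    also have "\<dots> = M * dist z w" by (simp only: d distrib_left[symmetric])
    finally show ?thesis .
  qed
  consider "0 \<le> Im z" "0 \<le> Im w" | "Im z \<le> 0" "Im w \<le> 0" | "0 < Im z" "Im w < 0" | "Im z < 0" "0 < Im w"
    by linarith
  then show ?thesis
  proof cases
    case 1 then show ?thesis using half[of 1] zw by simp
  next
    case 2 then show ?thesis using half[of "-1"] zw by simp
  next
    case 3 then show ?thesis using cross zw by simp
  next
    case 4 then show ?thesis using cross[of w z] zw by (simp add: dist_commute abs_minus_commute)
  qed
qed

text \<open>Here \<open>\<Phi>\<close> maps a rectangle to the disk minus the two geodesic rays that prolong the hyperbolic segment from
  \<open>p\<close> to \<open>q\<close>; the segment is the image of the real axis.  The functions \<open>v\<close> and \<open>u\<close> are the real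
  part and the absolute value of the imaginary part of the inverse, extended continuously to the
  rays, and \<open>\<rho>\<close> is the norm of the gradient of \<open>u\<close>, that is, the extremal metric.\<close>

locale groetzsch_data =
  fixes p q :: complex and r :: real and \<Phi> :: "complex \<Rightarrow> complex" and u v \<rho> :: "complex \<Rightarrow> real"
  assumes \<Phi>_hol: "\<Phi> holomorphic_on ell_range r" and \<Phi>_inj: "inj_on \<Phi> (ell_range r)"
    and \<Phi>_img: "\<Phi> ` ell_range r \<subseteq> ball 0 1"
    and v_cont: "continuous_on (ball 0 1) v" and v_p: "v p = 0" and v_q: "v q = 2 * compl_K r"
    and v_level: "\<And>z. z \<in> ball 0 1 \<Longrightarrow> 0 < v z \<Longrightarrow> v z < 2 * compl_K r \<Longrightarrow>
        \<exists>s. \<bar>s\<bar> < compl_K (sqrt (1 - r\<^sup>2)) \<and> z = \<Phi> (Complex (v z) s)"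
    and u_cont: "continuous_on (ball 0 1) u"
    and u_bounds: "\<And>z. z \<in> ball 0 1 \<Longrightarrow> 0 \<le> u z \<and> u z < compl_K (sqrt (1 - r\<^sup>2))"
    and u_\<Phi>: "\<And>\<zeta>. \<zeta> \<in> ell_range r \<Longrightarrow> u (\<Phi> \<zeta>) = \<bar>Im \<zeta>\<bar>"
    and u_compact: "\<And>c. c < compl_K (sqrt (1 - r\<^sup>2)) \<Longrightarrow> compact {z \<in> ball 0 1. u z \<le> c}"
    and u_zero: "connected {z \<in> ball 0 1. u z = 0}" "u p = 0" "u q = 0"
    and \<rho>_meas: "\<rho> \<in> borel_measurable borel" and \<rho>_nonneg: "\<And>z. 0 \<le> \<rho> z"
    and \<rho>_cont: "continuous_on (ball 0 1 - {p, q}) \<rho>"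
    and \<rho>_integral: "(\<integral>\<^sup>+ z\<in>ball 0 1. ennreal ((\<rho> z)\<^sup>2) \<partial>lborel) \<le> ennreal (4 * compl_K r * compl_K (sqrt (1 - r\<^sup>2)))"
    and u_lipschitz: "\<And>z e. z \<in> ball 0 1 - {p, q} \<Longrightarrow> 0 < e \<Longrightarrow> \<exists>d>0. \<forall>w\<in>ball 0 1 - {p, q}. \<forall>w'\<in>ball 0 1 - {p, q}.
        dist w z < d \<longrightarrow> dist w' z < d \<longrightarrow> \<bar>u w - u w'\<bar> \<le> (\<rho> z + e) * dist w w'"

section \<open>The folding of the rectangle onto the disk\<close>

context
  fixes r :: real assumes r: "0 < r" "r < 1"
begin

text \<open>On \<open>ell_rect r\<close> this folds the edge Re = 0 onto [-1, 0] and the edge Re =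
  pi / 2 onto [r, 1], and it takes the real segment onto [0, r].\<close>

definition ell_proj :: "complex \<Rightarrow> complex" where
  "ell_proj \<theta> = of_real r * (sin \<theta>)\<^sup>2"

lemma norm_ell_proj: "norm (ell_proj \<theta>) = r * ((sin (Re \<theta>))\<^sup>2 + (sinh (Im \<theta>))\<^sup>2)"
  unfolding ell_proj_def norm_mult norm_sin_squared_cart using r by simp

lemma ell_proj_surj:
  obtains \<theta> where "0 \<le> Re \<theta>" "Re \<theta> \<le> pi / 2" "ell_proj \<theta> = z"
proof -
  \<comment> \<open>From \<open>cos (2 * \<theta>) = 1 - 2 * (sin \<theta>)\<^sup>2\<close>; the
    sign of \<open>w\<close> is then adjusted to make the real part nonnegative.\<close>
  define w where "w = Arccos (1 - 2 * (z / of_real r))"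
  define \<theta> where "\<theta> = (if Re w < 0 then - w else w) / 2"
  have "cos (2 * \<theta>) = 1 - 2 * (z / of_real r)" by (simp add: \<theta>_def w_def)
  then have "2 * (sin \<theta>)\<^sup>2 = 2 * (z / of_real r)" by (simp add: cos_double_sin)
  then have "(sin \<theta>)\<^sup>2 = z / of_real r" by (rule mult_left_cancel[THEN iffD1, rotated]) simp
  then have "ell_proj \<theta> = z" using r by (simp add: ell_proj_def)
  moreover have "0 \<le> Re \<theta>" "Re \<theta> \<le> pi / 2" using Re_Arccos_bounds[of "1 - 2 * (z / of_real r)"] by (auto simp: \<theta>_def w_def)
  ultimately show thesis by (rule that[rotated 2])
qed

lemma ell_proj_in_cball: "\<theta> \<in> ell_rect r \<Longrightarrow> ell_proj \<theta> \<in> cball 0 1"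
  using r by (simp add: norm_ell_proj ell_rect_def field_simps)

lemma in_ell_rect_of_proj:
  assumes "0 \<le> Re \<theta>" "Re \<theta> \<le> pi / 2" "ell_proj \<theta> \<in> cball 0 1"
  shows "\<theta> \<in> ell_rect r"
  using assms r by (simp add: norm_ell_proj ell_rect_def field_simps)

lemma ell_proj_image: "ell_proj ` ell_rect r = cball 0 1"
proof
  show "cball 0 1 \<subseteq> ell_proj ` ell_rect r"
  proof
    fix z :: complex assume "z \<in> cball 0 1"
    moreover obtain \<theta> where "0 \<le> Re \<theta>" "Re \<theta> \<le> pi / 2" "ell_proj \<theta> = z" by (rule ell_proj_surj)
    ultimately show "z \<in> ell_proj ` ell_rect r" using in_ell_rect_of_proj[of \<theta>] by auto
  qed
qed (use ell_proj_in_cball in auto)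

text \<open>Equal cosines of the double angles leave translations and point reflections by multiples
  of pi. The bounds on the real parts leave the identity and, on a vertical edge, the change of sign
  of the imaginary part.\<close>

lemma ell_proj_fibre:
  assumes \<theta>: "\<theta> \<in> ell_rect r" "\<theta>' \<in> ell_rect r" and eq: "ell_proj \<theta> = ell_proj \<theta>'"
  shows "\<theta>' = \<theta> \<or> (\<theta>' = Complex (Re \<theta>) (- Im \<theta>) \<and> (Re \<theta> = 0 \<or> Re \<theta> = pi / 2))"
proof -
  have b: "0 \<le> Re \<theta>" "Re \<theta> \<le> pi / 2" "0 \<le> Re \<theta>'" "Re \<theta>' \<le> pi / 2" using \<theta> by (auto simp: ell_rect_def)
  have "(sin \<theta>)\<^sup>2 = (sin \<theta>')\<^sup>2" using eq r by (simp add: ell_proj_def)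
  then have "cos (2 * \<theta>') = cos (2 * \<theta>)" by (simp add: cos_double_sin)
  then obtain n where n: "n \<in> \<int>" "2 * \<theta>' = 2 * \<theta> + of_real (2 * n * pi) \<or> 2 * \<theta>' = - (2 * \<theta>) + of_real (2 * n * pi)"
    unfolding complex_cos_eq by blast
  obtain k :: int where k: "n = of_int k" using n(1) by (auto elim: Ints_cases)
  from n(2) show ?thesis
  proof
    assume *: "2 * \<theta>' = 2 * \<theta> + of_real (2 * n * pi)"
    have "Re (2 * \<theta>') = Re (2 * \<theta> + of_real (2 * n * pi))" by (simp only: *)
    then have "Re \<theta>' - Re \<theta> = of_int k * pi" by (simp add: k)
    then have "\<bar>of_int k :: real\<bar> * pi \<le> pi / 2" using b by (simp add: abs_mult[symmetric, of _ pi, unfolded abs_of_pos[OF pi_gt_zero]] abs_le_iff)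
    then have "\<bar>of_int k :: real\<bar> < 1" using pi_gt_zero by (simp add: field_simps)
    then have "k = 0" by linarith
    then show ?thesis using * by (simp add: k)
  next
    assume *: "2 * \<theta>' = - (2 * \<theta>) + of_real (2 * n * pi)"
    have Re: "Re (2 * \<theta>') = Re (- (2 * \<theta>) + of_real (2 * n * pi))" by (simp only: *)
    have Im: "Im (2 * \<theta>') = Im (- (2 * \<theta>) + of_real (2 * n * pi))" by (simp only: *)
    have 1: "Re \<theta>' + Re \<theta> = of_int k * pi" using Re by (simp add: k)
    have 2: "Im \<theta>' = - Im \<theta>" using Im by simp
    have "0 \<le> of_int k * pi" "of_int k * pi \<le> 1 * pi" using b 1 by linarith+
    then have "0 \<le> (of_int k :: real)" "(of_int k :: real) \<le> 1"
      by (simp_all only: zero_le_mult_iff mult_le_cancel_right_pos[OF pi_gt_zero]) (use pi_gt_zero in linarith)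
    then have "k = 0 \<or> k = 1" by linarith
    then have "Re \<theta>' = Re \<theta> \<and> (Re \<theta> = 0 \<or> Re \<theta> = pi / 2)"
    proof
      assume "k = 0" then show ?thesis using 1 b by auto
    next
      assume "k = 1"
      then have "Re \<theta>' + Re \<theta> = pi" using 1 by simp
      then show ?thesis using b by auto
    qed
    then show ?thesis using 2 by (auto simp: complex_eq_iff)
  qed
qed

definition ell_lift :: "complex \<Rightarrow> complex" where
  "ell_lift z = (SOME \<theta>. \<theta> \<in> ell_rect r \<and> ell_proj \<theta> = z)"

definition ell_u :: "complex \<Rightarrow> real" where "ell_u z = \<bar>Im (ell_F r (ell_lift z))\<bar>"
definition ell_v :: "complex \<Rightarrow> real" where "ell_v z = Re (ell_F r (ell_lift z))"

text \<open>Two points that are folded together lie on an edge and differ in the sign of Im; there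
  \<open>ell_F r\<close> keeps its real part and changes the sign of its imaginary part. This is the
  reason for the absolute value in \<open>ell_u\<close>.\<close>

lemma ell_uv_proj:
  assumes \<theta>: "\<theta> \<in> ell_rect r"
  shows "ell_u (ell_proj \<theta>) = \<bar>Im (ell_F r \<theta>)\<bar>" "ell_v (ell_proj \<theta>) = Re (ell_F r \<theta>)"
proof -
  define \<theta>' where "\<theta>' = ell_lift (ell_proj \<theta>)"
  have \<theta>': "\<theta>' \<in> ell_rect r \<and> ell_proj \<theta>' = ell_proj \<theta>"
    unfolding \<theta>'_def ell_lift_def by (rule someI[of _ \<theta>]) (use \<theta> in simp)
  have "\<bar>Im (ell_F r \<theta>')\<bar> = \<bar>Im (ell_F r \<theta>)\<bar> \<and> Re (ell_F r \<theta>') = Re (ell_F r \<theta>)"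
  proof (cases "\<theta>' = \<theta>")
    case False
    then have eq: "\<theta>' = Complex (Re \<theta>) (- Im \<theta>)" and edge: "Re \<theta> = 0 \<or> Re \<theta> = pi / 2"
      using ell_proj_fibre[OF \<theta>, of \<theta>'] \<theta>' by auto
    have rect: "Complex (Re \<theta>) (Im \<theta>) \<in> ell_rect r" "Complex (Re \<theta>) (- Im \<theta>) \<in> ell_rect r" using \<theta> \<theta>' eq by auto
    have 1: "Re (ell_F r (Complex (Re \<theta>) (Im \<theta>))) = Re (ell_F r (Complex (Re \<theta>) 0))"
      by (rule ell_F_vertical_edge(1)[OF r edge rect(1)])
    have 2: "Re (ell_F r (Complex (Re \<theta>) (- Im \<theta>))) = Re (ell_F r (Complex (Re \<theta>) 0))"
      by (rule ell_F_vertical_edge(1)[OF r edge rect(2)])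
    have 3: "Im (ell_F r (Complex (Re \<theta>) (- Im \<theta>))) = - Im (ell_F r (Complex (Re \<theta>) (Im \<theta>)))"
      by (rule ell_F_vertical_edge(2)[OF r edge rect(1)])
    show ?thesis using 1 2 3 unfolding eq complex_surj by simp
  qed simp
  then show "ell_u (ell_proj \<theta>) = \<bar>Im (ell_F r \<theta>)\<bar>" "ell_v (ell_proj \<theta>) = Re (ell_F r \<theta>)"
    by (simp_all add: ell_u_def ell_v_def \<theta>'_def)
qed

lemma ell_proj_continuous: "continuous_on S ell_proj"
  unfolding ell_proj_def by (intro continuous_intros)

lemma ell_u_continuous: "continuous_on (cball 0 1) ell_u"
  and ell_v_continuous: "continuous_on (cball 0 1) ell_v"
proof -
  have cu: "continuous_on (ell_rect r) (\<lambda>\<theta>. \<bar>Im (ell_F r \<theta>)\<bar>)" and cv: "continuous_on (ell_rect r) (\<lambda>\<theta>. Re (ell_F r \<theta>))"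
    by (intro continuous_intros ell_F_continuous[OF r])+
  show "continuous_on (cball 0 1) ell_u"
    unfolding ell_proj_image[symmetric]
    by (rule continuous_on_descend[where S = "ell_rect r" and s = ell_proj and f = ell_u,
        OF compact_ell_rect[OF r] ell_proj_continuous cu ell_uv_proj(1)])
  show "continuous_on (cball 0 1) ell_v"
    unfolding ell_proj_image[symmetric]
    by (rule continuous_on_descend[where S = "ell_rect r" and s = ell_proj and f = ell_v,
        OF compact_ell_rect[OF r] ell_proj_continuous cv ell_uv_proj(2)])
qed

lemma ell_proj_holomorphic: "ell_proj holomorphic_on S"
  unfolding ell_proj_def by (intro holomorphic_intros)

lemma ell_proj_inj: "inj_on ell_proj (ell_open r)"
proof (rule inj_onI)
  fix \<theta> \<theta>' assume \<theta>: "\<theta> \<in> ell_open r" "\<theta>' \<in> ell_open r" "ell_proj \<theta> = ell_proj \<theta>'"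
  then show "\<theta> = \<theta>'"
    using ell_proj_fibre[of \<theta> \<theta>'] ell_open_subset[OF r] by (auto simp: ell_open_def[OF r])
qed

lemma ell_proj_open: "\<theta> \<in> ell_open r \<Longrightarrow> ell_proj \<theta> \<in> ball 0 1"
  using r by (simp add: norm_ell_proj ell_open_def[OF r] field_simps)

lemma ell_open_of_proj:
  assumes "z \<in> ball 0 1" "Im z \<noteq> 0"
  obtains \<theta> where "\<theta> \<in> ell_open r" "ell_proj \<theta> = z"
proof -
  obtain \<theta> where \<theta>: "0 \<le> Re \<theta>" "Re \<theta> \<le> pi / 2" "ell_proj \<theta> = z" by (rule ell_proj_surj)
  have "(sin \<theta>)\<^sup>2 = (Complex (sin (Re \<theta>) * cosh (Im \<theta>)) (cos (Re \<theta>) * sinh (Im \<theta>)))\<^sup>2"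
    using sin_Complex[of "Re \<theta>" "Im \<theta>"] by simp
  then have "Im z = r * (2 * (sin (Re \<theta>) * cosh (Im \<theta>)) * (cos (Re \<theta>) * sinh (Im \<theta>)))"
    unfolding \<theta>(3)[symmetric] ell_proj_def by (simp add: power2_eq_square)
  then have nz: "sin (Re \<theta>) \<noteq> 0" "cos (Re \<theta>) \<noteq> 0" using assms(2) by auto
  have "Re \<theta> \<noteq> 0"
  proof
    assume e: "Re \<theta> = 0" show False using nz(1) unfolding e by simp
  qed
  moreover have "Re \<theta> \<noteq> pi / 2"
  proof
    assume e: "Re \<theta> = pi / 2" show False using nz(2) unfolding e by simp
  qed
  moreover have "(sin (Re \<theta>))\<^sup>2 + (sinh (Im \<theta>))\<^sup>2 < 1 / r"
    using assms(1) r norm_ell_proj[of \<theta>] \<theta>(3) by (simp add: field_simps)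
  ultimately have "\<theta> \<in> ell_open r" using \<theta> by (simp add: ell_open_def[OF r])
  then show thesis using \<theta>(3) that by blast
qed

text \<open>The density of the Euclidean length element of the rectangle in the coordinate
  \<open>z\<close>. It is unbounded near 0 and \<open>r\<close>, where its value 0 is only the
  default of \<open>inverse\<close>; these two points are removed wherever continuity is
  used.\<close>

definition ell_rho :: "complex \<Rightarrow> real" where
  "ell_rho z = inverse (sqrt (norm (z * (of_real r - z) * (1 - of_real r * z))))"

lemma deriv_ell_proj: "(ell_proj has_field_derivative 2 * of_real r * sin \<theta> * cos \<theta>) (at \<theta>)"
  unfolding ell_proj_def[abs_def] by (auto intro!: derivative_eq_intros simp: power2_eq_square)

lemma ell_rho_proj:
  assumes "\<theta> \<in> ell_open r"
  shows "norm (ell_integrand r \<theta>) = ell_rho (ell_proj \<theta>) * norm (2 * of_real r * sin \<theta> * cos \<theta>)"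
    and "0 < norm (2 * of_real r * sin \<theta> * cos \<theta>)" and "0 < norm (ell_integrand r \<theta>)"
proof -
  define S where "S = (sin \<theta>)\<^sup>2"
  have nz: "Re (sin \<theta>) \<noteq> 0" "Re (cos \<theta>) \<noteq> 0"
  proof -
    have x: "0 < Re \<theta>" "Re \<theta> < pi / 2" using assms by (auto simp: ell_open_def[OF r])
    have "0 < sin (Re \<theta>)" "0 < cos (Re \<theta>)" using x by (auto intro: sin_gt_zero cos_gt_zero_pi)
    then show "Re (sin \<theta>) \<noteq> 0" "Re (cos \<theta>) \<noteq> 0"
      using sin_Complex[of "Re \<theta>" "Im \<theta>"] cos_Complex[of "Re \<theta>" "Im \<theta>"] by auto
  qed
  then show pos: "0 < norm (2 * of_real r * sin \<theta> * cos \<theta>)" using r by auto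
  have "\<theta> \<in> ell_domain r" using assms ell_open_subset[OF r] ell_rect_subset[OF r] by auto
  from Re_ell_integrand_pos[OF r this] show epos: "0 < norm (ell_integrand r \<theta>)" by auto
  have w: "1 - of_real (r\<^sup>2) * S \<noteq> 0"
    using ell_integrand_squared[OF r, of \<theta>] epos by (auto simp: S_def)
  have C: "(cos \<theta>)\<^sup>2 = 1 - S" by (simp add: S_def cos_squared_eq)
  have "(norm (2 * of_real r * sin \<theta> * cos \<theta>))\<^sup>2 = norm ((2 * of_real r * sin \<theta> * cos \<theta>)\<^sup>2)" by (simp add: norm_power)
  also have "(2 * of_real r * sin \<theta> * cos \<theta>)\<^sup>2 = 4 * (of_real r)\<^sup>2 * S * (1 - S)"
    by (simp add: power_mult_distrib C S_def)
  finally have n1: "(norm (2 * of_real r * sin \<theta> * cos \<theta>))\<^sup>2 = norm (4 * (of_real r)\<^sup>2 * S * (1 - S))" .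
  have n2: "(norm (ell_integrand r \<theta>))\<^sup>2 = norm (4 / (1 - of_real (r\<^sup>2) * S))"
    unfolding norm_power[symmetric] ell_integrand_squared[OF r] S_def ..
  have "(ell_rho (ell_proj \<theta>))\<^sup>2 = inverse (norm (ell_proj \<theta> * (of_real r - ell_proj \<theta>) * (1 - of_real r * ell_proj \<theta>)))"
    by (simp add: ell_rho_def power_inverse)
  also have "ell_proj \<theta> * (of_real r - ell_proj \<theta>) * (1 - of_real r * ell_proj \<theta>) =
      (of_real r)\<^sup>2 * S * (1 - S) * (1 - of_real (r\<^sup>2) * S)"
    by (simp add: ell_proj_def S_def power2_eq_square algebra_simps)
  finally have n3: "(ell_rho (ell_proj \<theta>))\<^sup>2 = inverse (norm ((of_real r)\<^sup>2 * S * (1 - S) * (1 - of_real (r\<^sup>2) * S)))" .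
  have SS: "norm ((of_real r)\<^sup>2 * S * (1 - S)) \<noteq> 0"
    using pos n1 by (auto simp: norm_mult)
  have "(norm (ell_integrand r \<theta>))\<^sup>2 = (ell_rho (ell_proj \<theta>) * norm (2 * of_real r * sin \<theta> * cos \<theta>))\<^sup>2"
  proof -
    define A where "A = norm ((of_real r)\<^sup>2 * S * (1 - S))"
    define B where "B = norm (1 - of_real (r\<^sup>2) * S)"
    have e1: "norm (4 * (of_real r)\<^sup>2 * S * (1 - S)) = 4 * A" by (simp add: A_def norm_mult)
    have e2: "norm (4 / (1 - of_real (r\<^sup>2) * S)) = 4 / B" by (simp add: B_def norm_divide)
    have e3: "norm ((of_real r)\<^sup>2 * S * (1 - S) * (1 - of_real (r\<^sup>2) * S)) = A * B"
      unfolding A_def B_def by (rule norm_mult)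
    have "A \<noteq> 0" using SS by (simp only: A_def not_False_eq_True)
    moreover have "B \<noteq> 0" using w by (simp add: B_def)
    ultimately have "4 / B = inverse (A * B) * (4 * A)" by (simp add: field_simps)
    then show ?thesis
      unfolding power_mult_distrib n1 n2 n3 e1 e2 e3 .
  qed
  then show "norm (ell_integrand r \<theta>) = ell_rho (ell_proj \<theta>) * norm (2 * of_real r * sin \<theta> * cos \<theta>)"
    by (rule power2_eq_imp_eq) (auto simp: ell_rho_def)
qed

end

lemma groetzsch_data_standard:
  assumes r: "0 < r" "r < 1"
  shows "\<exists>\<Phi> u v \<rho>. groetzsch_data 0 (of_real r) r \<Phi> u v \<rho>"
proof -
  let ?F = "ell_F r" and ?K = "compl_K r" and ?L = "compl_K (sqrt (1 - r\<^sup>2))"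
  let ?s = "ell_proj r"
  have K: "0 < ?K" "0 < ?L" using compl_K_pos compl_modulus[OF r] by auto
  have Finj: "inj_on ?F (ell_open r)" and Fimg: "?F ` ell_open r = ell_range r"
    using ell_F_bij[OF r] by (auto simp: bij_betw_def)
  obtain G where G: "G holomorphic_on ell_range r" "\<And>z. z \<in> ell_open r \<Longrightarrow> deriv ?F z * deriv G (?F z) = 1"
    "\<And>z. z \<in> ell_open r \<Longrightarrow> G (?F z) = z"
    using holomorphic_has_inverse[OF ell_F_holomorphic[OF r] open_ell_open[OF r] Finj] unfolding Fimg by blast
  have Gin: "G \<zeta> \<in> ell_open r" "?F (G \<zeta>) = \<zeta>" if "\<zeta> \<in> ell_range r" for \<zeta>
  proof -
    have "\<zeta> \<in> ?F ` ell_open r" using that by (simp only: Fimg)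
    then obtain z where "z \<in> ell_open r" "\<zeta> = ?F z" by blast
    then show "G \<zeta> \<in> ell_open r" "?F (G \<zeta>) = \<zeta>" using G(3) by auto
  qed
  obtain g where g: "g holomorphic_on (?s ` ell_open r)" "\<And>z. z \<in> ell_open r \<Longrightarrow> deriv ?s z * deriv g (?s z) = 1"
    "\<And>z. z \<in> ell_open r \<Longrightarrow> g (?s z) = z"
    using holomorphic_has_inverse[OF ell_proj_holomorphic[OF r] open_ell_open[OF r] ell_proj_inj[OF r]] by blast
  have open_img: "open (?s ` ell_open r)"
    by (rule open_mapping_thm3[OF ell_proj_holomorphic[OF r] open_ell_open[OF r] ell_proj_inj[OF r]])
  define \<Phi> where "\<Phi> \<zeta> = ?s (G \<zeta>)" for \<zeta>
  have openR: "open (ell_range r)"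
    unfolding Fimg[symmetric] by (rule open_mapping_thm3[OF ell_F_holomorphic[OF r] open_ell_open[OF r] Finj])
  have \<Phi>hol: "\<Phi> holomorphic_on ell_range r"
    unfolding \<Phi>_def
    using holomorphic_on_compose_gen[OF G(1) ell_proj_holomorphic[OF r, of UNIV]] by (simp add: o_def)
  have \<Phi>inj: "inj_on \<Phi> (ell_range r)"
  proof (rule inj_onI)
    fix \<zeta> \<zeta>' assume *: "\<zeta> \<in> ell_range r" "\<zeta>' \<in> ell_range r" "\<Phi> \<zeta> = \<Phi> \<zeta>'"
    then have "G \<zeta> = G \<zeta>'" using inj_onD[OF ell_proj_inj[OF r]] Gin(1) by (simp add: \<Phi>_def)
    then have "?F (G \<zeta>) = ?F (G \<zeta>')" by simp
    then show "\<zeta> = \<zeta>'" using Gin(2) * by simp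
  qed
  have \<Phi>img: "\<Phi> ` ell_range r = ?s ` ell_open r"
  proof
    show "?s ` ell_open r \<subseteq> \<Phi> ` ell_range r"
    proof clarify
      fix \<theta> assume \<theta>: "\<theta> \<in> ell_open r"
      then have "?F \<theta> \<in> ell_range r" "\<Phi> (?F \<theta>) = ?s \<theta>" using Fimg G(3) by (auto simp: \<Phi>_def)
      then show "?s \<theta> \<in> \<Phi> ` ell_range r" by (metis imageI)
    qed
  qed (use Gin in \<open>auto simp: \<Phi>_def\<close>)
  have sball: "?s ` ell_open r \<subseteq> ball 0 1" using ell_proj_open[OF r] by blast
  have lift: "\<exists>\<theta>. \<theta> \<in> ell_rect r \<and> ?s \<theta> = z" if "z \<in> cball 0 1" for z
    using that unfolding ell_proj_image[OF r, symmetric] by blast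
  have Im_bound: "\<bar>Im (?F (Complex x y))\<bar> < ?L" if x: "0 \<le> x" "x \<le> pi / 2" and y: "\<bar>y\<bar> < ell_height r x" for x y
  proof -
    have vert: "Complex x t \<in> ell_domain r" if "\<bar>t\<bar> \<le> ell_height r x" for t
      using that x ell_rect_subset[OF r] ell_rect_height_iff(1)[OF r, of x t] by auto
    have "Im (?F (Complex x y)) < Im (?F (Complex x (ell_height r x)))"
      by (rule ell_F_Im_strict_mono[OF r]) (use y in \<open>auto intro!: vert\<close>)
    moreover have "Im (?F (Complex x (- ell_height r x))) < Im (?F (Complex x y))"
      by (rule ell_F_Im_strict_mono[OF r]) (use y in \<open>auto intro!: vert\<close>)
    ultimately show ?thesis
      using ell_F_arc_Im[OF r x] by (simp add: ell_top_eq[OF r] abs_less_iff)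
  qed
  have u_in: "0 \<le> ell_u r z \<and> ell_u r z < ?L" if "z \<in> ball 0 1" for z
  proof -
    have "z \<in> cball 0 1" using that by simp
    then obtain \<theta> where \<theta>: "\<theta> \<in> ell_rect r" "?s \<theta> = z" using lift[of z] by blast
    have "(sin (Re \<theta>))\<^sup>2 + (sinh (Im \<theta>))\<^sup>2 < 1 / r"
      using that r \<theta>(2) norm_ell_proj[OF r, of \<theta>] by (simp add: field_simps)
    then have "\<bar>Im \<theta>\<bar> < ell_height r (Re \<theta>)" using ell_rect_height_iff(2)[OF r] by blast
    then have "\<bar>Im (?F \<theta>)\<bar> < ?L" using Im_bound[of "Re \<theta>" "Im \<theta>"] \<theta>(1) by (simp add: ell_rect_def)
    then show ?thesis using ell_uv_proj(1)[OF r \<theta>(1)] \<theta>(2) by simp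
  qed
  \<comment> \<open>On the unit circle \<open>u\<close> attains the full height. So a sublevel set
    below it is the same in the open and in the closed disk, hence compact.\<close>
  have u_sphere: "ell_u r z = ?L" if "norm z = 1" for z
  proof -
    have "z \<in> cball 0 1" using that by simp
    then obtain \<theta> where \<theta>: "\<theta> \<in> ell_rect r" "?s \<theta> = z" using lift[of z] by blast
    obtain x y where xy: "\<theta> = Complex x y" by (cases \<theta>)
    have x: "0 \<le> x" "x \<le> pi / 2" "\<bar>y\<bar> \<le> ell_height r x" using \<theta>(1) by (auto simp: xy ell_rect_height_iff(1)[OF r])
    have "(sin x)\<^sup>2 + (sinh y)\<^sup>2 = 1 / r"
      using that r \<theta>(2) norm_ell_proj[OF r, of \<theta>] by (simp add: field_simps xy)
    then have "\<not> \<bar>y\<bar> < ell_height r x" using ell_rect_height_iff(2)[OF r, of x y] by simp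
    then have "y = ell_height r x \<or> y = - ell_height r x" using x by linarith
    then have "\<bar>Im (?F \<theta>)\<bar> = ?L"
      using ell_F_arc_Im[OF r x(1,2)] K by (auto simp: xy ell_top_eq[OF r])
    then show ?thesis using ell_uv_proj(1)[OF r \<theta>(1)] \<theta>(2) by simp
  qed
  have s0: "?s 0 = 0" "?s (Complex (pi / 2) 0) = of_real r"
    by (simp_all add: ell_proj_def[OF r] sin_Complex complex_eq_iff power2_eq_square)
  have rect0: "0 \<in> ell_rect r" "Complex (pi / 2) 0 \<in> ell_rect r"
    using real_axis_in_rect[OF r, of 0] real_axis_in_rect[OF r, of "pi / 2"] by (auto simp: zero_complex.code)
  have uv0: "ell_u r 0 = 0" "ell_v r 0 = 0" "ell_u r (of_real r) = 0" "ell_v r (of_real r) = 2 * ?K"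
    using ell_uv_proj[OF r rect0(1)] ell_uv_proj[OF r rect0(2)] ell_F_real_axis[OF r, of "pi / 2"]
    unfolding s0 by (simp_all add: ell_F_0[OF r] ell_F_half_period[OF r])
  \<comment> \<open>The zero set is the image of a real interval, which yields its
    connectedness.\<close>
  have zero_set: "{z \<in> ball 0 1. ell_u r z = 0} = (\<lambda>x. ?s (Complex x 0)) ` {0..pi/2}"
  proof (intro equalityI subsetI)
    fix z assume z: "z \<in> {z \<in> ball 0 1. ell_u r z = 0}"
    obtain \<theta> where \<theta>: "\<theta> \<in> ell_rect r" "?s \<theta> = z" using lift[of z] z by auto
    obtain x y where xy: "\<theta> = Complex x y" by (cases \<theta>)
    have "Im (?F (Complex x y)) = 0" using ell_uv_proj(1)[OF r \<theta>(1)] \<theta>(2) z by (simp add: xy)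
    moreover have "Complex x y \<in> ell_rect r" "Complex x (- y) \<in> ell_rect r"
      using \<theta>(1) by (auto simp: xy ell_rect_height_iff(1)[OF r])
    ultimately have "y = 0"
      using ell_F_Im_sign(1)[OF r, of x y] ell_F_Im_sign(2)[OF r, of x "- y"] by (cases "y = 0") (auto simp: neq_iff)
    then show "z \<in> (\<lambda>x. ?s (Complex x 0)) ` {0..pi/2}" using \<theta> by (auto simp: xy ell_rect_def)
  next
    fix z assume "z \<in> (\<lambda>x. ?s (Complex x 0)) ` {0..pi/2}"
    then obtain x where x: "0 \<le> x" "x \<le> pi / 2" "z = ?s (Complex x 0)" by auto
    have "(sin x)\<^sup>2 \<le> 1" by (simp add: abs_square_le_1)
    then have "r * (sin x)\<^sup>2 \<le> r * 1" using r by (intro mult_left_mono) auto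
    then have "r * (sin x)\<^sup>2 < 1" using r by linarith
    then have "z \<in> ball 0 1" by (simp add: x(3) norm_ell_proj[OF r])
    moreover have "ell_u r z = 0"
      using ell_uv_proj(1)[OF r real_axis_in_rect[OF r x(1,2)]] ell_F_real_axis[OF r x(1,2)] by (simp add: x(3))
    ultimately show "z \<in> {z \<in> ball 0 1. ell_u r z = 0}" by simp
  qed
  \<comment> \<open>Chain rule: pulled back to the rectangle the metric is the Euclidean
    one.\<close>
  have dG: "norm (deriv \<Phi> \<zeta>) * ell_rho r (\<Phi> \<zeta>) = 1" if "\<zeta> \<in> ell_range r" for \<zeta>
  proof -
    define \<theta> where "\<theta> = G \<zeta>"
    have \<theta>: "\<theta> \<in> ell_open r" "?F \<theta> = \<zeta>" using Gin[OF that] by (auto simp: \<theta>_def)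
    have "(G has_field_derivative deriv G \<zeta>) (at \<zeta>)" by (rule holomorphic_derivI[OF G(1) openR that])
    from DERIV_chain2[OF deriv_ell_proj[OF r, of "G \<zeta>"] this]
    have "deriv \<Phi> \<zeta> = 2 * of_real r * sin \<theta> * cos \<theta> * deriv G \<zeta>"
      unfolding \<Phi>_def[abs_def] \<theta>_def by (rule DERIV_imp_deriv)
    moreover have "ell_integrand r \<theta> * deriv G \<zeta> = 1"
      using G(2)[OF \<theta>(1)] ell_F_deriv_nz[OF r, of \<theta>] \<theta> ell_open_subset[OF r] by auto
    then have "norm (ell_integrand r \<theta>) * norm (deriv G \<zeta>) = 1" by (metis norm_mult norm_one)
    ultimately show ?thesis
      using ell_rho_proj(1)[OF r \<theta>(1)] by (simp add: \<Phi>_def \<theta>_def[symmetric] norm_mult mult_ac)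
  qed
  have rho_nz: "ell_rho r z > 0" if "z \<in> ball 0 1 - {0, of_real r}" for z
  proof -
    have "norm (of_real r * z) < 1"
    proof -
      have "norm (of_real r * z) = r * norm z" using r by (simp add: norm_mult)
      also have "\<dots> \<le> 1 * norm z" using r by (intro mult_right_mono) auto
      finally show ?thesis using that by simp
    qed
    then have "1 - of_real r * z \<noteq> 0" by auto
    then show ?thesis using that by (auto simp: ell_rho_def[OF r])
  qed
  have rho_cont: "continuous_on (ball 0 1 - {0, of_real r}) (ell_rho r)"
  proof -
    have "sqrt (norm (z * (of_real r - z) * (1 - of_real r * z))) \<noteq> 0" if "z \<in> ball 0 1 - {0, of_real r}" for z :: complex
      using rho_nz[OF that] by (auto simp: ell_rho_def[OF r])
    then show ?thesis
      unfolding ell_rho_def[OF r, abs_def] by (intro continuous_intros) auto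
  qed
  have rho_meas: "ell_rho r \<in> borel_measurable borel"
    unfolding ell_rho_def[OF r, abs_def]
    by (intro borel_measurable_inverse borel_measurable_continuous_onI continuous_intros)
  have bd: "bounded (\<Phi> ` ell_range r)" unfolding \<Phi>img by (rule bounded_subset[OF bounded_ball sball])
  \<comment> \<open>The disk and the image of the open rectangle differ only in points of the real
    axis, a null set. After the change of variables the integral is the area of the
    rectangle.\<close>
  have "(\<integral>\<^sup>+ z\<in>ball 0 1. ennreal ((ell_rho r z)\<^sup>2) \<partial>lborel) = (\<integral>\<^sup>+ z\<in>\<Phi> ` ell_range r. ennreal ((ell_rho r z)\<^sup>2) \<partial>lborel)"
  proof (rule nn_integral_cong_AE)
    have "negligible {z :: complex. z \<bullet> \<i> = 0}" by (rule negligible_standard_hyperplane) (simp add: Basis_complex_def)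
    moreover have "{z :: complex. z \<bullet> \<i> = 0} \<in> sets borel" by (intro borel_closed closed_Collect_eq continuous_intros)
    ultimately have "{z :: complex. z \<bullet> \<i> = 0} \<in> null_sets lborel"
      by (simp add: negligible_iff_null_sets null_sets_completion_iff)
    then have "AE z in lborel. z \<notin> {z :: complex. z \<bullet> \<i> = 0}" by (rule AE_not_in)
    then show "AE z in lborel. ennreal ((ell_rho r z)\<^sup>2) * indicator (ball 0 1) z = ennreal ((ell_rho r z)\<^sup>2) * indicator (\<Phi> ` ell_range r) z"
    proof eventually_elim
      case (elim z)
      then have "Im z \<noteq> 0" by (simp add: inner_complex_def)
      then have "z \<in> ball 0 1 \<longleftrightarrow> z \<in> \<Phi> ` ell_range r"
        unfolding \<Phi>img using sball ell_open_of_proj[OF r, of z] by blast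
      then show ?case by (simp add: indicator_def)
    qed
  qed
  also have "\<dots> = (\<integral>\<^sup>+ \<zeta>\<in>ell_range r. ennreal ((ell_rho r (\<Phi> \<zeta>))\<^sup>2) * ennreal ((norm (deriv \<Phi> \<zeta>))\<^sup>2) \<partial>lborel)"
    using rho_meas by (intro nn_integral_conformal_image openR \<Phi>hol \<Phi>inj bd) measurable
  also have "\<dots> = (\<integral>\<^sup>+ \<zeta>. indicator (ell_range r) \<zeta> \<partial>lborel)"
  proof (rule nn_integral_cong)
    fix \<zeta> :: complex
    show "ennreal ((ell_rho r (\<Phi> \<zeta>))\<^sup>2) * ennreal ((norm (deriv \<Phi> \<zeta>))\<^sup>2) * indicator (ell_range r) \<zeta> = indicator (ell_range r) \<zeta>"
    proof (cases "\<zeta> \<in> ell_range r")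
      case True
      have "(ell_rho r (\<Phi> \<zeta>))\<^sup>2 * (norm (deriv \<Phi> \<zeta>))\<^sup>2 = (norm (deriv \<Phi> \<zeta>) * ell_rho r (\<Phi> \<zeta>))\<^sup>2"
        by (simp add: power_mult_distrib)
      then show ?thesis using True by (simp add: dG[OF True] flip: ennreal_mult')
    qed simp
  qed
  also have "\<dots> = emeasure lborel (ell_range r)" using openR by (intro nn_integral_indicator) auto
  also have "\<dots> = ennreal (4 * ?K * ?L)"
  proof -
    have "ell_range r = box (Complex 0 (- ?L)) (Complex (2 * ?K) ?L)"
      by (auto simp: ell_range_def[OF r] in_box_complex_iff abs_less_iff)
    then show ?thesis using K
      by (simp add: emeasure_lborel_box_eq Basis_complex_def inner_complex_def complex_eq_iff)
  qed
  finally have area: "(\<integral>\<^sup>+ z\<in>ball 0 1. ennreal ((ell_rho r z)\<^sup>2) \<partial>lborel) = ennreal (4 * ?K * ?L)" .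
  have "groetzsch_data 0 (of_real r) r \<Phi> (ell_u r) (ell_v r) (ell_rho r)"
  proof
    show "\<Phi> ` ell_range r \<subseteq> ball 0 1" unfolding \<Phi>img by (rule sball)
    show "continuous_on (ball 0 1) (ell_v r)" "continuous_on (ball 0 1) (ell_u r)"
      using ell_v_continuous[OF r] ell_u_continuous[OF r] by (auto intro: continuous_on_subset)
    show "\<exists>s. \<bar>s\<bar> < ?L \<and> z = \<Phi> (Complex (ell_v r z) s)" if z: "z \<in> ball 0 1" "0 < ell_v r z" "ell_v r z < 2 * ?K" for z
    proof -
      obtain \<theta> where \<theta>: "\<theta> \<in> ell_rect r" "?s \<theta> = z" using lift[of z] z(1) by auto
      obtain x y where xy: "\<theta> = Complex x y" by (cases \<theta>)
      have v: "ell_v r z = Re (?F \<theta>)" using ell_uv_proj(2)[OF r \<theta>(1)] \<theta>(2) by simp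
      have c: "(sin x)\<^sup>2 + (sinh y)\<^sup>2 < 1 / r"
        using z(1) r \<theta>(2) norm_ell_proj[OF r, of \<theta>] by (simp add: field_simps xy)
      have "x \<noteq> 0"
      proof
        assume "x = 0"
        then have "Re (?F \<theta>) = Re (?F (Complex 0 0))"
          using ell_F_vertical_edge(1)[OF r, of 0 y] \<theta>(1) by (simp add: xy)
        then show False using z(2) v by (simp add: ell_F_0[OF r] zero_complex.code[symmetric])
      qed
      moreover have "x \<noteq> pi / 2"
      proof
        assume x: "x = pi / 2"
        have "Complex (pi / 2) y \<in> ell_rect r" using \<theta>(1) unfolding xy x .
        then have "Re (?F \<theta>) = Re (?F (Complex (pi / 2) 0))"
          unfolding xy x by (rule ell_F_vertical_edge(1)[OF r, rotated]) simp
        then show False using z(3) v by (simp add: ell_F_half_period[OF r])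
      qed
      ultimately have \<theta>Q: "\<theta> \<in> ell_open r" using \<theta>(1) c by (auto simp: xy ell_open_def[OF r] ell_rect_def)
      then have "?F \<theta> \<in> ell_range r" using Fimg by blast
      then have "\<bar>Im (?F \<theta>)\<bar> < ?L" by (simp add: ell_range_def[OF r])
      moreover have "z = \<Phi> (Complex (ell_v r z) (Im (?F \<theta>)))"
        by (simp add: v \<Phi>_def G(3)[OF \<theta>Q] \<theta>(2))
      ultimately show ?thesis by blast
    qed
    show "ell_u r (\<Phi> \<zeta>) = \<bar>Im \<zeta>\<bar>" if "\<zeta> \<in> ell_range r" for \<zeta>
      using ell_uv_proj(1)[OF r subsetD[OF ell_open_subset[OF r] Gin(1)[OF that]]] Gin(2)[OF that] by (simp add: \<Phi>_def)
    show "compact {z \<in> ball 0 1. ell_u r z \<le> c}" if "c < ?L" for c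
    proof -
      have "{z \<in> ball 0 1. ell_u r z \<le> c} = {z \<in> cball 0 1. ell_u r z \<le> c}"
        using u_sphere that by (auto simp: less_le)
      also have "\<dots> = cball 0 1 \<inter> ell_u r -` {..c}" by auto
      finally have eq: "{z \<in> ball 0 1. ell_u r z \<le> c} = cball 0 1 \<inter> ell_u r -` {..c}" .
      have "closed (ell_u r -` {..c} \<inter> cball 0 1)"
        using ell_u_continuous[OF r] by (simp add: continuous_on_closed_vimage)
      then have "compact ((ell_u r -` {..c} \<inter> cball 0 1) \<inter> cball 0 1)" by (intro closed_Int_compact) auto
      then show ?thesis unfolding eq by (simp add: Int_assoc Int_commute)
    qed
    show "connected {z \<in> ball 0 1. ell_u r z = 0}"
      unfolding zero_set
    proof (rule connected_continuous_image)
      have "continuous_on {0..pi/2} (\<lambda>x. Complex x 0)" by (simp add: complex_of_real_def[symmetric] Complex_eq continuous_intros)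
      then show "continuous_on {0..pi/2} (\<lambda>x. ?s (Complex x 0))"
        by (rule continuous_on_compose2[OF ell_proj_continuous[OF r, of UNIV]]) auto
    qed simp
    show "(\<integral>\<^sup>+ z\<in>ball 0 1. ennreal ((ell_rho r z)\<^sup>2) \<partial>lborel) \<le> ennreal (4 * ?K * ?L)" by (simp add: area)
    fix z :: complex and e :: real assume z: "z \<in> ball 0 1 - {0, of_real r}" and e: "0 < e"
    define D where "D = ball 0 1 - {0, of_real r :: complex}"
    have "open D" unfolding D_def by (intro open_Diff) auto
    then obtain d1 where d1: "d1 > 0" "ball z d1 \<subseteq> D" using openE[of D z] z by (auto simp: D_def)
    obtain d2 where d2: "d2 > 0" "\<And>w. w \<in> D \<Longrightarrow> dist w z < d2 \<Longrightarrow> dist (ell_rho r w) (ell_rho r z) < e"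
      using rho_cont[unfolded continuous_on_iff, rule_format, OF z e] unfolding D_def by blast
    define d where "d = min d1 d2"
    define M where "M = ell_rho r z + e"
    have rho_le: "ell_rho r w \<le> M" if "w \<in> ball z d" for w
    proof -
      have "dist (ell_rho r w) (ell_rho r z) < e"
        using that d1(2) by (intro d2(2)) (auto simp: d_def dist_commute)
      then show ?thesis unfolding M_def dist_real_def by linarith
    qed
    have CD: "ball z d \<subseteq> D" using d1(2) by (force simp: d_def)
    have CB: "ball z d \<subseteq> ball 0 1" using CD by (auto simp: D_def)
    show "\<exists>d>0. \<forall>w\<in>ball 0 1 - {0, of_real r}. \<forall>w'\<in>ball 0 1 - {0, of_real r}.
        dist w z < d \<longrightarrow> dist w' z < d \<longrightarrow> \<bar>ell_u r w - ell_u r w'\<bar> \<le> (ell_rho r z + e) * dist w w'"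
    proof (intro exI conjI ballI impI)
      show "0 < d" using d1 d2 by (simp add: d_def)
      fix w w' assume "dist w z < d" "dist w' z < d"
      then have ww: "w \<in> ball z d" "w' \<in> ball z d" by (auto simp: dist_commute)
      \<comment> \<open>The disk around \<open>z\<close> may meet the segment or the slits, all of
        them on the real axis. In each of its halves the inverse \<open>g\<close> of the folding is
        available, and the derivative of \<open>ell_F r\<close> composed with \<open>g\<close> has
        the norm \<open>ell_rho r\<close>.\<close>
      have "\<bar>ell_u r w - ell_u r w'\<bar> \<le> M * dist w w'"
      proof (rule lipschitz_across_real_axis[OF open_ball convex_ball _ _ ww])
        show "continuous_on (ball z d) (ell_u r)"
          using CB by (intro continuous_on_subset[OF ell_u_continuous[OF r]]) auto
        fix s :: real and a b assume s: "s = 1 \<or> s = -1" and ab: "a \<in> ball z d" "b \<in> ball z d" "0 < s * Im a" "0 < s * Im b"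
        define H where "H = ball z d \<inter> {w. 0 < s * Im w}"
        have "{w. 0 < s * Im w} = {w. (of_real s * \<i>) \<bullet> w > 0}" by (simp add: inner_complex_def)
        then have convH: "convex H" unfolding H_def by (auto intro!: convex_Int convex_halfspace_gt)
        have Hs: "\<exists>\<theta>. \<theta> \<in> ell_open r \<and> w = ?s \<theta>" if "w \<in> H" for w
        proof -
          have "w \<in> ball 0 1" "Im w \<noteq> 0" using that CB by (auto simp: H_def)
          then show ?thesis using ell_open_of_proj[OF r] by metis
        qed
        have u_eq: "ell_u r w = \<bar>Im (?F (g w))\<bar>" if "w \<in> H" for w
        proof -
          from Hs[OF that] obtain \<theta> where "\<theta> \<in> ell_open r" "w = ?s \<theta>" by blast
          then show ?thesis using ell_uv_proj(1)[OF r, of \<theta>] ell_open_subset[OF r] g(3) by auto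
        qed
        have "norm (?F (g a) - ?F (g b)) \<le> M * norm (a - b)"
        proof (rule field_differentiable_bound[OF convH, where f' = "\<lambda>w. ell_integrand r (g w) * deriv g w"])
          fix w assume w: "w \<in> H"
          obtain \<theta> where \<theta>: "\<theta> \<in> ell_open r" "w = ?s \<theta>" using Hs[OF w] by blast
          have gw: "g w = \<theta>" using g(3) \<theta> by simp
          have "(g has_field_derivative deriv g w) (at w)"
            using \<theta> by (intro holomorphic_derivI[OF g(1) open_img]) auto
          moreover have "(?F has_field_derivative ell_integrand r (g w)) (at (g w))"
            unfolding gw using \<theta>(1) ell_open_subset[OF r] ell_rect_subset[OF r] by (intro ell_F_deriv[OF r]) auto
          ultimately have "((\<lambda>w. ?F (g w)) has_field_derivative ell_integrand r (g w) * deriv g w) (at w)"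
            by (rule DERIV_chain2[rotated])
          then show "((\<lambda>w. ?F (g w)) has_field_derivative ell_integrand r (g w) * deriv g w) (at w within H)"
            by (rule has_field_derivative_at_within)
          have "deriv ?s \<theta> = 2 * of_real r * sin \<theta> * cos \<theta>" by (rule DERIV_imp_deriv[OF deriv_ell_proj[OF r]])
          then have "(2 * of_real r * sin \<theta> * cos \<theta>) * deriv g w = 1"
            using g(2)[OF \<theta>(1)] by (simp only: \<theta>(2))
          then have 1: "norm (2 * of_real r * sin \<theta> * cos \<theta>) * norm (deriv g w) = 1"
            by (simp only: norm_mult[symmetric] norm_one)
          have "norm (ell_integrand r (g w) * deriv g w) = norm (ell_integrand r \<theta>) * norm (deriv g w)"
            by (simp only: gw norm_mult)
          also have "norm (ell_integrand r \<theta>) = ell_rho r w * norm (2 * of_real r * sin \<theta> * cos \<theta>)"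
            using ell_rho_proj(1)[OF r \<theta>(1)] by (simp only: \<theta>(2))
          also have "ell_rho r w * norm (2 * of_real r * sin \<theta> * cos \<theta>) * norm (deriv g w) =
              ell_rho r w * (norm (2 * of_real r * sin \<theta> * cos \<theta>) * norm (deriv g w))"
            by (rule mult.assoc)
          finally have "norm (ell_integrand r (g w) * deriv g w) = ell_rho r w" by (simp only: 1 mult_1_right)
          then show "norm (ell_integrand r (g w) * deriv g w) \<le> M"
            using rho_le[of w] w by (simp add: H_def)
        qed (use ab in \<open>auto simp: H_def\<close>)
        moreover have "a \<in> H" "b \<in> H" using ab by (auto simp: H_def)
        moreover have "\<bar>\<bar>Im (?F (g a))\<bar> - \<bar>Im (?F (g b))\<bar>\<bar> \<le> norm (?F (g a) - ?F (g b))"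
          using abs_Im_le_cmod[of "?F (g a) - ?F (g b)"] by simp
        ultimately show "\<bar>ell_u r a - ell_u r b\<bar> \<le> M * dist a b"
          by (simp add: u_eq dist_norm)
      qed
      then show "\<bar>ell_u r w - ell_u r w'\<bar> \<le> (ell_rho r z + e) * dist w w'" by (simp add: M_def)
    qed
  qed (use \<Phi>hol \<Phi>inj uv0 u_in rho_meas rho_cont in \<open>auto simp: ell_rho_def[OF r]\<close>)
  then show ?thesis by blast
qed

text \<open>Conformal invariance: the functions are composed with the automorphism \<open>m\<close>
  of the disk, and the metric is multiplied by the norm of its derivative. Outside the disk the
  metric is set to 0 to stay Borel measurable.\<close>

lemma groetzsch_data_transport:
  assumes data: "groetzsch_data p' q' r \<Phi> u v \<rho>" and r: "0 < r" "r < 1"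
    and m: "m holomorphic_on ball 0 1" "\<And>z. z \<in> ball 0 1 \<Longrightarrow> m z \<in> ball 0 1 \<and> n (m z) = z"
    and n: "n holomorphic_on ball 0 1" "\<And>w. w \<in> ball 0 1 \<Longrightarrow> n w \<in> ball 0 1 \<and> m (n w) = w"
    and pq: "p \<in> ball 0 1" "q \<in> ball 0 1" "m p = p'" "m q = q'"
  shows "groetzsch_data p q r (\<lambda>\<zeta>. n (\<Phi> \<zeta>)) (\<lambda>z. u (m z)) (\<lambda>z. v (m z))
    (\<lambda>z. if z \<in> ball 0 1 then \<rho> (m z) * norm (deriv m z) else 0)"
proof -
  interpret groetzsch_data p' q' r \<Phi> u v \<rho> by (rule data)
  have mc: "continuous_on (ball 0 1) m" and nc: "continuous_on (ball 0 1) n"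
    using m n by (auto intro: holomorphic_on_imp_continuous_on)
  have m'c: "continuous_on (ball 0 1) (deriv m)"
    by (intro holomorphic_on_imp_continuous_on holomorphic_deriv m(1)) simp
  have mb: "m ` ball 0 1 \<subseteq> ball 0 1" using m by blast
  have minj: "inj_on m (ball 0 1)" using m(2) by (metis inj_onI)
  have mimg: "m ` ball 0 1 = ball 0 1" using m(2) n(2) by (metis image_eqI mb subset_antisym subsetI)
  have D: "m z \<in> ball 0 1 - {p', q'}" if "z \<in> ball 0 1 - {p, q}" for z
    using that m(2) pq by (metis DiffD1 DiffD2 DiffI insertE insertI1 insertI2 singletonD)
  have sets: "{z \<in> ball 0 1. P (u (m z))} = n ` {w \<in> ball 0 1. P (u w)}" for P
    using m(2) n(2) by (force simp: image_iff)
  show ?thesis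
  proof
    show "(\<lambda>\<zeta>. n (\<Phi> \<zeta>)) holomorphic_on ell_range r"
      using holomorphic_on_compose_gen[OF \<Phi>_hol n(1) \<Phi>_img] by (simp add: o_def)
    show "inj_on (\<lambda>\<zeta>. n (\<Phi> \<zeta>)) (ell_range r)"
    proof (rule inj_onI)
      fix x y assume "x \<in> ell_range r" "y \<in> ell_range r" "n (\<Phi> x) = n (\<Phi> y)"
      moreover have "\<Phi> x \<in> ball 0 1" "\<Phi> y \<in> ball 0 1" using calculation \<Phi>_img by blast+
      then have "m (n (\<Phi> x)) = \<Phi> x" "m (n (\<Phi> y)) = \<Phi> y" using n(2) by blast+
      ultimately show "x = y" using \<Phi>_inj by (metis inj_onD)
    qed
    show "(\<lambda>\<zeta>. n (\<Phi> \<zeta>)) ` ell_range r \<subseteq> ball 0 1" using \<Phi>_img n(2) by blast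
    show "continuous_on (ball 0 1) (\<lambda>z. v (m z))" "continuous_on (ball 0 1) (\<lambda>z. u (m z))"
      using continuous_on_compose2[OF v_cont mc mb] continuous_on_compose2[OF u_cont mc mb] by auto
    show "\<exists>s. \<bar>s\<bar> < compl_K (sqrt (1 - r\<^sup>2)) \<and> z = n (\<Phi> (Complex (v (m z)) s))"
      if "z \<in> ball 0 1" "0 < v (m z)" "v (m z) < 2 * compl_K r" for z
    proof -
      have "\<exists>s. \<bar>s\<bar> < compl_K (sqrt (1 - r\<^sup>2)) \<and> m z = \<Phi> (Complex (v (m z)) s)"
        using v_level[of "m z"] m(2) that by blast
      then obtain s where "\<bar>s\<bar> < compl_K (sqrt (1 - r\<^sup>2))" "m z = \<Phi> (Complex (v (m z)) s)" by blast
      then show ?thesis using m(2)[OF that(1)] by metis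
    qed
    show "0 \<le> u (m z) \<and> u (m z) < compl_K (sqrt (1 - r\<^sup>2))" if "z \<in> ball 0 1" for z
      using u_bounds m(2) that by blast
    show "u (m (n (\<Phi> \<zeta>))) = \<bar>Im \<zeta>\<bar>" if "\<zeta> \<in> ell_range r" for \<zeta>
    proof -
      have "\<Phi> \<zeta> \<in> ball 0 1" using \<Phi>_img that by blast
      then show ?thesis using u_\<Phi>[OF that] n(2) by simp
    qed
    show "compact {z \<in> ball 0 1. u (m z) \<le> c}" if "c < compl_K (sqrt (1 - r\<^sup>2))" for c
      unfolding sets[of "\<lambda>x. x \<le> c"]
      by (rule compact_continuous_image[OF continuous_on_subset[OF nc] u_compact[OF that]]) auto
    show "connected {z \<in> ball 0 1. u (m z) = 0}"
      unfolding sets[of "\<lambda>x. x = 0"]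
      by (rule connected_continuous_image[OF continuous_on_subset[OF nc] u_zero(1)]) auto
    show "(\<lambda>z. if z \<in> ball 0 1 then \<rho> (m z) * norm (deriv m z) else 0) \<in> borel_measurable borel"
    proof -
      have 1: "(\<lambda>z. if z \<in> ball 0 1 then m z else 0) \<in> borel_measurable borel"
        by (intro borel_measurable_continuous_on_if mc continuous_intros) auto
      have 2: "(\<lambda>z. if z \<in> ball 0 1 then deriv m z else 0) \<in> borel_measurable borel"
        by (intro borel_measurable_continuous_on_if m'c continuous_intros) auto
      have "(\<lambda>z. \<rho> (if z \<in> ball 0 1 then m z else 0) * norm (if z \<in> ball 0 1 then deriv m z else 0)) \<in> borel_measurable borel"
        using measurable_compose[OF 1 \<rho>_meas] measurable_compose[OF 2 borel_measurable_norm] by (rule borel_measurable_times)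
      also have "(\<lambda>z. \<rho> (if z \<in> ball 0 1 then m z else 0) * norm (if z \<in> ball 0 1 then deriv m z else 0)) =
          (\<lambda>z. if z \<in> ball 0 1 then \<rho> (m z) * norm (deriv m z) else 0)" by (rule ext) simp
      finally show ?thesis .
    qed
    show "continuous_on (ball 0 1 - {p, q}) (\<lambda>z. if z \<in> ball 0 1 then \<rho> (m z) * norm (deriv m z) else 0)"
    proof -
      have "continuous_on (ball 0 1 - {p, q}) (\<lambda>z. \<rho> (m z) * norm (deriv m z))"
      proof (intro continuous_on_mult continuous_on_norm)
        show "continuous_on (ball 0 1 - {p, q}) (\<lambda>z. \<rho> (m z))"
          by (rule continuous_on_compose2[OF \<rho>_cont continuous_on_subset[OF mc]]) (use D in blast)+
        show "continuous_on (ball 0 1 - {p, q}) (deriv m)" by (rule continuous_on_subset[OF m'c]) auto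
      qed
      then show ?thesis by (rule continuous_on_eq) auto
    qed
    have "(\<integral>\<^sup>+ z\<in>ball 0 1. ennreal ((\<rho> z)\<^sup>2) \<partial>lborel) = (\<integral>\<^sup>+ z\<in>m ` ball 0 1. ennreal ((\<rho> z)\<^sup>2) \<partial>lborel)"
      by (simp only: mimg)
    also have "\<dots> = (\<integral>\<^sup>+ z\<in>ball 0 1. ennreal ((\<rho> (m z))\<^sup>2) * ennreal ((norm (deriv m z))\<^sup>2) \<partial>lborel)"
    proof (rule nn_integral_conformal_image[OF open_ball m(1) minj])
      show "bounded (m ` ball 0 1)" using mb bounded_ball bounded_subset by blast
      show "(\<lambda>z. ennreal ((\<rho> z)\<^sup>2)) \<in> borel_measurable borel" using \<rho>_meas by measurable
    qed
    also have "\<dots> = (\<integral>\<^sup>+ z\<in>ball 0 1. ennreal ((if z \<in> ball 0 1 then \<rho> (m z) * norm (deriv m z) else 0)\<^sup>2) \<partial>lborel)"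
      by (intro nn_integral_cong) (auto simp: indicator_def power_mult_distrib ennreal_mult)
    finally show "(\<integral>\<^sup>+ z\<in>ball 0 1. ennreal ((if z \<in> ball 0 1 then \<rho> (m z) * norm (deriv m z) else 0)\<^sup>2) \<partial>lborel)
        \<le> ennreal (4 * compl_K r * compl_K (sqrt (1 - r\<^sup>2)))" using \<rho>_integral by simp
    fix z :: complex and e :: real assume z: "z \<in> ball 0 1 - {p, q}" and e: "0 < e"
    then have zb: "z \<in> ball 0 1" by auto
    define A B where "A = \<rho> (m z)" and "B = norm (deriv m z)"
    have AB: "0 \<le> A" "0 \<le> B" using \<rho>_nonneg by (auto simp: A_def B_def)
    \<comment> \<open>Chosen so that \<open>(A + e') * (B + e') \<le> A * B + e\<close>: the errors
      of both Lipschitz constants are absorbed in \<open>e\<close>.\<close>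
    define e' where "e' = min 1 (e / (A + B + 1))"
    have e': "0 < e'" "e' \<le> 1" "e' \<le> e / (A + B + 1)" using e AB by (auto simp: e'_def)
    have "e' * (A + B + 1) \<le> e" using e'(3) AB by (simp add: pos_le_divide_eq)
    moreover have "e' * e' \<le> e' * 1" using e' by (intro mult_left_mono) auto
    ultimately have prod: "(A + e') * (B + e') \<le> A * B + e" by (simp add: algebra_simps)
    obtain d1 where d1: "d1 > 0" "\<And>w w'. w \<in> ball 0 1 - {p', q'} \<Longrightarrow> w' \<in> ball 0 1 - {p', q'} \<Longrightarrow>
        dist w (m z) < d1 \<Longrightarrow> dist w' (m z) < d1 \<Longrightarrow> \<bar>u w - u w'\<bar> \<le> (A + e') * dist w w'"
      using u_lipschitz[OF D[OF z] e'(1)] unfolding A_def by blast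
    obtain d2 where d2: "d2 > 0" "\<And>w. w \<in> ball 0 1 \<Longrightarrow> dist w z < d2 \<Longrightarrow> dist (m w) (m z) < d1"
      using mc[unfolded continuous_on_iff, rule_format, OF zb d1(1)] by blast
    obtain d3 where d3: "d3 > 0" "\<And>w. w \<in> ball 0 1 \<Longrightarrow> dist w z < d3 \<Longrightarrow> dist (deriv m w) (deriv m z) < e'"
      using m'c[unfolded continuous_on_iff, rule_format, OF zb e'(1)] by blast
    obtain d4 where d4: "d4 > 0" "ball z d4 \<subseteq> ball 0 1" using openE[OF open_ball zb] by blast
    define d where "d = min (min d2 d3) d4"
    show "\<exists>d>0. \<forall>w\<in>ball 0 1 - {p, q}. \<forall>w'\<in>ball 0 1 - {p, q}. dist w z < d \<longrightarrow> dist w' z < d \<longrightarrow>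
        \<bar>u (m w) - u (m w')\<bar> \<le> ((if z \<in> ball 0 1 then \<rho> (m z) * norm (deriv m z) else 0) + e) * dist w w'"
    proof (intro exI conjI ballI impI)
      show "0 < d" using d2 d3 d4 by (simp add: d_def)
      fix w w' assume w: "w \<in> ball 0 1 - {p, q}" "w' \<in> ball 0 1 - {p, q}" and dw: "dist w z < d" "dist w' z < d"
      have "norm (m w - m w') \<le> (B + e') * norm (w - w')"
      proof (rule field_differentiable_bound[OF convex_ball[of z d], where f' = "deriv m"])
        fix t assume t: "t \<in> ball z d"
        then have tb: "t \<in> ball 0 1" using d4 by (auto simp: d_def)
        show "(m has_field_derivative deriv m t) (at t within ball z d)"
          by (rule has_field_derivative_at_within[OF holomorphic_derivI[OF m(1) open_ball tb]])
        have "dist (deriv m t) (deriv m z) < e'" using t tb by (intro d3(2)) (auto simp: d_def dist_commute)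
        then show "norm (deriv m t) \<le> B + e'"
          using norm_triangle_ineq2[of "deriv m t" "deriv m z"] by (simp add: dist_norm B_def)
      qed (use dw in \<open>auto simp: dist_commute\<close>)
      then have md: "dist (m w) (m w') \<le> (B + e') * dist w w'" by (simp add: dist_norm)
      have "\<bar>u (m w) - u (m w')\<bar> \<le> (A + e') * dist (m w) (m w')"
        using w dw d2(2) D by (intro d1(2)) (auto simp: d_def)
      also have "\<dots> \<le> (A + e') * ((B + e') * dist w w')" using md AB e' by (intro mult_left_mono) auto
      also have "\<dots> = ((A + e') * (B + e')) * dist w w'" by (simp only: mult.assoc)
      also have "\<dots> \<le> (A * B + e) * dist w w'" using prod by (intro mult_right_mono) auto
      finally show "\<bar>u (m w) - u (m w')\<bar> \<le> ((if z \<in> ball 0 1 then \<rho> (m z) * norm (deriv m z) else 0) + e) * dist w w'"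
        using zb by (simp add: A_def B_def)
    qed
  qed (use v_p v_q u_zero \<rho>_nonneg pq in auto)
qed

section \<open>The Schwarz lemma for quasiconformal mappings\<close>

text \<open>The pseudohyperbolic distance, which equals tanh (\<rho> / 2) in the disk.\<close>

definition pseudo_hyp_dist :: "complex \<Rightarrow> complex \<Rightarrow> real" where
  "pseudo_hyp_dist p q = norm ((q - p) / (1 - cnj p * q))"

lemma norm_1_minus_cnj_mult:
  "(norm (1 - cnj p * q))\<^sup>2 = (dist p q)\<^sup>2 + (1 - (norm p)\<^sup>2) * (1 - (norm q)\<^sup>2)"
  unfolding dist_norm cmod_power2 by (simp add: power2_eq_square algebra_simps)

lemma pseudo_hyp_dist_bounds:
  assumes "p \<in> ball 0 1" "q \<in> ball 0 1" "p \<noteq> q"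
  shows "0 < pseudo_hyp_dist p q" "pseudo_hyp_dist p q < 1" "hyp_dist p q = 2 * artanh (pseudo_hyp_dist p q)"
proof -
  have pq: "(norm p)\<^sup>2 < 1" "(norm q)\<^sup>2 < 1" using assms by (auto simp: power_less_one_iff)
  have pos: "0 < (1 - (norm p)\<^sup>2) * (1 - (norm q)\<^sup>2)" using pq by simp
  have "(dist p q)\<^sup>2 < (norm (1 - cnj p * q))\<^sup>2" using pos by (simp add: norm_1_minus_cnj_mult)
  then have lt: "dist p q < norm (1 - cnj p * q)" by (rule power2_less_imp_less) simp
  have d: "0 < dist p q" using assms by simp
  have eq: "pseudo_hyp_dist p q = dist p q / norm (1 - cnj p * q)"
    by (simp add: pseudo_hyp_dist_def norm_divide dist_norm norm_minus_commute)
  have n0: "0 < norm (1 - cnj p * q)" using lt d by linarith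
  show "0 < pseudo_hyp_dist p q" unfolding eq using d n0 by (rule divide_pos_pos)
  show "pseudo_hyp_dist p q < 1" unfolding eq using lt n0 by (simp only: divide_less_eq_1_pos)
  have "sqrt ((dist p q)\<^sup>2 + (1 - (norm p)\<^sup>2) * (1 - (norm q)\<^sup>2)) = norm (1 - cnj p * q)"
    unfolding norm_1_minus_cnj_mult[symmetric] by simp
  then show "hyp_dist p q = 2 * artanh (pseudo_hyp_dist p q)" by (simp add: hyp_dist_def eq)
qed

lemma groetzsch_data_exists:
  assumes pq: "p \<in> ball 0 1" "q \<in> ball 0 1" "p \<noteq> q"
  shows "\<exists>\<Phi> u v \<rho>. groetzsch_data p q (pseudo_hyp_dist p q) \<Phi> u v \<rho>"
proof -
  define r where "r = pseudo_hyp_dist p q"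
  have r: "0 < r" "r < 1" using pseudo_hyp_dist_bounds[OF pq] by (auto simp: r_def)
  define b where "b = Moebius_function 0 p q"
  have nb: "norm b = r" by (simp add: b_def r_def Moebius_function_simple pseudo_hyp_dist_def)
  then have b0: "b \<noteq> 0" using r by auto
  \<comment> \<open>The rotation that brings the image \<open>b\<close> of \<open>q\<close> to the
    positive number \<open>r\<close>.\<close>
  define c where "c = of_real r / b"
  have nc: "norm c = 1" using nb r by (simp add: c_def norm_divide)
  then have c0: "c \<noteq> 0" by auto
  have np: "norm p < 1" "norm (- p) < 1" using pq by auto
  define m n where "m z = c * Moebius_function 0 p z" and "n w = Moebius_function 0 (- p) (w / c)" for z w
  obtain \<Phi> u v \<rho> where data: "groetzsch_data 0 (of_real r) r \<Phi> u v \<rho>"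
    using groetzsch_data_standard[OF r] by blast
  have "groetzsch_data p q r (\<lambda>\<zeta>. n (\<Phi> \<zeta>)) (\<lambda>z. u (m z)) (\<lambda>z. v (m z))
    (\<lambda>z. if z \<in> ball 0 1 then \<rho> (m z) * norm (deriv m z) else 0)"
  proof (rule groetzsch_data_transport[OF data r])
    show "m holomorphic_on ball 0 1"
      unfolding m_def by (intro holomorphic_intros Moebius_function_holomorphic np)
    show "n holomorphic_on ball 0 1"
    proof -
      have "(\<lambda>w. w / c) holomorphic_on ball 0 1" using c0 by (intro holomorphic_intros) auto
      moreover have "(\<lambda>w. w / c) ` ball 0 1 \<subseteq> ball 0 1" using nc by (auto simp: norm_divide)
      ultimately show ?thesis
        using holomorphic_on_compose_gen[OF _ Moebius_function_holomorphic[OF np(2), of 0], of "\<lambda>w. w / c" "ball 0 1"]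
        by (simp add: o_def n_def[abs_def])
    qed
    show "m z \<in> ball 0 1 \<and> n (m z) = z" if "z \<in> ball 0 1" for z
    proof
      have z: "norm z < 1" using that by simp
      show "m z \<in> ball 0 1" using Moebius_function_norm_lt_1[OF np(1) z, of 0] nc by (simp add: m_def norm_mult)
      have "m z / c = Moebius_function 0 p z" using c0 by (simp add: m_def)
      then show "n (m z) = z"
        unfolding n_def using Moebius_function_compose[of "- p" p z] np(2) z by simp
    qed
    show "n w \<in> ball 0 1 \<and> m (n w) = w" if "w \<in> ball 0 1" for w
    proof
      have w: "norm (w / c) < 1" using that nc by (simp add: norm_divide)
      show "n w \<in> ball 0 1" using Moebius_function_norm_lt_1[OF np(2) w, of 0] by (simp add: n_def)
      show "m (n w) = w"
        unfolding n_def m_def using Moebius_function_compose[of p "- p" "w / c"] np(1) w c0 by simp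
    qed
    show "m p = 0" by (simp add: m_def Moebius_function_eq_zero)
    show "m q = of_real r" using b0 by (simp add: m_def c_def b_def[symmetric])
  qed (use pq in auto)
  then show ?thesis unfolding r_def by blast
qed

section \<open>Upper and lower estimates of moduli: the ends of a curve need not converge, so values
  of \<open>u\<close> arbitrarily close to 0 and to \<open>L\<close> express that it joins the
  segment to the unit circle\<close>

definition ring_curves :: "complex set \<Rightarrow> (complex \<Rightarrow> real) \<Rightarrow> real \<Rightarrow> curve set" where
  "ring_curves S u L = {(I, \<gamma>). is_interval I \<and> I \<noteq> {} \<and> continuous_on I \<gamma> \<and> \<gamma> ` I \<subseteq> S \<and>
     (\<forall>e>0. \<exists>t\<in>I. u (\<gamma> t) < e) \<and> (\<forall>e>0. \<exists>t\<in>I. L - e < u (\<gamma> t))}"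

lemma ennreal_AM_GM: "0 \<le> c \<Longrightarrow> 2 * ennreal c * x \<le> x\<^sup>2 + (ennreal c)\<^sup>2" for x :: ennreal
proof (cases x)
  case (real a)
  assume c: "0 \<le> c"
  have "2 * c * a \<le> a\<^sup>2 + c\<^sup>2" using sum_squares_bound[of a c] by (simp add: mult_ac)
  then have "ennreal (2 * c * a) \<le> ennreal (a\<^sup>2 + c\<^sup>2)" by (rule ennreal_leI)
  then show ?thesis using real c by (simp add: ennreal_mult ennreal_power[symmetric] ennreal_plus)
qed (simp add: ennreal_top_eq_mult_iff power2_eq_square)

context groetzsch_data
begin

text \<open>\<open>\<rho> / L\<close> is admissible because \<open>\<rho>\<close> is an upper
  gradient of \<open>u\<close>, whose oscillation along a curve of the family is at least any number
  below \<open>L\<close>. Its square integral is at most the area of the rectangle divided by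
  \<open>L\<^sup>2\<close>.\<close>

lemma curve_modulus_ring_curves_le:
  assumes r: "0 < r" "r < 1"
  shows "curve_modulus (ring_curves (ball 0 1 - {p, q}) u (compl_K (sqrt (1 - r\<^sup>2))))
    \<le> ennreal (4 * compl_K r / compl_K (sqrt (1 - r\<^sup>2)))"
proof -
  define L where "L = compl_K (sqrt (1 - r\<^sup>2))"
  have L: "0 < L" unfolding L_def by (rule compl_K_pos[OF compl_modulus(6)[OF r]])
  have K: "0 < compl_K r" by (rule compl_K_pos[OF compl_modulus(5)[OF r]])
  define \<rho>' where "\<rho>' z = ennreal (\<rho> z / L) * indicator (ball 0 1) z" for z
  have meas: "\<rho>' \<in> borel_measurable borel"
    unfolding \<rho>'_def using \<rho>_meas borel_open[OF open_ball, of "0::complex" 1]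
    by (intro borel_measurable_times_ennreal borel_measurable_indicator) simp_all
  have adm: "admissible (ring_curves (ball 0 1 - {p, q}) u L) \<rho>'"
    unfolding admissible_def
  proof (intro conjI meas ballI impI)
    fix C assume C: "C \<in> ring_curves (ball 0 1 - {p, q}) u L" and rect: "locally_rectifiable C"
    obtain I \<gamma> where CI: "C = (I, \<gamma>)" by (cases C)
    have I: "is_interval I" "continuous_on I \<gamma>" "\<gamma> ` I \<subseteq> ball 0 1 - {p, q}"
      and lo: "\<And>e. e > 0 \<Longrightarrow> \<exists>t\<in>I. u (\<gamma> t) < e" and hi: "\<And>e. e > 0 \<Longrightarrow> \<exists>t\<in>I. L - e < u (\<gamma> t)"
      using C by (auto simp: CI ring_curves_def)
    have seg: "ennreal \<bar>u (\<gamma> b) / L - u (\<gamma> a) / L\<bar> \<le> line_integral \<rho>' C" if ab: "a \<in> I" "b \<in> I" "a \<le> b" for a b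
    proof -
      have sub: "{a..b} \<subseteq> I" using mem_is_interval_1_I[OF I(1) ab(1,2)] by auto
      have fin: "curve_length {a..b} \<gamma> < \<infinity>" using rect ab(3) sub by (auto simp: CI locally_rectifiable_def)
      have "ennreal \<bar>u (\<gamma> b) / L - u (\<gamma> a) / L\<bar> \<le> closed_line_integral \<rho>' a b \<gamma>"
      proof (rule closed_line_integral_ge_oscillation[where S = "ball 0 1 - {p, q}" and \<rho> = "\<lambda>z. \<rho> z / L" and u = "\<lambda>z. u z / L"])
        show "continuous_on {a..b} \<gamma>" by (rule continuous_on_subset[OF I(2) sub])
        show "continuous_on (ball 0 1 - {p, q}) (\<lambda>z. \<rho> z / L)" using L by (intro continuous_intros \<rho>_cont) auto
        show "\<gamma> ` {a..b} \<subseteq> ball 0 1 - {p, q}" using I(3) sub by blast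
        fix z and e :: real assume z: "z \<in> ball 0 1 - {p, q}" and e: "0 < e"
        have "0 < e * L" using e L by simp
        obtain d where d: "d > 0" "\<And>w w'. w \<in> ball 0 1 - {p, q} \<Longrightarrow> w' \<in> ball 0 1 - {p, q} \<Longrightarrow> dist w z < d \<Longrightarrow>
            dist w' z < d \<Longrightarrow> \<bar>u w - u w'\<bar> \<le> (\<rho> z + e * L) * dist w w'"
          using u_lipschitz[OF z \<open>0 < e * L\<close>] by blast
        show "\<exists>d>0. \<forall>w\<in>ball 0 1 - {p, q}. \<forall>w'\<in>ball 0 1 - {p, q}. dist w z < d \<longrightarrow> dist w' z < d \<longrightarrow>
            \<bar>u w / L - u w' / L\<bar> \<le> (\<rho> z / L + e) * dist w w'"
        proof (intro exI conjI ballI impI)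
          fix w w' assume w: "w \<in> ball 0 1 - {p, q}" "w' \<in> ball 0 1 - {p, q}" "dist w z < d" "dist w' z < d"
          have "\<bar>u w - u w'\<bar> / L \<le> ((\<rho> z + e * L) * dist w w') / L"
            by (rule divide_right_mono[OF d(2)[OF w]]) (use L in simp)
          also have "((\<rho> z + e * L) * dist w w') / L = (\<rho> z / L + e) * dist w w'"
            using L by (simp add: field_simps)
          also have "\<bar>u w - u w'\<bar> / L = \<bar>u w / L - u w' / L\<bar>"
            using L by (simp add: diff_divide_distrib[symmetric])
          finally show "\<bar>u w / L - u w' / L\<bar> \<le> (\<rho> z / L + e) * dist w w'" .
        qed (rule d(1))
      qed (use fin ab(3) \<rho>_nonneg L in \<open>auto simp: \<rho>'_def\<close>)
      also have "\<dots> \<le> line_integral \<rho>' C"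
        unfolding CI line_integral_def prod.case
        by (rule SUP_upper2[where i = "(a, b)"]) (use ab sub in auto)
      finally show ?thesis .
    qed
    show "1 \<le> line_integral \<rho>' C"
    proof (rule ccontr)
      assume "\<not> 1 \<le> line_integral \<rho>' C"
      then have lt: "line_integral \<rho>' C < 1" by simp
      then obtain x where x: "line_integral \<rho>' C = ennreal x" "0 \<le> x" by (cases "line_integral \<rho>' C") auto
      have x1: "x < 1" using lt x by (simp add: ennreal_less_one_iff)
      \<comment> \<open>With this \<open>e\<close> the oscillation exceeds \<open>L - 2 * e\<close>,
        which is still more than \<open>x * L\<close>.\<close>
      define e where "e = (1 - x) * L / 4"
      have e: "0 < e" using x1 L by (simp add: e_def)
      obtain s t where st: "s \<in> I" "t \<in> I" "u (\<gamma> s) < e" "L - e < u (\<gamma> t)" using lo[OF e] hi[OF e] by blast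
      have "ennreal \<bar>u (\<gamma> t) / L - u (\<gamma> s) / L\<bar> \<le> ennreal x"
        using seg[of s t] seg[of t s] st(1,2) x(1) by (cases "s \<le> t") (auto simp: abs_minus_commute)
      then have "u (\<gamma> t) / L - u (\<gamma> s) / L \<le> x" using x(2) by simp
      then have "u (\<gamma> t) - u (\<gamma> s) \<le> x * L" using L by (simp add: field_simps)
      then have "L - 2 * e < x * L" using st by linarith
      moreover have "L - 2 * e = x * L + (1 - x) * L / 2" by (simp add: e_def field_simps)
      moreover have "0 < (1 - x) * L / 2" using x1 L by simp
      ultimately show False by linarith
    qed
  qed
  have "curve_modulus (ring_curves (ball 0 1 - {p, q}) u L) \<le> (\<integral>\<^sup>+ z. (\<rho>' z)\<^sup>2 \<partial>lborel)"
    unfolding curve_modulus_def by (rule INF_lower) (simp add: adm)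
  also have "\<dots> = (\<integral>\<^sup>+ z. ennreal (1 / L\<^sup>2) * (ennreal ((\<rho> z)\<^sup>2) * indicator (ball 0 1) z) \<partial>lborel)"
  proof (rule nn_integral_cong)
    fix z :: complex
    have "(\<rho> z / L)\<^sup>2 = (1 / L\<^sup>2) * (\<rho> z)\<^sup>2" by (simp add: power_divide)
    then show "(\<rho>' z)\<^sup>2 = ennreal (1 / L\<^sup>2) * (ennreal ((\<rho> z)\<^sup>2) * indicator (ball 0 1) z)"
      using \<rho>_nonneg[of z] L by (simp add: \<rho>'_def indicator_def ennreal_power ennreal_mult[symmetric])
  qed
  also have "\<dots> = ennreal (1 / L\<^sup>2) * (\<integral>\<^sup>+ z\<in>ball 0 1. ennreal ((\<rho> z)\<^sup>2) \<partial>lborel)"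
    using \<rho>_meas borel_open[OF open_ball, of "0::complex" 1]
    by (intro nn_integral_cmult borel_measurable_times_ennreal borel_measurable_indicator) simp_all
  also have "\<dots> \<le> ennreal (1 / L\<^sup>2) * ennreal (4 * compl_K r * L)"
    using \<rho>_integral by (intro mult_left_mono) (auto simp: L_def)
  also have "\<dots> = ennreal (1 / L\<^sup>2 * (4 * compl_K r * L))" using L K by (intro ennreal_mult[symmetric]) auto
  also have "1 / L\<^sup>2 * (4 * compl_K r * L) = 4 * compl_K r / L" using L by (simp add: power2_eq_square)
  finally show ?thesis by (simp only: L_def)
qed

text \<open>Length-area method along the verticals of the rectangle. The hypothesis on \<Gamma>
  provides each open curve outside \<open>E\<close> that comes arbitrarily close to a point of
  \<open>E\<close> and leaves every compact subset of the disk. Agreement is asked only on the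
  parameter interval, since the maps take arbitrary values outside it.\<close>

lemma curve_modulus_ge:
  assumes r: "0 < r" "r < 1"
    and E: "compact E" "connected E" "E \<subseteq> ball 0 1" "p \<in> E" "q \<in> E"
    and \<Gamma>: "\<And>a b \<beta>. a < b \<Longrightarrow> continuous_on {a<..<b} \<beta> \<Longrightarrow> \<beta> ` {a<..<b} \<subseteq> ball 0 1 - E \<Longrightarrow>
      (\<exists>e\<in>E. \<forall>d>0. \<exists>t\<in>{a<..<b}. dist (\<beta> t) e < d) \<Longrightarrow>
      (\<And>C. compact C \<Longrightarrow> C \<subseteq> ball 0 1 \<Longrightarrow> \<exists>t\<in>{a<..<b}. \<beta> t \<notin> C) \<Longrightarrow>
      \<exists>\<gamma>. ({a<..<b}, \<gamma>) \<in> \<Gamma> \<and> (\<forall>t\<in>{a<..<b}. \<gamma> t = \<beta> t)"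
  shows "ennreal (4 * compl_K r / compl_K (sqrt (1 - r\<^sup>2))) \<le> curve_modulus \<Gamma>"
  unfolding curve_modulus_def
proof (rule INF_greatest)
  fix \<sigma> assume "\<sigma> \<in> {\<rho>. admissible \<Gamma> \<rho>}"
  then have meas: "\<sigma> \<in> borel_measurable borel"
    and adm: "\<And>C. C \<in> \<Gamma> \<Longrightarrow> locally_rectifiable C \<Longrightarrow> 1 \<le> line_integral \<sigma> C"
    by (auto simp: admissible_def)
  define L where "L = compl_K (sqrt (1 - r\<^sup>2))"
  define K where "K = compl_K r"
  have L: "0 < L" unfolding L_def by (rule compl_K_pos[OF compl_modulus(6)[OF r]])
  have K: "0 < K" unfolding K_def by (rule compl_K_pos[OF compl_modulus(5)[OF r]])
  have R: "Complex x y \<in> ell_range r \<longleftrightarrow> 0 < x \<and> x < 2 * K \<and> \<bar>y\<bar> < L" for x y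
    by (simp add: ell_range_def[OF r] K_def L_def)
  have openR: "open (ell_range r)"
    unfolding ell_range_def[OF r] by (intro open_Collect_conj open_Collect_less continuous_intros)
  define \<Psi> \<Psi>' where "\<Psi> z = (if z \<in> ell_range r then \<Phi> z else 0)" and "\<Psi>' z = (if z \<in> ell_range r then deriv \<Phi> z else 0)" for z
  have meas\<Psi>: "\<Psi> \<in> borel_measurable borel" "\<Psi>' \<in> borel_measurable borel"
    unfolding \<Psi>_def \<Psi>'_def using openR
    by (auto intro!: borel_measurable_continuous_on_if holomorphic_on_imp_continuous_on \<Phi>_hol holomorphic_deriv)
  define h where "h z = \<sigma> (\<Psi> z) * ennreal (norm (\<Psi>' z)) * indicator (ell_range r) z" for z
  have h: "h \<in> borel_measurable borel"
    unfolding h_def using measurable_compose[OF meas\<Psi>(1) meas] meas\<Psi>(2) borel_open[OF openR]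
    by (intro borel_measurable_times_ennreal borel_measurable_indicator) simp_all
  have h_eq: "h (Complex x y) = \<sigma> (\<Phi> (Complex x y)) * ennreal (norm (deriv \<Phi> (Complex x y)))" if "Complex x y \<in> ell_range r" for x y
    using that by (simp add: h_def \<Psi>_def \<Psi>'_def)
  \<comment> \<open>Twice 1: the vertical over \<open>x\<close> runs to the unit circle at both
    ends, and its parts above the highest and below the lowest point of \<open>E\<close> both give
    curves of the family.\<close>
  have inner: "2 \<le> (\<integral>\<^sup>+ y. h (Complex x y) \<partial>lborel)" if x: "0 < x" "x < 2 * K" for x
  proof -
    define \<beta> where "\<beta> y = \<Phi> (Complex x y)" for y
    define \<beta>' where "\<beta>' y = deriv \<Phi> (Complex x y) * \<i>" for y
    have inR: "Complex x y \<in> ell_range r" if "\<bar>y\<bar> < L" for y using that x by (simp add: R)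
    have eqx: "Complex x y = Complex x 0 + of_real y * \<i>" for y by (simp add: complex_eq_iff)
    have der: "(\<beta> has_vector_derivative \<beta>' y) (at y)" if "\<bar>y\<bar> < L" for y
    proof -
      have "((\<lambda>y. \<Phi> (Complex x 0 + of_real y * \<i>)) has_vector_derivative deriv \<Phi> (Complex x y) * \<i>) (at y)"
        by (rule has_field_derivative_along_line) (use holomorphic_derivI[OF \<Phi>_hol openR inR[OF that]] in \<open>simp only: eqx[symmetric]\<close>)
      then show ?thesis by (simp only: eqx[symmetric] \<beta>_def[abs_def] \<beta>'_def)
    qed
    have \<beta>c: "continuous_on {y. \<bar>y\<bar> < L} \<beta>"
      using has_vector_derivative_continuous[OF der] by (intro continuous_at_imp_continuous_on) auto
    have \<beta>'c: "continuous_on {y. \<bar>y\<bar> < L} \<beta>'"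
    proof -
      have "continuous_on (ell_range r) (deriv \<Phi>)"
        by (intro holomorphic_on_imp_continuous_on holomorphic_deriv \<Phi>_hol openR)
      moreover have "continuous_on {y. \<bar>y\<bar> < L} (\<lambda>y. Complex x 0 + of_real y * \<i>)"
        by (intro continuous_intros)
      then have "continuous_on {y. \<bar>y\<bar> < L} (\<lambda>y. Complex x y)" by (simp only: eqx[symmetric])
      ultimately have "continuous_on {y. \<bar>y\<bar> < L} (\<lambda>y. deriv \<Phi> (Complex x y))"
        by (rule continuous_on_compose2) (use inR in auto)
      then show ?thesis unfolding \<beta>'_def[abs_def] by (intro continuous_intros)
    qed
    have \<beta>ball: "\<beta> y \<in> ball 0 1" if "\<bar>y\<bar> < L" for y
      using \<Phi>_img inR[OF that] by (auto simp: \<beta>_def)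
    have u\<beta>: "u (\<beta> y) = \<bar>y\<bar>" if "\<bar>y\<bar> < L" for y
      using u_\<Phi>[OF inR[OF that]] by (simp add: \<beta>_def)
    \<comment> \<open>On a compact subset of the disk \<open>u\<close> has a maximum below
      \<open>L\<close>, so the vertical is outside this set near both ends.\<close>
    have esc: "\<exists>c. 0 \<le> c \<and> c < L \<and> (\<forall>y. \<bar>y\<bar> < L \<longrightarrow> \<beta> y \<in> C \<longrightarrow> \<bar>y\<bar> \<le> c)" if C: "compact C" "C \<subseteq> ball 0 1" for C
    proof (cases "C = {}")
      case False
      obtain z where z: "z \<in> C" "\<And>w. w \<in> C \<Longrightarrow> u w \<le> u z"
        using continuous_attains_sup[OF C(1) False continuous_on_subset[OF u_cont C(2)]] by blast
      have "0 \<le> u z \<and> u z < L" using u_bounds z(1) C(2) by (auto simp: L_def)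
      moreover have "\<bar>y\<bar> \<le> u z" if "\<bar>y\<bar> < L" "\<beta> y \<in> C" for y using z(2)[OF that(2)] u\<beta>[OF that(1)] by simp
      ultimately show ?thesis by (intro exI[of _ "u z"]) auto
    qed (use L in \<open>auto intro: exI[of _ 0]\<close>)
    obtain c where c: "0 \<le> c" "c < L" "\<And>y. \<bar>y\<bar> < L \<Longrightarrow> \<beta> y \<in> E \<Longrightarrow> \<bar>y\<bar> \<le> c"
      using esc[OF E(1,3)] by blast
    define Y where "Y = {y \<in> {-c..c}. \<beta> y \<in> E}"
    have \<beta>cc: "continuous_on {-c..c} \<beta>" using c by (intro continuous_on_subset[OF \<beta>c]) auto
    have "closed ({-c..c} \<inter> \<beta> -` E)"
      using continuous_closed_preimage[OF \<beta>cc _ compact_imp_closed[OF E(1)]] by simp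
    then have "closed Y" by (simp add: Y_def Int_def vimage_def)
    moreover have "bounded Y" by (rule bounded_subset[OF bounded_closed_interval[of "-c" c]]) (auto simp: Y_def)
    ultimately have Yc: "compact Y" by (simp add: compact_eq_bounded_closed)
    have Y_iff: "y \<in> Y \<longleftrightarrow> \<bar>y\<bar> < L \<and> \<beta> y \<in> E" for y
      using c(2) c(3)[of y] by (auto simp: Y_def abs_le_iff)
    \<comment> \<open>Connectedness of \<open>E\<close> enters here: \<open>v\<close> takes the
      values 0 and \<open>2 * K\<close> on \<open>E\<close>, hence also the value
      \<open>x\<close>.\<close>
    have Yne: "Y \<noteq> {}"
    proof -
      have "connected (v ` E)" by (intro connected_continuous_image continuous_on_subset[OF v_cont] E)
      moreover have "0 \<in> v ` E" "2 * K \<in> v ` E" using imageI[OF E(4), of v] imageI[OF E(5), of v] v_p v_q by (auto simp: K_def)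
      ultimately have "x \<in> v ` E" using x connectedD_interval[of "v ` E" 0 "2 * K" x] by simp
      then obtain z where z: "z \<in> E" "v z = x" by auto
      have "z \<in> ball 0 1" using z(1) E(3) by (rule rev_subsetD)
      from v_level[OF this] obtain s where "\<bar>s\<bar> < L" "z = \<Phi> (Complex (v z) s)"
        using x z(2) by (auto simp: K_def L_def)
      then have "s \<in> Y" unfolding Y_iff using z by (simp add: \<beta>_def)
      then show ?thesis by blast
    qed
    obtain y1 where y1: "y1 \<in> Y" "\<And>y. y \<in> Y \<Longrightarrow> y \<le> y1" using compact_attains_sup[OF Yc Yne] by blast
    obtain y0 where y0: "y0 \<in> Y" "\<And>y. y \<in> Y \<Longrightarrow> y0 \<le> y" using compact_attains_inf[OF Yc Yne] by blast
    have b: "\<bar>y0\<bar> < L" "\<bar>y1\<bar> < L" "y0 \<le> y1" using y0 y1 Y_iff by auto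
    \<comment> \<open>\<open>e\<close> is the end of the interval that is mapped into
      \<open>E\<close>, and \<open>t\<close> the end at which the curve runs to the unit
      circle.\<close>
    have piece: "1 \<le> (\<integral>\<^sup>+ y. \<sigma> (\<beta> y) * ennreal (norm (\<beta>' y)) * indicator {a<..<b'} y \<partial>lborel)"
      if ab: "a < b'" "{a<..<b'} \<subseteq> {y. \<bar>y\<bar> < L}" and noE: "\<And>y. y \<in> {a<..<b'} \<Longrightarrow> \<beta> y \<notin> E"
        and e: "e \<in> Y" "e = a \<or> e = b'" and t: "\<bar>t\<bar> = L" "t = a \<or> t = b'" for a b' e t
    proof -
      have "\<exists>\<gamma>. ({a<..<b'}, \<gamma>) \<in> \<Gamma> \<and> (\<forall>t\<in>{a<..<b'}. \<gamma> t = \<beta> t)"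
      proof (rule \<Gamma>[OF ab(1)])
        show "continuous_on {a<..<b'} \<beta>" by (rule continuous_on_subset[OF \<beta>c ab(2)])
        show "\<beta> ` {a<..<b'} \<subseteq> ball 0 1 - E" using \<beta>ball noE ab(2) by blast
        show "\<exists>e\<in>E. \<forall>d>0. \<exists>t\<in>{a<..<b'}. dist (\<beta> t) e < d"
        proof (intro bexI[of _ "\<beta> e"] allI impI)
          fix d :: real assume "0 < d"
          have "isCont \<beta> e" using has_vector_derivative_continuous[OF der] e(1) Y_iff by auto
          then obtain d' where d': "d' > 0" "\<And>t. dist t e < d' \<Longrightarrow> dist (\<beta> t) (\<beta> e) < d"
            using \<open>0 < d\<close> unfolding continuous_at_eps_delta dist_norm by (metis real_norm_def)
          define k where "k = min (d' / 2) ((b' - a) / 2)"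
          have k: "0 < k" "k < d'" "k < b' - a" using d'(1) ab(1) by (auto simp: k_def min_def)
          show "\<exists>t\<in>{a<..<b'}. dist (\<beta> t) (\<beta> e) < d"
          proof (cases "e = a")
            case True
            then show ?thesis using k by (intro bexI[of _ "a + k"] d'(2)) (auto simp: dist_real_def)
          next
            case False
            then have "e = b'" using e(2) by simp
            then show ?thesis using k by (intro bexI[of _ "b' - k"] d'(2)) (auto simp: dist_real_def)
          qed
        qed (use e(1) Y_iff in blast)
        fix C :: "complex set" assume C: "compact C" "C \<subseteq> ball 0 1"
        obtain c' where c': "0 \<le> c'" "c' < L" "\<And>y. \<bar>y\<bar> < L \<Longrightarrow> \<beta> y \<in> C \<Longrightarrow> \<bar>y\<bar> \<le> c'" using esc[OF C] by blast
        define k where "k = min ((L - c') / 2) ((b' - a) / 2)"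
        have k: "0 < k" "k < L - c'" "k < b' - a" using c'(2) ab(1) by (auto simp: k_def min_def)
        define y where "y = (if t = a then a + k else b' - k)"
        have y: "y \<in> {a<..<b'}" using k by (auto simp: y_def)
        have "\<bar>y - t\<bar> = k" using t(2) k by (auto simp: y_def)
        then have "c' < \<bar>y\<bar>" using t(1) k by linarith
        then have "\<beta> y \<notin> C" using c'(3)[of y] y ab(2) by auto
        then show "\<exists>t\<in>{a<..<b'}. \<beta> t \<notin> C" using y by blast
      qed
      then obtain \<gamma> where \<gamma>: "({a<..<b'}, \<gamma>) \<in> \<Gamma>" "\<And>t. t \<in> {a<..<b'} \<Longrightarrow> \<gamma> t = \<beta> t" by blast
      have d\<gamma>: "(\<gamma> has_vector_derivative \<beta>' t) (at t)" if "t \<in> {a<..<b'}" for t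
      proof (rule has_vector_derivative_transform_within_open[OF der, of t "{a<..<b'}"])
        show "\<bar>t\<bar> < L" using that ab(2) by blast
      qed (use that \<gamma>(2) in auto)
      have c\<gamma>: "continuous_on {a<..<b'} \<beta>'" by (rule continuous_on_subset[OF \<beta>'c ab(2)])
      have "locally_rectifiable ({a<..<b'}, \<gamma>)"
        by (rule locally_rectifiable_regular[OF open_greaterThanLessThan _ d\<gamma> c\<gamma>]) (simp_all add: is_interval_oo)
      then have "1 \<le> line_integral \<sigma> ({a<..<b'}, \<gamma>)" by (rule adm[OF \<gamma>(1)])
      also have "\<dots> \<le> (\<integral>\<^sup>+ t. \<sigma> (\<gamma> t) * ennreal (norm (\<beta>' t)) * indicator {a<..<b'} t \<partial>lborel)"
        by (rule line_integral_regular_le[OF open_greaterThanLessThan _ d\<gamma> c\<gamma> meas]) (simp_all add: is_interval_oo)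
      also have "\<dots> = (\<integral>\<^sup>+ t. \<sigma> (\<beta> t) * ennreal (norm (\<beta>' t)) * indicator {a<..<b'} t \<partial>lborel)"
        using \<gamma>(2) by (intro nn_integral_cong) (auto simp: indicator_def)
      finally show ?thesis .
    qed
    define H where "H y = \<sigma> (\<beta> y) * ennreal (norm (\<beta>' y))" for y
    have hH: "h (Complex x y) = H y" if "\<bar>y\<bar> < L" for y
      using h_eq[OF inR[OF that]] by (simp add: H_def \<beta>_def \<beta>'_def norm_mult)
    have mI: "(\<lambda>y. H y * indicator {a<..<b'} y) \<in> borel_measurable borel" if "{a<..<b'} \<subseteq> {y. \<bar>y\<bar> < L}" for a b'
    proof -
      have "(\<lambda>y. h (Complex x y)) \<in> borel_measurable borel"
      proof (rule measurable_compose[OF _ h])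
        have "continuous_on UNIV (\<lambda>y. Complex x 0 + of_real y * \<i>)" by (intro continuous_intros)
        then show "(\<lambda>y. Complex x y) \<in> borel_measurable borel"
          by (simp only: eqx[symmetric] borel_measurable_continuous_onI)
      qed
      then have "(\<lambda>y. h (Complex x y) * indicator {a<..<b'} y) \<in> borel_measurable borel" by measurable
      also have "(\<lambda>y. h (Complex x y) * indicator {a<..<b'} y) = (\<lambda>y. H y * indicator {a<..<b'} y)"
        using hH that by (auto simp: fun_eq_iff indicator_def)
      finally show ?thesis .
    qed
    have s1: "{y1<..<L} \<subseteq> {y. \<bar>y\<bar> < L}" and s0: "{-L<..<y0} \<subseteq> {y. \<bar>y\<bar> < L}" using b by auto
    have n1: "\<beta> y \<notin> E" if "y \<in> {y1<..<L}" for y using that y1(2)[of y] s1 Y_iff[of y] by auto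
    have n0: "\<beta> y \<notin> E" if "y \<in> {-L<..<y0}" for y using that y0(2)[of y] s0 Y_iff[of y] by auto
    have p1: "1 \<le> (\<integral>\<^sup>+ y. H y * indicator {y1<..<L} y \<partial>lborel)"
      unfolding H_def by (rule piece[of y1 L y1 L]) (use b s1 n1 y1 L in auto)
    have p0: "1 \<le> (\<integral>\<^sup>+ y. H y * indicator {-L<..<y0} y \<partial>lborel)"
      unfolding H_def by (rule piece[of "-L" y0 y0 "-L"]) (use b s0 n0 y0 L in auto)
    have "2 \<le> (\<integral>\<^sup>+ y. H y * indicator {-L<..<y0} y \<partial>lborel) + (\<integral>\<^sup>+ y. H y * indicator {y1<..<L} y \<partial>lborel)"
      using add_mono[OF p0 p1] by simp
    also have "\<dots> = (\<integral>\<^sup>+ y. H y * indicator {-L<..<y0} y + H y * indicator {y1<..<L} y \<partial>lborel)"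
      using mI[OF s0] mI[OF s1] by (intro nn_integral_add[symmetric]) auto
    also have "\<dots> \<le> (\<integral>\<^sup>+ y. h (Complex x y) \<partial>lborel)"
      using hH s0 s1 b(3) by (intro nn_integral_mono) (auto simp: indicator_def subset_iff)
    finally show ?thesis .
  qed
  have "ennreal (4 * K) = 2 * ennreal (2 * K)" using K ennreal_mult'[of 2 "2 * K"] by simp
  also have "\<dots> = (\<integral>\<^sup>+ x. 2 * indicator {0<..<2 * K} x \<partial>lborel)"
    using K by (simp add: nn_integral_cmult_indicator)
  also have "\<dots> \<le> (\<integral>\<^sup>+ x. \<integral>\<^sup>+ y. h (Complex x y) \<partial>lborel \<partial>lborel)"
    using inner by (intro nn_integral_mono) (auto simp: indicator_def)
  also have "\<dots> = (\<integral>\<^sup>+ z. h z \<partial>lborel)" by (rule nn_integral_lborel_complex[OF h, symmetric])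
  finally have I1: "ennreal (4 * K) \<le> (\<integral>\<^sup>+ z. h z \<partial>lborel)" .
  have I2: "(\<integral>\<^sup>+ z. (h z)\<^sup>2 \<partial>lborel) \<le> (\<integral>\<^sup>+ z. (\<sigma> z)\<^sup>2 \<partial>lborel)"
  proof -
    have "(\<integral>\<^sup>+ z. (h z)\<^sup>2 \<partial>lborel) = (\<integral>\<^sup>+ z\<in>ell_range r. (\<sigma> (\<Phi> z))\<^sup>2 * ennreal ((norm (deriv \<Phi> z))\<^sup>2) \<partial>lborel)"
      by (intro nn_integral_cong) (auto simp: h_def \<Psi>_def \<Psi>'_def indicator_def power_mult_distrib ennreal_power)
    also have "\<dots> = (\<integral>\<^sup>+ z\<in>\<Phi> ` ell_range r. (\<sigma> z)\<^sup>2 \<partial>lborel)"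
    proof (rule nn_integral_conformal_image[symmetric, OF openR \<Phi>_hol \<Phi>_inj])
      show "bounded (\<Phi> ` ell_range r)" by (rule bounded_subset[OF bounded_ball \<Phi>_img])
      show "(\<lambda>z. (\<sigma> z)\<^sup>2) \<in> borel_measurable borel" using meas by measurable
    qed
    also have "\<dots> \<le> (\<integral>\<^sup>+ z. (\<sigma> z)\<^sup>2 \<partial>lborel)" by (intro nn_integral_mono) (auto simp: indicator_def)
    finally show ?thesis .
  qed
  have areaR: "emeasure lborel (ell_range r) = ennreal (4 * K * L)"
  proof -
    have "ell_range r = box (Complex 0 (- L)) (Complex (2 * K) L)"
      by (auto simp: ell_range_def[OF r] in_box_complex_iff abs_less_iff K_def L_def)
    then show ?thesis using K L
      by (simp add: emeasure_lborel_box_eq Basis_complex_def inner_complex_def complex_eq_iff)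
  qed
  \<comment> \<open>Cauchy-Schwarz in additive form:
    \<open>2 * h / L \<le> h\<^sup>2 + 1 / L\<^sup>2\<close> on the rectangle, integrated. The
    second term contributes \<open>4 * K / L\<close>, half of the left side, and is cancelled at the
    end.\<close>
  have "2 * ennreal (1 / L) * ennreal (4 * K) \<le> 2 * ennreal (1 / L) * (\<integral>\<^sup>+ z. h z \<partial>lborel)"
    by (intro mult_left_mono I1) simp
  also have "\<dots> = (\<integral>\<^sup>+ z. 2 * ennreal (1 / L) * h z \<partial>lborel)" using h by (intro nn_integral_cmult[symmetric]) simp
  also have "\<dots> \<le> (\<integral>\<^sup>+ z. (h z)\<^sup>2 + (ennreal (1 / L))\<^sup>2 * indicator (ell_range r) z \<partial>lborel)"
  proof (intro nn_integral_mono)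
    fix z
    show "2 * ennreal (1 / L) * h z \<le> (h z)\<^sup>2 + (ennreal (1 / L))\<^sup>2 * indicator (ell_range r) z"
      using ennreal_AM_GM[of "1 / L" "h z"] L by (cases "z \<in> ell_range r") (auto simp: h_def)
  qed
  also have "\<dots> = (\<integral>\<^sup>+ z. (h z)\<^sup>2 \<partial>lborel) + (ennreal (1 / L))\<^sup>2 * emeasure lborel (ell_range r)"
    using h openR by (subst nn_integral_add) (auto simp: nn_integral_cmult_indicator)
  also have "\<dots> \<le> (\<integral>\<^sup>+ z. (\<sigma> z)\<^sup>2 \<partial>lborel) + (ennreal (1 / L))\<^sup>2 * ennreal (4 * K * L)"
    unfolding areaR by (intro add_right_mono I2)
  also have "(ennreal (1 / L))\<^sup>2 * ennreal (4 * K * L) = ennreal (4 * K / L)"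
  proof -
    have "(1 / L)\<^sup>2 * (4 * K * L) = 4 * K / L" using L by (simp add: power2_eq_square)
    then show ?thesis using L K by (simp add: ennreal_power ennreal_mult[symmetric])
  qed
  also have "2 * ennreal (1 / L) * ennreal (4 * K) = ennreal (4 * K / L) + ennreal (4 * K / L)"
  proof -
    have "2 * ennreal (1 / L) * ennreal (4 * K) = ennreal (2 * (1 / L) * (4 * K))"
      using L K ennreal_mult'[of "2 * (1 / L)" "4 * K"] ennreal_mult'[of 2 "1 / L"] by simp
    also have "2 * (1 / L) * (4 * K) = 4 * K / L + 4 * K / L" by simp
    also have "ennreal (4 * K / L + 4 * K / L) = ennreal (4 * K / L) + ennreal (4 * K / L)"
      using L K by (intro ennreal_plus) simp_all
    finally show ?thesis .
  qed
  finally have "ennreal (4 * K / L) + ennreal (4 * K / L) \<le> (\<integral>\<^sup>+ z. (\<sigma> z)\<^sup>2 \<partial>lborel) + ennreal (4 * K / L)" .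
  then have "ennreal (4 * K / L) \<le> (\<integral>\<^sup>+ z. (\<sigma> z)\<^sup>2 \<partial>lborel)"
    by (subst (asm) add.commute[of "integral\<^sup>N lborel _"], subst (asm) ennreal_add_left_cancel_le) simp
  then show "ennreal (4 * compl_K r / compl_K (sqrt (1 - r\<^sup>2))) \<le> (\<integral>\<^sup>+ z. (\<sigma> z)\<^sup>2 \<partial>lborel)"
    by (simp only: K_def L_def)
qed

end

lemma artanh_mono_real: "0 \<le> x \<Longrightarrow> x \<le> y \<Longrightarrow> y < 1 \<Longrightarrow> artanh x \<le> artanh (y :: real)"
  using tanh_real_le_iff[of "artanh x" "artanh y"] tanh_artanh_real[of x] tanh_artanh_real[of y] by simp

text \<open>\<open>Z\<close>, the zero set of \<open>u\<close>, is the segment. A curve that comes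
  close to its image and leaves every compact set is pulled back by the inverse \<open>g\<close>;
  along the pullback \<open>u\<close> comes close to 0 by continuity and close to \<open>L\<close>
  because its sublevel sets are compact.\<close>

theorem quasiconformal_Schwarz:
  assumes K: "1 \<le> K" and qc: "quasiconformal K (ball 0 1) (ball 0 1) f"
    and xy: "x \<in> ball 0 1" "y \<in> ball 0 1" "x \<noteq> y"
  shows "hyp_dist (f x) (f y) \<le> 2 * artanh (phi K (tanh (hyp_dist x y / 2)))"
proof -
  obtain g where hom: "homeomorphism (ball 0 1) (ball 0 1) f g" using qc by (auto simp: quasiconformal_def)
  have fg: "f ` ball 0 1 = ball 0 1" "g ` ball 0 1 = ball 0 1" "continuous_on (ball 0 1) f" "continuous_on (ball 0 1) g"
    "\<And>z. z \<in> ball 0 1 \<Longrightarrow> g (f z) = z" "\<And>z. z \<in> ball 0 1 \<Longrightarrow> f (g z) = z"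
    using hom by (auto simp: homeomorphism_def)
  have fin: "f z \<in> ball 0 1" if "z \<in> ball 0 1" for z using fg(1) that by blast
  have gin: "g z \<in> ball 0 1" if "z \<in> ball 0 1" for z using fg(2) that by blast
  have fxy: "f x \<in> ball 0 1" "f y \<in> ball 0 1" using fin xy by auto
  have fne: "f x \<noteq> f y"
  proof
    assume "f x = f y"
    then have "g (f x) = g (f y)" by simp
    then show False using fg(5) xy by simp
  qed
  define r s where "r = pseudo_hyp_dist x y" and "s = pseudo_hyp_dist (f x) (f y)"
  have r: "0 < r" "r < 1" "hyp_dist x y = 2 * artanh r" using pseudo_hyp_dist_bounds[OF xy] by (auto simp: r_def)
  have s: "0 < s" "s < 1" "hyp_dist (f x) (f y) = 2 * artanh s"
    using pseudo_hyp_dist_bounds[OF fxy fne] by (auto simp: s_def)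
  obtain \<Phi> u v \<rho> where "groetzsch_data x y r \<Phi> u v \<rho>" using groetzsch_data_exists[OF xy] by (auto simp: r_def)
  then interpret A: groetzsch_data x y r \<Phi> u v \<rho> .
  obtain \<Phi>' u' v' \<rho>' where "groetzsch_data (f x) (f y) s \<Phi>' u' v' \<rho>'"
    using groetzsch_data_exists[OF fxy fne] by (auto simp: s_def)
  then interpret B: groetzsch_data "f x" "f y" s \<Phi>' u' v' \<rho>' .
  define L where "L = compl_K (sqrt (1 - r\<^sup>2))"
  have L: "0 < L" unfolding L_def by (rule compl_K_pos[OF compl_modulus(6)[OF r(1,2)]])
  define Z where "Z = {z \<in> ball 0 1. u z = 0}"
  have Zeq: "Z = {z \<in> ball 0 1. u z \<le> 0}" using A.u_bounds by (auto simp: Z_def intro: antisym)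
  have Zc: "compact Z" unfolding Zeq using A.u_compact[of 0] L by (simp add: L_def)
  have Zs: "connected Z" "Z \<subseteq> ball 0 1" "x \<in> Z" "y \<in> Z"
    unfolding Z_def using A.u_zero xy by auto
  note Z = Zc Zs
  define \<Gamma> where "\<Gamma> = ring_curves (ball 0 1 - {x, y}) u L"
  have "ennreal (4 * compl_K s / compl_K (sqrt (1 - s\<^sup>2))) \<le> curve_modulus (curve_image f ` \<Gamma>)"
  proof (rule B.curve_modulus_ge[OF s(1,2), where E = "f ` Z"])
    show "compact (f ` Z)" by (rule compact_continuous_image[OF continuous_on_subset[OF fg(3) Z(3)] Z(1)])
    show "connected (f ` Z)" by (rule connected_continuous_image[OF continuous_on_subset[OF fg(3) Z(3)] Z(2)])
    show "f ` Z \<subseteq> ball 0 1" using fin Z(3) by blast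
    show "f x \<in> f ` Z" "f y \<in> f ` Z" using Z by auto
    fix a b :: real and \<beta> assume ab: "a < b" and \<beta>: "continuous_on {a<..<b} \<beta>" "\<beta> ` {a<..<b} \<subseteq> ball 0 1 - f ` Z"
      and e: "\<exists>e\<in>f ` Z. \<forall>d>0. \<exists>t\<in>{a<..<b}. dist (\<beta> t) e < d"
      and esc: "\<And>C. compact C \<Longrightarrow> C \<subseteq> ball 0 1 \<Longrightarrow> \<exists>t\<in>{a<..<b}. \<beta> t \<notin> C"
    define \<gamma> where "\<gamma> t = g (\<beta> t)" for t
    have \<beta>b: "\<beta> t \<in> ball 0 1" "\<beta> t \<notin> f ` Z" if "t \<in> {a<..<b}" for t
      using imageI[OF that, of \<beta>, THEN subsetD[OF \<beta>(2)]] by auto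
    have \<gamma>c: "continuous_on {a<..<b} \<gamma>"
      unfolding \<gamma>_def by (rule continuous_on_compose2[OF fg(4) \<beta>(1)]) (use \<beta>b in blast)
    have \<gamma>b: "\<gamma> t \<in> ball 0 1" "f (\<gamma> t) = \<beta> t" "\<gamma> t \<notin> Z" if "t \<in> {a<..<b}" for t
    proof -
      show "\<gamma> t \<in> ball 0 1" "f (\<gamma> t) = \<beta> t" unfolding \<gamma>_def using gin fg(6) \<beta>b(1)[OF that] by auto
      then show "\<gamma> t \<notin> Z" using \<beta>b(2)[OF that] by (metis imageI)
    qed
    have "({a<..<b}, \<gamma>) \<in> \<Gamma>"
      unfolding \<Gamma>_def ring_curves_def mem_Collect_eq prod.case
    proof (intro conjI allI impI \<gamma>c)
      show "is_interval {a<..<b}" by (rule is_interval_oo)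
      show "{a<..<b} \<noteq> {}" using ab by auto
      show "\<gamma> ` {a<..<b} \<subseteq> ball 0 1 - {x, y}" using \<gamma>b(1,3) Z(4,5) by blast
      fix c :: real assume c: "0 < c"
      show "\<exists>t\<in>{a<..<b}. u (\<gamma> t) < c"
      proof -
        obtain z where z: "z \<in> Z" "\<And>d. d > 0 \<Longrightarrow> \<exists>t\<in>{a<..<b}. dist (\<beta> t) (f z) < d" using e by blast
        have zb: "z \<in> ball 0 1" "f z \<in> ball 0 1" using z(1) Z(3) fin by auto
        have "continuous_on (ball 0 1) (\<lambda>w. u (g w))"
          by (rule continuous_on_compose2[OF A.u_cont fg(4)]) (use gin in blast)
        from this[unfolded continuous_on_iff, rule_format, OF zb(2) c] obtain d where d: "d > 0"
          "\<And>w. w \<in> ball 0 1 \<Longrightarrow> dist w (f z) < d \<Longrightarrow> dist (u (g w)) (u (g (f z))) < c" by blast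
        obtain t where t: "t \<in> {a<..<b}" "dist (\<beta> t) (f z) < d" using z(2)[OF d(1)] by blast
        have "dist (u (\<gamma> t)) (u (g (f z))) < c" unfolding \<gamma>_def by (rule d(2)[OF \<beta>b(1)[OF t(1)] t(2)])
        moreover have "u (g (f z)) = 0" using fg(5)[OF zb(1)] z(1) by (simp add: Z_def)
        ultimately have "u (\<gamma> t) < c" by (simp add: dist_real_def)
        then show ?thesis using t(1) by blast
      qed
      show "\<exists>t\<in>{a<..<b}. L - c < u (\<gamma> t)"
      proof -
        define Cs where "Cs = {z \<in> ball 0 1. u z \<le> L - c}"
        have "compact Cs" unfolding Cs_def using c by (intro A.u_compact) (simp add: L_def)
        moreover have "Cs \<subseteq> ball 0 1" by (auto simp: Cs_def)
        ultimately have "compact (f ` Cs)" "f ` Cs \<subseteq> ball 0 1"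
          using compact_continuous_image[OF continuous_on_subset[OF fg(3)]] fin by blast+
        then obtain t where t: "t \<in> {a<..<b}" "\<beta> t \<notin> f ` Cs" using esc by blast
        then have "\<gamma> t \<notin> Cs" using \<gamma>b(2)[OF t(1)] by (metis imageI)
        then have "L - c < u (\<gamma> t)" using \<gamma>b(1)[OF t(1)] by (simp add: Cs_def)
        then show ?thesis using t(1) by blast
      qed
    qed
    then have "curve_image f ({a<..<b}, \<gamma>) \<in> curve_image f ` \<Gamma>" by (rule imageI)
    then show "\<exists>\<gamma>. ({a<..<b}, \<gamma>) \<in> curve_image f ` \<Gamma> \<and> (\<forall>t\<in>{a<..<b}. \<gamma> t = \<beta> t)"
      using \<gamma>b(2) by (intro exI[of _ "f \<circ> \<gamma>"]) (simp add: curve_image_def)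
  qed
  also have "\<dots> \<le> ennreal K * curve_modulus \<Gamma>"
  proof -
    have "\<forall>C\<in>\<Gamma>. curve_in (ball 0 1) C" by (auto simp: \<Gamma>_def ring_curves_def curve_in_def)
    then show ?thesis using qc unfolding quasiconformal_def by blast
  qed
  also have "\<dots> \<le> ennreal K * ennreal (4 * compl_K r / L)"
    using A.curve_modulus_ring_curves_le[OF r(1,2)] by (intro mult_left_mono) (auto simp: \<Gamma>_def L_def)
  also have "\<dots> = ennreal (K * (4 * compl_K r / L))" using K by (intro ennreal_mult'[symmetric]) simp
  finally have "4 * compl_K s / compl_K (sqrt (1 - s\<^sup>2)) \<le> K * (4 * compl_K r / L)"
    using K L compl_K_pos[OF compl_modulus(5)[OF r(1,2)]] by (subst (asm) ennreal_le_iff) auto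
  moreover have pos: "0 < compl_K r" "0 < compl_K s" "0 < compl_K (sqrt (1 - s\<^sup>2))"
    using compl_K_pos compl_modulus[OF r(1,2)] compl_modulus[OF s(1,2)] by auto
  ultimately have "mu r / K \<le> mu s"
    unfolding mu_eq[OF r(1,2)] mu_eq[OF s(1,2)] L_def[symmetric] using L K by (simp add: field_simps)
  then have "s \<le> phi K r" using s r by (intro le_phi[OF K]) auto
  then have "artanh s \<le> artanh (phi K r)" using s phi_props[OF K r(1,2)] by (intro artanh_mono_real) auto
  moreover have "tanh (hyp_dist x y / 2) = r" using r by (simp add: tanh_artanh_real)
  ultimately show ?thesis by (simp add: s(3))
qed

section \<open>Ideal quadrilaterals\<close>

lemma inner_mult_unit: "norm m = 1 \<Longrightarrow> (m * z) \<bullet> (m * w) = z \<bullet> w" for m z w :: complex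
proof -
  assume "norm m = 1"
  then have "(Re m)\<^sup>2 + (Im m)\<^sup>2 = 1" by (simp add: cmod_power2[symmetric])
  moreover have "(m * z) \<bullet> (m * w) = ((Re m)\<^sup>2 + (Im m)\<^sup>2) * (z \<bullet> w)"
    by (simp add: inner_complex_def power2_eq_square algebra_simps)
  ultimately show ?thesis by simp
qed

lemma inner_mult_unit_self: "norm m = 1 \<Longrightarrow> (m * z) \<bullet> m = Re z" for m z :: complex
  using inner_mult_unit[of m z 1] by (simp add: inner_complex_def)

lemma mem_sphere_iff_inner:
  fixes z c :: complex
  assumes "0 \<le> r"
  shows "z \<in> sphere c r \<longleftrightarrow> (norm z)\<^sup>2 - 2 * (z \<bullet> c) + (norm c)\<^sup>2 = r\<^sup>2"
proof -
  have "z \<in> sphere c r \<longleftrightarrow> (dist c z)\<^sup>2 = r\<^sup>2" using assms by (simp add: power2_eq_iff_nonneg)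
  moreover have "(dist c z)\<^sup>2 = (norm z)\<^sup>2 - 2 * (z \<bullet> c) + (norm c)\<^sup>2"
    by (simp add: dist_norm power2_norm_eq_inner inner_diff_left inner_diff_right inner_commute)
  ultimately show ?thesis by simp
qed

text \<open>In the disk this is the geodesic with end points \<open>m * cis (- \<delta>)\<close> and
  \<open>m * cis \<delta>\<close>, provided \<open>0 < sin \<delta>\<close>. The equation of the
  orthogonal circle with center \<open>m / cos \<delta>\<close> is multiplied by
  \<open>cos \<delta>\<close>, so that it covers the diameters, where
  \<open>cos \<delta> = 0\<close>.\<close>

definition geodesic_locus :: "real \<Rightarrow> complex \<Rightarrow> complex set" where
  "geodesic_locus \<delta> m = {z. (1 + (norm z)\<^sup>2) * cos \<delta> = 2 * (z \<bullet> m)}"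

lemma closed_geodesic_locus: "closed (geodesic_locus \<delta> m)"
  unfolding geodesic_locus_def by (intro closed_Collect_eq continuous_intros)

lemma geodesic_locus_circle:
  assumes m: "norm m = 1" and \<delta>: "0 < sin \<delta>" and C: "cos \<delta> \<noteq> 0"
  defines "r \<equiv> sqrt (1 / (cos \<delta>)\<^sup>2 - 1)"
  shows "0 < r" "geodesic_locus \<delta> m = sphere ((1 / cos \<delta>) *\<^sub>R m) r"
proof -
  have "1 / (cos \<delta>)\<^sup>2 - 1 = (sin \<delta> / cos \<delta>)\<^sup>2" using C sin_squared_eq[of \<delta>]
    by (simp add: power_divide field_simps)
  then have r2: "0 < 1 / (cos \<delta>)\<^sup>2 - 1" using \<delta> C by (simp add: zero_less_power2)
  then show r: "0 < r" by (simp add: r_def)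
  define c where "c = (1 / cos \<delta>) *\<^sub>R m"
  have nc: "(norm c)\<^sup>2 = 1 / (cos \<delta>)\<^sup>2" "z \<bullet> c = (z \<bullet> m) / cos \<delta>" for z
    by (simp_all add: c_def m power_divide)
  have "z \<in> sphere c r \<longleftrightarrow> z \<in> geodesic_locus \<delta> m" for z
  proof -
    have "z \<in> sphere c r \<longleftrightarrow> (norm z)\<^sup>2 - 2 * ((z \<bullet> m) / cos \<delta>) = - 1"
      using r r2 by (subst mem_sphere_iff_inner) (auto simp: nc r_def)
    also have "\<dots> \<longleftrightarrow> z \<in> geodesic_locus \<delta> m" using C by (auto simp: geodesic_locus_def field_simps)
    finally show ?thesis .
  qed
  then show "geodesic_locus \<delta> m = sphere ((1 / cos \<delta>) *\<^sub>R m) r" unfolding c_def by blast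
qed

lemma geodesic_locus_diameter:
  assumes m: "norm m = 1" and C: "cos \<delta> = 0"
  shows "geodesic_locus \<delta> m = span {m * \<i>}"
proof (intro set_eqI iffI)
  have m0: "m \<noteq> 0" using m by auto
  fix z
  define w where "w = z / m"
  have z: "z = m * w" using m0 by (simp add: w_def)
  assume "z \<in> geodesic_locus \<delta> m"
  then have "Re w = 0" using C inner_mult_unit_self[OF m, of w] by (simp add: geodesic_locus_def z)
  then have "z = Im w *\<^sub>R (m * \<i>)" by (simp add: z complex_eq_iff)
  then show "z \<in> span {m * \<i>}" by (auto simp: span_singleton)
next
  fix z assume "z \<in> span {m * \<i>}"
  then obtain k where "z = k *\<^sub>R (m * \<i>)" by (auto simp: span_singleton)
  then have "z = m * (k *\<^sub>R \<i>)" by simp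
  then show "z \<in> geodesic_locus \<delta> m"
    using C inner_mult_unit_self[OF m, of "k *\<^sub>R \<i>"] by (simp add: geodesic_locus_def)
qed

lemma geodesic_locus_sphere:
  assumes m: "norm m = 1" and z: "norm z = 1"
  shows "z \<in> geodesic_locus \<delta> m \<longleftrightarrow> z = m * cis (- \<delta>) \<or> z = m * cis \<delta>"
proof -
  have m0: "m \<noteq> 0" using m by auto
  define w where "w = z / m"
  have zw: "z = m * w" using m0 by (simp add: w_def)
  have w: "(Re w)\<^sup>2 + (Im w)\<^sup>2 = 1" using m z by (simp add: w_def norm_divide flip: cmod_power2)
  have "z \<in> geodesic_locus \<delta> m \<longleftrightarrow> Re w = cos \<delta>"
    using inner_mult_unit_self[OF m, of w] z by (auto simp: geodesic_locus_def zw[symmetric])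
  also have "\<dots> \<longleftrightarrow> w = cis (- \<delta>) \<or> w = cis \<delta>"
  proof
    assume R: "Re w = cos \<delta>"
    then have "(Im w)\<^sup>2 = (sin \<delta>)\<^sup>2" using w by (simp add: sin_squared_eq)
    then have "Im w = sin \<delta> \<or> Im w = - sin \<delta>" by (simp add: power2_eq_iff)
    then show "w = cis (- \<delta>) \<or> w = cis \<delta>" using R by (auto simp: complex_eq_iff)
  qed auto
  also have "\<dots> \<longleftrightarrow> z = m * cis (- \<delta>) \<or> z = m * cis \<delta>" using m0 by (auto simp: zw)
  finally show ?thesis .
qed

text \<open>The two end points are approached along the parametrization of the arc by the
  coordinate \<open>y\<close> in the direction \<open>m * \<i>\<close>, with the smaller root \<open>x\<close> of
  \<open>(1 + x\<^sup>2 + y\<^sup>2) * cos \<delta> = 2 * x\<close>.\<close>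

lemma geodesic_locus_closure:
  assumes m: "norm m = 1" and \<delta>: "0 < sin \<delta>"
  shows "closure (geodesic_locus \<delta> m \<inter> ball 0 1) \<inter> sphere 0 1 = {m * cis (- \<delta>), m * cis \<delta>}"
proof (intro equalityI subsetI)
  fix z assume "z \<in> closure (geodesic_locus \<delta> m \<inter> ball 0 1) \<inter> sphere 0 1"
  then have "z \<in> geodesic_locus \<delta> m" "norm z = 1"
    using closure_minimal[OF Int_lower1 closed_geodesic_locus] by auto
  then show "z \<in> {m * cis (- \<delta>), m * cis \<delta>}" using geodesic_locus_sphere[OF m] by auto
next
  define C S where "C = cos \<delta>" and "S = sin \<delta>"
  have CS: "C\<^sup>2 = 1 - S\<^sup>2" "0 < S" using \<delta> by (auto simp: C_def S_def cos_squared_eq)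
  define q where "q y = sqrt (1 - C\<^sup>2 * (1 + y\<^sup>2))" for y
  \<comment> \<open>The root is rationalized, since the form \<open>(1 - q y) / C\<close> would fail
    for \<open>C = 0\<close>.\<close>
  define x where "x y = C * (1 + y\<^sup>2) / (1 + q y)" for y
  define p where "p y = m * Complex (x y) y" for y
  \<comment> \<open>Hence the radicand is at least \<open>y^4\<close> and
    \<open>y\<^sup>2 \<le> q y\<close>, which gives
    \<open>\<bar>x y\<bar> \<le> \<bar>C\<bar>\<close> and a norm below 1 inside the
    interval.\<close>
  have bnd: "C\<^sup>2 * (1 + y\<^sup>2) \<le> 1 - y^4" if "y\<^sup>2 \<le> S\<^sup>2" for y
  proof -
    have "1 - y^4 - C\<^sup>2 * (1 + y\<^sup>2) = (S\<^sup>2 - y\<^sup>2) * (1 + y\<^sup>2)"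
      unfolding CS(1) by (simp add: algebra_simps power2_eq_square power4_eq_xxxx)
    moreover have "0 \<le> (S\<^sup>2 - y\<^sup>2) * (1 + y\<^sup>2)" using that by simp
    ultimately show ?thesis by linarith
  qed
  have q2: "(q y)\<^sup>2 = 1 - C\<^sup>2 * (1 + y\<^sup>2)" "y\<^sup>2 \<le> q y" if "y\<^sup>2 \<le> S\<^sup>2" for y
  proof -
    have "y^4 \<ge> 0" by simp
    then show "(q y)\<^sup>2 = 1 - C\<^sup>2 * (1 + y\<^sup>2)" unfolding q_def using bnd[OF that] by (intro real_sqrt_pow2) linarith
    have "(y\<^sup>2)\<^sup>2 \<le> 1 - C\<^sup>2 * (1 + y\<^sup>2)" using bnd[OF that] by (simp flip: power_mult)
    then show "y\<^sup>2 \<le> q y" unfolding q_def by (rule real_le_rsqrt)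
  qed
  have inL: "p y \<in> geodesic_locus \<delta> m \<inter> ball 0 1" if y: "y \<in> {-S<..<S}" for y
  proof -
    have y2: "y\<^sup>2 < S\<^sup>2" using y by (intro abs_square_less_1[THEN iffD2] power2_strict_mono) auto
    then have y2': "y\<^sup>2 \<le> S\<^sup>2" by simp
    have q: "0 \<le> q y" using q2(2)[OF y2'] zero_le_power2[of y] by linarith
    have xq: "x y * (1 + q y) = C * (1 + y\<^sup>2)" using q by (simp add: x_def)
    have "C * x y * (1 + q y) = (1 - q y) * (1 + q y)"
      using xq q2(1)[OF y2'] by (simp add: mult.assoc) (simp add: algebra_simps power2_eq_square)
    then have Cx: "C * x y = 1 - q y" using q by simp
    have n: "(norm (p y))\<^sup>2 = (x y)\<^sup>2 + y\<^sup>2" by (simp add: p_def norm_mult m power_mult_distrib cmod_power2)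
    have "C * (1 + y\<^sup>2) + (C * x y) * x y = 2 * x y" unfolding xq[symmetric] Cx by (simp add: algebra_simps)
    then have "(1 + (norm (p y))\<^sup>2) * C = 2 * x y" unfolding n by (simp add: algebra_simps power2_eq_square)
    then have 1: "p y \<in> geodesic_locus \<delta> m"
      using inner_mult_unit_self[OF m, of "Complex (x y) y"] by (simp add: geodesic_locus_def C_def[symmetric] p_def)
    have "\<bar>x y\<bar> = \<bar>C\<bar> * ((1 + y\<^sup>2) / (1 + q y))" using q by (simp add: x_def abs_mult)
    also have "\<dots> \<le> \<bar>C\<bar> * 1" using q q2(2)[OF y2'] by (intro mult_left_mono) (auto simp: divide_le_eq_1)
    finally have "(x y)\<^sup>2 \<le> C\<^sup>2" by (simp add: abs_le_square_iff)
    then have "(norm (p y))\<^sup>2 < 1" unfolding n using y2 CS(1) by linarith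
    then have "norm (p y) < 1" by (simp add: abs_square_less_1)
    then show ?thesis using 1 by simp
  qed
  have "continuous_on {-S..S} p"
  proof -
    have "1 + q y \<noteq> 0" if "y \<in> {-S..S}" for y
    proof -
      have "y\<^sup>2 \<le> S\<^sup>2" using that by (simp add: abs_le_square_iff[symmetric] abs_le_iff)
      then show ?thesis using q2(2)[of y] zero_le_power2[of y] by linarith
    qed
    then show ?thesis unfolding p_def x_def Complex_eq q_def by (intro continuous_intros) auto
  qed
  moreover have cl: "closure {-S<..<S} = {-S..S}" using CS(2) by (intro closure_greaterThanLessThan) simp
  ultimately have "p ` closure {-S<..<S} \<subseteq> closure (geodesic_locus \<delta> m \<inter> ball 0 1)"
    using inL by (intro image_closure_subset closed_closure subset_trans[OF image_subsetI closure_subset]) auto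
  then have "p S \<in> closure (geodesic_locus \<delta> m \<inter> ball 0 1)" "p (- S) \<in> closure (geodesic_locus \<delta> m \<inter> ball 0 1)"
    using CS(2) unfolding cl by auto
  moreover have "q S = S\<^sup>2" "q (- S) = S\<^sup>2"
  proof -
    have "1 - C\<^sup>2 * (1 + S\<^sup>2) = (S\<^sup>2)\<^sup>2" unfolding CS(1) by (simp add: algebra_simps power2_eq_square)
    then show "q S = S\<^sup>2" "q (- S) = S\<^sup>2"
      unfolding q_def power2_minus by (auto intro: real_sqrt_unique[OF sym])
  qed
  then have "p S = m * cis \<delta>" "p (- S) = m * cis (- \<delta>)"
  proof -
    have "1 + S\<^sup>2 \<noteq> 0" using zero_le_power2[of S] by linarith
    then have "x S = C" "x (- S) = C" using \<open>q S = S\<^sup>2\<close> \<open>q (- S) = S\<^sup>2\<close> by (simp_all add: x_def)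
    then show "p S = m * cis \<delta>" "p (- S) = m * cis (- \<delta>)" by (simp_all add: p_def C_def S_def complex_eq_iff)
  qed
  ultimately show "z \<in> closure (geodesic_locus \<delta> m \<inter> ball 0 1) \<inter> sphere 0 1"
    if "z \<in> {m * cis (- \<delta>), m * cis \<delta>}" for z using that by (auto simp: norm_mult m)
qed

lemma hyp_line_geodesic_locus:
  assumes m: "norm m = 1" and \<delta>: "0 < sin \<delta>"
  shows "hyp_line (geodesic_locus \<delta> m \<inter> ball 0 1)"
proof (cases "cos \<delta> = 0")
  case True
  have "m * \<i> \<noteq> 0" using m by auto
  then show ?thesis unfolding hyp_line_def geodesic_locus_diameter[OF m True] by blast
next
  case False
  define c r where "c = (1 / cos \<delta>) *\<^sub>R m" and "r = sqrt (1 / (cos \<delta>)\<^sup>2 - 1)"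
  have r: "0 < r" "geodesic_locus \<delta> m = sphere c r"
    using geodesic_locus_circle[OF m \<delta> False] by (auto simp: c_def r_def)
  have "m * cis \<delta> \<in> sphere c r" unfolding r(2)[symmetric]
    by (subst geodesic_locus_sphere[OF m]) (auto simp: norm_mult m)
  moreover have "m * cis \<delta> \<in> sphere 0 1" by (simp add: norm_mult m)
  moreover have "(p - c) \<bullet> (p - 0) = 0" if p: "p \<in> sphere c r" "p \<in> sphere 0 1" for p
  proof -
    have "p \<bullet> m = cos \<delta>" using p unfolding r(2)[symmetric] by (simp add: geodesic_locus_def)
    then have "c \<bullet> p = 1" using False by (simp add: c_def inner_commute)
    moreover have "p \<bullet> p = 1" using p(2) by (simp add: norm_eq_1)
    ultimately show ?thesis by (simp add: inner_diff_left)
  qed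
  ultimately have "perpendicular_circles c r 0 1" unfolding perpendicular_circles_def by blast
  then show ?thesis unfolding hyp_line_def r(2) using r(1) by blast
qed

text \<open>For a circle, perpendicularity at the two end points says that both have inner product 1
  with the center; this fixes the center and then the radius. A diameter has opposite end points,
  which forces \<open>cos \<delta> = 0\<close>.\<close>

lemma hyp_line_unique:
  assumes m: "norm m = 1" and \<delta>: "0 < sin \<delta>" and L: "hyp_line L"
    and cl: "closure L \<inter> sphere 0 1 = {m * cis (- \<delta>), m * cis \<delta>}"
  shows "L = geodesic_locus \<delta> m \<inter> ball 0 1"
proof -
  define a b where "a = m * cis (- \<delta>)" and "b = m * cis \<delta>"
  have ab: "a \<in> closure L" "b \<in> closure L" "norm a = 1" "norm b = 1"
    using cl by (auto simp: a_def b_def norm_mult m)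
  have m0: "m \<noteq> 0" using m by auto
  from L consider (circle) c r where "r > 0" "perpendicular_circles c r 0 1" "L = sphere c r \<inter> ball 0 1"
    | (line) u where "u \<noteq> 0" "L = span {u} \<inter> ball 0 1" unfolding hyp_line_def by blast
  then show ?thesis
  proof cases
    case circle
    have "closure L \<subseteq> sphere c r" unfolding circle(3) by (intro closure_minimal) auto
    then have on: "a \<in> sphere c r" "b \<in> sphere c r" using ab by auto
    have "(a - c) \<bullet> (a - 0) = 0" "(b - c) \<bullet> (b - 0) = 0"
      using circle(2) on ab(3,4) unfolding perpendicular_circles_def by auto
    then have i: "a \<bullet> c = 1" "b \<bullet> c = 1"
      using ab(3,4) by (auto simp: inner_diff_left inner_diff_right norm_eq_1 inner_commute)
    define w where "w = c / m"
    have c: "c = m * w" using m0 by (simp add: w_def)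
    have "Re w * cos \<delta> - Im w * sin \<delta> = 1" "Re w * cos \<delta> + Im w * sin \<delta> = 1"
      using i unfolding a_def b_def c inner_mult_unit[OF m] by (auto simp: inner_complex_def mult.commute)
    then have "Im w * sin \<delta> = 0" and R: "Re w * cos \<delta> = 1" by linarith+
    then have "Im w = 0" using \<delta> by simp
    then have "w = of_real (Re w)" by (simp add: complex_eq_iff)
    then have c': "c = Re w *\<^sub>R m" unfolding c by (metis mult.commute scaleR_conv_of_real)
    have "(norm c)\<^sup>2 = 1 + r\<^sup>2"
      using on(1)[unfolded mem_sphere_iff_inner[OF less_imp_le[OF circle(1)]]] ab(3) i(1) by simp
    then have "z \<in> sphere c r \<longleftrightarrow> z \<in> geodesic_locus \<delta> m" for z
    proof -
      have "z \<in> sphere c r \<longleftrightarrow> 1 + (norm z)\<^sup>2 = 2 * (Re w * (z \<bullet> m))"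
        using circle(1) \<open>(norm c)\<^sup>2 = 1 + r\<^sup>2\<close> by (subst mem_sphere_iff_inner) (auto simp: c')
      also have "\<dots> \<longleftrightarrow> (1 + (norm z)\<^sup>2) * cos \<delta> = 2 * (Re w * (z \<bullet> m)) * cos \<delta>" using R by auto
      also have "2 * (Re w * (z \<bullet> m)) * cos \<delta> = 2 * (Re w * cos \<delta>) * (z \<bullet> m)" by simp
      finally show ?thesis by (simp add: R geodesic_locus_def)
    qed
    then show ?thesis unfolding circle(3) by blast
  next
    case line
    have "closure L \<subseteq> span {u}" unfolding line(2) by (intro closure_minimal closed_subspace) auto
    then have "a \<in> span {u}" "b \<in> span {u}" using ab by auto
    then obtain \<alpha> \<beta> where \<alpha>\<beta>: "a = \<alpha> *\<^sub>R u" "b = \<beta> *\<^sub>R u" unfolding span_singleton by blast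
    have \<alpha>: "\<alpha> \<noteq> 0" using \<alpha>\<beta>(1) ab(3) by auto
    have "\<bar>\<alpha>\<bar> = \<bar>\<beta>\<bar>" using ab(3,4) line(1) by (simp add: \<alpha>\<beta>) (metis mult_right_cancel norm_eq_zero)
    moreover have "a \<noteq> b" using \<delta> m0 by (auto simp: a_def b_def complex_eq_iff)
    ultimately have "\<beta> = - \<alpha>" using \<alpha>\<beta> by (auto simp: abs_eq_iff)
    then have "a + b = 0" using \<alpha>\<beta> by simp
    then have "m * (cis (- \<delta>) + cis \<delta>) = 0" by (simp add: a_def b_def algebra_simps)
    then have C: "cos \<delta> = 0" using m0 by (auto simp: complex_eq_iff)
    then have "\<bar>sin \<delta>\<bar> = 1" using sin_cos_squared_add[of \<delta>] by (simp add: abs_square_eq_1)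
    then have "sin \<delta> = 1" using \<delta> by simp
    then have "b = m * \<i>" using C by (simp add: b_def complex_eq_iff)
    moreover have "span {u} = span {b}"
      using \<open>\<beta> = - \<alpha>\<close> \<alpha> unfolding \<alpha>\<beta>(2) span_singleton
    proof (intro equalityI subsetI)
      fix z assume "z \<in> range (\<lambda>k. k *\<^sub>R u)"
      then obtain k where "z = k *\<^sub>R u" by blast
      then have "z = (k / \<beta>) *\<^sub>R (\<beta> *\<^sub>R u)" using \<open>\<beta> = - \<alpha>\<close> \<alpha> by simp
      then show "z \<in> range (\<lambda>k. k *\<^sub>R (\<beta> *\<^sub>R u))" by blast
    next
      fix z assume "z \<in> range (\<lambda>k. k *\<^sub>R (\<beta> *\<^sub>R u))"
      then show "z \<in> range (\<lambda>k. k *\<^sub>R u)" unfolding scaleR_scaleR by blast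
    qed
    ultimately show ?thesis unfolding line(2) geodesic_locus_diameter[OF m C] by simp
  qed
qed

lemma geodesic_eq:
  assumes "s < t" "t < s + 2 * pi"
  shows "geodesic (cis s) (cis t) = geodesic_locus ((t - s) / 2) (cis ((s + t) / 2)) \<inter> ball 0 1"
proof -
  define \<delta> m where "\<delta> = (t - s) / 2" and "m = cis ((s + t) / 2)"
  have m: "norm m = 1" by (simp add: m_def)
  have \<delta>: "0 < sin \<delta>" using assms by (intro sin_gt_zero) (auto simp: \<delta>_def)
  have ab: "cis s = m * cis (- \<delta>)" "cis t = m * cis \<delta>"
    by (simp_all add: m_def \<delta>_def cis_mult field_simps)
  show ?thesis
    unfolding geodesic_def ab \<delta>_def[symmetric] m_def[symmetric]
    using hyp_line_geodesic_locus[OF m \<delta>] geodesic_locus_closure[OF m \<delta>] hyp_line_unique[OF m \<delta>]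
    by (intro the_equality) blast+
qed

text \<open>In the hyperboloid model the point with coordinates \<open>(T, V)\<close>, \<open>T\<^sup>2 - |V|\<^sup>2 = 1\<close>, \<open>T > 0\<close>,
  corresponds to \<open>V / (1 + T)\<close>, and the geodesic with data \<open>(\<delta>, m)\<close> is the orthogonal complement of
  the vector \<open>(cos \<delta>, m)\<close> for the Lorentz form.  The feet of the common perpendicular of
  two geodesics are the projections of each of these vectors to the complement of the other one.\<close>

lemma hyperboloid_to_disk:
  fixes V m :: complex and T :: real
  assumes T: "0 < T" "T\<^sup>2 - (norm V)\<^sup>2 = 1"
  shows "(norm (V /\<^sub>R (1 + T)))\<^sup>2 = (T - 1) / (T + 1)"
    "V /\<^sub>R (1 + T) \<in> ball 0 1"
    "T * cos \<delta> = V \<bullet> m \<Longrightarrow> V /\<^sub>R (1 + T) \<in> geodesic_locus \<delta> m"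
proof -
  have "(norm (V /\<^sub>R (1 + T)))\<^sup>2 = (T\<^sup>2 - 1) / (T + 1)\<^sup>2"
  proof -
    have "(norm V)\<^sup>2 = T\<^sup>2 - 1" using T by simp
    then show ?thesis by (simp add: power_mult_distrib power_divide divide_inverse add.commute power_inverse)
  qed
  also have "\<dots> = (T - 1) / (T + 1)" using T(1) by (simp add: divide_simps) (simp add: power2_eq_square algebra_simps)
  finally show n: "(norm (V /\<^sub>R (1 + T)))\<^sup>2 = (T - 1) / (T + 1)" .
  also have "\<dots> < 1" using T(1) by simp
  finally show "V /\<^sub>R (1 + T) \<in> ball 0 1" by (simp add: abs_square_less_1)
  show "V /\<^sub>R (1 + T) \<in> geodesic_locus \<delta> m" if "T * cos \<delta> = V \<bullet> m"
  proof -
    have "(1 + (T - 1) / (T + 1)) * cos \<delta> = 2 * (T * cos \<delta>) / (1 + T)" using T(1) by (simp add: field_simps)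
    then show ?thesis unfolding geodesic_locus_def mem_Collect_eq n that by (simp add: divide_inverse)
  qed
qed

text \<open>\<open>T * U - V \<bullet> W\<close> is cosh \<rho>, and
  \<open>(dist x y)\<^sup>2\<close> divided by the last product is
  \<open>(sinh (\<rho> / 2))\<^sup>2\<close>; so this is the half-angle formula for cosh \<rho> -
  1.\<close>

lemma dist_hyperboloid:
  fixes V W :: complex and T U :: real
  assumes T: "0 < T" "T\<^sup>2 - (norm V)\<^sup>2 = 1" and U: "0 < U" "U\<^sup>2 - (norm W)\<^sup>2 = 1"
  defines "x \<equiv> V /\<^sub>R (1 + T)" and "y \<equiv> W /\<^sub>R (1 + U)"
  shows "2 * (dist x y)\<^sup>2 = (T * U - V \<bullet> W - 1) * ((1 - (norm x)\<^sup>2) * (1 - (norm y)\<^sup>2))"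
proof -
  have nx: "(norm x)\<^sup>2 = (T - 1) / (T + 1)" and ny: "(norm y)\<^sup>2 = (U - 1) / (U + 1)"
    using hyperboloid_to_disk(1)[OF T] hyperboloid_to_disk(1)[OF U] by (simp_all add: x_def y_def)
  have xy: "x \<bullet> y = (V \<bullet> W) / ((T + 1) * (U + 1))" by (simp add: x_def y_def divide_inverse add.commute)
  have "(dist x y)\<^sup>2 = (norm x)\<^sup>2 + (norm y)\<^sup>2 - 2 * (x \<bullet> y)"
    by (simp add: dist_norm power2_norm_eq_inner inner_diff_left inner_diff_right inner_commute)
  then show ?thesis unfolding nx ny xy using T(1) U(1) by (simp add: divide_simps) (simp add: algebra_simps)
qed

lemma normalize_timelike:
  fixes V :: complex and T :: real
  assumes "0 < T\<^sup>2 - (norm V)\<^sup>2"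
  obtains k where "0 < k * T" "k\<^sup>2 * (T\<^sup>2 - (norm V)\<^sup>2) = 1"
proof -
  define N where "N = T\<^sup>2 - (norm V)\<^sup>2"
  have "T \<noteq> 0" using assms by auto
  then have "0 < (sgn T / sqrt N) * T" "(sgn T / sqrt N)\<^sup>2 * N = 1"
    using assms by (auto simp: N_def[symmetric] power_divide sgn_if divide_simps)
  then show ?thesis unfolding N_def by (rule that)
qed

text \<open>\<open>A\<close> is the Lorentz product of the two normals, whose squares are
  \<open>- (sin \<delta>)\<^sup>2\<close> and \<open>- (sin \<delta>')\<^sup>2\<close>. The
  hypothesis on \<open>A\<close> makes the projected vectors timelike, and
  \<open>\<bar>A\<bar> / (sin \<delta> * sin \<delta>')\<close> is cosh of the distance of the
  feet.\<close>

lemma geodesic_feet: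
  fixes m m' :: complex
  assumes m: "norm m = 1" "norm m' = 1" and s: "0 < sin \<delta>" "0 < sin \<delta>'"
  defines "A \<equiv> cos \<delta> * cos \<delta>' - m \<bullet> m'"
  assumes A: "sin \<delta> * sin \<delta>' < \<bar>A\<bar>"
  obtains x y where "x \<in> geodesic_locus \<delta> m \<inter> ball 0 1" "y \<in> geodesic_locus \<delta>' m' \<inter> ball 0 1"
    "2 * (dist x y)\<^sup>2 * (sin \<delta> * sin \<delta>') = (\<bar>A\<bar> - sin \<delta> * sin \<delta>') * ((1 - (norm x)\<^sup>2) * (1 - (norm y)\<^sup>2))"
proof -
  define S S' C C' B where "S = sin \<delta>" and "S' = sin \<delta>'" and "C = cos \<delta>" and "C' = cos \<delta>'" and "B = m \<bullet> m'"
  have CS: "C\<^sup>2 = 1 - S\<^sup>2" "C'\<^sup>2 = 1 - S'\<^sup>2" by (auto simp: C_def S_def C'_def S'_def cos_squared_eq)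
  have AB: "A = C * C' - B" by (simp add: A_def B_def C_def C'_def)
  have S: "0 < S" "0 < S'" using s by (auto simp: S_def S'_def)
  have mm: "m \<bullet> m = 1" "m' \<bullet> m' = 1" "m' \<bullet> m = B" using m by (auto simp: norm_eq_1 B_def inner_commute)
  have "(S * S')\<^sup>2 < A\<^sup>2" 
    using power_strict_mono[OF A, of 2] s by (simp add: S_def S'_def)
  define D where "D = A\<^sup>2 - (S * S')\<^sup>2"
  have D: "0 < D" using \<open>(S * S')\<^sup>2 < A\<^sup>2\<close> by (simp add: D_def)
  \<comment> \<open>The projection of \<open>(cos \<delta>', m')\<close> to the complement of
    \<open>(cos \<delta>, m)\<close>, multiplied by \<open>S\<^sup>2\<close> to clear the
    denominator; \<open>U\<close> and \<open>W\<close> are the same with exchanged roles.\<close>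
  define T V where "T = S\<^sup>2 * C' + A * C" and "V = S\<^sup>2 *\<^sub>R m' + A *\<^sub>R m"
  define U W where "U = S'\<^sup>2 * C + A * C'" and "W = S'\<^sup>2 *\<^sub>R m + A *\<^sub>R m'"
  have VV: "(norm V)\<^sup>2 = S^4 + 2 * S\<^sup>2 * A * B + A\<^sup>2"
    unfolding power2_norm_eq_inner V_def
    by (simp add: inner_add_left inner_add_right mm B_def[symmetric] algebra_simps power2_eq_square power4_eq_xxxx)
  have WW: "(norm W)\<^sup>2 = S'^4 + 2 * S'\<^sup>2 * A * B + A\<^sup>2"
    unfolding power2_norm_eq_inner W_def
    by (simp add: inner_add_left inner_add_right mm B_def[symmetric] algebra_simps power2_eq_square power4_eq_xxxx)
  have VW: "V \<bullet> W = S\<^sup>2 * S'\<^sup>2 * B + S\<^sup>2 * A + A * S'\<^sup>2 + A\<^sup>2 * B"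
    unfolding V_def W_def
    by (simp add: inner_add_left inner_add_right mm B_def[symmetric] algebra_simps power2_eq_square)
  have B: "B = C * C' - A" using AB by simp
  have TT: "T\<^sup>2 - (norm V)\<^sup>2 = S\<^sup>2 * D"
  proof -
    have "T\<^sup>2 = S^4 * C'\<^sup>2 + 2 * S\<^sup>2 * A * (C * C') + A\<^sup>2 * C\<^sup>2"
      by (simp add: T_def algebra_simps power2_eq_square power4_eq_xxxx)
    then show ?thesis unfolding VV B CS D_def by (simp add: algebra_simps power2_eq_square power4_eq_xxxx)
  qed
  have UU: "U\<^sup>2 - (norm W)\<^sup>2 = S'\<^sup>2 * D"
  proof -
    have "U\<^sup>2 = S'^4 * C\<^sup>2 + 2 * S'\<^sup>2 * A * (C * C') + A\<^sup>2 * C'\<^sup>2"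
      by (simp add: U_def algebra_simps power2_eq_square power4_eq_xxxx)
    then show ?thesis unfolding WW B CS D_def by (simp add: algebra_simps power2_eq_square power4_eq_xxxx)
  qed
  have TU: "T * U - V \<bullet> W = A * D"
  proof -
    have "T * U = S\<^sup>2 * S'\<^sup>2 * (C * C') + S\<^sup>2 * A * C'\<^sup>2 + A * S'\<^sup>2 * C\<^sup>2 + A\<^sup>2 * (C * C')"
      by (simp add: T_def U_def algebra_simps power2_eq_square)
    then show ?thesis unfolding VW B CS D_def by (simp add: algebra_simps power2_eq_square)
  qed
  have Tm: "T * C = V \<bullet> m"
  proof -
    have "T * C = S\<^sup>2 * (C * C') + A * C\<^sup>2" by (simp add: T_def algebra_simps power2_eq_square)
    moreover have "V \<bullet> m = S\<^sup>2 * B + A" by (simp add: V_def inner_add_left mm)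
    ultimately show ?thesis unfolding CS(1) B by (simp add: algebra_simps)
  qed
  have Um: "U * C' = W \<bullet> m'"
  proof -
    have "U * C' = S'\<^sup>2 * (C * C') + A * C'\<^sup>2" by (simp add: U_def algebra_simps power2_eq_square)
    moreover have "W \<bullet> m' = S'\<^sup>2 * B + A" by (simp add: W_def inner_add_left mm B_def[symmetric])
    ultimately show ?thesis unfolding CS(2) B by (simp add: algebra_simps)
  qed
  have "0 < S\<^sup>2 * D" "0 < S'\<^sup>2 * D" using S D by simp_all
  then obtain k k' where k: "0 < k * T" "k\<^sup>2 * (S\<^sup>2 * D) = 1" and k': "0 < k' * U" "k'\<^sup>2 * (S'\<^sup>2 * D) = 1"
    using normalize_timelike[of T V] normalize_timelike[of U W] unfolding TT UU by metis
  have kT: "(k * T)\<^sup>2 - (norm (k *\<^sub>R V))\<^sup>2 = 1" using k(2) TT by (simp add: power_mult_distrib algebra_simps)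
  have kU: "(k' * U)\<^sup>2 - (norm (k' *\<^sub>R W))\<^sup>2 = 1" using k'(2) UU by (simp add: power_mult_distrib algebra_simps)
  define P where "P = (k * T) * (k' * U) - (k *\<^sub>R V) \<bullet> (k' *\<^sub>R W)"
  have P: "P = k * k' * (A * D)" unfolding TU[symmetric] P_def by (simp add: algebra_simps)
  have "\<bar>P\<bar> * (S * S') = \<bar>A\<bar>"
  proof -
    have "(k * k' * D * (S * S'))\<^sup>2 = (k\<^sup>2 * (S\<^sup>2 * D)) * (k'\<^sup>2 * (S'\<^sup>2 * D))"
      by (simp add: power_mult_distrib power2_eq_square mult_ac)
    then have "\<bar>k * k' * D * (S * S')\<bar> = 1" unfolding k(2) k'(2) by (simp add: abs_square_eq_1)
    then have "\<bar>k * k' * D\<bar> * (S * S') = 1" using S by (simp add: abs_mult)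
    then show ?thesis unfolding P by (simp add: abs_mult mult_ac)
  qed
  \<comment> \<open>Reversed Cauchy-Schwarz for two timelike vectors, both future directed by the
    choice of the signs of \<open>k\<close> and \<open>k'\<close>.\<close>
  moreover have "0 < P"
  proof -
    have "norm (k *\<^sub>R V) < k * T" 
      by (rule power_less_imp_less_base[of _ 2, OF _ less_imp_le[OF k(1)]]) (use kT in linarith)
    moreover have "norm (k' *\<^sub>R W) < k' * U" 
      by (rule power_less_imp_less_base[of _ 2, OF _ less_imp_le[OF k'(1)]]) (use kU in linarith)
    ultimately have "norm (k *\<^sub>R V) * norm (k' *\<^sub>R W) < (k * T) * (k' * U)" by (rule mult_strict_mono[OF _ _ k(1) norm_ge_zero])
    then show ?thesis using norm_cauchy_schwarz[of "k *\<^sub>R V" "k' *\<^sub>R W"] unfolding P_def by linarith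
  qed
  ultimately have PS: "P * (S * S') = \<bar>A\<bar>" by simp
  define x y where "x = (k *\<^sub>R V) /\<^sub>R (1 + k * T)" and "y = (k' *\<^sub>R W) /\<^sub>R (1 + k' * U)"
  have "2 * (dist x y)\<^sup>2 = (P - 1) * ((1 - (norm x)\<^sup>2) * (1 - (norm y)\<^sup>2))"
    unfolding x_def y_def P_def by (rule dist_hyperboloid[OF k(1) kT k'(1) kU])
  then have "2 * (dist x y)\<^sup>2 * (S * S') = (P - 1) * ((1 - (norm x)\<^sup>2) * (1 - (norm y)\<^sup>2)) * (S * S')" by (simp only:)
  also have "\<dots> = (P * (S * S') - S * S') * ((1 - (norm x)\<^sup>2) * (1 - (norm y)\<^sup>2))" by (simp add: algebra_simps)
  finally have "2 * (dist x y)\<^sup>2 * (S * S') = (P * (S * S') - S * S') * ((1 - (norm x)\<^sup>2) * (1 - (norm y)\<^sup>2))" .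
  then have "2 * (dist x y)\<^sup>2 * (S * S') = (\<bar>A\<bar> - S * S') * ((1 - (norm x)\<^sup>2) * (1 - (norm y)\<^sup>2))" unfolding PS .
  moreover have "x \<in> geodesic_locus \<delta> m \<inter> ball 0 1"
    using hyperboloid_to_disk(2,3)[OF k(1) kT] Tm by (simp add: x_def C_def mult.assoc)
  moreover have "y \<in> geodesic_locus \<delta>' m' \<inter> ball 0 1"
    using hyperboloid_to_disk(2,3)[OF k'(1) kU] Um by (simp add: y_def C'_def mult.assoc)
  ultimately show ?thesis using that unfolding S_def S'_def by blast
qed

section \<open>The distances between opposite sides\<close>

lemma hyp_dist_eq_artanh:
  assumes x: "x \<in> ball 0 1" "y \<in> ball 0 1" and PQ: "0 < P" "0 < Q"
    and d: "(dist x y)\<^sup>2 * Q = P * ((1 - (norm x)\<^sup>2) * (1 - (norm y)\<^sup>2))"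
  shows "hyp_dist x y = 2 * artanh (sqrt (P / (P + Q)))"
proof -
  define E where "E = (1 - (norm x)\<^sup>2) * (1 - (norm y)\<^sup>2)"
  have E: "0 < E" using x by (simp add: E_def abs_square_less_1)
  have d2: "(dist x y)\<^sup>2 = P / Q * E" using d PQ by (simp add: E_def field_simps)
  have "dist x y / sqrt ((dist x y)\<^sup>2 + E) = sqrt ((dist x y)\<^sup>2 / ((dist x y)\<^sup>2 + E))" by (simp add: real_sqrt_divide)
  also have "(dist x y)\<^sup>2 / ((dist x y)\<^sup>2 + E) = P / (P + Q)" 
  proof -
    have "P / Q * E = P * (E / Q)" "P / Q * E + E = (P + Q) * (E / Q)" using PQ by (simp_all add: field_simps)
    then show ?thesis unfolding d2 using E PQ by simp
  qed
  finally show ?thesis by (simp add: hyp_dist_def E_def)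
qed

lemma cos_diff_cos_half: "cos p - cos q = 2 * sin ((p + q) / 2) * sin ((q - p) / 2)" for p q :: real
  using cos_diff_cos[of p q] by simp

text \<open>\<open>Q\<close> is the product of the sines of the half openings and
  \<open>2 * P + Q\<close> the absolute value of the Lorentz product of the normals. So
  \<open>P / Q\<close> is \<open>(sinh (\<rho> / 2))\<^sup>2\<close>, and \<open>P / (P + Q)\<close>
  is the square of tanh (\<rho> / 2).\<close>

lemma geodesics_hyp_dist:
  fixes s t u v :: real
  assumes "s < t" "t < s + 2 * pi" "u < v" "v < u + 2 * pi" and PQ: "0 < P" "0 < Q"
  assumes Q: "Q = sin ((t - s) / 2) * sin ((v - u) / 2)"
  assumes P: "2 * P + Q = \<bar>cos ((t - s) / 2) * cos ((v - u) / 2) - cos ((u + v - s - t) / 2)\<bar>"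
  obtains x y where "x \<in> geodesic (cis s) (cis t)" "y \<in> geodesic (cis u) (cis v)" "x \<in> ball 0 1" "y \<in> ball 0 1"
    "hyp_dist x y = 2 * artanh (sqrt (P / (P + Q)))"
proof -
  have i: "cis ((s + t) / 2) \<bullet> cis ((u + v) / 2) = cos ((u + v - s - t) / 2)"
  proof -
    have "(u + v - s - t) / 2 = (u + v) / 2 - (s + t) / 2" by (simp add: field_simps)
    then show ?thesis by (simp only: cos_diff) (simp add: inner_complex_def mult.commute)
  qed
  have pos: "0 < sin ((t - s) / 2)" "0 < sin ((v - u) / 2)" using assms by (auto intro!: sin_gt_zero)
  obtain x y where xy: "x \<in> geodesic_locus ((t - s) / 2) (cis ((s + t) / 2)) \<inter> ball 0 1"
      "y \<in> geodesic_locus ((v - u) / 2) (cis ((u + v) / 2)) \<inter> ball 0 1"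
      "2 * (dist x y)\<^sup>2 * Q = (2 * P + Q - Q) * ((1 - (norm x)\<^sup>2) * (1 - (norm y)\<^sup>2))"
    by (rule geodesic_feet[of "cis ((s + t) / 2)" "cis ((u + v) / 2)" "(t - s) / 2" "(v - u) / 2",
          unfolded i Q[symmetric] P[symmetric]]) (use pos PQ in auto)
  have "hyp_dist x y = 2 * artanh (sqrt (P / (P + Q)))" using xy by (intro hyp_dist_eq_artanh[OF _ _ PQ]) auto
  then show ?thesis using that xy(1,2) geodesic_eq[OF assms(1,2)] geodesic_eq[OF assms(3,4)] by auto
qed

text \<open>By the product formulas for cosines the two pairs of opposite sides lead to the same
  numbers \<open>P\<close> and \<open>Q\<close> in exchanged roles. The squares of the two tanh are
  therefore \<open>P / (P + Q)\<close> and \<open>Q / (P + Q)\<close>, with sum 1.\<close>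

lemma ideal_quadrilateral_points:
  assumes "ideal_quadrilateral a b c d"
  obtains r x y x' y' where "0 < r" "r < 1"
    "x \<in> geodesic a d" "y \<in> geodesic b c" "x \<in> ball 0 1" "y \<in> ball 0 1" "hyp_dist x y = 2 * artanh r"
    "x' \<in> geodesic a b" "y' \<in> geodesic c d" "x' \<in> ball 0 1" "y' \<in> ball 0 1"
    "hyp_dist x' y' = 2 * artanh (sqrt (1 - r\<^sup>2))"
proof -
  obtain s t u v where st: "s < t" "t < u" "u < v" "v < s + 2 * pi"
    and abcd: "a = cis s" "b = cis t" "c = cis u" "d = cis v"
    using assms unfolding ideal_quadrilateral_def by blast
  define P Q where "P = sin ((v - s) / 2) * sin ((u - t) / 2)" and "Q = sin ((t - s) / 2) * sin ((v - u) / 2)"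
  have PQ: "0 < P" "0 < Q" using st by (auto simp: P_def Q_def intro!: mult_pos_pos sin_gt_zero)
  have 1: "cos ((t - s) / 2) * cos ((v - u) / 2) - cos ((u + v - s - t) / 2) = 2 * P + Q"
  proof -
    have "cos ((t - s) / 2 + (v - u) / 2) - cos ((u + v - s - t) / 2) = 2 * P"
    proof -
      have "((t - s) / 2 + (v - u) / 2 + (u + v - s - t) / 2) / 2 = (v - s) / 2"
        "((u + v - s - t) / 2 - ((t - s) / 2 + (v - u) / 2)) / 2 = (u - t) / 2" by (simp_all add: field_simps)
      then show ?thesis by (simp only: cos_diff_cos_half P_def mult.assoc)
    qed
    then show ?thesis by (simp add: cos_add Q_def)
  qed
  \<comment> \<open>The side between \<open>a\<close> and \<open>d\<close> is parametrized from
    \<open>s\<close> to \<open>v\<close>. With this orientation of its normal the Lorentz product is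
    negative; the absolute value in \<open>geodesics_hyp_dist\<close> takes care of it.\<close>
  have 2: "cos ((v - s) / 2) * cos ((u - t) / 2) - cos ((t + u - s - v) / 2) = - (2 * Q + P)"
  proof -
    have "cos ((t + u - s - v) / 2) - cos ((v - s) / 2 - (u - t) / 2) = 2 * Q"
    proof -
      have "((t + u - s - v) / 2 + ((v - s) / 2 - (u - t) / 2)) / 2 = (t - s) / 2"
        "((v - s) / 2 - (u - t) / 2 - (t + u - s - v) / 2) / 2 = (v - u) / 2" by (simp_all add: field_simps)
      then show ?thesis by (simp only: cos_diff_cos_half Q_def mult.assoc)
    qed
    then show ?thesis by (simp add: cos_diff P_def)
  qed
  obtain x y where xy: "x \<in> geodesic a d" "y \<in> geodesic b c" "x \<in> ball 0 1" "y \<in> ball 0 1"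
    "hyp_dist x y = 2 * artanh (sqrt (Q / (Q + P)))"
    unfolding abcd by (rule geodesics_hyp_dist[of s v t u Q P]) (use st PQ 2 in \<open>auto simp: P_def[symmetric]\<close>)
  obtain x' y' where xy': "x' \<in> geodesic a b" "y' \<in> geodesic c d" "x' \<in> ball 0 1" "y' \<in> ball 0 1"
    "hyp_dist x' y' = 2 * artanh (sqrt (P / (P + Q)))"
    unfolding abcd by (rule geodesics_hyp_dist[of s t u v P Q]) (use st PQ 1 in \<open>auto simp: Q_def[symmetric]\<close>)
  have "1 - (sqrt (Q / (Q + P)))\<^sup>2 = P / (P + Q)" using PQ by (simp add: field_simps)
  then show ?thesis using PQ xy xy' by (intro that[of "sqrt (Q / (Q + P))" x y x' y']) auto
qed

section \<open>The maximum of \<open>T\<close>\<close>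

text \<open>The upper bound gives the sign of the derivative of \<open>f1\<close>.\<close>

lemma artanh_bounds:
  assumes x: "0 < x" "x < (1 :: real)"
  shows "x < artanh x" "artanh x < x / (1 - x\<^sup>2)"
proof -
  have lt: "y\<^sup>2 < 1" if "y \<in> {0..x}" for y using that x by (simp add: abs_square_less_1)
  have d: "(artanh has_real_derivative 1 / (1 - y\<^sup>2)) (at y)" if "y \<in> {0..x}" for y
    using that x by (intro artanh_real_has_field_derivative) auto
  have cont: "continuous_on {0..x} artanh" by (rule DERIV_atLeastAtMost_imp_continuous_on) (use d in auto)
  have "artanh 0 - 0 < artanh x - x"
  proof (rule DERIV_pos_imp_increasing_open[OF x(1)])
    fix y assume y: "0 < y" "y < x"
    have "((\<lambda>y. artanh y - y) has_real_derivative 1 / (1 - y\<^sup>2) - 1) (at y)"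
      using y by (intro derivative_intros d) auto
    moreover have "0 < 1 / (1 - y\<^sup>2) - 1" using y lt[of y] by (simp add: field_simps)
    ultimately show "\<exists>D. ((\<lambda>y. artanh y - y) has_real_derivative D) (at y) \<and> 0 < D" by blast
  qed (intro continuous_intros cont)
  then show "x < artanh x" by (simp add: artanh_def)
  have "0 / (1 - 0\<^sup>2) - artanh 0 < x / (1 - x\<^sup>2) - artanh x"
  proof (rule DERIV_pos_imp_increasing_open[OF x(1)])
    fix y assume y: "0 < y" "y < x"
    have p: "0 < 1 - y\<^sup>2" using y lt[of y] by simp
    have "((\<lambda>y. y / (1 - y\<^sup>2) - artanh y) has_real_derivative
        (1 * (1 - y\<^sup>2) - y * (- (2 * y))) / ((1 - y\<^sup>2) * (1 - y\<^sup>2)) - 1 / (1 - y\<^sup>2)) (at y)"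
      using y x p by (auto intro!: derivative_eq_intros d)
    moreover have "(1 * (1 - y\<^sup>2) - y * (- (2 * y))) / ((1 - y\<^sup>2) * (1 - y\<^sup>2)) - 1 / (1 - y\<^sup>2)
        = 2 * y\<^sup>2 / (1 - y\<^sup>2)\<^sup>2"
      using p by (simp add: divide_simps) (simp add: algebra_simps power2_eq_square)
    moreover have "0 < 2 * y\<^sup>2 / (1 - y\<^sup>2)\<^sup>2" using y p by simp
    ultimately show "\<exists>D. ((\<lambda>y. y / (1 - y\<^sup>2) - artanh y) has_real_derivative D) (at y) \<and> 0 < D" by metis
  next
    show "continuous_on {0..x} (\<lambda>y. y / (1 - y\<^sup>2) - artanh y)"
      using lt by (intro continuous_intros cont) fastforce
  qed
  then show "artanh x < x / (1 - x\<^sup>2)" by (simp add: artanh_def)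
qed

lemma f1_pos: "0 < x \<Longrightarrow> x < 1 \<Longrightarrow> 0 < f1 x"
  by (simp add: f1_def artanh_pos)

lemma f1_has_derivative:
  assumes x: "0 < x" "x < 1"
  shows "(f1 has_real_derivative (artanh x - x / (1 - x\<^sup>2)) / (artanh x)\<^sup>2) (at x)"
  unfolding f1_def[abs_def]
  using artanh_pos[OF x] x by (auto intro!: derivative_eq_intros simp: power2_eq_square)

lemma f1_strict_decreasing:
  assumes "0 < x" "x < y" "y < 1"
  shows "f1 y < f1 x"
proof (rule DERIV_neg_imp_decreasing[OF assms(2)])
  fix z assume "x \<le> z" "z \<le> y"
  then have z: "0 < z" "z < 1" using assms by auto
  have "(artanh z - z / (1 - z\<^sup>2)) / (artanh z)\<^sup>2 < 0"
    using artanh_bounds(2)[OF z] artanh_pos[OF z] by (intro divide_neg_pos) auto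
  then show "\<exists>D. (f1 has_real_derivative D) (at z) \<and> D < 0" using f1_has_derivative[OF z] by blast
qed

lemma sqrt_compl_bounds:
  assumes "0 < x" "x < (1 :: real)"
  shows "0 < sqrt (1 - x\<^sup>2)" "sqrt (1 - x\<^sup>2) < 1" "(sqrt (1 - x\<^sup>2))\<^sup>2 = 1 - x\<^sup>2"
    "sqrt (1 - (sqrt (1 - x\<^sup>2))\<^sup>2) = x"
proof -
  have "0 < x\<^sup>2" "x\<^sup>2 < 1" using assms by (auto simp: abs_square_less_1)
  then show "0 < sqrt (1 - x\<^sup>2)" "sqrt (1 - x\<^sup>2) < 1" and 1: "(sqrt (1 - x\<^sup>2))\<^sup>2 = 1 - x\<^sup>2" by auto
  show "sqrt (1 - (sqrt (1 - x\<^sup>2))\<^sup>2) = x" unfolding 1 using assms by simp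
qed

definition f1_diff :: "real \<Rightarrow> real \<Rightarrow> real" where
  "f1_diff K r = K * f1 r - f1 (sqrt (1 - r\<^sup>2))"

text \<open>A modulus and its complementary modulus move in opposite directions, so both terms
  decrease.\<close>

lemma f1_diff_strict_decreasing:
  assumes K: "1 \<le> K" and x: "0 < x" "x < y" "y < 1"
  shows "f1_diff K y < f1_diff K x"
proof -
  have "f1 y < f1 x" by (rule f1_strict_decreasing[OF x])
  then have "K * f1 y < K * f1 x" using K by simp
  moreover have "x\<^sup>2 < y\<^sup>2" using x by (intro power_strict_mono) auto
  then have "sqrt (1 - y\<^sup>2) < sqrt (1 - x\<^sup>2)" by simp
  then have "f1 (sqrt (1 - x\<^sup>2)) < f1 (sqrt (1 - y\<^sup>2))"
    using sqrt_compl_bounds[of x] sqrt_compl_bounds[of y] x by (intro f1_strict_decreasing) auto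
  ultimately show ?thesis by (simp add: f1_diff_def)
qed

lemma ln_T_has_derivative:
  assumes K: "1 \<le> K" and x: "0 < x" "x < 1"
  shows "((\<lambda>x. ln (artanh x) + ln (artanh (sqrt (1 - x\<^sup>2))) / K) has_real_derivative
    f1_diff K x / (K * x * (1 - x\<^sup>2))) (at x)"
proof -
  define q where "q = sqrt (1 - x\<^sup>2)"
  have q: "0 < q" "q < 1" "q\<^sup>2 = 1 - x\<^sup>2" using sqrt_compl_bounds[OF x] by (auto simp: q_def)
  have a: "0 < artanh x" "0 < artanh q" using artanh_pos x q by auto
  have dq: "((\<lambda>x. sqrt (1 - x\<^sup>2)) has_real_derivative (- (x / q))) (at x)"
    using q x unfolding q_def by (auto intro!: derivative_eq_intros simp: divide_simps)
  have "(artanh has_real_derivative 1 / (1 - q\<^sup>2)) (at (sqrt (1 - x\<^sup>2)))"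
    using q unfolding q_def by (intro artanh_real_has_field_derivative) auto
  then have "((\<lambda>x. artanh (sqrt (1 - x\<^sup>2))) has_real_derivative (1 / (1 - q\<^sup>2) * - (x / q))) (at x)"
    by (rule DERIV_chain2[OF _ dq])
  then have "((\<lambda>x. ln (artanh (sqrt (1 - x\<^sup>2)))) has_real_derivative (1 / artanh q * (1 / (1 - q\<^sup>2) * - (x / q)))) (at x)"
    unfolding q_def by (rule DERIV_chain2[where f = ln and g = "\<lambda>x. artanh (sqrt (1 - x\<^sup>2))" and x = x, OF DERIV_ln_divide[OF a(2)[unfolded q_def]]])
  moreover have "((\<lambda>x. ln (artanh x)) has_real_derivative (1 / artanh x * (1 / (1 - x\<^sup>2)))) (at x)"
    by (rule DERIV_chain2[where f = ln and g = artanh and x = x, OF DERIV_ln_divide[OF a(1)]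
          artanh_real_has_field_derivative]) (use x in auto)
  ultimately have "((\<lambda>x. ln (artanh x) + ln (artanh (sqrt (1 - x\<^sup>2))) / K) has_real_derivative
      1 / artanh x * (1 / (1 - x\<^sup>2)) + 1 / artanh q * (1 / (1 - q\<^sup>2) * - (x / q)) / K) (at x)"
    by (intro DERIV_add DERIV_cdivide)
  also have "1 / artanh x * (1 / (1 - x\<^sup>2)) + 1 / artanh q * (1 / (1 - q\<^sup>2) * - (x / q)) / K
      = f1_diff K x / (K * x * (1 - x\<^sup>2))"
  proof -
    have "1 - q\<^sup>2 = x\<^sup>2" using q(3) by simp
    then have "1 / artanh q * (1 / (1 - q\<^sup>2) * - (x / q)) / K = - (q / artanh q) / (K * x * q\<^sup>2)"
      using x q a K by (simp add: divide_simps power2_eq_square)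
    moreover have "1 / artanh x * (1 / (1 - x\<^sup>2)) = (K * (x / artanh x)) / (K * x * (1 - x\<^sup>2))"
    proof -
      have "1 / artanh x * (1 / Y) = (K * (x / artanh x)) / (K * x * Y)" for Y using x K by simp
      then show ?thesis .
    qed
    ultimately show ?thesis
      unfolding f1_diff_def f1_def q_def[symmetric] q(3) by (simp add: diff_divide_distrib)
  qed
  finally show ?thesis .
qed

lemma T_eq_exp:
  assumes "0 < x" "x < 1"
  shows "T K x = exp (ln (artanh x) + ln (artanh (sqrt (1 - x\<^sup>2))) / K)"
  using artanh_pos[OF assms] artanh_pos[of "sqrt (1 - x\<^sup>2)"] sqrt_compl_bounds[OF assms]
  by (simp add: T_def exp_add powr_def)

lemma T_increasing:
  assumes K: "1 \<le> K" and x: "0 < x" "x \<le> y" "y < 1" and y: "0 \<le> f1_diff K y"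
  shows "T K x \<le> T K y"
proof -
  have "ln (artanh x) + ln (artanh (sqrt (1 - x\<^sup>2))) / K \<le> ln (artanh y) + ln (artanh (sqrt (1 - y\<^sup>2))) / K"
  proof (rule DERIV_nonneg_imp_nondecreasing[OF x(2)])
    fix z assume z: "x \<le> z" "z \<le> y"
    then have z1: "0 < z" "z < 1" using x by auto
    have "0 \<le> f1_diff K z" using f1_diff_strict_decreasing[OF K z1(1), of y] z y x by (cases "z = y") auto
    then have "0 \<le> f1_diff K z / (K * z * (1 - z\<^sup>2))"
      using z1 K by (intro divide_nonneg_nonneg mult_nonneg_nonneg) (auto simp: abs_square_le_1)
    then show "\<exists>D. ((\<lambda>x. ln (artanh x) + ln (artanh (sqrt (1 - x\<^sup>2))) / K) has_real_derivative D) (at z) \<and> 0 \<le> D"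
      using ln_T_has_derivative[OF K z1] by blast
  qed
  then show ?thesis using x by (simp add: T_eq_exp)
qed

lemma T_decreasing:
  assumes K: "1 \<le> K" and x: "0 < x" "x \<le> y" "y < 1" and y: "f1_diff K x \<le> 0"
  shows "T K y \<le> T K x"
proof -
  have "ln (artanh y) + ln (artanh (sqrt (1 - y\<^sup>2))) / K \<le> ln (artanh x) + ln (artanh (sqrt (1 - x\<^sup>2))) / K"
  proof (rule DERIV_nonpos_imp_nonincreasing[OF x(2)])
    fix z assume z: "x \<le> z" "z \<le> y"
    then have z1: "0 < z" "z < 1" using x by auto
    have "f1_diff K z \<le> 0" using f1_diff_strict_decreasing[OF K x(1), of z] z y z1 by (cases "z = x") auto
    then have "f1_diff K z / (K * z * (1 - z\<^sup>2)) \<le> 0"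
      using z1 K by (intro divide_nonpos_nonneg mult_nonneg_nonneg) (auto simp: abs_square_le_1)
    then show "\<exists>D. ((\<lambda>x. ln (artanh x) + ln (artanh (sqrt (1 - x\<^sup>2))) / K) has_real_derivative D) (at z) \<and> D \<le> 0"
      using ln_T_has_derivative[OF K z1] by blast
  qed
  then show ?thesis using x by (simp add: T_eq_exp)
qed

text \<open>With \<open>E = sqrt (exp 1)\<close> one recognizes \<open>r1\<close> as
  \<open>1 / cosh (1/2)\<close>, with the complementary modulus \<open>tanh (1/2)\<close>; it
  belongs to the distance 1, where the exponent in the distortion bound switches. \<open>M1\<close>
  is \<open>f1\<close> at this complementary modulus divided by \<open>f1 r1\<close>.\<close>

lemma r1_facts:
  shows "0 < r1" "r1 < 1" "1 / 2 \<le> r1\<^sup>2" "artanh (sqrt (1 - r1\<^sup>2)) = 1 / 2"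
    "f1_diff K r1 = (K - M1) * f1 r1"
proof -
  define E where "E = sqrt (exp 1)"
  have E2: "E\<^sup>2 = exp 1" by (simp add: E_def)
  have E: "1 < E" by (simp add: E_def)
  have e: "2 \<le> exp (1::real)" "exp (1::real) \<le> 3" using exp_ge_add_one_self[of "1::real"] exp_le by auto
  have r1: "r1 = 2 * E / (E\<^sup>2 + 1)" by (simp add: r1_def E_def)
  have p: "0 < E\<^sup>2 + 1" by (simp add: E2 add_pos_pos)
  show r0: "0 < r1" unfolding r1 using E p by simp
  have "2 * E < E\<^sup>2 + 1" using E zero_less_power2[of "E - 1"] by (simp add: power2_diff)
  then show "r1 < 1" unfolding r1 using p by simp
  have "(E\<^sup>2 + 1)\<^sup>2 \<le> 8 * E\<^sup>2"
  proof -
    have "exp 1 * exp 1 \<le> 3 * (exp 1 :: real)" using e by (intro mult_right_mono) auto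
    then have "exp 1 * exp 1 + 1 \<le> 6 * (exp 1 :: real)" using e by linarith
    then show ?thesis unfolding E2 by (simp add: power2_eq_square algebra_simps)
  qed
  then show "1 / 2 \<le> r1\<^sup>2" unfolding r1 using p by (simp add: power_divide power_mult_distrib divide_simps)
  define s where "s = (E\<^sup>2 - 1) / (E\<^sup>2 + 1)"
  have E1: "0 < E\<^sup>2 - 1" using E by (simp add: one_less_power)
  have "1 - r1\<^sup>2 = s\<^sup>2" 
  proof -
    have "(E\<^sup>2 + 1)\<^sup>2 - (2 * E)\<^sup>2 = (E\<^sup>2 - 1)\<^sup>2" by (simp add: algebra_simps power2_eq_square)
    then have "(E\<^sup>2 - 1)\<^sup>2 / (E\<^sup>2 + 1)\<^sup>2 = ((E\<^sup>2 + 1)\<^sup>2 - (2 * E)\<^sup>2) / (E\<^sup>2 + 1)\<^sup>2" by simp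
    also have "\<dots> = 1 - (2 * E)\<^sup>2 / (E\<^sup>2 + 1)\<^sup>2" using p by (simp add: diff_divide_distrib)
    finally show ?thesis by (simp add: r1 s_def power_divide)
  qed
  then have s: "sqrt (1 - r1\<^sup>2) = s" using E1 p by (simp add: s_def)
  have "(1 + s) / (1 - s) = E\<^sup>2" unfolding s_def using p by (simp add: divide_simps)
  then have as: "artanh s = 1 / 2" by (simp add: artanh_def E2)
  then show "artanh (sqrt (1 - r1\<^sup>2)) = 1 / 2" by (simp add: s)
  have "(1 + r1) / (1 - r1) = ((E + 1) / (E - 1))\<^sup>2"
  proof -
    have "1 + r1 = (E + 1)\<^sup>2 / (E\<^sup>2 + 1)" "1 - r1 = (E - 1)\<^sup>2 / (E\<^sup>2 + 1)"
      unfolding r1 using p by (simp_all add: field_simps power2_eq_square)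
    then show ?thesis using p by (simp add: power_divide)
  qed
  then have ar: "artanh r1 = ln (E + 1) - ln (E - 1)"
    using E by (simp add: artanh_def ln_realpow ln_div)
  have ar0: "0 < artanh r1" using artanh_pos r0 \<open>r1 < 1\<close> by blast
  have "M1 * f1 r1 = (E\<^sup>2 - 1) * artanh r1 / E * (2 * E / (E\<^sup>2 + 1) / artanh r1)"
  proof -
    have "M1 = (E\<^sup>2 - 1) * artanh r1 / E" unfolding M1_def ar E2 by (simp only: E_def)
    moreover have "f1 r1 = 2 * E / (E\<^sup>2 + 1) / artanh r1" by (simp only: f1_def r1[symmetric])
    ultimately show ?thesis by (simp only:)
  qed
  also have "\<dots> = s / (1 / 2)" 
  proof -
    have "X * artanh r1 / E * (2 * E / Y / artanh r1) = X / Y / (1 / 2)" for X Y using ar0 E by simp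
    then show ?thesis unfolding s_def .
  qed
  also have "\<dots> = f1 (sqrt (1 - r1\<^sup>2))" unfolding s f1_def as ..
  finally show "f1_diff K r1 = (K - M1) * f1 r1" by (simp add: f1_diff_def algebra_simps)
qed

lemma r1K_props:
  assumes K: "1 \<le> K" and KM: "M1 < K"
  shows "r1 < r1K K" "r1K K < 1" "f1_diff K (r1K K) = 0"
proof -
  have r1p: "0 < f1_diff K r1" using KM f1_pos[OF r1_facts(1,2)] by (simp add: r1_facts(5))
  \<comment> \<open>So large that at \<open>x = tanh y\<close> the first term of
    \<open>f1_diff\<close> is at most 1 / 4, while the second one exceeds \<open>x\<^sup>2\<close>,
    which is more than 1 / 2.\<close>
  define y where "y = max (4 * K) (artanh r1 + 1)"
  have y: "4 * K \<le> y" "artanh r1 < y" by (auto simp: y_def)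
  define x where "x = tanh y"
  have ax: "artanh x = y" by (simp add: x_def artanh_tanh_real)
  have "r1 = tanh (artanh r1)" using r1_facts(1,2) by (simp add: tanh_artanh_real)
  also have "\<dots> < x" unfolding x_def using y(2) by (simp add: tanh_real_less_iff)
  finally have "r1 < x" .
  then have x: "r1 < x" "x < 1" "0 < x" using r1_facts(1) tanh_real_lt_1[of y] unfolding x_def by linarith+
  have "K * f1 x = K * x / y" by (simp add: f1_def ax)
  also have "\<dots> \<le> 1 / 4"
  proof -
    have "K * x \<le> K * 1" using K x by (intro mult_left_mono) auto
    then have "4 * (K * x) \<le> y" using y(1) by linarith
    then show ?thesis using y(1) K by (simp add: divide_le_eq)
  qed
  finally have "K * f1 x \<le> 1 / 4" .
  moreover have "1 / 2 < f1 (sqrt (1 - x\<^sup>2))"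
  proof -
    define q where "q = sqrt (1 - x\<^sup>2)"
    have q: "0 < q" "q < 1" "q\<^sup>2 = 1 - x\<^sup>2" using sqrt_compl_bounds[OF x(3,2)] by (auto simp: q_def)
    have "r1\<^sup>2 < x\<^sup>2" using x(1) r1_facts(1) by (intro power_strict_mono) auto
    then have "1 / 2 < x\<^sup>2" using r1_facts(3) by linarith
    moreover have "x\<^sup>2 < f1 q"
      using artanh_bounds(2)[OF q(1,2)] artanh_pos[OF q(1,2)] x(3)
      by (simp add: f1_def q(3) field_simps)
    ultimately show ?thesis by (simp add: q_def)
  qed
  ultimately have "f1_diff K x < 0" by (simp add: f1_diff_def)
  have "continuous_on {r1..x} (f1_diff K)"
  proof -
    have c: "continuous_on {0<..<1} f1"
      by (rule DERIV_continuous_on[OF DERIV_subset[OF f1_has_derivative]]) auto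
    have "continuous_on {r1..x} f1" by (rule continuous_on_subset[OF c]) (use x r1_facts(1) in auto)
    moreover have "continuous_on {r1..x} (\<lambda>r. f1 (sqrt (1 - r\<^sup>2)))"
    proof (rule continuous_on_compose2[OF c])
      show "continuous_on {r1..x} (\<lambda>r. sqrt (1 - r\<^sup>2))" by (intro continuous_intros)
      show "(\<lambda>r. sqrt (1 - r\<^sup>2)) ` {r1..x} \<subseteq> {0<..<1}"
      proof (intro image_subsetI)
        fix r assume "r \<in> {r1..x}"
        then have "0 < r" "r < 1" using x r1_facts(1) by auto
        then show "sqrt (1 - r\<^sup>2) \<in> {0<..<1}" using sqrt_compl_bounds(1,2)[of r] by simp
      qed
    qed
    ultimately show ?thesis unfolding f1_diff_def[abs_def] by (intro continuous_intros)
  qed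
  then obtain r where r: "r1 \<le> r" "r \<le> x" "f1_diff K r = 0"
    using IVT2'[of "f1_diff K" x 0 r1] r1p \<open>f1_diff K x < 0\<close> x(1) by auto
  then have "r1 < r" "r < 1" using r1p x by (cases "r = r1"; auto)+
  have "r1K K = r"
    unfolding r1K_def
  proof (rule the_equality)
    show "r1 < r \<and> r < 1 \<and> K * f1 r = f1 (sqrt (1 - r\<^sup>2))"
      using \<open>r1 < r\<close> \<open>r < 1\<close> r(3) by (simp add: f1_diff_def)
    fix r' assume r': "r1 < r' \<and> r' < 1 \<and> K * f1 r' = f1 (sqrt (1 - r'\<^sup>2))"
    then have "f1_diff K r' = f1_diff K r" using r(3) by (simp add: f1_diff_def)
    moreover have "0 < r" "0 < r'" using r' \<open>r1 < r\<close> r1_facts(1) by auto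
    ultimately show "r' = r"
      using f1_diff_strict_decreasing[OF K, of r r'] f1_diff_strict_decreasing[OF K, of r' r] r' \<open>r < 1\<close>
      by (cases r r' rule: linorder_cases) auto
  qed
  then show "r1 < r1K K" "r1K K < 1" "f1_diff K (r1K K) = 0" using \<open>r1 < r\<close> \<open>r < 1\<close> r(3) by auto
qed

lemma T_le_T_r1K:
  assumes K: "1 \<le> K" "M1 < K" and x: "0 < x" "x < 1"
  shows "T K x \<le> T K (r1K K)"
proof (cases "x \<le> r1K K")
  case True
  then show ?thesis using T_increasing[OF K(1) x(1)] r1K_props[OF K] by simp
next
  case False
  then show ?thesis using T_decreasing[OF K(1), of "r1K K" x] r1K_props[OF K] r1_facts(1) x by simp
qed

lemma T_le_T_r1:
  assumes K: "1 \<le> K" "K \<le> M1" and x: "r1 < x" "x < 1"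
  shows "T K x \<le> T K r1"
proof -
  have "f1_diff K r1 \<le> 0" unfolding r1_facts(5)
    using K(2) f1_pos[OF r1_facts(1,2)] by (intro mult_nonpos_nonneg) auto
  then show ?thesis using T_decreasing[OF K(1) r1_facts(1), of x] x by simp
qed

text \<open>The case \<open>K = 1\<close> of \<open>T\<close>, symmetric under passage to the
  complementary modulus; its maximum lies at the fixed point \<open>1 / sqrt 2\<close>.\<close>

lemma artanh_mult_artanh_compl_le:
  assumes x: "0 < x" "x < 1"
  shows "2 * artanh x * (2 * artanh (sqrt (1 - x\<^sup>2))) \<le> (2 * ln (sqrt 2 + 1))\<^sup>2"
proof -
  define w :: real where "w = 1 / sqrt 2"
  have s2: "1 < sqrt (2 :: real)" by simp
  have w: "0 < w" "w < 1" "w\<^sup>2 = 1 / 2" using s2 by (auto simp: w_def power_divide)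
  have q: "sqrt (1 - w\<^sup>2) = w" unfolding w(3) by (simp add: w_def real_sqrt_divide)
  have "f1_diff 1 w = 0" by (simp add: f1_diff_def q)
  then have "T 1 x \<le> T 1 w"
    using T_increasing[of 1 x w] T_decreasing[of 1 w x] x w by (cases "x \<le> w") auto
  moreover have "T 1 x = artanh x * artanh (sqrt (1 - x\<^sup>2))"
    using artanh_pos[of "sqrt (1 - x\<^sup>2)"] sqrt_compl_bounds[OF x] by (simp add: T_def)
  moreover have "T 1 w = (artanh w)\<^sup>2" using artanh_pos[OF w(1,2)] unfolding T_def q by (simp add: power2_eq_square)
  moreover have "artanh w = ln (sqrt 2 + 1)"
  proof -
    have "1 + w = (sqrt 2 + 1) / sqrt 2" "1 - w = (sqrt 2 - 1) / sqrt 2"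
      unfolding w_def using s2 by (simp_all add: add_divide_distrib diff_divide_distrib)
    then have "(1 + w) / (1 - w) = (sqrt 2 + 1) / (sqrt 2 - 1)" by simp
    also have "\<dots> = (sqrt 2 + 1)\<^sup>2"
    proof -
      have "(sqrt 2 + 1) * (sqrt 2 - 1) = (1 :: real)" by (simp add: algebra_simps)
      then have "(sqrt 2 + 1)\<^sup>2 * (sqrt 2 - 1) = (sqrt 2 + 1 :: real)" by (simp add: power2_eq_square mult.assoc)
      then show ?thesis using s2 by (simp add: divide_eq_eq)
    qed
    finally show ?thesis using s2 by (simp add: artanh_def ln_realpow)
  qed
  ultimately show ?thesis by (simp add: power_mult_distrib)
qed

lemma le_powr_inverse:
  assumes "1 \<le> K" "0 < d"
  shows "1 \<le> d \<Longrightarrow> max d (d powr (1 / K)) = (d :: real)" "d < 1 \<Longrightarrow> max d (d powr (1 / K)) = d powr (1 / K)"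
proof -
  show "max d (d powr (1 / K)) = d" if "1 \<le> d"
    using powr_mono[of "1 / K" 1 d] assms that by simp
  show "max d (d powr (1 / K)) = d powr (1 / K)" if "d < 1"
    using powr_mono'[of "1 / K" 1 d] assms that by simp
qed

text \<open>The two distances are not both below 1. If one is, the modulus \<open>y\<close> of the
  other exceeds \<open>r1\<close> and the product is \<open>2 powr (1 + 1 / K) * T K y\<close>; if
  none is, the product is \<open>d * d'\<close>.\<close>

lemma max_powr_mult_le:
  assumes K: "1 \<le> K" and x: "0 < x" "x < 1" and B: "\<And>y. r1 < y \<Longrightarrow> y < 1 \<Longrightarrow> T K y \<le> B"
  defines "d \<equiv> 2 * artanh x" and "d' \<equiv> 2 * artanh (sqrt (1 - x\<^sup>2))"
  shows "max d (d powr (1 / K)) * max d' (d' powr (1 / K)) \<le> max (2 powr (1 + 1 / K) * B) ((2 * ln (sqrt 2 + 1))\<^sup>2)"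
proof -
  have mono: "y < z" if "artanh y < artanh z" "0 < y" "y < 1" "0 < z" "z < 1" for y z :: real
    using that tanh_real_less_iff[of "artanh y" "artanh z"] by (simp add: tanh_artanh_real)
  have small: "max e (e powr (1 / K)) * max e' (e' powr (1 / K)) \<le> 2 powr (1 + 1 / K) * B"
    if y: "0 < y" "y < 1" and e: "e = 2 * artanh y" "e' = 2 * artanh (sqrt (1 - y\<^sup>2))" "e' < 1" for y e e'
  proof -
    have q: "0 < sqrt (1 - y\<^sup>2)" "sqrt (1 - y\<^sup>2) < 1" using sqrt_compl_bounds[OF y] by auto
    have e0: "0 < e'" using artanh_pos[OF q] e by simp
    have "artanh (sqrt (1 - y\<^sup>2)) < artanh (sqrt (1 - r1\<^sup>2))" using e r1_facts(4) by simp
    then have "sqrt (1 - y\<^sup>2) < sqrt (1 - r1\<^sup>2)"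
      by (rule mono) (use q sqrt_compl_bounds[OF r1_facts(1,2)] in simp_all)
    then have "r1\<^sup>2 < y\<^sup>2" by simp
    then have ry: "r1 < y" using y(1) by (rule power_less_imp_less_base[OF _ less_imp_le])
    \<comment> \<open>The larger distance is at least 1: otherwise
      \<open>r1\<^sup>2 < y\<^sup>2\<close> and \<open>y\<^sup>2 < 1 - r1\<^sup>2\<close>, against
      \<open>1 / 2 \<le> r1\<^sup>2\<close>.\<close>
    have "artanh (sqrt (1 - r1\<^sup>2)) \<le> artanh y"
    proof (rule ccontr)
      assume "\<not> ?thesis"
      then have "artanh y < artanh (sqrt (1 - r1\<^sup>2))" by simp
      then have "y < sqrt (1 - r1\<^sup>2)"
        by (rule mono) (use y sqrt_compl_bounds[OF r1_facts(1,2)] in simp_all)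
      then have "y\<^sup>2 < 1 - r1\<^sup>2" using y sqrt_compl_bounds(3)[OF r1_facts(1,2)] power_strict_mono[of y "sqrt (1 - r1\<^sup>2)" 2] by simp
      then show False using \<open>r1\<^sup>2 < y\<^sup>2\<close> r1_facts(3) by linarith
    qed
    then have e1: "1 \<le> e" using r1_facts(4) e by simp
    have "max e (e powr (1 / K)) * max e' (e' powr (1 / K)) = e * e' powr (1 / K)"
      using le_powr_inverse[OF K, of e] le_powr_inverse[OF K e0] e1 e(3) by simp
    also have "\<dots> = 2 powr (1 + 1 / K) * T K y"
      unfolding e T_def using artanh_pos[OF q] by (simp add: powr_mult powr_add)
    also have "\<dots> \<le> 2 powr (1 + 1 / K) * B" by (intro mult_left_mono B ry y) simp
    finally show ?thesis .
  qed
  have q: "0 < sqrt (1 - x\<^sup>2)" "sqrt (1 - x\<^sup>2) < 1" "sqrt (1 - (sqrt (1 - x\<^sup>2))\<^sup>2) = x"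
    using sqrt_compl_bounds[OF x] by auto
  have d0: "0 < d" "0 < d'" using artanh_pos x q by (auto simp: d_def d'_def)
  consider "d' < 1" | "d < 1" | "1 \<le> d" "1 \<le> d'" by linarith
  then show ?thesis
  proof cases
    case 1
    show ?thesis using small[OF x d_def[THEN meta_eq_to_obj_eq] d'_def[THEN meta_eq_to_obj_eq] 1] by simp
  next
    case 2
    have "d = 2 * artanh (sqrt (1 - (sqrt (1 - x\<^sup>2))\<^sup>2))" unfolding q(3) by (simp add: d_def)
    from small[OF q(1,2) d'_def[THEN meta_eq_to_obj_eq] this 2] show ?thesis by (simp add: mult.commute)
  next
    case 3
    then have "max d (d powr (1 / K)) * max d' (d' powr (1 / K)) = d * d'" using le_powr_inverse[OF K] d0 by simp
    then show ?thesis using artanh_mult_artanh_compl_le[OF x] by (simp add: d_def d'_def)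
  qed
qed

section \<open>The product of the distances\<close>

lemma hyp_dist_nonneg:
  assumes "x \<in> ball 0 1" "y \<in> ball 0 1"
  shows "0 \<le> hyp_dist x y"
proof (cases "x = y")
  case False
  then show ?thesis using pseudo_hyp_dist_bounds[OF assms False] artanh_pos[of "pseudo_hyp_dist x y"] by auto
qed (simp add: hyp_dist_def)

lemma hyp_setdist_bounds:
  assumes "A \<subseteq> ball 0 1" "B \<subseteq> ball 0 1" "x \<in> A" "y \<in> B"
  shows "0 \<le> hyp_setdist A B" "hyp_setdist A B \<le> hyp_dist x y"
proof -
  have nonneg: "0 \<le> (case p of (x, y) \<Rightarrow> hyp_dist x y)" if "p \<in> A \<times> B" for p
    using that assms(1,2) by (auto intro!: hyp_dist_nonneg)
  show "0 \<le> hyp_setdist A B"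
    unfolding hyp_setdist_def using assms(3,4) nonneg by (intro cINF_greatest) auto
  have "bdd_below ((\<lambda>(x, y). hyp_dist x y) ` (A \<times> B))"
    by (rule bdd_belowI2[of _ 0]) (rule nonneg)
  then show "hyp_setdist A B \<le> hyp_dist x y"
    unfolding hyp_setdist_def using cINF_lower[of "\<lambda>(x, y). hyp_dist x y" "A \<times> B" "(x, y)"] assms(3,4) by simp
qed

lemma geodesic_subset_ball:
  assumes "s < t" "t < s + 2 * pi"
  shows "geodesic (cis s) (cis t) \<subseteq> ball 0 1"
  unfolding geodesic_eq[OF assms] by blast

text \<open>The infimum is at most the distance of the images of one pair of points; the pair will
  be the feet of the common perpendicular.\<close>

lemma hyp_setdist_image_le:
  assumes K: "1 \<le> K" and qc: "quasiconformal K (ball 0 1) (ball 0 1) f"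
    and G: "G \<subseteq> ball 0 1" "G' \<subseteq> ball 0 1" and x: "x \<in> G" "y \<in> G'"
    and d: "hyp_dist x y = 2 * artanh r" "0 < r" "r < 1"
  shows "0 \<le> hyp_setdist (f ` G) (f ` G')"
    "hyp_setdist (f ` G) (f ` G') \<le> A_const K * max (2 * artanh r) ((2 * artanh r) powr (1 / K))"
proof -
  obtain g where "homeomorphism (ball 0 1) (ball 0 1) f g" using qc by (auto simp: quasiconformal_def)
  then have f: "f ` ball 0 1 = ball 0 1" by (simp add: homeomorphism_def)
  have sub: "f ` G \<subseteq> ball 0 1" "f ` G' \<subseteq> ball 0 1" using image_mono[OF G(1), of f] image_mono[OF G(2), of f] f by auto
  have d0: "0 < 2 * artanh r" using artanh_pos[OF d(2,3)] by simp
  have xy: "x \<in> ball 0 1" "y \<in> ball 0 1" "x \<noteq> y" using G x d d0 by (auto simp: hyp_dist_def)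
  note b = hyp_setdist_bounds[OF sub imageI[OF x(1)] imageI[OF x(2)]]
  show "0 \<le> hyp_setdist (f ` G) (f ` G')" by (rule b(1))
  have "hyp_setdist (f ` G) (f ` G') \<le> hyp_dist (f x) (f y)" by (rule b(2))
  also have "\<dots> \<le> 2 * artanh (phi K (tanh (2 * artanh r / 2)))"
    using quasiconformal_Schwarz[OF K qc xy] unfolding d(1) .
  also have "\<dots> \<le> A_const K * max (2 * artanh r) ((2 * artanh r) powr (1 / K))"
    by (rule artanh_phi_le[OF K d0])
  finally show "hyp_setdist (f ` G) (f ` G') \<le> A_const K * max (2 * artanh r) ((2 * artanh r) powr (1 / K))" .
qed

theorem corollary1p7:
  fixes K :: real and f :: "complex \<Rightarrow> complex" and a b c d :: complex and D1 D2 :: real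
  assumes "K \<ge> 1"
    and "quasiconformal K (ball 0 1) (ball 0 1) f"
    and "ideal_quadrilateral a b c d"
  defines "D1 \<equiv> hyp_setdist (f ` geodesic a d) (f ` geodesic b c)"
    and "D2 \<equiv> hyp_setdist (f ` geodesic a b) (f ` geodesic c d)"
  shows "(K > M1 \<longrightarrow>
            D1 * D2 \<le> (A_const K)\<^sup>2 *
              max (2 powr (1 + 1 / K) * T K (r1K K)) ((2 * ln (sqrt 2 + 1))\<^sup>2)) \<and>
         (K \<le> M1 \<longrightarrow>
            D1 * D2 \<le> (A_const K)\<^sup>2 *
              max (2 powr (1 + 1 / K) * T K r1) ((2 * ln (sqrt 2 + 1))\<^sup>2))"
proof -
  note K = assms(1)
  obtain s t u v where st: "s < t" "t < u" "u < v" "v < s + 2 * pi"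
    and abcd: "a = cis s" "b = cis t" "c = cis u" "d = cis v"
    using assms(3) unfolding ideal_quadrilateral_def by blast
  have sub: "geodesic a d \<subseteq> ball 0 1" "geodesic b c \<subseteq> ball 0 1" "geodesic a b \<subseteq> ball 0 1" "geodesic c d \<subseteq> ball 0 1"
    unfolding abcd using st by (intro geodesic_subset_ball; linarith)+
  obtain r x y x' y' where r: "0 < r" "r < 1"
    and xy: "x \<in> geodesic a d" "y \<in> geodesic b c" "hyp_dist x y = 2 * artanh r"
    and xy': "x' \<in> geodesic a b" "y' \<in> geodesic c d" "hyp_dist x' y' = 2 * artanh (sqrt (1 - r\<^sup>2))"
    using ideal_quadrilateral_points[OF assms(3)] by metis
  define d1 d2 where "d1 = 2 * artanh r" and "d2 = 2 * artanh (sqrt (1 - r\<^sup>2))"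
  define m1 m2 where "m1 = max d1 (d1 powr (1 / K))" and "m2 = max d2 (d2 powr (1 / K))"
  have D1: "0 \<le> D1" "D1 \<le> A_const K * m1"
    using hyp_setdist_image_le[OF K assms(2) sub(1,2) xy r] by (auto simp: D1_def d1_def m1_def)
  have D2: "0 \<le> D2" "D2 \<le> A_const K * m2"
    using hyp_setdist_image_le[OF K assms(2) sub(3,4) xy' sqrt_compl_bounds(1,2)[OF r]]
    by (auto simp: D2_def d2_def m2_def)
  have "D1 * D2 \<le> (A_const K * m1) * (A_const K * m2)" using D1 D2 by (intro mult_mono) auto
  also have "\<dots> = (A_const K)\<^sup>2 * (m1 * m2)" by (simp add: power2_eq_square)
  finally have D: "D1 * D2 \<le> (A_const K)\<^sup>2 * (m1 * m2)" .
  \<comment> \<open>\<open>B\<close> is left open to serve both cases: it becomes the value of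
    \<open>T\<close> at \<open>r1K K\<close> or at \<open>r1\<close>, and it has to dominate
    \<open>T\<close> only above \<open>r1\<close>.\<close>
  have "D1 * D2 \<le> (A_const K)\<^sup>2 * max (2 powr (1 + 1 / K) * B) ((2 * ln (sqrt 2 + 1))\<^sup>2)"
    if "\<And>y. r1 < y \<Longrightarrow> y < 1 \<Longrightarrow> T K y \<le> B" for B
  proof -
    have "m1 * m2 \<le> max (2 powr (1 + 1 / K) * B) ((2 * ln (sqrt 2 + 1))\<^sup>2)"
      unfolding m1_def m2_def d1_def d2_def by (rule max_powr_mult_le[OF K r that])
    then show ?thesis using D mult_left_mono[OF _ zero_le_power2[of "A_const K"]] by (meson order_trans)
  qed
  then show ?thesis using T_le_T_r1K[OF K] T_le_T_r1[OF K] r1_facts(1) by (auto simp del: max.bounded_iff)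
qed

end
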